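(* Let $f,g\in z+1+z^{-2}\mathbb C\{z^{-1}\}$ be two simple parabolic germs at $\infty$ with vanishing resiter. Then $f$ and $g$ are analytically conjugate if and only if there exists $c\in\mathbb C$ such that their pairs of lifted horn maps $(h_f^{\mathrm{up}},h_f^{\mathrm{low}})$ and $(h_g^{\mathrm{up}},h_g^{\mathrm{low}})$ are related by $$h_g^{\mathrm{up}}(z)\equiv h_f^{\mathrm{up}}(z+c)-c,\qquad h_g^{\mathrm{low}}(z)\equiv h_f^{\mathrm{low}}(z+c)-c,$$ or, equivalently, $A_m(g)=e^{-2\pi\mathrm i mc}A_m(f)$ for every $m\in\mathbb Z^*$.
   Context: $\mathbb Z^*=\mathbb Z\setminus\{0\}$. $f$ and $g$ are analytically conjugate if there is a convergent $h\in\mathrm{id}+\mathbb C\{z^{-1}\}$ with $g\circ h=h\circ f$. For a simple parabolic germ $f(z)=z+1+O(z^{-2})$, the iterator is the unique $\tilde v_*\in\mathrm{id}+z^{-1}\mathbb C[[z^{-1}]]$ with $\tilde v_*\circ f=\tilde v_*+1$, and $\tilde u_*=\tilde v_*^{\circ(-1)}$. Write $\tilde v_*=\mathrm{id}+\tilde\varphi$, $\tilde u_*=\mathrm{id}+\tilde\psi$ and let $\hat\varphi,\hat\psi$ be the formal Borel transforms ($\sum a_nz^{-n-1}\mapsto\sum a_n\zeta^n/n!$) of $\tilde\varphi,\tilde\psi$. With $I^+=(-\frac\pi2,\frac\pi2)$, $I^-=(\frac\pi2,\frac{3\pi}2)$, both $\hat\varphi$ and $\hat\psi$ are convergent and extend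 analytically to the sectors $\{\xi e^{\mathrm i\theta}\mid\xi>0,\theta\in I^\pm\}$, with exponential bounds $\alpha(\theta)e^{\beta(\theta)\xi}$, $\alpha,\beta$ locally bounded on $I^+\cup I^-$. The Borel sums are $v_*^\pm(z)=z+\int_0^{+\infty}e^{-z\xi e^{\mathrm i\theta}}\hat\varphi(\xi e^{\mathrm i\theta})e^{\mathrm i\theta}d\xi$ for any $\theta\in I^\pm$ with $\mathrm{Re}(ze^{\mathrm i\theta})>\beta(\theta)$, and $u_*^\pm$ is defined likewise from $\hat\psi$; they are holomorphic in sectorial neighbourhoods of $\infty$ of the form $\bigcup_{\theta\in I^\pm}\{\mathrm{Re}(ze^{\mathrm i\theta})>\beta(\theta)\}$, asymptotic to the identity, and $u_*^\pm$ is the inverse of $v_*^\pm$ there (for $\beta$ large enough). For $R>0$ large enough, $h:=v_*^+\circ u_*^-$ is well defined on $\{re^{\mathrm i\theta}\mid r>R,\ \frac\pi4<\theta<\frac{3\pi}4\}$, where it is denoted $h^{\mathrm{up}}$, and on $\{re^{\mathrm i\theta}\mid r>R,\ \frac{5\pi}4<\theta<\frac{7\pi}4\}$, where it is denoted $h^{\mathrm{low}}$. For some $\sigma>0$, $h^{\mathrm{up}}$ (resp. $h^{\mathrm{low}}$) extends analytically to $\{\mathrm{Im}\,z>\sigma\}$ (resp. $\{\mathrm{Im}\,z<-\sigma\}$), $h^{\mathrm{up}}-\mathrm{id}$ and $h^{\mathrm{low}}-\mathrm{id}$ are $1$-periodic, and $h^{\mathrm{up}}(z)-z=\sum_{m\ge1}A_{-m}e^{2\pi\mathrm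 i mz}$, $h^{\mathrm{low}}(z)-z=\sum_{m\ge1}A_me^{-2\pi\mathrm i mz}$. The pair $(h^{\mathrm{up}},h^{\mathrm{low}})=(h_f^{\mathrm{up}},h_f^{\mathrm{low}})$ is the pair of lifted horn maps of $f$, and $A_m=A_m(f)$, $m\in\mathbb Z^*$, are its Écalle–Voronin invariants. *)

theory Defs
  imports "HOL-Complex_Analysis.Complex_Analysis"
begin

text \<open>
  A germ at infinity \<open>f(z) = z + a\<^sub>0 + a\<^sub>1 z\<^sup>-\<^sup>1 + a\<^sub>2 z\<^sup>-\<^sup>2 + \<dots>\<close> tangent to the identity, formal or
  convergent, is encoded by the formal power series \<open>a\<close> of \<open>f - id\<close> in the variable \<open>z\<^sup>-\<^sup>1\<close>.
  In particular the identity is encoded by \<open>0\<close>, and \<open>z + 1\<close> by \<open>1\<close>.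
\<close>

definition germ_fun :: "complex fps \<Rightarrow> complex \<Rightarrow> complex" where
  "germ_fun a z = z + eval_fps a (inverse z)"

text \<open>
  If \<open>f = id + a\<close> and \<open>g = id + b\<close> then \<open>f \<circ> g = id + b + a \<circ> g\<close>, and \<open>1 / g(z) = w / (1 + w b(w))\<close>
  where \<open>w = z\<^sup>-\<^sup>1\<close>.
\<close>

definition germ_comp :: "complex fps \<Rightarrow> complex fps \<Rightarrow> complex fps" where
  "germ_comp a b = b + fps_compose a (fps_X * inverse (1 + fps_X * b))"

lemma germ_fun_comp:
  assumes "fps_conv_radius a > 0" "fps_conv_radius b > 0"
  shows "\<forall>\<^sub>F z in at_infinity. germ_fun (germ_comp a b) z = germ_fun a (germ_fun b z)"
proof -
  have a: "eval_fps a has_fps_expansion a" and b: "eval_fps b has_fps_expansion b"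
    using assms by (simp_all add: has_fps_expansion_def)
  have c: "(\<lambda>w. w * inverse (1 + w * eval_fps b w)) has_fps_expansion
             (fps_X * inverse (1 + fps_X * b))"
    by (intro fps_expansion_intros b) simp
  have "(eval_fps a \<circ> (\<lambda>w. w * inverse (1 + w * eval_fps b w))) has_fps_expansion
             (a oo (fps_X * inverse (1 + fps_X * b)))"
    by (rule has_fps_expansion_compose[OF a c]) simp
  hence "(\<lambda>w. eval_fps b w + eval_fps a (w * inverse (1 + w * eval_fps b w))) has_fps_expansion
            germ_comp a b"
    unfolding germ_comp_def o_def by (intro fps_expansion_intros b)
  hence "\<forall>\<^sub>F w in nhds 0. eval_fps (germ_comp a b) w =
            eval_fps b w + eval_fps a (w * inverse (1 + w * eval_fps b w))"
    by (simp add: has_fps_expansion_def)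
  hence "\<forall>\<^sub>F z in at_infinity. eval_fps (germ_comp a b) (inverse z) =
            eval_fps b (inverse z) + eval_fps a (inverse z * inverse (1 + inverse z * eval_fps b (inverse z)))"
    by (rule eventually_compose_filterlim) (rule tendsto_inverse_0)
  moreover have "\<forall>\<^sub>F z in at_infinity. (z::complex) \<noteq> 0"
    by (rule eventually_not_equal_at_infinity)
  ultimately show ?thesis
    by eventually_elim (simp add: germ_fun_def field_simps)
qed

text \<open>\<open>f \<in> z + 1 + z\<^sup>-\<^sup>2 \<complex>{z\<^sup>-\<^sup>1}\<close>; the coefficient of \<open>z\<^sup>-\<^sup>1\<close> is, up to sign, the resiter.\<close>

definition simple_parabolic_resiter0 :: "complex fps \<Rightarrow> bool" where
  "simple_parabolic_resiter0 f \<longleftrightarrow>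
     fps_conv_radius f > 0 \<and> fps_nth f 0 = 1 \<and> fps_nth f 1 = 0"

definition analytically_conjugate :: "complex fps \<Rightarrow> complex fps \<Rightarrow> bool" where
  "analytically_conjugate f g \<longleftrightarrow>
     (\<exists>h. fps_conv_radius h > 0 \<and> germ_comp g h = germ_comp h f)"

definition germ_inv :: "complex fps \<Rightarrow> complex fps" where
  "germ_inv a = (THE b. germ_comp a b = 0 \<and> germ_comp b a = 0)"

text \<open>The series \<open>\<phi>\<close> and \<open>\<psi>\<close> in \<open>v\<^sub>* = id + \<phi>\<close> and \<open>u\<^sub>* = id + \<psi>\<close>.\<close>

definition iterator :: "complex fps \<Rightarrow> complex fps" where
  "iterator f = (THE \<phi>. fps_nth \<phi> 0 = 0 \<and> germ_comp \<phi> f = \<phi> + 1)"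

definition inv_iterator :: "complex fps \<Rightarrow> complex fps" where
  "inv_iterator f = germ_inv (iterator f)"

text \<open>Intended for series without constant term, which is all it is applied to.\<close>

definition borel_transform :: "complex fps \<Rightarrow> complex fps" where
  "borel_transform \<phi> = Abs_fps (\<lambda>n. fps_nth \<phi> (Suc n) / fact n)"

definition arc_plus :: "real set" where
  "arc_plus = {-pi/2<..<pi/2}"

definition arc_minus :: "real set" where
  "arc_minus = {pi/2<..<3*pi/2}"

definition sector :: "real set \<Rightarrow> complex set" where
  "sector I = {of_real \<xi> * cis \<theta> | \<xi> \<theta>. \<xi> > 0 \<and> \<theta> \<in> I}"

text \<open>
  \<open>F\<close> is the analytic continuation of the convergent Borel transform to the sector;
  only the values of \<open>F\<close> on the sector are meaningful.
\<close>

definition borel_continuation :: "complex fps \<Rightarrow> real set \<Rightarrow> (complex \<Rightarrow> complex) \<Rightarrow> bool" where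
  "borel_continuation \<phi> I F \<longleftrightarrow>
     fps_conv_radius (borel_transform \<phi>) > 0 \<and>
     F holomorphic_on sector I \<and>
     (\<exists>r>0. \<forall>\<zeta>\<in>sector I. norm \<zeta> < r \<longrightarrow> F \<zeta> = eval_fps (borel_transform \<phi>) \<zeta>)"

definition locally_bounded_on :: "real set \<Rightarrow> (real \<Rightarrow> real) \<Rightarrow> bool" where
  "locally_bounded_on I b \<longleftrightarrow> (\<forall>\<theta>\<in>I. \<exists>d>0. bounded (b ` (I \<inter> ball \<theta> d)))"

definition exp_bounded_on :: "real set \<Rightarrow> (complex \<Rightarrow> complex) \<Rightarrow> (real \<Rightarrow> real) \<Rightarrow> bool" where
  "exp_bounded_on I F \<beta> \<longleftrightarrow> locally_bounded_on I \<beta> \<and>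
     (\<exists>\<alpha>. locally_bounded_on I \<alpha> \<and>
        (\<forall>\<theta>\<in>I. \<forall>\<xi>>0. norm (F (of_real \<xi> * cis \<theta>)) \<le> \<alpha> \<theta> * exp (\<beta> \<theta> * \<xi>)))"

text \<open>
  The Borel sum of \<open>id + \<phi>\<close> in the directions of \<open>I\<close>. By Cauchy's theorem the value of the
  Laplace integral depends neither on the direction \<open>\<theta>\<close> nor on the bound \<open>\<beta>\<close>; it is
  meaningful for \<open>z\<close> in the union over \<open>\<theta> \<in> I\<close> of the half-planes \<open>Re (z e\<^sup>i\<^sup>\<theta>) > \<beta>(\<theta>)\<close>.
\<close>

definition borel_sum :: "complex fps \<Rightarrow> real set \<Rightarrow> complex \<Rightarrow> complex" where
  "borel_sum \<phi> I z = z +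
     (THE L. \<exists>F \<beta> \<theta>. borel_continuation \<phi> I F \<and> exp_bounded_on I F \<beta> \<and>
        \<theta> \<in> I \<and> Re (z * cis \<theta>) > \<beta> \<theta> \<and>
        L = (LBINT \<xi>:{0<..}. exp (- z * of_real \<xi> * cis \<theta>) * F (of_real \<xi> * cis \<theta>) * cis \<theta>))"

definition v_plus :: "complex fps \<Rightarrow> complex \<Rightarrow> complex" where
  "v_plus f = borel_sum (iterator f) arc_plus"

definition u_minus :: "complex fps \<Rightarrow> complex \<Rightarrow> complex" where
  "u_minus f = borel_sum (inv_iterator f) arc_minus"

text \<open>
  The lifted horn maps are the analytic continuations of \<open>v\<^sub>*\<^sup>+ \<circ> u\<^sub>*\<^sup>-\<close> to some half-plane
  \<open>Im z > \<sigma>\<close>, resp. \<open>Im z < - \<sigma>\<close>. No particular \<open>\<sigma>\<close> is singled out, so that only their values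
  for \<open>\<bar>Im z\<bar>\<close> large enough are determined, and identities between them are meant there.
\<close>

definition horn_up :: "complex fps \<Rightarrow> complex \<Rightarrow> complex" where
  "horn_up f = (SOME H. \<exists>\<sigma>>0. H holomorphic_on {z. Im z > \<sigma>} \<and>
     (\<exists>R>0. \<forall>r>R. \<forall>\<theta>\<in>{pi/4<..<3*pi/4}.
        H (of_real r * cis \<theta>) = v_plus f (u_minus f (of_real r * cis \<theta>))))"

definition horn_low :: "complex fps \<Rightarrow> complex \<Rightarrow> complex" where
  "horn_low f = (SOME H. \<exists>\<sigma>>0. H holomorphic_on {z. Im z < - \<sigma>} \<and>
     (\<exists>R>0. \<forall>r>R. \<forall>\<theta>\<in>{5*pi/4<..<7*pi/4}.
        H (of_real r * cis \<theta>) = v_plus f (u_minus f (of_real r * cis \<theta>))))"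

definition horn_maps_related :: "complex fps \<Rightarrow> complex fps \<Rightarrow> complex \<Rightarrow> bool" where
  "horn_maps_related f g c \<longleftrightarrow>
     (\<exists>\<sigma>>0. \<forall>z. Im z > \<sigma> \<longrightarrow> horn_up g z = horn_up f (z + c) - c) \<and>
     (\<exists>\<sigma>>0. \<forall>z. Im z < - \<sigma> \<longrightarrow> horn_low g z = horn_low f (z + c) - c)"

text \<open>The \<open>A\<^sub>m\<close> for \<open>m \<noteq> 0\<close>; the value at \<open>0\<close> is a dummy.\<close>

definition ecalle_voronin :: "complex fps \<Rightarrow> int \<Rightarrow> complex" where
  "ecalle_voronin f = (THE A. A 0 = 0 \<and> (\<exists>\<sigma>>0.
     (\<forall>z. Im z > \<sigma> \<longrightarrow>
        (\<lambda>n. A (- int (Suc n)) * exp (2 * of_real pi * \<i> * of_nat (Suc n) * z))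
          sums (horn_up f z - z)) \<and>
     (\<forall>z. Im z < - \<sigma> \<longrightarrow>
        (\<lambda>n. A (int (Suc n)) * exp (- (2 * of_real pi * \<i> * of_nat (Suc n) * z)))
          sums (horn_low f z - z))))"

end

theory Submission
  imports Defs "HOL-Real_Asymp.Real_Asymp"
begin

text \<open>
  On the complement of a half-strip around the negative (positive) axis, the sum along the orbits
  of \<open>f - id - 1\<close> produces a Fatou coordinate \<open>v\<^sup>+\<close> (\<open>v\<^sup>-\<close>), i.e. a holomorphic solution of
  \<open>v \<circ> f = v + 1\<close> close to the identity, with inverse \<open>u\<^sup>+\<close> (\<open>u\<^sup>-\<close>). Since \<open>v\<^sup>+ \<circ> u\<^sup>- - id\<close> is
  \<open>1\<close>-periodic, the differences \<open>v\<^sup>+ - v\<^sup>-\<close> and \<open>u\<^sup>+ - u\<^sup>-\<close> are exponentially small far above and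
  below the axis. A Cauchy--Heine integral then exhibits both functions of such a pair as Borel
  sums of one formal series, which is the iterator or its inverse by uniqueness of the formal
  solution; no convolution equation in the Borel plane is needed. So the horn maps are
  \<open>v\<^sup>+ \<circ> u\<^sup>-\<close> for the Fatou coordinates.

  If \<open>h\<close> conjugates \<open>f\<close> to \<open>g\<close>, then \<open>v\<^sub>g \<circ> h - v\<^sub>f\<close> is invariant under \<open>f\<close>, hence constant,
  equal to the constant term of \<open>h\<close> on both sides, and the horn maps are related by this constant.
  Conversely, if they are related by \<open>c\<close>, then \<open>u\<^sub>g\<^sup>\<plusminus> \<circ> (v\<^sub>f\<^sup>\<plusminus> - c)\<close> agree far above and below the
  axis and form a conjugacy around \<open>\<infinity>\<close>, which is a convergent germ because the singularity
  at \<open>\<infinity>\<close> of its difference with the identity is removable. The relation between the invariants is the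
  uniqueness of Fourier expansions.
\<close>

subsection \<open>Composition of formal germs\<close>

text \<open>The hard point is analytic: a series that usually diverges must be shown to have a
  convergent Borel transform with an exponentially bounded continuation. Its source is the factor
  exp (-2 pi |Im z|), forced by 1-periodicity, in the difference of the two functions of a pair. An
  integral of this difference against exp (\<zeta> t) along a vertical ray converges for |\<zeta>| <
  1, which gives the disc of convergence; turning the rays to the left leaves an integral of the
  right-hand function alone, which converges for all Re \<zeta> > 0 and gives the continuation. The
  Laplace transform replaces exp (\<zeta> t) by 1 / (x - t), and Cauchy's formula recovers the
  function. Vanishing resiter means f - id - 1 = O(z^-2), so that the sums along orbits converge
  without a logarithmic correction. The series of u is recognised by the equation f o u = u o (z +
  1), not by inverting that of v, so that the two are treated alike. The left side is reduced to the
  right one by z -> -z, applied to the inverse of f. Since the horn maps are only specified up to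
  the choice of a half-plane, they are compared throughout with one explicit composite.\<close>

definition recip_coord :: "complex fps \<Rightarrow> complex fps" where
  "recip_coord b = fps_X * inverse (1 + fps_X * b)"

lemma recip_coord_nth_0 [simp]: "fps_nth (recip_coord b) 0 = 0"
  by (simp add: recip_coord_def)

lemma recip_coord_0 [simp]: "recip_coord 0 = fps_X"
  by (simp add: recip_coord_def)

lemma germ_comp_eq: "germ_comp a b = b + (a oo recip_coord b)"
  by (simp add: germ_comp_def recip_coord_def)

text \<open>In the coordinate w = 1/z a germ is the ordinary power series w / (1 + w b(w)), so that
  composition of germs becomes composition of series. Associativity of \<open>germ_comp\<close>
  below is that of \<open>fps_compose\<close> read through this.\<close>

lemma recip_coord_germ_comp: "recip_coord (germ_comp a b) = recip_coord a oo recip_coord b"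
proof -
  define Y where "Y = inverse (1 + fps_X * b)"
  define A where "A = a oo recip_coord b"
  have n1: "fps_nth (1 + fps_X * b) 0 \<noteq> 0" by simp
  have W: "recip_coord b = fps_X * Y" by (simp add: recip_coord_def Y_def)
  have Y: "(1 + fps_X * b) * Y = 1"
    unfolding Y_def using n1 by (metis inverse_mult_eq_1 mult.commute)
  have Y0: "fps_nth Y 0 \<noteq> 0" by (simp add: Y_def)
  have "recip_coord a oo recip_coord b = (fps_X oo recip_coord b) * (inverse (1 + fps_X * a) oo recip_coord b)"
    unfolding recip_coord_def[of a] by (rule fps_compose_mult_distrib) simp
  also have "inverse (1 + fps_X * a) oo recip_coord b = inverse ((1 + fps_X * a) oo recip_coord b)"
    by (rule fps_inverse_compose) (simp_all add: recip_coord_def)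
  also have "(1 + fps_X * a) oo recip_coord b = 1 + recip_coord b * A"
    by (simp add: fps_compose_add_distrib fps_compose_mult_distrib A_def)
  also have "1 + recip_coord b * A = (1 + fps_X * (b + A)) * Y"
    using Y by (simp add: W algebra_simps)
  also have "inverse ((1 + fps_X * (b + A)) * Y) = inverse (1 + fps_X * (b + A)) * inverse Y"
    by (rule fps_inverse_mult)
  also have "inverse Y = 1 + fps_X * b"
    unfolding Y_def by (rule fps_inverse_idempotent) simp
  finally have "recip_coord a oo recip_coord b = (fps_X * inverse (1 + fps_X * (b + A))) * ((1 + fps_X * b) * Y)"
    by (simp add: W fps_X_fps_compose_startby0 mult_ac)
  thus ?thesis by (simp only: Y) (simp add: germ_comp_eq A_def recip_coord_def)
qed

lemma germ_comp_assoc: "germ_comp a (germ_comp b c) = germ_comp (germ_comp a b) c"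
proof -
  have "a oo recip_coord b oo recip_coord c = a oo (recip_coord b oo recip_coord c)"
    by (rule fps_compose_assoc[symmetric]) simp_all
  thus ?thesis
    by (simp add: germ_comp_eq[of a] germ_comp_eq[of b] germ_comp_eq[of _ c]
        recip_coord_germ_comp[of b c, unfolded germ_comp_eq[of b]] fps_compose_add_distrib add_ac)
qed

lemma germ_comp_0_right [simp]: "germ_comp a 0 = a"
  by (simp add: germ_comp_eq)

lemma germ_comp_0_left [simp]: "germ_comp 0 b = b"
  by (simp add: germ_comp_eq)

lemma germ_comp_add_const: "germ_comp (a + fps_const c) b = germ_comp a b + fps_const c"
  by (simp add: germ_comp_eq fps_compose_add_distrib)

lemma compose_recip_coord_eq_0:
  assumes "a oo recip_coord b = 0"
  shows "a = 0"
proof -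
  have "fps_nth (recip_coord b) 1 = 1" by (simp add: recip_coord_def)
  hence "recip_coord b \<noteq> 0" by auto
  thus ?thesis using assms by (simp add: fps_compose_eq_0_iff)
qed

text \<open>Let f_0 be the constant coefficient. Substituting w -> w - f_0 w^2 + ... in w^k u(w)
  changes the coefficient of w^(k+1) by -k f_0 u_0. This is nonzero when w^k, k > 0, is the leading
  power of the nonconstant part, so an invariant series has no such part.\<close>

lemma invariant_series_const:
  assumes f: "fps_nth f 0 \<noteq> 0" and inv: "d oo recip_coord f = d"
  shows "d = fps_const (fps_nth d 0)"
proof (rule ccontr)
  define e where "e = d - fps_const (fps_nth d 0)"
  assume "d \<noteq> fps_const (fps_nth d 0)"
  hence e0: "e \<noteq> 0" by (simp add: e_def)
  have einv: "e oo recip_coord f = e" by (simp add: e_def fps_compose_sub_distrib inv)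
  define k where "k = subdegree e"
  have k: "k > 0" using e0 by (simp add: k_def e_def subdegree_eq_0_iff flip: neq0_conv)
  define u where "u = fps_shift k e"
  have eu: "e = fps_X ^ k * u" unfolding u_def k_def
    by (metis mult.commute subdegree_decompose)
  have u0: "fps_nth u 0 \<noteq> 0" using e0 by (simp add: u_def k_def)
  define y where "y = inverse (1 + fps_X * f)"
  have y0: "fps_nth y 0 = 1" by (simp add: y_def)
  have "(1 + fps_X * f) * y = 1"
    unfolding y_def using inverse_mult_eq_1[of "1 + fps_X * f"] by (simp add: mult.commute)
  hence "fps_nth ((1 + fps_X * f) * y) 1 = 0" by simp
  hence y1: "fps_nth y 1 = - fps_nth f 0" using y0
    by (simp add: fps_mult_nth_1 algebra_simps eq_neg_iff_add_eq_0)
  have W: "recip_coord f = fps_X * y" by (simp add: recip_coord_def y_def)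
  have "e oo recip_coord f = (fps_X ^ k oo recip_coord f) * (u oo recip_coord f)"
    unfolding eu by (rule fps_compose_mult_distrib) simp
  also have "fps_X ^ k oo recip_coord f = fps_X ^ k * y ^ k"
    by (simp add: fps_compose_power[symmetric] W fps_X_fps_compose_startby0 power_mult_distrib)
  finally have "fps_X ^ k * (y ^ k * (u oo recip_coord f)) = fps_X ^ k * u"
    using einv eu by (simp add: mult_ac)
  hence eq: "y ^ k * (u oo recip_coord f) = u" by simp
  have yk: "fps_nth (y ^ k) 0 = 1" by (simp add: y0 fps_power_zeroth)
  have yk1: "fps_nth (y ^ k) 1 = of_nat k * fps_nth y 1"
    using fps_power_first[of y k] y0 by simp
  have uc: "fps_nth (u oo recip_coord f) 0 = fps_nth u 0"
    by simp
  have uc1: "fps_nth (u oo recip_coord f) 1 = fps_nth u 1"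
    by (simp add: fps_compose_nth W y0 fps_mult_nth_1)
  have "fps_nth (y ^ k * (u oo recip_coord f)) 1 = fps_nth u 1 - of_nat k * fps_nth f 0 * fps_nth u 0"
    by (simp add: fps_mult_nth_1 yk[simplified] yk1[simplified] uc uc1[simplified] y1[simplified])
  with eq have "of_nat k * fps_nth f 0 * fps_nth u 0 = 0" by simp
  with k f u0 show False by simp
qed

text \<open>Two solutions differ by an invariant series without constant term, hence not at all.
  With this, any solution found by analysis identifies the definite description.\<close>

lemma iterator_unique:
  assumes "fps_nth f 0 = 1" "fps_nth \<phi> 0 = 0" "germ_comp \<phi> f = \<phi> + 1"
  shows "iterator f = \<phi>"
  unfolding iterator_def
proof (rule the_equality)
  fix \<phi>' assume \<phi>': "fps_nth \<phi>' 0 = 0 \<and> germ_comp \<phi>' f = \<phi>' + 1"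
  have "\<phi>' - \<phi> = (\<phi>' - \<phi>) oo recip_coord f"
  proof -
    have 1: "f + (\<phi> oo recip_coord f) = \<phi> + 1" "f + (\<phi>' oo recip_coord f) = \<phi>' + 1"
      using assms(3) \<phi>' by (simp_all add: germ_comp_eq)
    show ?thesis using arg_cong2[OF 1(2) 1(1), of minus] by (simp add: fps_compose_sub_distrib)
  qed
  from invariant_series_const[OF _ this[symmetric]] assms \<phi>' show "\<phi>' = \<phi>" by simp
qed (use assms in auto)

text \<open>A one-sided inverse suffices: the composite c in the other order is idempotent, and c +
  (c oo \<open>recip_coord c\<close>) = c leaves a vanishing substitution into c, so that c =
  0.\<close>

lemma germ_inv_unique:
  assumes "germ_comp a b = 0"
  shows "germ_inv a = b"
proof -
  have ba: "germ_comp b a = 0"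
  proof -
    define c where "c = germ_comp b a"
    have "germ_comp c c = c"
      unfolding c_def by (metis assms germ_comp_assoc germ_comp_0_left)
    thus ?thesis unfolding c_def[symmetric]
      by (intro compose_recip_coord_eq_0[of c c]) (simp add: germ_comp_eq)
  qed
  show ?thesis unfolding germ_inv_def
  proof (rule the_equality)
    fix b' assume "germ_comp a b' = 0 \<and> germ_comp b' a = 0"
    thus "b' = b" by (metis assms germ_comp_assoc germ_comp_0_left germ_comp_0_right)
  qed (use assms ba in auto)
qed

text \<open>\<psi> is characterised by the equation f o u = u o (z + 1), which can be read off from
  a Fatou coordinate. Then v o u commutes with the translation by 1, so v o u - id is an invariant
  series, hence constant, and its constant term is 0.\<close>

lemma inv_iterator_unique:
  assumes f: "fps_nth f 0 = 1" and \<phi>: "fps_nth \<phi> 0 = 0" "germ_comp \<phi> f = \<phi> + 1"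
    and \<psi>: "fps_nth \<psi> 0 = 0" "germ_comp f \<psi> = germ_comp \<psi> 1"
  shows "inv_iterator f = \<psi>"
proof -
  define \<eta> where "\<eta> = germ_comp \<phi> \<psi>"
  have "germ_comp \<eta> 1 = germ_comp (\<phi> + fps_const 1) \<psi>"
    using \<phi> \<psi> by (simp add: \<eta>_def germ_comp_assoc flip: germ_comp_assoc)
       (metis germ_comp_assoc)
  hence "germ_comp \<eta> 1 = \<eta> + 1" unfolding germ_comp_add_const \<eta>_def by simp
  hence "\<eta> oo recip_coord 1 = \<eta>" by (simp add: germ_comp_eq)
  hence "\<eta> = fps_const (fps_nth \<eta> 0)" by (rule invariant_series_const[rotated]) simp
  also have "fps_nth \<eta> 0 = 0" by (simp add: \<eta>_def germ_comp_eq \<phi> \<psi>)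
  finally have "\<eta> = 0" by simp
  thus ?thesis unfolding inv_iterator_def iterator_unique[OF f \<phi>] \<eta>_def
    by (rule germ_inv_unique)
qed

subsection \<open>Asymptotic expansions\<close>

text \<open>A Poincare expansion in powers of 1/z; at order N the terms of degree below N are kept.
  A filter takes the place of a sector, because expansions are needed at \<open>at_infinity\<close>,
  in a cone and on half-lines.\<close>

definition asymptotic_to :: "complex filter \<Rightarrow> (complex \<Rightarrow> complex) \<Rightarrow> complex fps \<Rightarrow> bool" where
  "asymptotic_to G p a \<longleftrightarrow>
     (\<forall>N. (\<lambda>z. p z - eval_fps (fps_cutoff N a) (inverse z)) \<in> O[G](\<lambda>z. inverse z ^ N))"

lemma eval_fps_cutoff: "eval_fps (fps_cutoff N a) z = (\<Sum>k<N. fps_nth a k * z ^ k)"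
  for z :: complex
  unfolding eval_fps_def by (subst suminf_finite[of "{..<N}"]) auto

lemma fps_conv_radius_cutoff [simp]: "fps_conv_radius (fps_cutoff N a :: complex fps) = \<infinity>"
proof -
  have "eventually (\<lambda>n. fps_nth (fps_cutoff N a) n = 0) sequentially"
    using eventually_ge_at_top[of N] by eventually_elim simp
  thus ?thesis unfolding fps_conv_radius_def
    using conv_radius_cong'[of "fps_nth (fps_cutoff N a)" "\<lambda>_. 0"] by (simp add: eventually_mono)
qed

lemma asymptotic_to_mono: "asymptotic_to G' p a \<Longrightarrow> G \<le> G' \<Longrightarrow> asymptotic_to G p a"
  unfolding asymptotic_to_def by (meson landau_o.big.filter_mono)

lemma asymptotic_to_cong:
  "asymptotic_to G p a \<Longrightarrow> \<forall>\<^sub>F z in G. p z = q z \<Longrightarrow> asymptotic_to G q a"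
  unfolding asymptotic_to_def
proof (intro allI)
  fix N assume *: "\<forall>N. (\<lambda>z. p z - eval_fps (fps_cutoff N a) (inverse z)) \<in> O[G](\<lambda>z. inverse z ^ N)"
    and ev: "\<forall>\<^sub>F z in G. p z = q z"
  have "\<forall>\<^sub>F z in G. p z - eval_fps (fps_cutoff N a) (inverse z) = q z - eval_fps (fps_cutoff N a) (inverse z)"
    using ev by eventually_elim simp
  from landau_o.big.in_cong[OF this] *
  show "(\<lambda>z. q z - eval_fps (fps_cutoff N a) (inverse z)) \<in> O[G](\<lambda>z. inverse z ^ N)" by blast
qed

text \<open>The difference of the two series is w^N times a convergent series, which is bounded near
  w = 0.\<close>

lemma eval_fps_cutoff_diff_bigo:
  assumes a: "fps_conv_radius a > 0" and b: "fps_conv_radius b > 0"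
    and eq: "fps_cutoff N a = fps_cutoff N b"
  shows "(\<lambda>z. eval_fps a (inverse z) - eval_fps b (inverse z)) \<in> O[at_infinity](\<lambda>z::complex. inverse z ^ N)"
proof -
  define c where "c = a - b"
  have c: "fps_conv_radius c > 0" unfolding c_def
    using a b by (intro less_le_trans[OF _ fps_conv_radius_diff]) simp
  have ec: "\<forall>\<^sub>F w in nhds 0. eval_fps a w - eval_fps b w = eval_fps c w"
    using has_fps_expansion_diff[of "eval_fps a" a "eval_fps b" b] a b
    unfolding c_def has_fps_expansion_def by (auto elim: eventually_mono)
  define d where "d = fps_shift N c"
  have "fps_cutoff N c = 0" using eq by (simp add: c_def fps_cutoff_diff)
  hence cd: "c = d * fps_X ^ N" unfolding d_def
    using fps_shift_cutoff[of N c] by simp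
  have d: "fps_conv_radius d > 0" using c by (simp add: d_def)
  have ev: "\<forall>\<^sub>F w in nhds 0. eval_fps c w = w ^ N * eval_fps d w"
  proof -
    have "(\<lambda>w. eval_fps d w * w ^ N) has_fps_expansion d * fps_X ^ N"
      using d by (intro fps_expansion_intros) (auto simp: has_fps_expansion_def)
    thus ?thesis unfolding cd[symmetric] has_fps_expansion_def by (auto elim: eventually_mono simp: mult.commute)
  qed
  have "isCont (eval_fps d) 0"
    by (rule continuous_eval_fps) (use d in \<open>simp add: zero_ereal_def\<close>)
  hence lim: "(eval_fps d \<longlongrightarrow> eval_fps d 0) (nhds 0)"
    by (simp add: isCont_def tendsto_at_iff_tendsto_nhds)
  have "((\<lambda>z. eval_fps d (inverse z)) \<longlongrightarrow> eval_fps d 0) at_infinity"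
    by (rule filterlim_compose[OF lim tendsto_inverse_0])
  hence "(\<lambda>z. eval_fps d (inverse z)) \<in> O[at_infinity](\<lambda>_. 1)"
    by (intro bigoI_tendsto[of _ _ "eval_fps d 0"]) auto
  hence "(\<lambda>z. inverse z ^ N * eval_fps d (inverse z)) \<in> O[at_infinity](\<lambda>z. inverse z ^ N * 1)"
    by (intro landau_o.big.mult) auto
  moreover have "\<forall>\<^sub>F z in at_infinity. eval_fps a (inverse z) - eval_fps b (inverse z)
      = inverse z ^ N * eval_fps d (inverse z)"
    using eventually_compose_filterlim[OF eventually_conj[OF ec ev] tendsto_inverse_0]
    by eventually_elim simp
  ultimately show ?thesis by (simp add: landau_o.big.in_cong)
qed

lemma asymptotic_to_eval_fps:
  assumes "fps_conv_radius a > 0"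
  shows "asymptotic_to at_infinity (\<lambda>z. eval_fps a (inverse z)) a"
  unfolding asymptotic_to_def
  by (intro allI eval_fps_cutoff_diff_bigo assms) (auto simp: fps_eq_iff)

text \<open>At the first index k where the series differ, the two expansions of order k + 1 would
  give z^-k = O(z^-(k+1)).\<close>

lemma asymptotic_to_unique:
  assumes G: "G \<le> at_infinity" "G \<noteq> bot" and a: "asymptotic_to G p a" and b: "asymptotic_to G p b"
  shows "a = b"
proof (rule ccontr)
  assume "a \<noteq> b"
  define c where "c = b - a"
  define k where "k = subdegree c"
  have c: "c \<noteq> 0" using \<open>a \<noteq> b\<close> by (simp add: c_def)
  have ck: "fps_nth c k \<noteq> 0" using c by (simp add: k_def)
  have nz: "\<forall>\<^sub>F z in G. z \<noteq> 0"
    by (rule filter_leD[OF G(1)]) (rule eventually_not_equal_at_infinity)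
  have big: "(\<lambda>z. (p z - eval_fps (fps_cutoff (Suc k) a) (inverse z)) - (p z - eval_fps (fps_cutoff (Suc k) b) (inverse z)))
      \<in> O[G](\<lambda>z. inverse z ^ Suc k)"
    using a[unfolded asymptotic_to_def, rule_format, of "Suc k"] b[unfolded asymptotic_to_def, rule_format, of "Suc k"]
    by (rule sum_in_bigo(2))
  have eq: "(p z - eval_fps (fps_cutoff (Suc k) a) (inverse z)) - (p z - eval_fps (fps_cutoff (Suc k) b) (inverse z))
      = fps_nth c k * inverse z ^ k" for z
  proof -
    have "(\<Sum>i<k. fps_nth c i * inverse z ^ i) = 0"
    proof (rule sum.neutral, rule ballI)
      fix i assume "i \<in> {..<k}"
      hence "fps_nth c i = 0" using nth_less_subdegree_zero[of i c] by (simp add: k_def)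
      thus "fps_nth c i * inverse z ^ i = 0" by simp
    qed
    hence "(\<Sum>i<Suc k. fps_nth c i * inverse z ^ i) = fps_nth c k * inverse z ^ k" by simp
    thus ?thesis
      by (simp add: eval_fps_cutoff c_def sum_subtractf left_diff_distrib del: sum.lessThan_Suc)
  qed
  from big have "(\<lambda>z. fps_nth c k * inverse z ^ k) \<in> O[G](\<lambda>z. inverse z ^ Suc k)"
    unfolding eq .
  then obtain C where C: "\<forall>\<^sub>F z in G. norm (fps_nth c k * inverse z ^ k) \<le> C * norm (inverse z ^ Suc k)"
    by (elim landau_o.bigE)
  have "\<forall>\<^sub>F z in G. norm (fps_nth c k) \<le> C * norm (inverse z)"
    using C nz
  proof eventually_elim
    case (elim z)
    hence "norm (inverse z) ^ k * norm (fps_nth c k) \<le> norm (inverse z) ^ k * (C * norm (inverse z))"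
      by (simp add: norm_mult norm_power mult_ac)
    thus ?case using elim by (simp add: mult_le_cancel_left)
  qed
  moreover have "((\<lambda>z. C * norm (inverse z)) \<longlongrightarrow> C * norm (0::complex)) G"
    by (intro tendsto_intros tendsto_mono[OF G(1) tendsto_inverse_0])
  ultimately have "norm (fps_nth c k) \<le> C * norm (0::complex)"
    by (intro tendsto_lowerbound[OF _ _ G(2)])
  with ck show False by simp
qed

text \<open>Makes it possible to replace formal series by polynomials modulo X^N, to which facts on
  convergent series apply.\<close>

lemma fps_cutoff_compose_cong:
  fixes a a' :: "'a :: idom fps"
  assumes "fps_cutoff N a = fps_cutoff N a'" "fps_cutoff N b = fps_cutoff N b'"
    "fps_nth b 0 = 0" "fps_nth b' 0 = 0"
  shows "fps_cutoff N (a oo b) = fps_cutoff N (a' oo b')"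
proof -
  have pow: "fps_cutoff N (b ^ i) = fps_cutoff N (b' ^ i)" for i
  proof (induction i)
    case (Suc i)
    have "fps_nth (b * b ^ i) n = fps_nth (b' * b' ^ i) n" if "n < N" for n
      unfolding fps_mult_nth
    proof (rule sum.cong)
      fix j assume "j \<in> {0..n}"
      hence "j < N" "n - j < N" using that by auto
      thus "fps_nth b j * fps_nth (b ^ i) (n - j) = fps_nth b' j * fps_nth (b' ^ i) (n - j)"
        using assms(2) Suc by (simp add: fps_cutoff_eq_fps_cutoff_iff)
    qed simp
    thus ?case by (simp add: fps_cutoff_eq_fps_cutoff_iff)
  qed simp
  show ?thesis using assms(1) pow
    by (auto simp: fps_cutoff_eq_fps_cutoff_iff fps_compose_nth intro!: sum.cong)
qed

lemma fps_conv_radius_germ_comp: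
  assumes "fps_conv_radius a > 0" "fps_conv_radius b > 0"
  shows "fps_conv_radius (germ_comp a b) > 0"
proof -
  have a: "eval_fps a has_fps_expansion a" and b: "eval_fps b has_fps_expansion b"
    using assms by (simp_all add: has_fps_expansion_def)
  have c: "(\<lambda>w. w * inverse (1 + w * eval_fps b w)) has_fps_expansion recip_coord b"
    unfolding recip_coord_def by (intro fps_expansion_intros b) simp
  have "(eval_fps a \<circ> (\<lambda>w. w * inverse (1 + w * eval_fps b w))) has_fps_expansion (a oo recip_coord b)"
    by (rule has_fps_expansion_compose[OF a c]) simp
  from has_fps_expansion_add[OF b this]
  have "(\<lambda>w. eval_fps b w + (eval_fps a \<circ> (\<lambda>w. w * inverse (1 + w * eval_fps b w))) w) has_fps_expansion
            germ_comp a b"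
    by (simp add: germ_comp_eq)
  thus ?thesis by (simp add: has_fps_expansion_def)
qed

text \<open>Modulo w^N both series are replaced by polynomials A and B, for which formal and actual
  composition agree by \<open>germ_fun_comp\<close>. Four errors remain: that of p, that of q at
  P(z), the change of A when P is replaced by its approximation Q, and the terms of degree at least
  N in the composite.\<close>

lemma asymptotic_to_compose:
  assumes G: "G \<le> at_infinity" and p: "asymptotic_to G p b"
    and G': "G' \<le> at_infinity" and q: "asymptotic_to G' q a"
    and lim: "filterlim (\<lambda>z. z + p z) G' G"
  shows "asymptotic_to G (\<lambda>z. p z + q (z + p z)) (germ_comp a b)"
  unfolding asymptotic_to_def
proof
  fix N
  define A where "A = fps_cutoff N a"
  define B where "B = fps_cutoff N b"
  define P where "P = (\<lambda>z. z + p z)"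
  define Q where "Q = (\<lambda>z. z + eval_fps B (inverse z))"
  have nz: "\<forall>\<^sub>F z in G. z \<noteq> 0"
    by (rule filter_leD[OF G(1)]) (rule eventually_not_equal_at_infinity)
  have inv0: "(inverse \<longlongrightarrow> (0::complex)) G"
    by (rule tendsto_mono[OF G tendsto_inverse_0])
  have evB: "\<exists>l. ((\<lambda>z. eval_fps (fps_cutoff M b) (inverse z)) \<longlongrightarrow> l) G" for M
    unfolding eval_fps_cutoff
    by (rule exI[of _ "\<Sum>k<M. fps_nth b k * 0 ^ k"]) (intro tendsto_intros inv0)
  have bnd_id: "(\<lambda>z. z + r z) \<in> \<Theta>[G](\<lambda>z. z)" if "r \<in> O[G](\<lambda>_. 1)" for r
  proof -
    have "(\<lambda>_. 1) \<in> o[G](\<lambda>z::complex. z)"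
      using inv0 nz by (intro smalloI_tendsto) (auto simp: inverse_eq_divide[abs_def])
    hence "r \<in> o[G](\<lambda>z. z)" by (rule landau_o.big_small_trans[OF that])
    have eq: "\<Theta>[G](\<lambda>z. z + r z) = \<Theta>[G](\<lambda>z. z)"
      by (rule landau_theta.plus_absorb2) fact
    have "(\<lambda>z. z + r z) \<in> \<Theta>[G](\<lambda>z. z + r z)" by simp
    thus ?thesis unfolding eq .
  qed
  have rp: "p \<in> O[G](\<lambda>_. 1)"
    using p[unfolded asymptotic_to_def, rule_format, of 0] by simp
  have rB: "(\<lambda>z. eval_fps B (inverse z)) \<in> O[G](\<lambda>_. 1)"
    using evB[of N] unfolding B_def by (auto intro: bigoI_tendsto)
  have thP: "P \<in> \<Theta>[G](\<lambda>z. z)" and thQ: "Q \<in> \<Theta>[G](\<lambda>z. z)"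
    unfolding P_def Q_def by (intro bnd_id rp rB)+
  have iP: "(\<lambda>z. inverse (P z)) \<in> \<Theta>[G](\<lambda>z. inverse z)" and iQ: "(\<lambda>z. inverse (Q z)) \<in> \<Theta>[G](\<lambda>z. inverse z)"
    using thP thQ by (simp_all only: bigtheta_inverse)
  have "asymptotic_to G' q a" by fact
  have 1: "(\<lambda>z. p z - eval_fps B (inverse z)) \<in> O[G](\<lambda>z. inverse z ^ N)"
    using p by (simp add: asymptotic_to_def B_def)
  have "(\<lambda>z. q (P z) - eval_fps A (inverse (P z))) \<in> O[G](\<lambda>z. inverse (P z) ^ N)"
    by (rule landau_o.big.compose[of "\<lambda>z. q z - eval_fps A (inverse z)" G' "\<lambda>z. inverse z ^ N"])
       (use q lim in \<open>auto simp: asymptotic_to_def A_def P_def\<close>)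
  also have "(\<lambda>z. inverse (P z) ^ N) \<in> O[G](\<lambda>z. inverse z ^ N)"
    by (intro landau_o.big_power) (rule bigthetaD1[OF iP])
  finally have 2: "(\<lambda>z. q (P z) - eval_fps A (inverse (P z))) \<in> O[G](\<lambda>z. inverse z ^ N)" .
  have ab: "\<forall>\<^sub>F z in G. P z \<noteq> 0 \<and> Q z \<noteq> 0 "
    using nz eventually_nonzero_bigtheta[OF thP] eventually_nonzero_bigtheta[OF thQ]
    by (simp add: eventually_conj)
  \<comment> \<open>Induction on k by x^(k+1) - y^(k+1) = x (x^k - y^k) + (x - y) y^k, the factors
    1/P and 1/Q being bounded.\<close>
  have pw: "(\<lambda>z. inverse (P z) ^ k - inverse (Q z) ^ k) \<in> O[G](\<lambda>z. inverse z ^ N)" for k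
  proof (induction k)
    case (Suc k)
    have "(\<lambda>z. inverse (P z) - inverse (Q z)) \<in> O[G](\<lambda>z. inverse z ^ N)"
    proof -
      have "(\<lambda>z. (eval_fps B (inverse z) - p z) * (inverse (P z) * inverse (Q z)))
          \<in> O[G](\<lambda>z. inverse z ^ N * (1 * 1))"
      proof (intro landau_o.big.mult)
        show "(\<lambda>z. eval_fps B (inverse z) - p z) \<in> O[G](\<lambda>z. inverse z ^ N)"
          by (subst landau_o.big.uminus_in_iff[symmetric]) (use 1 in simp)
        have o1: "inverse \<in> O[G](\<lambda>_. 1::complex)" using inv0 by (intro bigoI_tendsto[of _ _ 0]) auto
        show "(\<lambda>z. inverse (P z)) \<in> O[G](\<lambda>_. 1)" "(\<lambda>z. inverse (Q z)) \<in> O[G](\<lambda>_. 1)"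
          by (rule landau_o.big.trans[OF bigthetaD1[OF iP] o1], rule landau_o.big.trans[OF bigthetaD1[OF iQ] o1])
      qed
      moreover have "\<forall>\<^sub>F z in G. (eval_fps B (inverse z) - p z) * (inverse (P z) * inverse (Q z)) = inverse (P z) - inverse (Q z)"
        using ab by eventually_elim (auto simp: field_simps P_def Q_def)
      ultimately show ?thesis by (simp add: landau_o.big.in_cong)
    qed
    hence "(\<lambda>z. inverse (P z) * (inverse (P z) ^ k - inverse (Q z) ^ k) + (inverse (P z) - inverse (Q z)) * inverse (Q z) ^ k)
      \<in> O[G](\<lambda>z. inverse z ^ N)"
    proof (intro sum_in_bigo)
      have o1: "inverse \<in> O[G](\<lambda>_. 1::complex)" using inv0 by (intro bigoI_tendsto[of _ _ 0]) auto
      have P1: "(\<lambda>z. inverse (P z)) \<in> O[G](\<lambda>_. 1)" and Q1: "(\<lambda>z. inverse (Q z)) \<in> O[G](\<lambda>_. 1)"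
          by (rule landau_o.big.trans[OF bigthetaD1[OF iP] o1], rule landau_o.big.trans[OF bigthetaD1[OF iQ] o1])
      show "(\<lambda>z. inverse (P z) * (inverse (P z) ^ k - inverse (Q z) ^ k)) \<in> O[G](\<lambda>z. inverse z ^ N)"
        using landau_o.big.mult[OF P1 Suc] by simp
      assume *: "(\<lambda>z. inverse (P z) - inverse (Q z)) \<in> O[G](\<lambda>z. inverse z ^ N)"
      have "(\<lambda>z. inverse (Q z) ^ k) \<in> O[G](\<lambda>_. 1 ^ k)" by (rule landau_o.big_power[OF Q1])
      from landau_o.big.mult[OF * this]
      show "(\<lambda>z. (inverse (P z) - inverse (Q z)) * inverse (Q z) ^ k) \<in> O[G](\<lambda>z. inverse z ^ N)" by simp
    qed
    thus ?case by (simp add: algebra_simps)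
  qed simp
  have 3: "(\<lambda>z. eval_fps A (inverse (P z)) - eval_fps A (inverse (Q z))) \<in> O[G](\<lambda>z. inverse z ^ N)"
  proof -
    have "(\<lambda>z. \<Sum>k<N. fps_nth a k * (inverse (P z) ^ k - inverse (Q z) ^ k)) \<in> O[G](\<lambda>z. inverse z ^ N)"
      by (rule big_sum_in_bigo) (use pw in simp)
    thus ?thesis by (simp add: A_def eval_fps_cutoff sum_subtractf right_diff_distrib)
  qed
  have cA: "fps_conv_radius A > 0" and cB: "fps_conv_radius B > 0" by (simp_all add: A_def B_def)
  have 4: "(\<lambda>z. eval_fps (germ_comp A B) (inverse z) - eval_fps (fps_cutoff N (germ_comp a b)) (inverse z))
      \<in> O[G](\<lambda>z. inverse z ^ N)"
  proof (rule landau_o.big.filter_mono[OF G], rule eval_fps_cutoff_diff_bigo)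
    have BB: "fps_cutoff N B = fps_cutoff N b" by (auto simp: B_def fps_eq_iff)
    have WW: "fps_cutoff N (recip_coord B) = fps_cutoff N (recip_coord b)"
    proof -
      \<comment> \<open>Written as a composition with X x, the inverse is covered by the truncation
        rule for compositions.\<close>
      have W: "recip_coord x = fps_X * (inverse (1 + fps_X) oo (fps_X * x))" for x :: "complex fps"
        unfolding recip_coord_def by (subst fps_inverse_compose) (auto simp: fps_compose_add_distrib)
      have XB: "fps_cutoff N (fps_X * B) = fps_cutoff N (fps_X * b)"
        using BB by (auto simp: fps_cutoff_eq_fps_cutoff_iff)
      have c: "fps_cutoff N (inverse (1 + fps_X) oo (fps_X * B)) = fps_cutoff N (inverse (1 + fps_X) oo (fps_X * b))"
        by (rule fps_cutoff_compose_cong[OF refl XB]) auto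
      show ?thesis unfolding W using c
        by (auto simp: fps_cutoff_eq_fps_cutoff_iff)
    qed
    have "fps_cutoff N (A oo recip_coord B) = fps_cutoff N (a oo recip_coord b)"
      by (rule fps_cutoff_compose_cong[OF _ WW]) (auto simp: A_def fps_eq_iff)
    thus "fps_cutoff N (germ_comp A B) = fps_cutoff N (fps_cutoff N (germ_comp a b))"
      using BB by (auto simp: germ_comp_eq fps_cutoff_add fps_eq_iff)
  qed (auto intro: fps_conv_radius_germ_comp cA cB)
  have "\<forall>\<^sub>F z in G. germ_fun (germ_comp A B) z = germ_fun A (germ_fun B z)"
    using germ_fun_comp[OF cA cB] by (rule filter_leD[OF G])
  hence ev: "\<forall>\<^sub>F z in G. eval_fps (germ_comp A B) (inverse z) = eval_fps B (inverse z) + eval_fps A (inverse (Q z))"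
    by eventually_elim (simp add: germ_fun_def Q_def)
  have "(\<lambda>z. (p z - eval_fps B (inverse z)) + (q (P z) - eval_fps A (inverse (P z)))
       + (eval_fps A (inverse (P z)) - eval_fps A (inverse (Q z)))
       + (eval_fps (germ_comp A B) (inverse z) - eval_fps (fps_cutoff N (germ_comp a b)) (inverse z)))
       \<in> O[G](\<lambda>z. inverse z ^ N)"
    by (intro sum_in_bigo 1 2 3 4)
  moreover have "\<forall>\<^sub>F z in G. (p z - eval_fps B (inverse z)) + (q (P z) - eval_fps A (inverse (P z)))
       + (eval_fps A (inverse (P z)) - eval_fps A (inverse (Q z)))
       + (eval_fps (germ_comp A B) (inverse z) - eval_fps (fps_cutoff N (germ_comp a b)) (inverse z))
       = p z + q (z + p z) - eval_fps (fps_cutoff N (germ_comp a b)) (inverse z)"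
    using ev by eventually_elim (simp add: P_def)
  ultimately show "(\<lambda>z. p z + q (z + p z) - eval_fps (fps_cutoff N (germ_comp a b)) (inverse z))
     \<in> O[G](\<lambda>z. inverse z ^ N)"
    by (rule iffD1[OF landau_o.big.in_cong, rotated])
qed

subsection \<open>Laplace integrals\<close>

lemma integral_ray_FTC:
  fixes F f :: "real \<Rightarrow> complex"
  assumes F: "\<And>s. s > 0 \<Longrightarrow> (F has_vector_derivative f s) (at s)"
    and f: "continuous_on {0<..} f" and int: "set_integrable lborel {0<..} f"
    and A: "(F \<longlongrightarrow> A) (at_right 0)" and B: "(F \<longlongrightarrow> B) at_top"
  shows "(LBINT s:{0<..}. f s) = B - A"
proof -
  have e: "einterval 0 \<infinity> = {0::real<..}"
    by (auto simp: einterval_def)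
  have "(LBINT s=0..\<infinity>. f s) = B - A"
  proof (rule interval_integral_FTC_integrable[where F = F])
    show "((F \<circ> real_of_ereal) \<longlongrightarrow> A) (at_right 0)"
      using A unfolding zero_ereal_def by (subst ereal_tendsto_simps) auto
    show "((F \<circ> real_of_ereal) \<longlongrightarrow> B) (at_left \<infinity>)"
      using B by (subst ereal_tendsto_simps) auto
    show "isCont f x" if "0 < ereal x" for x
      using f that by (simp add: continuous_on_eq_continuous_at)
  qed (use F int in \<open>auto simp: e\<close>)
  thus ?thesis by (simp add: interval_lebesgue_integral_def e)
qed

lemma set_integrable_continuous_bound:
  fixes f :: "real \<Rightarrow> complex" and h :: "real \<Rightarrow> real"
  assumes "continuous_on A f" "A \<in> sets borel" "set_integrable lborel A h"
    "\<And>s. s \<in> A \<Longrightarrow> norm (f s) \<le> h s"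
  shows "set_integrable lborel A f"
  unfolding set_integrable_def
proof (rule Bochner_Integration.integrable_bound)
  show "integrable lborel (\<lambda>x. indicat_real A x *\<^sub>R h x)" using assms(3) by (simp add: set_integrable_def)
  show "(\<lambda>x. indicat_real A x *\<^sub>R f x) \<in> borel_measurable lborel"
    using borel_measurable_continuous_on_indicator[OF assms(2,1)] by simp
  show "AE x in lborel. norm (indicat_real A x *\<^sub>R f x) \<le> norm (indicat_real A x *\<^sub>R h x)"
    using assms(4) by (intro AE_I2) (auto simp: indicator_def intro: order_trans[OF _ abs_ge_self])
qed

lemma set_integral_norm_le:
  fixes f :: "real \<Rightarrow> complex" and h :: "real \<Rightarrow> real"
  assumes "set_integrable lborel A f" "set_integrable lborel A h"
    "\<And>s. s \<in> A \<Longrightarrow> norm (f s) \<le> h s"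
  shows "norm (LBINT s:A. f s) \<le> (LBINT s:A. h s)"
proof -
  have "norm (LBINT s:A. f s) \<le> (LBINT s:A. norm (f s))"
    unfolding set_lebesgue_integral_def
    by (rule order_trans[OF integral_norm_bound]) simp
  also have "\<dots> \<le> (LBINT s:A. h s)"
    by (rule set_integral_mono) (use assms in \<open>auto intro: set_integrable_norm\<close>)
  finally show ?thesis .
qed

lemma
  fixes c :: real
  assumes c: "c > 0"
  shows set_integrable_exp_ray: "set_integrable lborel {0<..} (\<lambda>s::real. exp (- c * s))"
  and set_integral_exp_ray: "(LBINT s:{0<..}. exp (- c * s)) = 1 / c"
proof -
  have e: "einterval 0 \<infinity> = {0::real<..}" by (auto simp: einterval_def)
  have c0: "c \<noteq> 0" using c by simp
  have D: "((\<lambda>s. - exp (- c * s) / c) has_real_derivative exp (- c * x)) (at x)" for x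
    by (auto intro!: derivative_eq_intros simp: c0)
  have L1: "(((\<lambda>s. - exp (- c * s) / c) \<circ> real_of_ereal) \<longlongrightarrow> - 1 / c) (at_right 0)"
    unfolding zero_ereal_def
    by (subst ereal_tendsto_simps) (auto intro!: tendsto_eq_intros simp: c0)
  have L2: "(((\<lambda>s. - exp (- c * s) / c) \<circ> real_of_ereal) \<longlongrightarrow> 0) (at_left \<infinity>)"
  proof (subst ereal_tendsto_simps)
    have "((\<lambda>s. exp (- c * s)) \<longlongrightarrow> 0) at_top"
      using c by (intro filterlim_compose[OF exp_at_bot] filterlim_tendsto_neg_mult_at_bot[of _ "-c"] filterlim_ident) auto
    from tendsto_mult[OF tendsto_const[of "-1/c"] this]
    show "((\<lambda>s. - exp (- c * s) / c) \<longlongrightarrow> 0) at_top" by simp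
  qed
  note FTC = interval_integral_FTC_nonneg[of 0 \<infinity> "\<lambda>s. - exp (- c * s) / c" "\<lambda>s. exp (- c * s)" "-1/c" 0]
  show "set_integrable lborel {0<..} (\<lambda>s::real. exp (- c * s))"
    using FTC(1)[OF _ D _ _ L1 L2] by (auto simp: e)
  show "(LBINT s:{0<..}. exp (- c * s)) = 1 / (c::real)"
    using FTC(2)[OF _ D _ _ L1 L2] by (auto simp: e interval_lebesgue_integral_def)
qed

lemma set_integrable_square_ray:
  assumes k: "k > 0"
  shows "set_integrable lborel {0<..} (\<lambda>s::real. 1 / (k + s)\<^sup>2)"
proof -
  have e: "einterval 0 \<infinity> = {0::real<..}" by (auto simp: einterval_def)
  have D: "((\<lambda>s. - 1 / (k + s)) has_real_derivative 1 / (k + x)\<^sup>2) (at x)" if "x > 0" for x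
    using k that by (auto intro!: derivative_eq_intros simp: power2_eq_square)
  have L1: "(((\<lambda>s. - 1 / (k + s)) \<circ> real_of_ereal) \<longlongrightarrow> - 1 / k) (at_right 0)"
    unfolding zero_ereal_def using k
    by (subst ereal_tendsto_simps) (auto intro!: tendsto_eq_intros)
  have L2: "(((\<lambda>s. - 1 / (k + s)) \<circ> real_of_ereal) \<longlongrightarrow> 0) (at_left \<infinity>)"
    by (subst ereal_tendsto_simps) real_asymp
  show ?thesis
    using interval_integral_FTC_nonneg(1)[OF _ _ _ _ L1 L2, of "\<lambda>x. 1 / (k + x)\<^sup>2"] D k
    by (auto simp: e intro!: continuous_intros)
qed

lemma set_integrable_power_exp_ray:
  assumes c: "c > 0"
  shows "set_integrable lborel {0<..} (\<lambda>s::real. s ^ n * exp (- c * s))"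
proof -
  \<comment> \<open>Half of the exponential absorbs the power, the other half stays as an integrable
    bound.\<close>
  have "((\<lambda>s. (s ^ n * exp (- (c/2) * s))) \<longlongrightarrow> 0) at_top"
    using c by real_asymp
  hence "\<forall>\<^sub>F s in at_top. s ^ n * exp (- (c/2) * s) < 1" by (rule order_tendstoD) simp
  then obtain M where M: "\<And>s. s \<ge> M \<Longrightarrow> s ^ n * exp (- (c/2) * s) < 1"
    unfolding eventually_at_top_linorder by blast
  define C where "C = max 1 (\<bar>M\<bar> ^ n)"
  have b: "s ^ n * exp (- c * s) \<le> C * exp (- (c/2) * s)" if s: "s > 0" for s
  proof -
    have "s ^ n * exp (- (c/2) * s) \<le> C"
    proof (cases "s \<ge> M")
      case True thus ?thesis using M[OF True] by (simp add: C_def)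
    next
      case False
      hence "s ^ n \<le> \<bar>M\<bar> ^ n" using s by (intro power_mono) auto
      moreover have "exp (- (c/2) * s) \<le> 1" using c s by simp
      ultimately have "s ^ n * exp (- (c/2) * s) \<le> \<bar>M\<bar> ^ n * 1" using s by (intro mult_mono) auto
      thus ?thesis by (simp add: C_def)
    qed
    hence "s ^ n * exp (- (c/2) * s) * exp (- (c/2) * s) \<le> C * exp (- (c/2) * s)" by (intro mult_right_mono) auto
    thus ?thesis by (simp add: mult.assoc flip: exp_add)
  qed
  show ?thesis
  proof (rule set_integrable_bound)
    show "set_integrable lborel {0<..} (\<lambda>s. C * exp (- (c/2) * s))"
      using set_integrable_exp_ray[of "c/2"] c by (intro set_integrable_mult_right) auto
    show "set_borel_measurable lborel {0<..} (\<lambda>s. s ^ n * exp (- c * s))"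
      unfolding set_borel_measurable_def by measurable
  qed (use b in \<open>auto simp: C_def intro!: AE_I2\<close>)
qed

text \<open>Integration by parts in the form of the fundamental theorem: s^(n+1) exp (-z s) vanishes
  at both ends, which links the integrals for n and n + 1. This is the dictionary between \<zeta>^n
  / n! and z^-(n+1).\<close>

lemma laplace_power:
  fixes z :: complex
  assumes z: "Re z > 0"
  shows "(LBINT s:{0<..}. of_real s ^ n * exp (- z * of_real s)) = fact n / z ^ Suc n"
proof (induction n)
  have int: "set_integrable lborel {0<..} (\<lambda>s. of_real s ^ n * exp (- z * of_real s))" for n
    by (rule set_integrable_continuous_bound[OF _ _ set_integrable_power_exp_ray[OF z, of n]])
       (auto intro!: continuous_intros simp: norm_mult norm_power)
  have lim: "((\<lambda>s. of_real s ^ n * exp (- z * of_real s)) \<longlongrightarrow> 0) at_top" for n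
  proof (rule tendsto_norm_zero_cancel)
    have "((\<lambda>s. s ^ n * exp (- Re z * s)) \<longlongrightarrow> 0) at_top" using z by real_asymp
    moreover have "\<forall>\<^sub>F s in at_top. s ^ n * exp (- Re z * s) = norm (of_real s ^ n * exp (- z * of_real s))"
      using eventually_gt_at_top[of 0] by eventually_elim (simp add: norm_mult norm_power)
    ultimately show "((\<lambda>s. norm (of_real s ^ n * exp (- z * of_real s))) \<longlongrightarrow> 0) at_top"
      by (rule Lim_transform_eventually)
  qed
  have z0: "z \<noteq> 0" using z by auto
  {
    case 0
    have "(LBINT s:{0<..}. exp (- z * of_real s)) = 0 / (-z) - 1 / (-z)"
    proof (rule integral_ray_FTC[where F = "\<lambda>s. exp (- z * of_real s) / (-z)"])
      show "((\<lambda>s. exp (- z * of_real s) / (-z)) has_vector_derivative exp (- z * of_real s)) (at s)" for s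
        using z0 by (auto intro!: derivative_eq_intros has_vector_derivative_real_field)
      show "((\<lambda>s. exp (- z * of_real s) / - z) \<longlongrightarrow> 1 / - z) (at_right 0)"
        using z0 by (auto intro!: tendsto_eq_intros)
      show "((\<lambda>s. exp (- z * complex_of_real s) / - z) \<longlongrightarrow> 0 / - z) at_top"
        using lim[of 0] z0 by (intro tendsto_intros) auto
    qed (use int[of 0] in \<open>auto intro!: continuous_intros\<close>)
    thus ?case using z0 by simp
  next
    case (Suc n)
    have "(LBINT s:{0<..}. of_nat (Suc n) * (of_real s ^ n * exp (- z * of_real s)) - z * (of_real s ^ Suc n * exp (- z * of_real s))) = 0 - 0"
    proof (rule integral_ray_FTC[where F = "\<lambda>s. of_real s ^ Suc n * exp (- z * of_real s)"])
      show "((\<lambda>s. of_real s ^ Suc n * exp (- z * of_real s)) has_vector_derivative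
        of_nat (Suc n) * (of_real s ^ n * exp (- z * of_real s)) - z * (of_real s ^ Suc n * exp (- z * of_real s))) (at s)" for s
        by (rule has_vector_derivative_real_field)
           (auto intro!: derivative_eq_intros simp del: power_Suc of_nat_Suc)
      show "((\<lambda>s. of_real s ^ Suc n * exp (- z * of_real s)) \<longlongrightarrow> 0) (at_right 0)"
        by (auto intro!: tendsto_eq_intros)
    qed (use int lim in \<open>auto intro!: continuous_intros set_integral_diff set_integrable_mult_right simp del: power_Suc\<close>)
    hence "of_nat (Suc n) * (LBINT s:{0<..}. of_real s ^ n * exp (- z * of_real s)) = z * (LBINT s:{0<..}. of_real s ^ Suc n * exp (- z * of_real s))"
      using int by (subst (asm) set_integral_diff) (auto simp del: power_Suc)
    thus ?case unfolding Suc using z0 by (simp add: field_simps)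
  }
qed

text \<open>Rays (A the positive reals) and segments (A the unit interval) share one notion, so that
  holomorphy in a parameter and Fubini are proved once for both.\<close>

definition pint :: "real set \<Rightarrow> (complex \<Rightarrow> complex) \<Rightarrow> complex \<Rightarrow> complex \<Rightarrow> complex" where
  "pint A G a d = (LBINT s:A. G (a + of_real s * d) * d)"

definition ray_integrable :: "(complex \<Rightarrow> complex) \<Rightarrow> complex \<Rightarrow> complex \<Rightarrow> bool" where
  "ray_integrable G a d \<longleftrightarrow> set_integrable lborel {0<..} (\<lambda>s. G (a + of_real s * d) * d)"

abbreviation "ray_int \<equiv> pint {0<..}"

definition seg_int :: "(complex \<Rightarrow> complex) \<Rightarrow> complex \<Rightarrow> complex \<Rightarrow> complex" where
  "seg_int G a b = pint {0..1} G a (b - a)"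

lemma seg_int_primitive:
  assumes P: "\<And>x. x \<in> S \<Longrightarrow> (P has_field_derivative G x) (at x)"
    and seg: "closed_segment a b \<subseteq> S" and G: "continuous_on S G"
  shows "seg_int G a b = P b - P a"
proof -
  have in_S: "a + of_real s * (b - a) \<in> S" if "s \<in> {0..1}" for s :: real
    using seg that by (force simp: closed_segment_def scaleR_conv_of_real algebra_simps)
  have "(LBINT s. indicator {0..1::real} s *\<^sub>R (G (a + of_real s * (b - a)) * (b - a)))
     = P (a + of_real 1 * (b - a)) - P (a + of_real 0 * (b - a))"
  proof (rule integral_FTC_atLeastAtMost)
    fix x :: real assume "0 \<le> x" "x \<le> 1"
    hence "((\<lambda>w. P (a + w * (b - a))) has_field_derivative G (a + of_real x * (b - a)) * (b - a)) (at (of_real x))"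
      by (intro DERIV_chain2[OF P] in_S) (auto intro!: derivative_eq_intros)
    thus "((\<lambda>s. P (a + of_real s * (b - a))) has_vector_derivative G (a + of_real x * (b - a)) * (b - a)) (at x within {0..1})"
      by (rule has_vector_derivative_at_within[OF has_vector_derivative_real_field])
  next
    show "continuous_on {0..1} (\<lambda>x::real. G (a + of_real x * (b - a)) * (b - a))"
      by (intro continuous_intros continuous_on_compose2[OF G]) (use in_S in auto)
  qed simp
  moreover have "a + of_real 1 * (b - a) = b" "a + of_real 0 * (b - a) = a" by simp_all
  ultimately show ?thesis unfolding seg_int_def pint_def set_lebesgue_integral_def by (simp only:)
qed

lemma holomorphic_convex_primitive_open:
  assumes "convex S" "open S" "G holomorphic_on S"
  obtains P where "\<And>x. x \<in> S \<Longrightarrow> (P has_field_derivative G x) (at x)"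
proof -
  obtain P where "\<And>x. x \<in> S \<Longrightarrow> (P has_field_derivative G x) (at x within S)"
    using holomorphic_convex_primitive'[OF assms] by blast
  with assms(2) show ?thesis by (intro that[of P]) (metis at_within_open)
qed

lemma seg_int_norm_le:
  assumes seg: "closed_segment a b \<subseteq> S" and G: "continuous_on S G"
    and M: "\<And>x. x \<in> closed_segment a b \<Longrightarrow> norm (G x) \<le> M"
  shows "norm (seg_int G a b) \<le> M * norm (b - a)"
proof -
  have in_seg: "a + of_real s * (b - a) \<in> closed_segment a b" if "s \<in> {0..1}" for s :: real
    using that by (auto simp: closed_segment_def scaleR_conv_of_real algebra_simps intro!: exI[of _ s])
  have m: "set_integrable lborel {0..1::real} (\<lambda>_. M * norm (b - a))"
    by (simp add: set_integrable_def)
  have "norm (seg_int G a b) \<le> (LBINT s:{0..1::real}. M * norm (b - a))"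
    unfolding seg_int_def pint_def
  proof (rule set_integral_norm_le[OF _ m])
    show b: "norm (G (a + of_real s * (b - a)) * (b - a)) \<le> M * norm (b - a)" if "s \<in> {0..1}" for s :: real
      unfolding norm_mult by (intro mult_right_mono M in_seg that) auto
    show "set_integrable lborel {0..1} (\<lambda>s::real. G (a + of_real s * (b - a)) * (b - a))"
      by (rule set_integrable_continuous_bound[OF _ _ m b])
         (use in_seg seg in \<open>auto intro!: continuous_intros continuous_on_compose2[OF G]\<close>)
  qed
  thus ?thesis by (simp add: set_integral_const)
qed

text \<open>A primitive P on the convex set makes P(b + s e) - P(a + s d) an antiderivative, in s,
  of the difference of the two integrands. No closed contour is needed, only the behaviour of the
  connecting segment at both ends of the range of s. At s = 0 a limit replaces a value, because the
  rays of the Laplace integral start on the boundary of S.\<close>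

lemma ray_int_rotate_limit:
  assumes S: "convex S" "open S" and G: "G holomorphic_on S"
    and in_S: "\<And>s. s > 0 \<Longrightarrow> a + of_real s * d \<in> S" "\<And>s. s > 0 \<Longrightarrow> b + of_real s * e \<in> S"
    and int: "ray_integrable G a d" "ray_integrable G b e"
    and J: "((\<lambda>s. seg_int G (a + of_real s * d) (b + of_real s * e)) \<longlongrightarrow> J) (at_right 0)"
    and Z: "((\<lambda>s. seg_int G (a + of_real s * d) (b + of_real s * e)) \<longlongrightarrow> 0) at_top"
  shows "ray_int G a d = J + ray_int G b e"
proof -
  obtain P where P: "\<And>x. x \<in> S \<Longrightarrow> (P has_field_derivative G x) (at x)"
    using holomorphic_convex_primitive_open[OF S G] by blast
  have contG: "continuous_on S G" using G by (rule holomorphic_on_imp_continuous_on)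
  define f where "f = (\<lambda>s::real. G (b + of_real s * e) * e - G (a + of_real s * d) * d)"
  have f_int: "set_integrable lborel {0<..} f" unfolding f_def
    using int by (intro set_integral_diff) (auto simp: ray_integrable_def)
  have eq: "P (b + of_real s * e) - P (a + of_real s * d) = seg_int G (a + of_real s * d) (b + of_real s * e)" if "s > 0" for s
    by (rule seg_int_primitive[OF P closed_segment_subset[OF in_S(1)[OF that] in_S(2)[OF that] S(1)] contG, symmetric])
  have "(LBINT s:{0<..}. f s) = 0 - J"
  proof (rule integral_ray_FTC[OF _ _ f_int])
    fix s :: real assume s: "s > 0"
    have "((\<lambda>w. P (b + w * e) - P (a + w * d)) has_field_derivative G (b + of_real s * e) * e - G (a + of_real s * d) * d) (at (of_real s))"
      by (intro DERIV_diff DERIV_chain2[OF P] in_S s) (auto intro!: derivative_eq_intros)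
    thus "((\<lambda>s. P (b + of_real s * e) - P (a + of_real s * d)) has_vector_derivative f s) (at s)"
      unfolding f_def by (rule has_vector_derivative_real_field)
  next
    show "continuous_on {0<..} f" unfolding f_def
      by (intro continuous_intros continuous_on_compose2[OF contG]) (use in_S in auto)
    show "((\<lambda>s. P (b + of_real s * e) - P (a + of_real s * d)) \<longlongrightarrow> J) (at_right 0)"
      by (rule Lim_transform_eventually[OF J])
         (use eq eventually_at_right_less[of "0::real"] in \<open>auto elim!: eventually_mono\<close>)
    show "((\<lambda>s. P (b + of_real s * e) - P (a + of_real s * d)) \<longlongrightarrow> 0) at_top"
      by (rule Lim_transform_eventually[OF Z])
         (use eventually_gt_at_top[of "0::real"] in \<open>eventually_elim, simp add: eq\<close>)
  qed
  moreover have "(LBINT s:{0<..}. f s) = ray_int G b e - ray_int G a d"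
    unfolding f_def pint_def using int by (intro set_integral_diff) (auto simp: ray_integrable_def)
  ultimately show ?thesis by (simp add: algebra_simps)
qed

lemma seg_int_tendsto_0:
  assumes F: "\<forall>\<^sub>F s in F. closed_segment (u s) (v s) \<subseteq> S" and G: "continuous_on S G"
    and M: "\<forall>\<^sub>F s in F. \<forall>x\<in>closed_segment (u s) (v s). norm (G x) * norm (v s - u s) \<le> h s"
    and h: "(h \<longlongrightarrow> 0) F"
  shows "((\<lambda>s. seg_int G (u s) (v s)) \<longlongrightarrow> 0) F"
proof (rule Lim_null_comparison[OF _ h])
  show "\<forall>\<^sub>F s in F. norm (seg_int G (u s) (v s)) \<le> h s"
    using F M
  proof eventually_elim
    case (elim s)
    show ?case
    proof (cases "v s = u s")
      case True
      have "norm (seg_int G (u s) (v s)) \<le> 0" by (simp add: seg_int_def pint_def True)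
      also have "0 \<le> h s" using elim(2)[rule_format, of "u s"] True by simp
      finally show ?thesis .
    next
      case False
      have "norm (seg_int G (u s) (v s)) \<le> (h s / norm (v s - u s)) * norm (v s - u s)"
        by (rule seg_int_norm_le[OF elim(1) G]) (use elim(2) False in \<open>simp add: field_simps\<close>)
      thus ?thesis using False by simp
    qed
  qed
qed

text \<open>The version for rays that start inside S: the limit at s = 0 is then the integral over
  the segment from a to b.\<close>

lemma ray_int_rotate:
  assumes S: "convex S" "open S" and G: "G holomorphic_on S"
    and in_S: "\<And>s. s \<ge> 0 \<Longrightarrow> a + of_real s * d \<in> S" "\<And>s. s \<ge> 0 \<Longrightarrow> b + of_real s * e \<in> S"
    and int: "ray_integrable G a d" "ray_integrable G b e"
    and h: "\<And>s x. s \<ge> 1 \<Longrightarrow> x \<in> closed_segment (a + of_real s * d) (b + of_real s * e) \<Longrightarrow>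
        norm (G x) * norm ((b + of_real s * e) - (a + of_real s * d)) \<le> h s" "(h \<longlongrightarrow> 0) at_top"
  shows "ray_int G a d = seg_int G a b + ray_int G b e"
proof (rule ray_int_rotate_limit[OF S G _ _ int])
  obtain P where P: "\<And>x. x \<in> S \<Longrightarrow> (P has_field_derivative G x) (at x)"
    using holomorphic_convex_primitive_open[OF S G] by blast
  have contG: "continuous_on S G" using G by (rule holomorphic_on_imp_continuous_on)
  have ab: "a \<in> S" "b \<in> S" using in_S[of 0] by auto
  have seg: "closed_segment (a + of_real s * d) (b + of_real s * e) \<subseteq> S" if "s \<ge> 0" for s
    using in_S that S(1) by (intro closed_segment_subset) auto
  show "((\<lambda>s. seg_int G (a + of_real s * d) (b + of_real s * e)) \<longlongrightarrow> 0) at_top"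
  proof (rule seg_int_tendsto_0[OF _ contG _ h(2)])
    show "\<forall>\<^sub>F s in at_top. closed_segment (a + of_real s * d) (b + of_real s * e) \<subseteq> S"
      using eventually_ge_at_top[of 0] by eventually_elim (rule seg)
    show "\<forall>\<^sub>F s in at_top. \<forall>x\<in>closed_segment (a + of_real s * d) (b + of_real s * e).
        norm (G x) * norm ((b + of_real s * e) - (a + of_real s * d)) \<le> h s"
      using eventually_ge_at_top[of 1] by eventually_elim (use h(1) in auto)
  qed
  have "isCont P x" if "x \<in> S" for x using P[OF that] by (rule DERIV_isCont)
  hence "((\<lambda>s::real. P (b + of_real s * e) - P (a + of_real s * d)) \<longlongrightarrow> P (b + of_real 0 * e) - P (a + of_real 0 * d)) (at_right 0)"
    using ab by (intro tendsto_intros isCont_tendsto_compose[of _ P]) auto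
  moreover have "\<forall>\<^sub>F s in at_right 0. P (b + of_real s * e) - P (a + of_real s * d) = seg_int G (a + of_real s * d) (b + of_real s * e)"
    using eventually_at_right_less[of 0]
    by eventually_elim (rule seg_int_primitive[OF P seg contG, symmetric], auto)
  moreover have "seg_int G a b = P b - P a"
    using seg_int_primitive[OF P _ contG, of a b] seg[of 0] by simp
  ultimately show "((\<lambda>s. seg_int G (a + of_real s * d) (b + of_real s * e)) \<longlongrightarrow> seg_int G a b) (at_right 0)"
    by (auto intro: Lim_transform_eventually)
qed (use in_S in auto)

text \<open>Only the integrand is dominated, not its derivative: Cauchy's estimate on circles of
  radius r/2 bounds the derivative, hence the difference quotients, by 2 g / r, and dominated
  convergence applies along sequences h -> 0.\<close>

lemma holomorphic_on_parametric_integral: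
  fixes G :: "complex \<Rightarrow> 'a \<Rightarrow> complex"
  assumes Z: "open Z" and hol: "\<And>s. s \<in> space M \<Longrightarrow> (\<lambda>z. G z s) holomorphic_on Z"
    and int: "\<And>z. z \<in> Z \<Longrightarrow> integrable M (G z)"
    and dom: "\<And>z. z \<in> Z \<Longrightarrow> \<exists>r>0. \<exists>g. ball z r \<subseteq> Z \<and> integrable M g \<and> (\<forall>w\<in>ball z r. \<forall>s\<in>space M. norm (G w s) \<le> g s)"
  shows "(\<lambda>z. \<integral>s. G z s \<partial>M) holomorphic_on Z"
proof (rule holomorphic_on_open[OF Z, THEN iffD2], rule ballI)
  fix z assume z: "z \<in> Z"
  from dom[OF this] obtain r g where r: "r > 0" and sub: "ball z r \<subseteq> Z" and g: "integrable M g"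
    and bd: "\<And>w s. w \<in> ball z r \<Longrightarrow> s \<in> space M \<Longrightarrow> norm (G w s) \<le> g s" by blast
  define D where "D = (\<lambda>s. deriv (\<lambda>z. G z s) z)"
  have "((\<lambda>h. ((\<integral>s. G (z + h) s \<partial>M) - (\<integral>s. G z s \<partial>M)) / h) \<longlongrightarrow> (\<integral>s. D s \<partial>M)) (at 0)"
  proof (subst tendsto_at_iff_sequentially, intro allI impI)
    fix X :: "nat \<Rightarrow> complex" assume X: "\<forall>i. X i \<in> UNIV - {0}" "X \<longlonglongrightarrow> 0"
    have "\<forall>\<^sub>F i in sequentially. dist (X i) 0 < r / 2"
      using X(2) r by (intro tendstoD) auto
    then obtain N where N: "\<And>i. i \<ge> N \<Longrightarrow> norm (X i) < r / 2"
      by (auto simp: eventually_sequentially)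
    define Y where "Y = (\<lambda>i. X (i + N))"
    have Y: "Y i \<noteq> 0" "norm (Y i) < r / 2" for i using X(1) N by (auto simp: Y_def)
    have Y0: "Y \<longlonglongrightarrow> 0" unfolding Y_def by (rule LIMSEQ_ignore_initial_segment[OF X(2)])
    have inZ: "z + Y i \<in> Z" for i using Y(2)[of i] r sub by (auto simp: subset_iff dist_norm)
    have "(\<lambda>i. \<integral>s. (G (z + Y i) s - G z s) / Y i \<partial>M) \<longlonglongrightarrow> (\<integral>s. D s \<partial>M)"
    proof (rule integral_dominated_convergence[where w = "\<lambda>s. 2 * g s / r"])
      have lim: "(\<lambda>i. (G (z + Y i) s - G z s) / Y i) \<longlonglongrightarrow> D s" if s: "s \<in> space M" for s
      proof -
        have "((\<lambda>z. G z s) has_field_derivative D s) (at z)"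
          unfolding D_def by (rule holomorphic_derivI[OF hol[OF s] Z z])
        hence "((\<lambda>h. (G (z + h) s - G z s) / h) \<longlongrightarrow> D s) (at 0)"
          by (simp add: DERIV_def)
        thus ?thesis using Y0 Y(1) unfolding tendsto_at_iff_sequentially by (auto simp: o_def)
      qed
      thus "AE s in M. (\<lambda>i. (G (z + Y i) s - G z s) / Y i) \<longlonglongrightarrow> D s" by (intro AE_I2)
      show m: "(\<lambda>s. (G (z + Y i) s - G z s) / Y i) \<in> borel_measurable M" for i
        using borel_measurable_integrable[OF int[OF inZ[of i]]] borel_measurable_integrable[OF int[OF z]] by measurable
      show "D \<in> borel_measurable M"
        by (rule borel_measurable_LIMSEQ_metric[OF m lim])
      show "integrable M (\<lambda>s. 2 * g s / r)" using g by simp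
      have deriv_bd: "norm (deriv (\<lambda>z. G z s) w) \<le> 2 * g s / r" if s: "s \<in> space M" and w: "w \<in> ball z (r/2)" for s w
      proof -
        have sb: "ball w (r/2) \<subseteq> ball z r"
          using w by (auto simp: dist_commute) (metis dist_commute dist_triangle_half_l mult.commute less_divide_eq_numeral1(1))
        have "norm ((deriv ^^ 1) (\<lambda>z. G z s) w) \<le> fact 1 * (g s) / (r/2) ^ 1"
        proof (rule Cauchy_inequality)
          show "(\<lambda>z. G z s) holomorphic_on ball w (r/2)"
            using hol[OF s] by (rule holomorphic_on_subset) (use sb sub in auto)
          show "continuous_on (cball w (r/2)) (\<lambda>z. G z s)"
          proof (rule continuous_on_subset[OF holomorphic_on_imp_continuous_on[OF hol[OF s]]])
            have "cball w (r/2) \<subseteq> ball z r"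
            proof
              fix x assume "x \<in> cball w (r/2)"
              hence "dist z x \<le> dist z w + r/2" using dist_triangle[of z x w] by simp
              thus "x \<in> ball z r" using w by simp
            qed
            thus "cball w (r/2) \<subseteq> Z" using sub by blast
          qed
          show "norm (G x s) \<le> g s" if x: "norm (w - x) = r/2" for x
          proof (rule bd[OF _ s])
            have "dist z x \<le> dist z w + r/2" using dist_triangle[of z x w] x by (simp add: dist_norm)
            thus "x \<in> ball z r" using w by simp
          qed
        qed (use r in auto)
        thus ?thesis by (simp add: mult.commute)
      qed
      have "norm ((G (z + Y i) s - G z s) / Y i) \<le> 2 * g s / r" if s: "s \<in> space M" for i s
      proof -
        have "norm (G (z + Y i) s - G z s) \<le> 2 * g s / r * norm ((z + Y i) - z)"
        proof (rule field_differentiable_bound[where S = "ball z (r/2)"])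
          show "((\<lambda>z. G z s) has_field_derivative deriv (\<lambda>z. G z s) w) (at w within ball z (r/2))" if "w \<in> ball z (r/2)" for w
          proof -
            have "w \<in> Z" using that sub r by (auto simp: subset_iff)
            thus ?thesis by (rule has_field_derivative_at_within[OF holomorphic_derivI[OF hol[OF s] Z]])
          qed
        qed (use deriv_bd[OF s] Y(2)[of i] r in \<open>auto simp: dist_norm\<close>)
        thus ?thesis using Y(1)[of i] by (simp add: norm_divide field_simps)
      qed
      thus "AE s in M. norm ((G (z + Y i) s - G z s) / Y i) \<le> 2 * g s / r" for i by (intro AE_I2)
    qed
    also have "(\<lambda>i. \<integral>s. (G (z + Y i) s - G z s) / Y i \<partial>M) = (\<lambda>i. ((\<integral>s. G (z + Y i) s \<partial>M) - (\<integral>s. G z s \<partial>M)) / Y i)"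
      using int inZ z by simp
    finally have "(\<lambda>i. ((\<lambda>h. ((\<integral>s. G (z + h) s \<partial>M) - (\<integral>s. G z s \<partial>M)) / h) \<circ> X) (i + N)) \<longlonglongrightarrow> (\<integral>s. D s \<partial>M)"
      by (simp add: Y_def)
    thus "((\<lambda>h. ((\<integral>s. G (z + h) s \<partial>M) - (\<integral>s. G z s \<partial>M)) / h) \<circ> X) \<longlonglongrightarrow> (\<integral>s. D s \<partial>M)"
      by (rule LIMSEQ_offset)
  qed
  thus "\<exists>f'. ((\<lambda>z. \<integral>s. G z s \<partial>M) has_field_derivative f') (at z)"
    unfolding DERIV_def by blast
qed

section \<open>Laplace transforms along a ray and their independence of the direction\<close>

definition laplace :: "(complex \<Rightarrow> complex) \<Rightarrow> real \<Rightarrow> complex \<Rightarrow> complex" where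
  "laplace F \<theta> z = (LBINT \<xi>:{0<..}. exp (- z * of_real \<xi> * cis \<theta>) * F (of_real \<xi> * cis \<theta>) * cis \<theta>)"

lemma laplace_ray_int: "laplace F \<theta> z = ray_int (\<lambda>\<zeta>. exp (- z * \<zeta>) * F \<zeta>) 0 (cis \<theta>)"
  by (simp add: laplace_def pint_def mult_ac)

definition exp_bounded_ray :: "(complex \<Rightarrow> complex) \<Rightarrow> real \<Rightarrow> real \<Rightarrow> real \<Rightarrow> bool" where
  "exp_bounded_ray F \<theta> A B \<longleftrightarrow> continuous_on {0<..} (\<lambda>\<xi>::real. F (of_real \<xi> * cis \<theta>)) \<and>
     (\<forall>\<xi>>0. norm (F (of_real \<xi> * cis \<theta>)) \<le> A * exp (B * \<xi>))"

lemma exp_bounded_ray_nonneg: "exp_bounded_ray F \<theta> A B \<Longrightarrow> A \<ge> 0"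
proof -
  assume "exp_bounded_ray F \<theta> A B"
  hence "norm (F (of_real 1 * cis \<theta>)) \<le> A * exp (B * 1)" unfolding exp_bounded_ray_def using zero_less_one by blast
  hence "0 \<le> A * exp (B * 1)" using norm_ge_zero order_trans by blast
  thus "A \<ge> 0" by (simp add: zero_le_mult_iff)
qed

lemma laplace_integrand_bound:
  assumes F: "exp_bounded_ray F \<theta> A B" and "\<xi> > 0"
  shows "norm (exp (- z * of_real \<xi> * cis \<theta>) * F (of_real \<xi> * cis \<theta>) * cis \<theta>) \<le> A * exp (- (Re (z * cis \<theta>) - B) * \<xi>)"
proof -
  have e: "norm (exp (- z * of_real \<xi> * cis \<theta>)) = exp (- Re (z * cis \<theta>) * \<xi>)"
    by (simp add: algebra_simps)
  have "norm (exp (- z * of_real \<xi> * cis \<theta>) * F (of_real \<xi> * cis \<theta>) * cis \<theta>) \<le> exp (- Re (z * cis \<theta>) * \<xi>) * (A * exp (B * \<xi>))"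
    unfolding norm_mult e using F assms(2) by (simp add: exp_bounded_ray_def)
  also have "\<dots> = A * exp (- (Re (z * cis \<theta>) - B) * \<xi>)"
    by (simp add: algebra_simps flip: exp_add)
  finally show ?thesis .
qed

lemma laplace_integrable:
  assumes F: "exp_bounded_ray F \<theta> A B" and z: "Re (z * cis \<theta>) > B"
  shows "set_integrable lborel {0<..} (\<lambda>\<xi>. exp (- z * of_real \<xi> * cis \<theta>) * F (of_real \<xi> * cis \<theta>) * cis \<theta>)"
proof (rule set_integrable_continuous_bound)
  show "set_integrable lborel {0<..} (\<lambda>\<xi>. A * exp (- (Re (z * cis \<theta>) - B) * \<xi>))"
    by (rule set_integrable_mult_right, rule set_integrable_exp_ray) (use z in simp)
  show "continuous_on {0<..} (\<lambda>\<xi>. exp (- z * of_real \<xi> * cis \<theta>) * F (of_real \<xi> * cis \<theta>) * cis \<theta>)"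
    using F unfolding exp_bounded_ray_def by (elim conjE, intro continuous_intros)
qed (use laplace_integrand_bound[OF F] in simp_all)

lemma laplace_holomorphic:
  assumes F: "exp_bounded_ray F \<theta> A B"
  shows "laplace F \<theta> holomorphic_on {z. Re (z * cis \<theta>) > B}"
  unfolding laplace_def set_lebesgue_integral_def
proof (rule holomorphic_on_parametric_integral)
  have "{z. Re (z * cis \<theta>) > B} = (\<lambda>z. Re (z * cis \<theta>)) -` {B<..}" by auto
  also have "open \<dots>" by (intro open_vimage continuous_intros open_greaterThan)
  finally show op: "open {z. Re (z * cis \<theta>) > B}" .
  fix z assume z: "z \<in> {z. Re (z * cis \<theta>) > B}"
  define \<delta> where "\<delta> = Re (z * cis \<theta>) - B"
  have \<delta>: "\<delta> > 0" using z by (simp add: \<delta>_def)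
  show "integrable lborel (\<lambda>s. indicat_real {0<..} s *\<^sub>R (exp (- z * of_real s * cis \<theta>) * F (of_real s * cis \<theta>) * cis \<theta>))"
    using laplace_integrable[OF F] z by (simp add: set_integrable_def)
  have re: "Re (w * cis \<theta>) > B + \<delta>/2" if "w \<in> ball z (\<delta>/2)" for w
  proof -
    have "\<bar>Re ((z - w) * cis \<theta>)\<bar> \<le> norm ((z - w) * cis \<theta>)" by (rule abs_Re_le_cmod)
    also have "\<dots> < \<delta>/2" using that by (simp add: norm_mult dist_norm)
    finally have "\<bar>Re ((z - w) * cis \<theta>)\<bar> < \<delta>/2" .
    moreover have "Re ((z - w) * cis \<theta>) = Re (z * cis \<theta>) - Re (w * cis \<theta>)"
      by (simp only: left_diff_distrib minus_complex.sel)
    ultimately have "Re (z * cis \<theta>) - Re (w * cis \<theta>) < \<delta>/2" by linarith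
    moreover have "Re (z * cis \<theta>) = \<delta> + B" unfolding \<delta>_def by (rule diff_add_cancel[symmetric])
    ultimately show ?thesis by linarith
  qed
  show "\<exists>r>0. \<exists>g. ball z r \<subseteq> {z. Re (z * cis \<theta>) > B} \<and> integrable lborel g \<and> (\<forall>w\<in>ball z r. \<forall>s\<in>space lborel.
       norm (indicat_real {0<..} s *\<^sub>R (exp (- w * of_real s * cis \<theta>) * F (of_real s * cis \<theta>) * cis \<theta>)) \<le> g s)"
  proof (rule exI[of _ "\<delta>/2"], intro conjI, use \<delta> in simp,
      rule exI[of _ "\<lambda>s. indicator {0<..} s *\<^sub>R (A * exp (- (\<delta>/2) * s))"], intro conjI ballI)
    show "ball z (\<delta>/2) \<subseteq> {z. Re (z * cis \<theta>) > B}" using re \<delta> by fastforce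
    show "integrable lborel (\<lambda>s. indicator {0<..} s *\<^sub>R (A * exp (- (\<delta>/2) * s)))"
      using \<delta> set_integrable_mult_right[OF set_integrable_exp_ray[of "\<delta>/2"], of A] by (simp add: set_integrable_def)
    fix w s assume w: "w \<in> ball z (\<delta>/2)"
    show "norm (indicat_real {0<..} s *\<^sub>R (exp (- w * of_real s * cis \<theta>) * F (of_real s * cis \<theta>) * cis \<theta>)) \<le> indicator {0<..} s *\<^sub>R (A * exp (- (\<delta>/2) * s))"
    proof (cases "s > 0")
      case True
      have "A * exp (- (Re (w * cis \<theta>) - B) * s) \<le> A * exp (- (\<delta>/2) * s)"
      proof (intro mult_left_mono exp_bounded_ray_nonneg[OF F])
        have "- (Re (w * cis \<theta>) - B) * s \<le> - (\<delta>/2) * s"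
          by (rule mult_right_mono) (use re[OF w] True in linarith)+
        thus "exp (- (Re (w * cis \<theta>) - B) * s) \<le> exp (- (\<delta>/2) * s)" by (simp only: exp_le_cancel_iff)
      qed
      with laplace_integrand_bound[OF F True, of w] True show ?thesis by (simp del: mult_minus_left)
    qed auto
  qed
next
  fix s :: real
  show "(\<lambda>z. indicat_real {0<..} s *\<^sub>R (exp (- z * of_real s * cis \<theta>) * F (of_real s * cis \<theta>) * cis \<theta>)) holomorphic_on {z. Re (z * cis \<theta>) > B}"
    unfolding scaleR_conv_of_real by (intro holomorphic_intros)
qed

text \<open>Turned back by the bisecting angle, the chord is vertical at abscissa s cos \<eta>,
  where \<eta> is half the opening. Its height is at most s sin \<eta>, so the argument stays within
  \<eta>.\<close>

lemma chord_in_sector: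
  assumes "\<theta>1 \<le> \<theta>2" "\<theta>2 - \<theta>1 < pi" "s > 0"
    and x: "x \<in> closed_segment (of_real s * cis \<theta>1) (of_real s * cis \<theta>2)"
  obtains \<xi> \<theta> where "x = of_real \<xi> * cis \<theta>" "\<xi> \<ge> s * cos ((\<theta>2 - \<theta>1) / 2)" "\<theta> \<in> {\<theta>1..\<theta>2}" "\<xi> > 0" "\<xi> \<le> s"
proof -
  define \<mu> where "\<mu> = (\<theta>1 + \<theta>2) / 2"
  define \<eta> where "\<eta> = (\<theta>2 - \<theta>1) / 2"
  have \<eta>: "0 \<le> \<eta>" "\<eta> < pi/2" using assms by (auto simp: \<eta>_def)
  have cos: "cos \<eta> > 0" using \<eta> by (intro cos_gt_zero_pi) auto
  obtain t where t: "0 \<le> t" "t \<le> 1" "x = (1 - t) *\<^sub>R (of_real s * cis \<theta>1) + t *\<^sub>R (of_real s * cis \<theta>2)"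
    using x by (auto simp: closed_segment_def)
  have th: "\<theta>1 = \<mu> - \<eta>" "\<theta>2 = \<mu> + \<eta>" by (auto simp: \<mu>_def \<eta>_def field_simps)
  define w where "w = Complex (s * cos \<eta>) ((2 * t - 1) * (s * sin \<eta>))"
  have xw: "x = w * cis \<mu>" unfolding t(3) th w_def
    by (auto simp: complex_eq_iff cos_add cos_diff sin_add sin_diff algebra_simps)
  have Rew: "Re w > 0" using cos assms(3) by (simp add: w_def)
  have w0: "w \<noteq> 0" using Rew by auto
  have argw: "Arg w = arctan (Im w / Re w)" using Rew by (rule arg_conv_arctan)
  have "Im w / Re w = (2 * t - 1) * tan \<eta>" using assms(3) by (simp add: w_def tan_def)
  moreover have tan0: "tan \<eta> \<ge> 0" using \<eta> by (cases "\<eta> = 0") (auto intro!: less_imp_le tan_gt_zero)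
  have "(2 * t - 1) * tan \<eta> \<le> 1 * tan \<eta>" "-1 * tan \<eta> \<le> (2 * t - 1) * tan \<eta>"
    using t tan0 by (intro mult_right_mono; simp)+
  ultimately have "- tan \<eta> \<le> Im w / Re w" "Im w / Re w \<le> tan \<eta>" by simp_all
  hence "arctan (tan (-\<eta>)) \<le> Arg w" "Arg w \<le> arctan (tan \<eta>)"
    unfolding argw arctan_le_iff by simp_all
  moreover have "arctan (tan \<eta>) = \<eta>" "arctan (tan (-\<eta>)) = -\<eta>" using \<eta> by (intro arctan_tan; simp)+
  ultimately have arg: "-\<eta> \<le> Arg w" "Arg w \<le> \<eta>" by simp_all
  show ?thesis
  proof (rule that[of "norm w" "\<mu> + Arg w"])
    have "w = of_real (norm w) * cis (Arg w)" using rcis_cmod_Arg[of w] by (simp add: rcis_def)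
    thus "x = of_real (norm w) * cis (\<mu> + Arg w)" unfolding xw by (metis cis_mult mult.assoc mult.commute)
    show "s * cos ((\<theta>2 - \<theta>1) / 2) \<le> norm w" using complex_Re_le_cmod[of w] by (simp add: w_def \<eta>_def)
    show "\<mu> + Arg w \<in> {\<theta>1..\<theta>2}" using arg by (auto simp: th)
    show "norm w > 0" using w0 by simp
    have "norm w = norm x" by (simp add: xw norm_mult)
    also have "norm x \<le> (1 - t) * s + t * s" unfolding t(3)
      using t assms(3) by (intro order_trans[OF norm_triangle_ineq]) (simp add: norm_mult)
    also have "\<dots> = s" by (simp add: algebra_simps)
    finally show "norm w \<le> s" .
  qed
qed

text \<open>For z of argument minus the mean of the two directions, all Re (z cis \<theta>) in
  between are at least B + 1, so that the integrand is below A exp (-\<xi>) in the whole sector. The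
  chords then contribute nothing in the limit: near 0 because they are short, near infinity because
  their distance from 0 grows in proportion to s.\<close>

lemma laplace_rotate_far:
  assumes th: "\<theta>1 \<le> \<theta>2" "\<theta>2 - \<theta>1 < pi" and S: "convex S" "open S" and F: "F holomorphic_on S"
    and in_S: "\<And>\<xi> \<theta>. \<xi> > 0 \<Longrightarrow> \<theta> \<in> {\<theta>1..\<theta>2} \<Longrightarrow> of_real \<xi> * cis \<theta> \<in> S"
    and bd: "\<And>\<xi> \<theta>. \<xi> > 0 \<Longrightarrow> \<theta> \<in> {\<theta>1..\<theta>2} \<Longrightarrow> norm (F (of_real \<xi> * cis \<theta>)) \<le> A * exp (B * \<xi>)"
    and X: "X * cos ((\<theta>2 - \<theta>1) / 2) \<ge> B + 1" "X \<ge> 0"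
    and z: "z = of_real X * cis (- (\<theta>1 + \<theta>2) / 2)"
  shows "laplace F \<theta>1 z = laplace F \<theta>2 z"
proof -
  define \<eta> where "\<eta> = (\<theta>2 - \<theta>1) / 2"
  have \<eta>: "0 \<le> \<eta>" "\<eta> < pi/2" using assms by (auto simp: \<eta>_def)
  define c where "c = cos \<eta>"
  have c: "c > 0" unfolding c_def using \<eta> by (intro cos_gt_zero_pi) auto
  have A: "A \<ge> 0"
  proof -
    have "0 \<le> A * exp (B * 1)" using bd[of 1 \<theta>1] th(1) by (intro order_trans[OF norm_ge_zero]) auto
    thus ?thesis by (simp add: zero_le_mult_iff)
  qed
  have re: "Re (z * cis \<theta>) \<ge> B + 1" if "\<theta> \<in> {\<theta>1..\<theta>2}" for \<theta>
  proof -
    have e: "- (\<theta>1 + \<theta>2) / 2 + \<theta> = \<theta> - (\<theta>1 + \<theta>2) / 2" by (simp add: field_simps)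
    have "Re (z * cis \<theta>) = X * cos (\<theta> - (\<theta>1 + \<theta>2) / 2)"
      unfolding z mult.assoc cis_mult e by simp
    also have "cos (\<theta> - (\<theta>1 + \<theta>2) / 2) = cos \<bar>\<theta> - (\<theta>1 + \<theta>2) / 2\<bar>" by simp
    also have "\<dots> \<ge> c" unfolding c_def
      using that \<eta> by (subst cos_mono_le_eq) (auto simp: \<eta>_def abs_le_iff field_simps)
    hence "X * cos \<bar>\<theta> - (\<theta>1 + \<theta>2) / 2\<bar> \<ge> X * c" using X(2) by (rule mult_left_mono)
    finally show ?thesis using X(1) by (simp add: c_def \<eta>_def)
  qed
  define G where "G = (\<lambda>\<zeta>. exp (- z * \<zeta>) * F \<zeta>)"
  have G: "G holomorphic_on S" unfolding G_def by (intro holomorphic_intros F)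
  have Gbd: "norm (G (of_real \<xi> * cis \<theta>)) \<le> A * exp (- \<xi>)" if "\<xi> > 0" "\<theta> \<in> {\<theta>1..\<theta>2}" for \<xi> \<theta>
  proof -
    have "norm (G (of_real \<xi> * cis \<theta>)) = exp (- Re (z * cis \<theta>) * \<xi>) * norm (F (of_real \<xi> * cis \<theta>))"
      by (simp add: G_def norm_mult algebra_simps)
    also have "\<dots> \<le> exp (- (B + 1) * \<xi>) * (A * exp (B * \<xi>))"
      using re[OF that(2)] that bd[OF that] A by (intro mult_mono) (auto intro!: mult_right_mono simp del: minus_mult_left)
    also have "\<dots> = A * exp (- \<xi>)" by (simp add: algebra_simps flip: exp_add)
    finally show ?thesis .
  qed
  have int: "ray_integrable G 0 (cis \<theta>)" if "\<theta> \<in> {\<theta>1..\<theta>2}" for \<theta>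
    unfolding ray_integrable_def
  proof (rule set_integrable_continuous_bound)
    show "set_integrable lborel {0<..} (\<lambda>s. A * exp (- 1 * s))"
      by (intro set_integrable_mult_right set_integrable_exp_ray) simp
    show "continuous_on {0<..} (\<lambda>s. G (0 + of_real s * cis \<theta>) * cis \<theta>)"
      by (intro continuous_intros continuous_on_compose2[OF holomorphic_on_imp_continuous_on[OF G]]) (use in_S that in auto)
    show "norm (G (0 + of_real s * cis \<theta>) * cis \<theta>) \<le> A * exp (- 1 * s)" if "s \<in> {0<..}" for s
      using Gbd[of s \<theta>] that \<open>\<theta> \<in> {\<theta>1..\<theta>2}\<close> by (simp add: norm_mult)
  qed simp
  have chord: "norm (G x) * norm (of_real s * cis \<theta>2 - of_real s * cis \<theta>1) \<le> 2 * A * s * exp (- c * s)"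
    if s: "s > 0" and x: "x \<in> closed_segment (of_real s * cis \<theta>1) (of_real s * cis \<theta>2)" for s x
  proof -
    obtain \<xi> \<theta> where xi: "x = of_real \<xi> * cis \<theta>" "\<xi> \<ge> s * c" "\<theta> \<in> {\<theta>1..\<theta>2}" "\<xi> > 0"
      using chord_in_sector[OF th s x] unfolding c_def \<eta>_def by blast
    have "norm (of_real s * cis \<theta>2 - of_real s * cis \<theta>1) \<le> s + s"
      using s by (intro order_trans[OF norm_triangle_ineq4]) (simp add: norm_mult)
    moreover have "norm (G x) \<le> A * exp (- c * s)"
      using Gbd[OF xi(4,3)] xi(2) A unfolding xi(1)
      by (elim order_trans) (auto intro!: mult_left_mono simp: mult.commute)
    ultimately have "norm (G x) * norm (of_real s * cis \<theta>2 - of_real s * cis \<theta>1) \<le> (A * exp (- c * s)) * (s + s)"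
      using A by (intro mult_mono) auto
    thus ?thesis by (simp add: algebra_simps)
  qed
  have sub: "closed_segment (of_real s * cis \<theta>1) (of_real s * cis \<theta>2) \<subseteq> S" if "s > 0" for s
    using in_S[OF that] th(1) by (intro closed_segment_subset S(1)) auto
  have "ray_int G 0 (cis \<theta>1) = 0 + ray_int G 0 (cis \<theta>2)"
  proof (rule ray_int_rotate_limit[OF S G])
    show "((\<lambda>s. seg_int G (0 + of_real s * cis \<theta>1) (0 + of_real s * cis \<theta>2)) \<longlongrightarrow> 0) (at_right 0)"
    proof (rule seg_int_tendsto_0[OF _ holomorphic_on_imp_continuous_on[OF G]])
      show "\<forall>\<^sub>F s in at_right 0. closed_segment (0 + of_real s * cis \<theta>1) (0 + of_real s * cis \<theta>2) \<subseteq> S"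
        using eventually_at_right_less[of 0] by eventually_elim (use sub in simp)
      show "\<forall>\<^sub>F s in at_right 0. \<forall>x\<in>closed_segment (0 + of_real s * cis \<theta>1) (0 + of_real s * cis \<theta>2).
          norm (G x) * norm ((0 + of_real s * cis \<theta>2) - (0 + of_real s * cis \<theta>1)) \<le> 2 * A * s * exp (- c * s)"
        using eventually_at_right_less[of 0] by eventually_elim (use chord in simp)
      show "((\<lambda>s. 2 * A * s * exp (- c * s)) \<longlongrightarrow> 0) (at_right 0)"
        by (auto intro!: tendsto_eq_intros)
    qed
    show "((\<lambda>s. seg_int G (0 + of_real s * cis \<theta>1) (0 + of_real s * cis \<theta>2)) \<longlongrightarrow> 0) at_top"
    proof (rule seg_int_tendsto_0[OF _ holomorphic_on_imp_continuous_on[OF G]])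
      show "\<forall>\<^sub>F s in at_top. closed_segment (0 + of_real s * cis \<theta>1) (0 + of_real s * cis \<theta>2) \<subseteq> S"
        using eventually_gt_at_top[of 0] by eventually_elim (use sub in simp)
      show "\<forall>\<^sub>F s in at_top. \<forall>x\<in>closed_segment (0 + of_real s * cis \<theta>1) (0 + of_real s * cis \<theta>2).
          norm (G x) * norm ((0 + of_real s * cis \<theta>2) - (0 + of_real s * cis \<theta>1)) \<le> 2 * A * s * exp (- c * s)"
        using eventually_gt_at_top[of 0] by eventually_elim (use chord in simp)
      show "((\<lambda>s. 2 * A * s * exp (- c * s)) \<longlongrightarrow> 0) at_top"
        using c by real_asymp
    qed
  qed (use in_S int th(1) in auto)
  thus ?thesis by (simp add: laplace_ray_int G_def)
qed

lemma locally_bounded_on_imp_bounded: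
  assumes b: "locally_bounded_on I b" and sub: "{\<theta>1..\<theta>2} \<subseteq> I"
  obtains M where "\<And>\<theta>. \<theta> \<in> {\<theta>1..\<theta>2} \<Longrightarrow> \<bar>b \<theta>\<bar> \<le> M"
proof -
  have "\<forall>\<theta>\<in>{\<theta>1..\<theta>2}. \<exists>d>0. bounded (b ` (I \<inter> ball \<theta> d))"
    using b sub by (auto simp: locally_bounded_on_def)
  then obtain d where d: "\<And>\<theta>. \<theta> \<in> {\<theta>1..\<theta>2} \<Longrightarrow> d \<theta> > 0 \<and> bounded (b ` (I \<inter> ball \<theta> (d \<theta>)))"
    by metis
  have "{\<theta>1..\<theta>2} \<subseteq> (\<Union>\<theta>\<in>{\<theta>1..\<theta>2}. ball \<theta> (d \<theta>))" using d by force
  then obtain T where T: "T \<subseteq> {\<theta>1..\<theta>2}" "finite T" "{\<theta>1..\<theta>2} \<subseteq> (\<Union>\<theta>\<in>T. ball \<theta> (d \<theta>))"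
    using compactE_image[OF compact_Icc[of \<theta>1 \<theta>2], of "{\<theta>1..\<theta>2}" "\<lambda>\<theta>. ball \<theta> (d \<theta>)"] by blast
  have "bounded (\<Union>\<theta>\<in>T. b ` (I \<inter> ball \<theta> (d \<theta>)))" using T d by (intro bounded_UN) auto
  then obtain M where M: "\<And>y. y \<in> (\<Union>\<theta>\<in>T. b ` (I \<inter> ball \<theta> (d \<theta>))) \<Longrightarrow> norm y \<le> M"
    unfolding bounded_iff by blast
  show ?thesis
  proof (rule that[of M])
    fix \<theta> assume "\<theta> \<in> {\<theta>1..\<theta>2}"
    hence "b \<theta> \<in> (\<Union>\<theta>\<in>T. b ` (I \<inter> ball \<theta> (d \<theta>)))" using T(3) sub by blast
    from M[OF this] show "\<bar>b \<theta>\<bar> \<le> M" by simp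
  qed
qed

text \<open>The two half-planes of convergence meet in a convex set, so it is enough to compare the two
  integrals far away in the direction where the turning argument is elementary.\<close>

lemma laplace_direction_indep_le:
  assumes I: "convex (sector I)" "open (sector I)" "{\<theta>1..\<theta>2} \<subseteq> I"
    and th: "\<theta>1 \<le> \<theta>2" "\<theta>2 - \<theta>1 < pi" and F: "F holomorphic_on sector I"
    and b1: "exp_bounded_on I F \<beta>1" and b2: "exp_bounded_on I F \<beta>2"
    and z: "Re (z * cis \<theta>1) > \<beta>1 \<theta>1" "Re (z * cis \<theta>2) > \<beta>2 \<theta>2"
  shows "laplace F \<theta>1 z = laplace F \<theta>2 z"
proof -
  have in_S: "of_real \<xi> * cis \<theta> \<in> sector I" if "\<xi> > 0" "\<theta> \<in> I" for \<xi> \<theta>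
    using that by (auto simp: sector_def)
  have I12: "\<theta>1 \<in> I" "\<theta>2 \<in> I" using I(3) th(1) by auto
  have ray: "\<exists>A. exp_bounded_ray F \<theta> A (\<beta> \<theta>)" if "\<theta> \<in> I" "exp_bounded_on I F \<beta>" for \<theta> \<beta>
    using that unfolding exp_bounded_on_def exp_bounded_ray_def
    by (auto intro!: continuous_on_compose2[OF holomorphic_on_imp_continuous_on[OF F]] continuous_intros in_S)
  obtain A1 A2 where A: "exp_bounded_ray F \<theta>1 A1 (\<beta>1 \<theta>1)" "exp_bounded_ray F \<theta>2 A2 (\<beta>2 \<theta>2)"
    using ray[OF I12(1) b1] ray[OF I12(2) b2] by blast
  obtain \<alpha> where \<alpha>: "locally_bounded_on I \<alpha>" "locally_bounded_on I \<beta>1"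
     and bd: "\<And>\<theta> \<xi>. \<theta> \<in> I \<Longrightarrow> \<xi> > 0 \<Longrightarrow> norm (F (of_real \<xi> * cis \<theta>)) \<le> \<alpha> \<theta> * exp (\<beta>1 \<theta> * \<xi>)"
    using b1 unfolding exp_bounded_on_def by blast
  obtain A where A': "\<And>\<theta>. \<theta> \<in> {\<theta>1..\<theta>2} \<Longrightarrow> \<bar>\<alpha> \<theta>\<bar> \<le> A"
    using locally_bounded_on_imp_bounded[OF \<alpha>(1) I(3)] by blast
  obtain B where B: "\<And>\<theta>. \<theta> \<in> {\<theta>1..\<theta>2} \<Longrightarrow> \<bar>\<beta>1 \<theta>\<bar> \<le> B"
    using locally_bounded_on_imp_bounded[OF \<alpha>(2) I(3)] by blast
  have bd': "norm (F (of_real \<xi> * cis \<theta>)) \<le> A * exp (B * \<xi>)" if "\<xi> > 0" "\<theta> \<in> {\<theta>1..\<theta>2}" for \<xi> \<theta>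
  proof -
    have "\<alpha> \<theta> * exp (\<beta>1 \<theta> * \<xi>) \<le> A * exp (B * \<xi>)"
      using A'[OF that(2)] B[OF that(2)] that(1) by (intro mult_mono) (auto intro!: mult_right_mono)
    thus ?thesis using bd[of \<theta> \<xi>] that I(3) by fastforce
  qed
  define c where "c = cos ((\<theta>2 - \<theta>1) / 2)"
  have c: "c > 0" unfolding c_def using th by (intro cos_gt_zero_pi) auto
  define U where "U = {z. Re (z * cis \<theta>1) > \<beta>1 \<theta>1} \<inter> {z. Re (z * cis \<theta>2) > \<beta>2 \<theta>2}"
  have hp: "{z. Re (z * cis \<theta>) > b} = {z. inner (cis (-\<theta>)) z > b}" for \<theta> b
    by (auto simp: inner_complex_def algebra_simps)
  have U: "open U" "convex U"
    unfolding U_def hp by (auto intro!: open_Int open_halfspace_gt convex_Int convex_halfspace_gt)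
  \<comment> \<open>Beyond \<open>X0\<close> the point X \<mu> lies in both half-planes and far
    enough out for \<open>laplace_rotate_far\<close>, where B bounds the rate over all directions in
    between.\<close>
  define X0 where "X0 = Max {0, (B + 1) / c, (\<beta>1 \<theta>1 + 1) / c, (\<beta>2 \<theta>2 + 1) / c}"
  define \<mu> where "\<mu> = cis (- (\<theta>1 + \<theta>2) / 2)"
  have X0: "X \<ge> 0" "X * c \<ge> B + 1" "X * c \<ge> \<beta>1 \<theta>1 + 1" "X * c \<ge> \<beta>2 \<theta>2 + 1" if "X \<ge> X0" for X
    using that c by (auto simp: X0_def field_simps)
  have mu: "Re (of_real X * \<mu> * cis \<theta>1) = X * c" "Re (of_real X * \<mu> * cis \<theta>2) = X * c" for X
  proof -
    have e: "- (\<theta>1 + \<theta>2) / 2 + \<theta>1 = - ((\<theta>2 - \<theta>1) / 2)" "- (\<theta>1 + \<theta>2) / 2 + \<theta>2 = (\<theta>2 - \<theta>1) / 2"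
      by (simp_all add: field_simps)
    have "of_real X * \<mu> * cis \<theta>1 = of_real X * cis (- ((\<theta>2 - \<theta>1) / 2))"
      unfolding \<mu>_def mult.assoc cis_mult e ..
    thus "Re (of_real X * \<mu> * cis \<theta>1) = X * c" by (simp only: c_def) simp
    have "of_real X * \<mu> * cis \<theta>2 = of_real X * cis ((\<theta>2 - \<theta>1) / 2)"
      unfolding \<mu>_def mult.assoc cis_mult e ..
    thus "Re (of_real X * \<mu> * cis \<theta>2) = X * c" by (simp only: c_def) simp
  qed
  have inU: "of_real X * \<mu> \<in> U" if "X \<ge> X0" for X
    unfolding U_def Int_iff mem_Collect_eq mu using X0[OF that] by auto
  have "laplace F \<theta>1 z - laplace F \<theta>2 z = 0"
  proof (rule analytic_continuation[where f = "\<lambda>z. laplace F \<theta>1 z - laplace F \<theta>2 z" and S = U and U = "(\<lambda>X. of_real X * \<mu>) ` {X0..}" and \<xi> = "of_real X0 * \<mu>"])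
    show "(\<lambda>z. laplace F \<theta>1 z - laplace F \<theta>2 z) holomorphic_on U"
      using laplace_holomorphic[OF A(1)] laplace_holomorphic[OF A(2)]
      by (intro holomorphic_intros; elim holomorphic_on_subset; auto simp: U_def)
    show "connected U" using U(2) by (rule convex_connected)
    show "(\<lambda>X. of_real X * \<mu>) ` {X0..} \<subseteq> U" using inU by auto
    show "of_real X0 * \<mu> \<in> U" using inU by simp
    show "z \<in> U" using z by (simp add: U_def)
    show "(of_real X0 * \<mu>) islimpt (\<lambda>X. of_real X * \<mu>) ` {X0..}"
      unfolding islimpt_approachable
    proof (intro allI impI)
      fix e :: real assume e: "e > 0"
      have "\<mu> \<noteq> 0" by (simp add: \<mu>_def)
      show "\<exists>x'\<in>(\<lambda>X. of_real X * \<mu>) ` {X0..}. x' \<noteq> of_real X0 * \<mu> \<and> dist x' (of_real X0 * \<mu>) < e"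
      proof (rule bexI, rule conjI)
        show "of_real (X0 + e/2) * \<mu> \<noteq> of_real X0 * \<mu>" using e \<open>\<mu> \<noteq> 0\<close> by simp
        have "of_real (X0 + e/2) * \<mu> - of_real X0 * \<mu> = of_real (e/2) * \<mu>" by (simp add: algebra_simps)
        thus "dist (of_real (X0 + e/2) * \<mu>) (of_real X0 * \<mu>) < e"
          using e by (simp only: dist_norm norm_mult) (simp add: \<mu>_def norm_divide)
        show "of_real (X0 + e/2) * \<mu> \<in> (\<lambda>X. of_real X * \<mu>) ` {X0..}" by (rule imageI) (use e in simp)
      qed
    qed
    fix x assume "x \<in> (\<lambda>X. of_real X * \<mu>) ` {X0..}"
    then obtain X where X: "X \<ge> X0" "x = of_real X * \<mu>" by auto
    have "laplace F \<theta>1 x = laplace F \<theta>2 x"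
      by (rule laplace_rotate_far[OF th I(1,2) F _ bd' _ X0(1)[OF X(1)]])
         (use X X0[OF X(1)] I(3) in_S in \<open>auto simp: c_def \<mu>_def\<close>)
    thus "laplace F \<theta>1 x - laplace F \<theta>2 x = 0" by simp
  qed (use U in auto)
  thus ?thesis by simp
qed

lemma laplace_direction_indep:
  assumes I: "convex (sector I)" "open (sector I)" "is_interval I" "\<And>\<theta>1 \<theta>2. \<theta>1 \<in> I \<Longrightarrow> \<theta>2 \<in> I \<Longrightarrow> \<theta>2 - \<theta>1 < pi"
    and th: "\<theta>1 \<in> I" "\<theta>2 \<in> I" and F: "F holomorphic_on sector I"
    and b: "exp_bounded_on I F \<beta>1" "exp_bounded_on I F \<beta>2"
    and z: "Re (z * cis \<theta>1) > \<beta>1 \<theta>1" "Re (z * cis \<theta>2) > \<beta>2 \<theta>2"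
  shows "laplace F \<theta>1 z = laplace F \<theta>2 z"
proof (cases "\<theta>1 \<le> \<theta>2")
  case True
  have "{\<theta>1..\<theta>2} \<subseteq> I" using mem_is_interval_1_I[OF I(3) th] by auto
  from laplace_direction_indep_le[OF I(1,2) this True I(4)[OF th] F b z] show ?thesis .
next
  case False
  hence le: "\<theta>2 \<le> \<theta>1" by simp
  have "{\<theta>2..\<theta>1} \<subseteq> I" using mem_is_interval_1_I[OF I(3) th(2,1)] by auto
  from laplace_direction_indep_le[OF I(1,2) this le I(4)[OF th(2,1)] F b(2,1) z(2,1)] show ?thesis by simp
qed

section \<open>The two arcs and the Borel sums over them\<close>

lemma sector_arc_plus: "sector arc_plus = {\<zeta>. Re \<zeta> > 0}"
proof (intro equalityI subsetI)
  fix \<zeta> assume "\<zeta> \<in> sector arc_plus"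
  thus "\<zeta> \<in> {\<zeta>. Re \<zeta> > 0}" by (auto simp: sector_def arc_plus_def intro!: mult_pos_pos cos_gt_zero_pi)
next
  fix \<zeta> :: complex assume "\<zeta> \<in> {\<zeta>. Re \<zeta> > 0}"
  hence r: "Re \<zeta> > 0" by simp
  hence "Arg \<zeta> \<in> arc_plus" using arg_conv_arctan[OF r] arctan_bounded[of "Im \<zeta> / Re \<zeta>"] by (simp add: arc_plus_def)
  moreover have "\<zeta> = of_real (norm \<zeta>) * cis (Arg \<zeta>)" using rcis_cmod_Arg[of \<zeta>] by (simp add: rcis_def)
  moreover have "norm \<zeta> > 0" using r by auto
  ultimately show "\<zeta> \<in> sector arc_plus" unfolding sector_def by blast
qed

lemma arc_minus_iff: "\<theta> \<in> arc_minus \<longleftrightarrow> \<theta> - pi \<in> arc_plus"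
  by (auto simp: arc_minus_def arc_plus_def field_simps)

lemma cis_diff_pi: "cis (\<theta> - pi) = - cis \<theta>"
  by (auto simp: complex_eq_iff cos_diff sin_diff)

lemma sector_arc_minus: "sector arc_minus = {\<zeta>. Re \<zeta> < 0}"
proof -
  have "sector arc_minus = uminus ` sector arc_plus"
  proof (intro equalityI subsetI)
    fix \<zeta> assume "\<zeta> \<in> sector arc_minus"
    then obtain \<xi> \<theta> where "\<xi> > 0" "\<theta> \<in> arc_minus" "\<zeta> = of_real \<xi> * cis \<theta>" by (auto simp: sector_def)
    hence "- \<zeta> = of_real \<xi> * cis (\<theta> - pi)" "\<theta> - pi \<in> arc_plus" "\<xi> > 0"
      by (auto simp: cis_diff_pi arc_minus_iff)
    hence "- \<zeta> \<in> sector arc_plus" unfolding sector_def by blast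
    thus "\<zeta> \<in> uminus ` sector arc_plus" by (metis image_eqI minus_minus)
  next
    fix \<zeta> assume "\<zeta> \<in> uminus ` sector arc_plus"
    then obtain \<xi> \<theta> where "\<xi> > 0" "\<theta> \<in> arc_plus" "\<zeta> = - (of_real \<xi> * cis \<theta>)" by (auto simp: sector_def)
    hence "\<zeta> = of_real \<xi> * cis (\<theta> + pi)" "\<theta> + pi \<in> arc_minus"
      using cis_diff_pi[of "\<theta> + pi"] by (simp_all add: arc_minus_iff)
    thus "\<zeta> \<in> sector arc_minus" unfolding sector_def using \<open>\<xi> > 0\<close> by blast
  qed
  also have "\<dots> = {\<zeta>. Re \<zeta> < 0}" unfolding sector_arc_plus
    by (auto intro!: image_eqI[of _ _ "- x" for x])
  finally show ?thesis .
qed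

text \<open>One rate B serves all directions of the arc, which is what the Cauchy--Heine
  construction yields. The sum p is named, so that nothing has to be read off from the definite
  description in \<open>borel_sum\<close>.\<close>

definition borel_summable :: "complex fps \<Rightarrow> real set \<Rightarrow> real \<Rightarrow> (complex \<Rightarrow> complex) \<Rightarrow> bool" where
  "borel_summable \<phi> I B p \<longleftrightarrow> (\<exists>F. borel_continuation \<phi> I F \<and> exp_bounded_on I F (\<lambda>_. B) \<and>
     (\<forall>\<theta>\<in>I. \<forall>z. Re (z * cis \<theta>) > B \<longrightarrow> laplace F \<theta> z = p z))"

text \<open>The description is unambiguous: two continuations agree near 0 with the same convergent
  series, hence on the whole connected sector, and the value of the integral depends neither on the
  direction nor on the admissible rate.\<close>

lemma borel_sum_eq:
  assumes I: "I = arc_plus \<or> I = arc_minus" and bs: "borel_summable \<phi> I B p"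
    and th: "\<theta> \<in> I" "Re (z * cis \<theta>) > B"
  shows "borel_sum \<phi> I z = z + p z"
proof -
  obtain F where F: "borel_continuation \<phi> I F" "exp_bounded_on I F (\<lambda>_. B)"
     and L: "\<And>\<theta> z. \<theta> \<in> I \<Longrightarrow> Re (z * cis \<theta>) > B \<Longrightarrow> laplace F \<theta> z = p z"
    using bs unfolding borel_summable_def by blast
  have open_hp: "open {\<zeta>. Re \<zeta> > 0}" "open {\<zeta>. Re \<zeta> < 0}" "convex {\<zeta>. Re \<zeta> > 0}" "convex {\<zeta>. Re \<zeta> < 0}"
    by (auto intro: open_halfspace_Re_gt open_halfspace_Re_lt convex_halfspace_Re_gt convex_halfspace_Re_lt)
  have conv: "convex (sector I)" and op: "open (sector I)"
    using I open_hp by (auto simp: sector_arc_plus sector_arc_minus)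
  have ivl: "is_interval I" "\<And>\<theta>1 \<theta>2. \<theta>1 \<in> I \<Longrightarrow> \<theta>2 \<in> I \<Longrightarrow> \<theta>2 - \<theta>1 < pi"
    using I by (auto simp: arc_plus_def arc_minus_def is_interval_1)
  have holF: "F holomorphic_on sector I" using F(1) by (simp add: borel_continuation_def)
  \<comment> \<open>A ray in the sector, to see that the sector meets every disc around 0.\<close>
  have pos: "\<exists>\<zeta>0. norm \<zeta>0 = 1 \<and> (\<forall>t>0. of_real t * \<zeta>0 \<in> sector I)"
    using I by (auto simp: sector_arc_plus sector_arc_minus intro: exI[of _ 1] exI[of _ "-1"])
  have uniq: "L' = p z" if "borel_continuation \<phi> I F'" "exp_bounded_on I F' \<beta>" "\<theta>' \<in> I" "Re (z * cis \<theta>') > \<beta> \<theta>'"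
    "L' = laplace F' \<theta>' z" for F' \<beta> \<theta>' L'
  proof -
    from that(1) F(1) obtain r1 r2 where r: "r1 > 0" "r2 > 0"
      "\<And>\<zeta>. \<zeta> \<in> sector I \<Longrightarrow> norm \<zeta> < r1 \<Longrightarrow> F' \<zeta> = eval_fps (borel_transform \<phi>) \<zeta>"
      "\<And>\<zeta>. \<zeta> \<in> sector I \<Longrightarrow> norm \<zeta> < r2 \<Longrightarrow> F \<zeta> = eval_fps (borel_transform \<phi>) \<zeta>"
      unfolding borel_continuation_def by blast
    define r where "r = min r1 r2"
    have r0: "r > 0" using r by (simp add: r_def)
    obtain \<zeta>0 where z0: "norm \<zeta>0 = 1" "\<And>t. t > 0 \<Longrightarrow> of_real t * \<zeta>0 \<in> sector I" using pos by blast
    have eq: "F' \<zeta> = F \<zeta>" if "\<zeta> \<in> sector I" for \<zeta>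
    proof -
      have holF': "F' holomorphic_on sector I" using \<open>borel_continuation \<phi> I F'\<close> by (simp add: borel_continuation_def)
      have "F' \<zeta> - F \<zeta> = 0"
      proof (rule analytic_continuation_open[where s = "sector I \<inter> ball 0 r" and s' = "sector I" and f = "\<lambda>\<zeta>. F' \<zeta> - F \<zeta>" and g = "\<lambda>_. 0"])
        show "sector I \<inter> ball 0 r \<noteq> {}"
          using z0(2)[of "r/2"] z0(1) r0 by (intro ex_in_conv[THEN iffD1] exI[of _ "of_real (r/2) * \<zeta>0"]) (auto simp: norm_mult)
        show "F' x - F x = 0" if "x \<in> sector I \<inter> ball 0 r" for x
          using r(3,4)[of x] that by (auto simp: r_def)
      qed (use op conv that holF holF' in \<open>auto intro!: convex_connected holomorphic_intros\<close>)
      thus ?thesis by simp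
    qed
    have "laplace F' \<theta>' z = laplace F \<theta>' z" unfolding laplace_def
      by (rule set_lebesgue_integral_cong) (use eq that(3) in \<open>auto simp: sector_def\<close>)
    moreover have "exp_bounded_on I F \<beta>" using that(2) eq
      unfolding exp_bounded_on_def by (auto simp: sector_def) (metis (no_types, opaque_lifting))
    hence "laplace F \<theta>' z = laplace F \<theta> z"

      by (intro laplace_direction_indep[where ?\<beta>1.0 = \<beta> and ?\<beta>2.0 = "\<lambda>_. B" and I = I]) (use conv op ivl that th holF F in blast)+
    ultimately show ?thesis using L[OF th] that(5) by simp
  qed
  have "(THE L. \<exists>F \<beta> \<theta>. borel_continuation \<phi> I F \<and> exp_bounded_on I F \<beta> \<and>
        \<theta> \<in> I \<and> Re (z * cis \<theta>) > \<beta> \<theta> \<and>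
        L = (LBINT \<xi>:{0<..}. exp (- z * of_real \<xi> * cis \<theta>) * F (of_real \<xi> * cis \<theta>) * cis \<theta>)) = p z"
    unfolding laplace_def[symmetric]
    by (rule the_equality) (use F L[OF th, symmetric] th uniq in blast)+
  thus ?thesis by (simp add: borel_sum_def)
qed

section \<open>Integrals of exponentials and their Laplace transforms\<close>

lemma pint_exp_holomorphic:
  assumes A: "A \<in> sets borel" and cont: "continuous_on A (\<lambda>s::real. q (a + of_real s * d))" and Z: "open Z"
    and dom: "\<And>\<zeta>. \<zeta> \<in> Z \<Longrightarrow> \<exists>r>0. \<exists>g. ball \<zeta> r \<subseteq> Z \<and> set_integrable lborel A g \<and>
       (\<forall>w\<in>ball \<zeta> r. \<forall>s\<in>A. norm (q (a + of_real s * d) * exp (w * (a + of_real s * d)) * d) \<le> g s)"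
  shows "(\<lambda>\<zeta>. pint A (\<lambda>t. q t * exp (\<zeta> * t)) a d) holomorphic_on Z"
  unfolding pint_def set_lebesgue_integral_def
proof (rule holomorphic_on_parametric_integral[OF Z])
  fix s :: real
  show "(\<lambda>z. indicat_real A s *\<^sub>R (q (a + of_real s * d) * exp (z * (a + of_real s * d)) * d)) holomorphic_on Z"
    unfolding scaleR_conv_of_real by (intro holomorphic_intros)
next
  fix \<zeta> assume \<zeta>: "\<zeta> \<in> Z"
  from dom[OF this] obtain r g where r: "r > 0" "ball \<zeta> r \<subseteq> Z" "set_integrable lborel A g"
    and bd: "\<And>w s. w \<in> ball \<zeta> r \<Longrightarrow> s \<in> A \<Longrightarrow> norm (q (a + of_real s * d) * exp (w * (a + of_real s * d)) * d) \<le> g s" by blast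
  have "set_integrable lborel A (\<lambda>s. q (a + of_real s * d) * exp (\<zeta> * (a + of_real s * d)) * d)"
    by (rule set_integrable_continuous_bound[OF _ A r(3) bd]) (use r(1) in \<open>auto intro!: continuous_intros cont\<close>)
  thus "integrable lborel (\<lambda>s. indicat_real A s *\<^sub>R (q (a + of_real s * d) * exp (\<zeta> * (a + of_real s * d)) * d))"
    by (simp add: set_integrable_def)
  show "\<exists>r>0. \<exists>g. ball \<zeta> r \<subseteq> Z \<and> integrable lborel g \<and> (\<forall>w\<in>ball \<zeta> r. \<forall>s\<in>space lborel.
      norm (indicat_real A s *\<^sub>R (q (a + of_real s * d) * exp (w * (a + of_real s * d)) * d)) \<le> g s)"
    by (rule exI[of _ r], intro conjI r(1), rule exI[of _ "\<lambda>s. indicat_real A s *\<^sub>R g s"])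
       (use r bd in \<open>auto simp: set_integrable_def indicator_def\<close>)
qed

lemma seg_int_exp_holomorphic:
  assumes cont: "continuous_on (closed_segment a b) q"
  shows "(\<lambda>\<zeta>. seg_int (\<lambda>t. q t * exp (\<zeta> * t)) a b) holomorphic_on UNIV"
  unfolding seg_int_def
proof (rule pint_exp_holomorphic)
  have in_seg: "a + of_real s * (b - a) \<in> closed_segment a b" if "s \<in> {0..1}" for s :: real
    using that by (auto simp: closed_segment_def scaleR_conv_of_real algebra_simps intro!: exI[of _ s])
  show cont': "continuous_on {0..1} (\<lambda>s::real. q (a + of_real s * (b - a)))"
    by (intro continuous_on_compose2[OF cont] continuous_intros) (use in_seg in auto)
  fix \<zeta> :: complex
  have "compact (q ` closed_segment a b)" by (rule compact_continuous_image[OF cont]) simp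
  hence "bounded (q ` closed_segment a b)" by (rule compact_imp_bounded)
  then obtain M where M: "\<And>x. x \<in> closed_segment a b \<Longrightarrow> norm (q x) \<le> M" by (auto simp: bounded_iff)
  have M0: "M \<ge> 0" using M[of a] by (meson ends_in_segment(1) norm_ge_zero order_trans)
  define L where "L = norm a + norm (b - a)"
  show "\<exists>r>0. \<exists>g. ball \<zeta> r \<subseteq> UNIV \<and> set_integrable lborel {0..1::real} g \<and> (\<forall>w\<in>ball \<zeta> r. \<forall>s\<in>{0..1}.
      norm (q (a + of_real s * (b - a)) * exp (w * (a + of_real s * (b - a))) * (b - a)) \<le> g s)"
  proof (rule exI[of _ 1], intro conjI, simp, rule exI[of _ "\<lambda>_. M * exp ((norm \<zeta> + 1) * L) * norm (b - a)"], intro conjI ballI)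
    show "set_integrable lborel {0..1::real} (\<lambda>_. M * exp ((norm \<zeta> + 1) * L) * norm (b - a))"
      by (simp add: set_integrable_def)
    fix w s assume w: "w \<in> ball \<zeta> 1" and s: "s \<in> {0..1::real}"
    have "norm w \<le> norm \<zeta> + 1" using w norm_triangle_ineq2[of w \<zeta>] by (simp add: dist_norm norm_minus_commute)
    moreover have "norm (a + of_real s * (b - a)) \<le> norm a + norm (of_real s * (b - a))" by (rule norm_triangle_ineq)
    hence "norm (a + of_real s * (b - a)) \<le> L" unfolding L_def
      using s mult_right_mono[of s 1 "norm (b - a)"] by (simp add: norm_mult)
    ultimately have "norm (w * (a + of_real s * (b - a))) \<le> (norm \<zeta> + 1) * L"
      unfolding norm_mult by (intro mult_mono) auto
    hence "norm (exp (w * (a + of_real s * (b - a)))) \<le> exp ((norm \<zeta> + 1) * L)"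
      by (intro order_trans[OF norm_exp]) simp
    thus "norm (q (a + of_real s * (b - a)) * exp (w * (a + of_real s * (b - a))) * (b - a)) \<le> M * exp ((norm \<zeta> + 1) * L) * norm (b - a)"
      unfolding norm_mult[of _ "b - a"] norm_mult[of "q _"] using M[OF in_seg[OF s]] M0
      by (intro mult_mono) auto
  qed simp
qed auto

text \<open>By Fubini the integral over \<xi> may be taken inside, where exp ((t - x) \<xi>)
  integrates to 1 / (x - t) because Re t \<le> \<rho> < x. The bound 1 / (x - \<rho>) for the inner
  integral of the modulus gives absolute integrability of the double integral. Thus an exponential
  kernel becomes a Cauchy kernel.\<close>

lemma pint_exp_laplace:
  assumes A: "A \<in> sets borel" and cont: "continuous_on A (\<lambda>s::real. q (a + of_real s * d))"
    and int: "set_integrable lborel A (\<lambda>s. q (a + of_real s * d) * d)"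
    and Re: "\<And>s. s \<in> A \<Longrightarrow> Re (a + of_real s * d) \<le> \<rho>" and x: "x > \<rho>"
  shows "set_integrable lborel {0<..} (\<lambda>\<xi>. exp (- of_real (x * \<xi>)) * pint A (\<lambda>t. q t * exp (of_real \<xi> * t)) a d)"
    and "(LBINT \<xi>:{0<..}. exp (- of_real (x * \<xi>)) * pint A (\<lambda>t. q t * exp (of_real \<xi> * t)) a d)
       = pint A (\<lambda>t. q t * (1 / (of_real x - t))) a d"
proof -
  define Q where "Q = (\<lambda>s::real. indicat_real A s *\<^sub>R (q (a + of_real s * d) * d))"
  define t where "t = (\<lambda>s::real. a + of_real s * d)"
  define f where "f = (\<lambda>(s::real) (\<xi>::real). Q s * (indicat_real {0<..} \<xi> *\<^sub>R exp (- (of_real x - t s) * of_real \<xi>)))"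
  have Qi: "integrable lborel Q" using int by (simp add: set_integrable_def Q_def)
  hence Qm [measurable]: "Q \<in> borel_measurable borel" by simp
  have tm [measurable]: "t \<in> borel_measurable borel" unfolding t_def by measurable
  have fm [measurable]: "case_prod f \<in> borel_measurable (lborel \<Otimes>\<^sub>M lborel)"
    unfolding f_def by measurable
  have Q0: "Q s = 0" if "s \<notin> A" for s using that by (simp add: Q_def)
  have rei: "Re (of_real x - t s) \<ge> x - \<rho>" if "s \<in> A" for s using Re[OF that] by (simp add: t_def)
  have inner_norm: "(\<integral>\<xi>. norm (f s \<xi>) \<partial>lborel) = norm (Q s) * (1 / Re (of_real x - t s))" and
     inner_int: "integrable lborel (f s)" and
     inner_val: "(\<integral>\<xi>. f s \<xi> \<partial>lborel) = Q s * (1 / (of_real x - t s))" if s: "s \<in> A" for s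
  proof -
    define w where "w = of_real x - t s"
    have w: "Re w > 0" using rei[OF s] x by (simp add: w_def)
    have n: "norm (f s \<xi>) = norm (Q s) * (indicat_real {0<..} \<xi> *\<^sub>R exp (- Re w * \<xi>))" for \<xi>
      unfolding f_def w_def[symmetric] by (simp add: norm_mult indicator_def)
    show "(\<integral>\<xi>. norm (f s \<xi>) \<partial>lborel) = norm (Q s) * (1 / Re (of_real x - t s))"
      unfolding n using set_integral_exp_ray[OF w] by (simp add: set_lebesgue_integral_def w_def)
    have i: "set_integrable lborel {0<..} (\<lambda>\<xi>. exp (- w * of_real \<xi>))"
      by (rule set_integrable_continuous_bound[OF _ _ set_integrable_exp_ray[OF w]]) (auto intro!: continuous_intros)
    thus "integrable lborel (f s)"
      unfolding f_def w_def[symmetric] by (intro integrable_mult_right) (simp add: set_integrable_def)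
    show "(\<integral>\<xi>. f s \<xi> \<partial>lborel) = Q s * (1 / (of_real x - t s))"
    proof -
      have "(\<integral>\<xi>. f s \<xi> \<partial>lborel) = Q s * (LBINT \<xi>:{0<..}. exp (- w * of_real \<xi>))"
        unfolding f_def w_def[symmetric] set_lebesgue_integral_def by (rule integral_mult_right_zero)
      thus ?thesis using laplace_power[OF w, of 0] by (simp add: w_def)
    qed
  qed
  have fint: "integrable (lborel \<Otimes>\<^sub>M lborel) (case_prod f)"
  proof (rule lborel_pair.Fubini_integrable[OF fm])
    have "integrable lborel (\<lambda>s. norm (Q s) * (1 / (x - \<rho>)))" using Qi by simp
    moreover have "(\<lambda>s. \<integral>\<xi>. norm (f s \<xi>) \<partial>lborel) \<in> borel_measurable lborel" by measurable
    moreover have "norm (\<integral>\<xi>. norm (f s \<xi>) \<partial>lborel) \<le> norm (norm (Q s) * (1 / (x - \<rho>)))" for s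
    proof (cases "s \<in> A")
      case True
      have "1 / Re (of_real x - t s) \<le> 1 / (x - \<rho>)" using rei[OF True] x by (intro divide_left_mono) auto
      hence "norm (Q s) * (1 / Re (of_real x - t s)) \<le> norm (Q s) * (1 / (x - \<rho>))" by (intro mult_left_mono) auto
      moreover have "norm (Q s) * (1 / Re (of_real x - t s)) \<ge> 0" using rei[OF True] x by simp
      ultimately show ?thesis unfolding inner_norm[OF True] using rei[OF True] x by simp
    qed (simp add: f_def Q0)
    ultimately show "integrable lborel (\<lambda>s. \<integral>\<xi>. norm (case_prod f (s, \<xi>)) \<partial>lborel)"
      by (auto intro: Bochner_Integration.integrable_bound)
    show "AE s in lborel. integrable lborel (\<lambda>\<xi>. case_prod f (s, \<xi>))"
      by (intro AE_I2) (metis (no_types, lifting) case_prod_conv ext f_def inner_int integrable_zero Q0 mult_zero_left)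
  qed
  have eq: "indicat_real {0<..} \<xi> *\<^sub>R (exp (- of_real (x * \<xi>)) * pint A (\<lambda>t. q t * exp (of_real \<xi> * t)) a d) = (\<integral>s. f s \<xi> \<partial>lborel)" for \<xi>
  proof -
    have "(\<integral>s. f s \<xi> \<partial>lborel) = (\<integral>s. (indicat_real {0<..} \<xi> *\<^sub>R exp (- of_real (x * \<xi>))) *
        (indicat_real A s *\<^sub>R (q (t s) * exp (of_real \<xi> * t s) * d)) \<partial>lborel)"
      by (rule Bochner_Integration.integral_cong)
         (auto simp: f_def Q_def t_def indicator_def algebra_simps simp flip: exp_add)
    also have "\<dots> = (indicat_real {0<..} \<xi> *\<^sub>R exp (- of_real (x * \<xi>))) * pint A (\<lambda>t. q t * exp (of_real \<xi> * t)) a d"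
      unfolding pint_def set_lebesgue_integral_def t_def by (rule integral_mult_right_zero)
    finally show ?thesis by simp
  qed
  show "set_integrable lborel {0<..} (\<lambda>\<xi>. exp (- of_real (x * \<xi>)) * pint A (\<lambda>t. q t * exp (of_real \<xi> * t)) a d)"
    unfolding set_integrable_def eq by (rule lborel_pair.integrable_snd[OF fint])
  have "(LBINT \<xi>:{0<..}. exp (- of_real (x * \<xi>)) * pint A (\<lambda>t. q t * exp (of_real \<xi> * t)) a d) = (\<integral>\<xi>. (\<integral>s. f s \<xi> \<partial>lborel) \<partial>lborel)"
    unfolding set_lebesgue_integral_def eq ..
  also have "\<dots> = (\<integral>s. (\<integral>\<xi>. f s \<xi> \<partial>lborel) \<partial>lborel)"
    by (rule lborel_pair.Fubini_integral[OF fint])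
  also have "\<dots> = (\<integral>s. indicat_real A s *\<^sub>R (q (t s) * (1 / (of_real x - t s)) * d) \<partial>lborel)"
  proof (rule Bochner_Integration.integral_cong[OF refl])
    fix s show "(\<integral>\<xi>. f s \<xi> \<partial>lborel) = indicat_real A s *\<^sub>R (q (t s) * (1 / (of_real x - t s)) * d)"
    proof (cases "s \<in> A")
      case True thus ?thesis unfolding inner_val[OF True] by (simp add: Q_def t_def)
    next
      case False thus ?thesis by (simp add: f_def Q0)
    qed
  qed
  also have "\<dots> = pint A (\<lambda>t. q t * (1 / (of_real x - t))) a d"
    by (simp add: pint_def set_lebesgue_integral_def t_def)
  finally show "(LBINT \<xi>:{0<..}. exp (- of_real (x * \<xi>)) * pint A (\<lambda>t. q t * exp (of_real \<xi> * t)) a d)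
       = pint A (\<lambda>t. q t * (1 / (of_real x - t))) a d" .
qed

text \<open>The bridge to contour integrals, hence to Cauchy's formula on a rectangle.\<close>

lemma seg_int_contour:
  assumes cont: "continuous_on (closed_segment a b) f"
  shows "(f has_contour_integral seg_int f a b) (linepath a b)"
proof -
  have in_seg: "linepath a b s \<in> closed_segment a b" if "s \<in> {0..1}" for s :: real
    using linepath_image_01 that by blast
  have c: "continuous_on {0..1} (\<lambda>s. f (linepath a b s) * (b - a))"
    by (intro continuous_intros continuous_on_compose2[OF cont]) (use in_seg in auto)
  have "set_integrable lborel {0..1} (\<lambda>s. f (linepath a b s) * (b - a))"
    unfolding set_integrable_def by (rule borel_integrable_compact[OF compact_Icc c])
  from set_borel_integral_eq_integral[OF this]
  have "((\<lambda>s. f (linepath a b s) * (b - a)) has_integral (LBINT s:{0..1}. f (linepath a b s) * (b - a))) {0..1}"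
    by (simp only: integrable_integral)
  moreover have "(LBINT s:{0..1}. f (linepath a b s) * (b - a)) = seg_int f a b"
    unfolding seg_int_def pint_def by (rule set_lebesgue_integral_cong) (auto simp: linepath_def scaleR_conv_of_real algebra_simps)
  ultimately show ?thesis by (simp add: has_contour_integral_linepath)
qed

lemma seg_int_reverse:
  assumes cont: "continuous_on (closed_segment a b) f"
  shows "seg_int f b a = - seg_int f a b"
proof -
  have "continuous_on (closed_segment b a) f" using cont by (simp add: closed_segment_commute)
  from has_contour_integral_reversepath[OF _ seg_int_contour[OF this]]
  have "(f has_contour_integral - seg_int f b a) (linepath a b)" by simp
  with seg_int_contour[OF cont] show ?thesis by (metis has_contour_integral_unique minus_minus)
qed

text \<open>Opposite sides are taken in the same direction, hence the two minus signs on the left;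
  the kernel is 1 / (z - t), hence the sign on the right.\<close>

lemma Cauchy_rectangle:
  assumes S: "convex S" "open S" and f: "f holomorphic_on S" and z: "z \<in> box a c" and cbox: "cbox a c \<subseteq> S"
  defines "G \<equiv> (\<lambda>t. f t * (1 / (z - t)))" and "b \<equiv> Complex (Re c) (Im a)" and "d \<equiv> Complex (Re a) (Im c)"
  shows "seg_int G a b + seg_int G b c - seg_int G d c - seg_int G a d = - (2 * of_real pi * \<i> * f z)"
proof -
  have le: "Re a \<le> Re c" "Im a \<le> Im c" using z by (auto simp: in_box_complex_iff)
  have zS: "z \<in> S" using z cbox box_subset_cbox by blast
  have path: "path_image (rectpath a c) \<subseteq> cbox a c - box a c"
    using path_image_rectpath_cbox_minus_box[OF le] by simp
  have P: "path_image (rectpath a c) \<subseteq> S - {z}" using path z cbox by auto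
  have segs: "closed_segment a b \<subseteq> S - {z}" "closed_segment b c \<subseteq> S - {z}" "closed_segment c d \<subseteq> S - {z}" "closed_segment d a \<subseteq> S - {z}"
    using P by (auto simp: rectpath_def Let_def path_image_join b_def d_def)
  have contG: "continuous_on (S - {z}) G" unfolding G_def
    by (intro continuous_intros continuous_on_subset[OF holomorphic_on_imp_continuous_on[OF f]]) auto
  have c: "continuous_on (closed_segment a b) G" "continuous_on (closed_segment b c) G" "continuous_on (closed_segment c d) G" "continuous_on (closed_segment d a) G"
    by (rule continuous_on_subset[OF contG segs(1)] continuous_on_subset[OF contG segs(2)] continuous_on_subset[OF contG segs(3)] continuous_on_subset[OF contG segs(4)])+
  have "((\<lambda>w. f w / (w - z)) has_contour_integral (2 * pi * \<i> * winding_number (rectpath a c) z * f z)) (rectpath a c)"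
    by (rule Cauchy_integral_formula_convex_simple[OF S(1) f _ _ P]) (use zS S in \<open>auto simp: interior_open\<close>)
  hence 1: "((\<lambda>w. f w / (w - z)) has_contour_integral (2 * pi * \<i> * f z)) (rectpath a c)"
    using winding_number_rectpath[OF z] by simp
  have 2: "(G has_contour_integral - (2 * pi * \<i> * f z)) (rectpath a c)"
    using has_contour_integral_neg[OF 1]
    by (rule has_contour_integral_eq) (auto simp: G_def divide_simps algebra_simps)
  have "(G has_contour_integral (seg_int G a b + (seg_int G b c + (seg_int G c d + seg_int G d a)))) (rectpath a c)"
    unfolding rectpath_def Let_def b_def[symmetric] d_def[symmetric]
    by (intro has_contour_integral_join seg_int_contour c valid_path_join) auto
  from has_contour_integral_unique[OF this 2]
  have "seg_int G a b + (seg_int G b c + (seg_int G c d + seg_int G d a)) = - (2 * pi * \<i> * f z)" .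
  moreover have "seg_int G d c = - seg_int G c d" "seg_int G a d = - seg_int G d a"
    using c by (intro seg_int_reverse; simp)+
  ultimately show ?thesis by (simp add: algebra_simps)
qed

subsection \<open>The Cauchy--Heine integral\<close>

text \<open>For R > 0 this domain and its mirror image cover the exterior of a disc and overlap
  exactly where |Im z| > R, the place of the horn maps.\<close>

definition right_dom :: "real \<Rightarrow> complex set" where
  "right_dom R = {z. Re z > R \<or> \<bar>Im z\<bar> > R}"

definition left_dom :: "real \<Rightarrow> complex set" where
  "left_dom R = {z. Re z < - R \<or> \<bar>Im z\<bar> > R}"

lemma open_right_dom: "open (right_dom R)" and open_left_dom: "open (left_dom R)"
proof -
  have "right_dom R = {z. Re z > R} \<union> {z. Im z > R} \<union> {z. Im z < - R}" by (auto simp: right_dom_def)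
  thus "open (right_dom R)" by (simp add: open_halfspace_Re_gt open_halfspace_Im_gt open_halfspace_Im_lt open_Un)
  have "left_dom R = {z. Re z < - R} \<union> {z. Im z > R} \<union> {z. Im z < - R}" by (auto simp: left_dom_def)
  thus "open (left_dom R)" by (simp add: open_halfspace_Re_lt open_halfspace_Im_gt open_halfspace_Im_lt open_Un)
qed

lemma ray_integrableI:
  assumes S: "open S" and G: "G holomorphic_on S" and in_S: "\<And>s. s > 0 \<Longrightarrow> a + of_real s * d \<in> S"
    and h: "set_integrable lborel {0<..} h" "\<And>s. s > 0 \<Longrightarrow> norm (G (a + of_real s * d)) * norm d \<le> h s"
  shows "ray_integrable G a d"
  unfolding ray_integrable_def
  by (rule set_integrable_continuous_bound[OF _ _ h(1)])
     (use h(2) in_S in \<open>auto simp: norm_mult intro!: continuous_intros continuous_on_compose2[OF holomorphic_on_imp_continuous_on[OF G]]\<close>)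

lemma closed_segment_ReIm:
  assumes "x \<in> closed_segment a b"
  obtains u where "0 \<le> u" "u \<le> 1" "Re x = (1 - u) * Re a + u * Re b" "Im x = (1 - u) * Im a + u * Im b"
  using assms by (auto simp: closed_segment_def)

text \<open>
  A pair of functions with exponentially small difference above and below, as in the theorem of
  Ramis and Sibuya. Its common Borel transform is a Cauchy--Heine integral: \<open>heine k\<close> integrates
  \<open>p\<^sup>+ k\<close> and \<open>p\<^sup>- k\<close> along the sides of a square with corners \<open>\<plusminus>\<rho> \<plusminus> i\<rho>\<close> and the difference
  along two vertical rays, \<open>hankel k\<close> integrates \<open>p\<^sup>+ k\<close> along a Hankel contour around the negative axis.
\<close>

locale sectorial_pair =
  fixes R \<rho> M K C :: real and pp pm :: "complex \<Rightarrow> complex"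
  assumes R: "0 < R" "R < \<rho>" and const: "M \<ge> 0" "K \<ge> 0" "C \<ge> 0"
    and pp_hol: "pp holomorphic_on right_dom R" and pm_hol: "pm holomorphic_on left_dom R"
    and pp_bd: "\<And>z. z \<in> right_dom R \<Longrightarrow> norm (pp z) \<le> M"
    and pm_bd: "\<And>z. z \<in> left_dom R \<Longrightarrow> norm (pm z) \<le> M"
    and pp_Re: "\<And>z. Re z > R \<Longrightarrow> norm (pp z) \<le> K / Re z"
    and pm_Re: "\<And>z. Re z < - R \<Longrightarrow> norm (pm z) \<le> K / - Re z"
    and pp_Im: "\<And>z. \<bar>Im z\<bar> > R \<Longrightarrow> norm (pp z) \<le> K / \<bar>Im z\<bar>"
    and pm_Im: "\<And>z. \<bar>Im z\<bar> > R \<Longrightarrow> norm (pm z) \<le> K / \<bar>Im z\<bar>"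
    and diff_bd: "\<And>z. \<bar>Im z\<bar> > R \<Longrightarrow> norm (pp z - pm z) \<le> C * exp (- 2 * \<bar>Im z\<bar>)"
begin

text \<open>\<sigma> = 1 and \<sigma> = -1 stand for the upper and the lower side, so that each
  deformation is done once for both.\<close>

definition cr :: "real \<Rightarrow> complex" where "cr \<sigma> = Complex \<rho> (\<sigma> * \<rho>)"
definition cl :: "real \<Rightarrow> complex" where "cl \<sigma> = Complex (- \<rho>) (\<sigma> * \<rho>)"
definition up :: "real \<Rightarrow> complex" where "up \<sigma> = Complex 0 \<sigma>"

abbreviation "dd \<equiv> (\<lambda>t. pp t - pm t)"

definition heine_side :: "(complex \<Rightarrow> complex) \<Rightarrow> real \<Rightarrow> complex" where
  "heine_side k \<sigma> = seg_int (\<lambda>t. pm t * k t) (cr \<sigma>) (cl \<sigma>) + ray_int (\<lambda>t. dd t * k t) (cr \<sigma>) (up \<sigma>)"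

text \<open>The square is run through counterclockwise from its lower right corner. Both horizontal
  sides are parametrised from right to left, which is why the lower one is subtracted.\<close>

definition heine :: "(complex \<Rightarrow> complex) \<Rightarrow> complex" where
  "heine k = seg_int (\<lambda>t. pp t * k t) (cr (-1)) (cr 1) + heine_side k 1 - heine_side k (-1)
     + seg_int (\<lambda>t. pm t * k t) (cl 1) (cl (-1))"

definition hankel :: "(complex \<Rightarrow> complex) \<Rightarrow> complex" where
  "hankel k = seg_int (\<lambda>t. pp t * k t) (cr (-1)) (cr 1) + ray_int (\<lambda>t. pp t * k t) (cr 1) (-1)
     - ray_int (\<lambda>t. pp t * k t) (cr (-1)) (-1)"

definition half :: "real \<Rightarrow> complex set" where "half \<sigma> = {z. \<sigma> * Im z > R}"

lemma corner_simps [simp]: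
  "Re (cr \<sigma>) = \<rho>" "Im (cr \<sigma>) = \<sigma> * \<rho>" "Re (cl \<sigma>) = - \<rho>" "Im (cl \<sigma>) = \<sigma> * \<rho>" "Re (up \<sigma>) = 0" "Im (up \<sigma>) = \<sigma>"
  by (simp_all add: cr_def cl_def up_def)

lemma half: "open (half \<sigma>)" "convex (half \<sigma>)"
proof -
  have "half \<sigma> = {z. inner (Complex 0 \<sigma>) z > R}" by (auto simp: half_def inner_complex_def)
  thus "open (half \<sigma>)" "convex (half \<sigma>)" by (simp_all add: open_halfspace_gt convex_halfspace_gt)
qed

lemma half_abs:
  assumes "\<bar>\<sigma>\<bar> = 1" "z \<in> half \<sigma>" shows "\<bar>Im z\<bar> = \<sigma> * Im z" "\<bar>Im z\<bar> > R" "z \<in> right_dom R" "z \<in> left_dom R"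
proof -
  have "\<sigma> = 1 \<or> \<sigma> = -1" using assms(1) by (auto simp: abs_if split: if_splits)
  thus "\<bar>Im z\<bar> = \<sigma> * Im z" using assms(2) R by (auto simp: half_def)
  with assms(2) show "\<bar>Im z\<bar> > R" by (simp add: half_def)
  thus "z \<in> right_dom R" "z \<in> left_dom R" by (simp_all add: right_dom_def left_dom_def)
qed

lemma half_hol:
  assumes "\<bar>\<sigma>\<bar> = 1"
  shows "pp holomorphic_on half \<sigma>" "pm holomorphic_on half \<sigma>"
  using half_abs[OF assms] pp_hol pm_hol by (auto elim!: holomorphic_on_subset)

definition right_half :: "complex set" where "right_half = {z. Re z > R}"
definition left_half :: "complex set" where "left_half = {z. Re z < - R}"

lemma side_half: "open right_half" "convex right_half" "open left_half" "convex left_half"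
  "pp holomorphic_on right_half" "pm holomorphic_on left_half"
  unfolding right_half_def left_half_def
  using pp_hol pm_hol by (auto simp: open_halfspace_Re_gt open_halfspace_Re_lt convex_halfspace_Re_gt convex_halfspace_Re_lt
      right_dom_def left_dom_def elim!: holomorphic_on_subset)

lemma sigma_cases: "\<bar>\<sigma>\<bar> = 1 \<Longrightarrow> \<sigma> * (\<sigma> * x) = (x::real)"
  by (auto simp: abs_if split: if_splits)

lemma sigma_sq: "\<bar>\<sigma>\<bar> = 1 \<Longrightarrow> \<sigma> * \<sigma> = (1::real)"
  by (auto simp: abs_if split: if_splits)

section \<open>The exponential kernel: Cauchy--Heine integral and Hankel contour\<close>

context
  fixes \<zeta> :: complex
begin

lemma norm_exp_kernel: "norm (exp (\<zeta> * t)) = exp (Re \<zeta> * Re t - Im \<zeta> * Im t)"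
  by simp

lemma exp_hol: "f holomorphic_on S \<Longrightarrow> (\<lambda>t. f t * exp (\<zeta> * t)) holomorphic_on S"
  by (intro holomorphic_intros)

lemma Im_prod_le: "- (Im \<zeta> * y) \<le> \<bar>Im \<zeta>\<bar> * \<bar>y\<bar>"
  by (metis abs_ge_minus_self abs_mult)

lemma abs_sigma_rho: "\<bar>\<sigma>\<bar> = 1 \<Longrightarrow> \<bar>\<sigma> * \<rho>\<bar> = \<rho>"
  using R by (simp add: abs_mult)

lemma left_ray_bound:
  assumes "Re \<zeta> > 0" "Re t \<le> \<rho> - s" "\<bar>Im t\<bar> \<le> \<rho>" "norm q \<le> M"
  shows "norm (q * exp (\<zeta> * t)) \<le> M * exp (Re \<zeta> * \<rho> + \<bar>Im \<zeta>\<bar> * \<rho>) * exp (- Re \<zeta> * s)"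
proof -
  have "Re \<zeta> * Re t \<le> Re \<zeta> * (\<rho> - s)" using assms by (intro mult_left_mono) auto
  moreover have "- (Im \<zeta> * Im t) \<le> \<bar>Im \<zeta>\<bar> * \<rho>"
    by (rule order_trans[OF Im_prod_le]) (use assms in \<open>auto intro: mult_left_mono\<close>)
  ultimately have "exp (Re \<zeta> * Re t - Im \<zeta> * Im t) \<le> exp ((Re \<zeta> * \<rho> + \<bar>Im \<zeta>\<bar> * \<rho>) + (- Re \<zeta> * s))"
    by (simp add: algebra_simps)
  hence "norm q * norm (exp (\<zeta> * t)) \<le> M * exp ((Re \<zeta> * \<rho> + \<bar>Im \<zeta>\<bar> * \<rho>) + (- Re \<zeta> * s))"
    unfolding norm_exp_kernel using assms(4) const by (intro mult_mono) auto
  thus ?thesis by (simp only: norm_mult exp_add mult.assoc)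
qed

lemma left_ray_integrable:
  assumes \<zeta>: "Re \<zeta> > 0" and S: "open S" "q holomorphic_on S"
    and a: "Re a \<le> \<rho>" "\<bar>Im a\<bar> \<le> \<rho>" "\<And>s. s > 0 \<Longrightarrow> a + of_real s * (-1) \<in> S"
    and M: "\<And>z. z \<in> S \<Longrightarrow> norm (q z) \<le> M"
  shows "ray_integrable (\<lambda>t. q t * exp (\<zeta> * t)) a (-1)"
proof (rule ray_integrableI[OF S(1) exp_hol[OF S(2)]])
  show "set_integrable lborel {0<..} (\<lambda>s. M * exp (Re \<zeta> * \<rho> + \<bar>Im \<zeta>\<bar> * \<rho>) * exp (- Re \<zeta> * s))"
    by (intro set_integrable_mult_right set_integrable_exp_ray \<zeta>)
  show "norm (q (a + of_real s * -1) * exp (\<zeta> * (a + of_real s * -1))) * norm (-1::complex) \<le> M * exp (Re \<zeta> * \<rho> + \<bar>Im \<zeta>\<bar> * \<rho>) * exp (- Re \<zeta> * s)"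
    if "s > 0" for s
    using left_ray_bound[OF \<zeta>, of "a + of_real s * -1" s "q (a + of_real s * -1)"] a M that by simp
qed (use a in auto)

text \<open>Of the rate 2 in the decay of the difference, |Im \<zeta>| \<le> 1 costs at most one
  unit; the remaining one makes the vertical rays converge. This is where the unit disc for the
  Borel transform comes from.\<close>

lemma delta_bound:
  assumes \<zeta>: "\<bar>Im \<zeta>\<bar> \<le> 1" and \<sigma>: "\<bar>\<sigma>\<bar> = 1" and t: "t \<in> half \<sigma>"
  shows "norm (dd t * exp (\<zeta> * t)) \<le> C * exp (Re \<zeta> * Re t - \<sigma> * Im t)"
proof -
  have "- (Im \<zeta> * Im t) \<le> \<bar>Im \<zeta>\<bar> * \<bar>Im t\<bar>" by (rule Im_prod_le)
  also have "\<dots> \<le> 1 * \<bar>Im t\<bar>" using \<zeta> by (intro mult_right_mono) auto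
  finally have "Re \<zeta> * Re t - Im \<zeta> * Im t \<le> Re \<zeta> * Re t + \<bar>Im t\<bar>" by simp
  hence "norm (dd t) * norm (exp (\<zeta> * t)) \<le> (C * exp (- 2 * \<bar>Im t\<bar>)) * exp (Re \<zeta> * Re t + \<bar>Im t\<bar>)"
    unfolding norm_exp_kernel using diff_bd[OF half_abs(2)[OF \<sigma> t]] const by (intro mult_mono) auto
  also have "\<dots> = C * exp (Re \<zeta> * Re t - \<sigma> * Im t)"
    using half_abs(1)[OF \<sigma> t] by (simp add: mult.assoc flip: exp_add)
  finally show ?thesis by (simp add: norm_mult)
qed

lemma delta_up_integrable:
  assumes \<zeta>: "\<bar>Im \<zeta>\<bar> \<le> 1" and \<sigma>: "\<bar>\<sigma>\<bar> = 1"
  shows "ray_integrable (\<lambda>t. dd t * exp (\<zeta> * t)) (cr \<sigma>) (up \<sigma>)"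
proof (rule ray_integrableI[OF half(1) exp_hol])
  show "set_integrable lborel {0<..} (\<lambda>s. C * exp (Re \<zeta> * \<rho> - \<rho>) * exp (- 1 * s))"
    by (intro set_integrable_mult_right set_integrable_exp_ray) simp
  show "(\<lambda>t. dd t) holomorphic_on half \<sigma>" using half_hol[OF \<sigma>] by (intro holomorphic_intros)
  show in_half: "cr \<sigma> + of_real s * up \<sigma> \<in> half \<sigma>" if "s > 0" for s
    using that R \<sigma> by (auto simp: half_def distrib_left sigma_cases mult.left_commute[of \<sigma> s] sigma_sq)
  show "norm (dd (cr \<sigma> + of_real s * up \<sigma>) * exp (\<zeta> * (cr \<sigma> + of_real s * up \<sigma>))) * norm (up \<sigma>) \<le> C * exp (Re \<zeta> * \<rho> - \<rho>) * exp (- 1 * s)" if "s > 0" for s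
  proof -
    have n: "norm (up \<sigma>) = 1" using \<sigma> by (simp add: up_def cmod_def)
    have "\<sigma> * Im (cr \<sigma> + of_real s * up \<sigma>) = \<rho> + s" "Re (cr \<sigma> + of_real s * up \<sigma>) = \<rho>"
      using \<sigma> by (auto simp: distrib_left sigma_cases mult.left_commute[of \<sigma> s] sigma_sq)
    with delta_bound[OF \<zeta> \<sigma> in_half[OF that]] show ?thesis
      unfolding n by (simp add: mult.assoc flip: exp_add) (simp add: algebra_simps)
  qed
qed

text \<open>The difference decays vertically by itself and to the left through the exponential, so
  the ray may turn by a right angle.\<close>

lemma delta_rotate:
  assumes \<zeta>: "Re \<zeta> > 0" "\<bar>Im \<zeta>\<bar> \<le> 1" and \<sigma>: "\<bar>\<sigma>\<bar> = 1"
    and int: "ray_integrable (\<lambda>t. dd t * exp (\<zeta> * t)) (cr \<sigma>) (-1)"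
  shows "ray_int (\<lambda>t. dd t * exp (\<zeta> * t)) (cr \<sigma>) (-1) = ray_int (\<lambda>t. dd t * exp (\<zeta> * t)) (cr \<sigma>) (up \<sigma>)"
proof -
  \<comment> \<open>On the chord joining the two rays at parameter s, the leftward part (1 - u) s
    decays at rate Re \<zeta> and the vertical part u s at rate 1; together they decay at least at
    rate m in s.\<close>
  define m where "m = min (Re \<zeta>) 1"
  have m: "m > 0" "m \<le> Re \<zeta>" "m \<le> 1" using \<zeta> by (auto simp: m_def)
  have half_t: "t \<in> half \<sigma>" "norm (dd t * exp (\<zeta> * t)) \<le> C * exp (Re \<zeta> * \<rho>) * exp (- m * s)"
    if s0: "s \<ge> 0" and seg: "t \<in> closed_segment (cr \<sigma> + of_real s * (-1)) (cr \<sigma> + of_real s * up \<sigma>)" for s t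
  proof -
    obtain u where u: "0 \<le> u" "u \<le> 1" "Re t = (1 - u) * (\<rho> - s) + u * \<rho>" "Im t = (1 - u) * (\<sigma> * \<rho>) + u * (\<sigma> * \<rho> + s * \<sigma>)"
      using closed_segment_ReIm[OF seg] by auto
    have im: "\<sigma> * Im t = \<rho> + u * s" unfolding u(4) using \<sigma> by (simp add: algebra_simps sigma_cases sigma_sq)
    have re: "Re t = \<rho> - (1 - u) * s" unfolding u(3) by (simp add: algebra_simps)
    show h: "t \<in> half \<sigma>" unfolding half_def using im R mult_nonneg_nonneg[OF u(1) s0] by simp
    have "m * ((1 - u) * s) \<le> Re \<zeta> * ((1 - u) * s)" "m * (u * s) \<le> 1 * (u * s)"
      using u m s0 by (intro mult_right_mono; simp)+
    hence "Re \<zeta> * Re t - \<sigma> * Im t \<le> Re \<zeta> * \<rho> + (- m * s)"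
      unfolding im re using R by (simp add: algebra_simps)
    hence "C * exp (Re \<zeta> * Re t - \<sigma> * Im t) \<le> C * exp (Re \<zeta> * \<rho> + (- m * s))"
      using const by (intro mult_left_mono) auto
    with delta_bound[OF \<zeta>(2) \<sigma> h] show "norm (dd t * exp (\<zeta> * t)) \<le> C * exp (Re \<zeta> * \<rho>) * exp (- m * s)"
      by (simp only: exp_add mult.assoc)
  qed
  have "ray_int (\<lambda>t. dd t * exp (\<zeta> * t)) (cr \<sigma>) (-1) = seg_int (\<lambda>t. dd t * exp (\<zeta> * t)) (cr \<sigma>) (cr \<sigma>) + ray_int (\<lambda>t. dd t * exp (\<zeta> * t)) (cr \<sigma>) (up \<sigma>)"
  proof (rule ray_int_rotate[OF half(2) half(1) exp_hol _ _ int delta_up_integrable[OF \<zeta>(2) \<sigma>],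
        where h = "\<lambda>s. C * exp (Re \<zeta> * \<rho>) * exp (- m * s) * (2 * s)"])
    show "(\<lambda>t. dd t) holomorphic_on half \<sigma>" using half_hol[OF \<sigma>] by (intro holomorphic_intros)
    show "((\<lambda>s. C * exp (Re \<zeta> * \<rho>) * exp (- m * s) * (2 * s)) \<longlongrightarrow> 0) at_top"
      using m(1) by real_asymp
    fix s :: real
    show "s \<ge> 0 \<Longrightarrow> cr \<sigma> + of_real s * -1 \<in> half \<sigma>" "s \<ge> 0 \<Longrightarrow> cr \<sigma> + of_real s * up \<sigma> \<in> half \<sigma>"
      by (auto intro: half_t(1)[of s])
    fix t assume st: "s \<ge> 1" "t \<in> closed_segment (cr \<sigma> + of_real s * (-1)) (cr \<sigma> + of_real s * up \<sigma>)"
    have "norm (cr \<sigma> + of_real s * up \<sigma> - (cr \<sigma> + of_real s * -1)) \<le> norm (of_real s * up \<sigma>) + norm (of_real s :: complex)"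
      using norm_triangle_ineq[of "of_real s * up \<sigma>" "of_real s"] by simp
    also have "\<dots> = 2 * s" using \<sigma> st(1) by (simp add: norm_mult up_def cmod_def abs_mult)
    finally show "norm (dd t * exp (\<zeta> * t)) * norm (cr \<sigma> + of_real s * up \<sigma> - (cr \<sigma> + of_real s * -1)) \<le> C * exp (Re \<zeta> * \<rho>) * exp (- m * s) * (2 * s)"
      using half_t(2)[of s t] st const by (intro mult_mono) auto
  qed
  thus ?thesis by (simp add: seg_int_def pint_def)
qed

lemma left_ray_shift:
  assumes \<zeta>: "Re \<zeta> > 0" and S: "open S" "convex S" "q holomorphic_on S"
    and a: "Re a \<le> \<rho>" "\<bar>Im a\<bar> \<le> \<rho>" "\<And>s. s \<ge> 0 \<Longrightarrow> a + of_real s * (-1) \<in> S"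
    and b: "Re b \<le> \<rho>" "\<bar>Im b\<bar> \<le> \<rho>" "\<And>s. s \<ge> 0 \<Longrightarrow> b + of_real s * (-1) \<in> S"
    and M: "\<And>z. z \<in> S \<Longrightarrow> norm (q z) \<le> M"
  shows "ray_int (\<lambda>t. q t * exp (\<zeta> * t)) a (-1) = seg_int (\<lambda>t. q t * exp (\<zeta> * t)) a b + ray_int (\<lambda>t. q t * exp (\<zeta> * t)) b (-1)"
proof (rule ray_int_rotate[OF S(2) S(1) exp_hol[OF S(3)] a(3) b(3),
      where h = "\<lambda>s. M * exp (Re \<zeta> * \<rho> + \<bar>Im \<zeta>\<bar> * \<rho>) * exp (- Re \<zeta> * s) * norm (b - a)"])
  show "ray_integrable (\<lambda>t. q t * exp (\<zeta> * t)) a (-1)" "ray_integrable (\<lambda>t. q t * exp (\<zeta> * t)) b (-1)"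
    using a b M by (intro left_ray_integrable[OF \<zeta> S(1) S(3)]; simp)+
  show "((\<lambda>s. M * exp (Re \<zeta> * \<rho> + \<bar>Im \<zeta>\<bar> * \<rho>) * exp (- Re \<zeta> * s) * norm (b - a)) \<longlongrightarrow> 0) at_top"
    using \<zeta> by real_asymp
  fix s :: real and t assume st: "s \<ge> 1" "t \<in> closed_segment (a + of_real s * (-1)) (b + of_real s * (-1))"
  have tS: "t \<in> S" using closed_segment_subset[OF a(3) b(3) S(2), of s s] st by auto
  obtain u where u: "0 \<le> u" "u \<le> 1" "Re t = (1 - u) * (Re a - s) + u * (Re b - s)" "Im t = (1 - u) * Im a + u * Im b"
      using closed_segment_ReIm[OF st(2)] by auto
  have "(1 - u) * (Re a - s) \<le> (1 - u) * (\<rho> - s)" "u * (Re b - s) \<le> u * (\<rho> - s)"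
    using u a b by (intro mult_left_mono; simp)+
  hence re: "Re t \<le> \<rho> - s" unfolding u(3) by (simp add: algebra_simps)
  have "\<bar>Im t\<bar> \<le> (1 - u) * \<bar>Im a\<bar> + u * \<bar>Im b\<bar>" unfolding u(4) using u
    by (intro order_trans[OF abs_triangle_ineq]) (simp add: abs_mult)
  also have "\<dots> \<le> (1 - u) * \<rho> + u * \<rho>" using u a b by (intro add_mono mult_left_mono) auto
  finally have im: "\<bar>Im t\<bar> \<le> \<rho>" by (simp add: algebra_simps)
  have "norm (q t * exp (\<zeta> * t)) \<le> M * exp (Re \<zeta> * \<rho> + \<bar>Im \<zeta>\<bar> * \<rho>) * exp (- Re \<zeta> * s)"
    by (rule left_ray_bound[OF \<zeta> re im M[OF tS]])
  thus "norm (q t * exp (\<zeta> * t)) * norm (b + of_real s * (-1) - (a + of_real s * (-1))) \<le>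
     M * exp (Re \<zeta> * \<rho> + \<bar>Im \<zeta>\<bar> * \<rho>) * exp (- Re \<zeta> * s) * norm (b - a)"
    by (simp add: mult_right_mono)
qed

lemma in_half_left: "\<bar>\<sigma>\<bar> = 1 \<Longrightarrow> cr \<sigma> + of_real s * (-1) \<in> half \<sigma>" "\<bar>\<sigma>\<bar> = 1 \<Longrightarrow> cl \<sigma> + of_real s * (-1) \<in> half \<sigma>"
  using R by (auto simp: half_def sigma_cases)

text \<open>On each horizontal ray pp is split as (pp - pm) + pm. The difference is turned to the
  vertical, and pm is moved to the corner on the left; the two remaining rays of pm close up through
  the left side of the square, since pm is holomorphic on the left half-plane.\<close>

lemma hankel_eq_heine:
  assumes \<zeta>: "Re \<zeta> > 0" "\<bar>Im \<zeta>\<bar> \<le> 1"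
  shows "hankel (\<lambda>t. exp (\<zeta> * t)) = heine (\<lambda>t. exp (\<zeta> * t))"
proof -
  have side: "ray_int (\<lambda>t. pp t * exp (\<zeta> * t)) (cr \<sigma>) (-1) = heine_side (\<lambda>t. exp (\<zeta> * t)) \<sigma> + ray_int (\<lambda>t. pm t * exp (\<zeta> * t)) (cl \<sigma>) (-1)"
    if \<sigma>: "\<bar>\<sigma>\<bar> = 1" for \<sigma>
  proof -
    have bd: "norm (pp z) \<le> M" "norm (pm z) \<le> M" if "z \<in> half \<sigma>" for z
      using half_abs[OF \<sigma> that] pp_bd pm_bd by auto
    have ip: "ray_integrable (\<lambda>t. pp t * exp (\<zeta> * t)) (cr \<sigma>) (-1)" and im: "ray_integrable (\<lambda>t. pm t * exp (\<zeta> * t)) (cr \<sigma>) (-1)"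
      using left_ray_integrable[OF \<zeta>(1) half(1) half_hol(1)[OF \<sigma>]] left_ray_integrable[OF \<zeta>(1) half(1) half_hol(2)[OF \<sigma>]]
        bd in_half_left \<sigma> abs_sigma_rho[OF \<sigma>] by auto
    have id: "ray_integrable (\<lambda>t. dd t * exp (\<zeta> * t)) (cr \<sigma>) (-1)"
      using set_integral_diff(1)[OF ip[unfolded ray_integrable_def] im[unfolded ray_integrable_def]]
      by (simp add: ray_integrable_def algebra_simps)
    have "ray_int (\<lambda>t. pp t * exp (\<zeta> * t)) (cr \<sigma>) (-1) = ray_int (\<lambda>t. dd t * exp (\<zeta> * t)) (cr \<sigma>) (-1) + ray_int (\<lambda>t. pm t * exp (\<zeta> * t)) (cr \<sigma>) (-1)"
      unfolding pint_def using set_integral_add(2)[OF id[unfolded ray_integrable_def] im[unfolded ray_integrable_def]]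
      by (simp add: algebra_simps)
    also have "ray_int (\<lambda>t. dd t * exp (\<zeta> * t)) (cr \<sigma>) (-1) = ray_int (\<lambda>t. dd t * exp (\<zeta> * t)) (cr \<sigma>) (up \<sigma>)"
      by (rule delta_rotate[OF \<zeta> \<sigma> id])
    also have "ray_int (\<lambda>t. pm t * exp (\<zeta> * t)) (cr \<sigma>) (-1) = seg_int (\<lambda>t. pm t * exp (\<zeta> * t)) (cr \<sigma>) (cl \<sigma>) + ray_int (\<lambda>t. pm t * exp (\<zeta> * t)) (cl \<sigma>) (-1)"
      using left_ray_shift[OF \<zeta>(1) half half_hol(2)[OF \<sigma>]] bd in_half_left \<sigma> abs_sigma_rho[OF \<sigma>] R by auto
    finally show ?thesis by (simp add: heine_side_def algebra_simps)
  qed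
  have "ray_int (\<lambda>t. pm t * exp (\<zeta> * t)) (cl 1) (-1) = seg_int (\<lambda>t. pm t * exp (\<zeta> * t)) (cl 1) (cl (-1)) + ray_int (\<lambda>t. pm t * exp (\<zeta> * t)) (cl (-1)) (-1)"
    using R by (intro left_ray_shift[OF \<zeta>(1) side_half(3,4,6)]) (auto simp: left_half_def intro!: pm_bd simp: left_dom_def)
  thus ?thesis unfolding hankel_def heine_def side[of 1, simplified] side[of "-1", simplified] by simp
qed

end

end

section \<open>The Cauchy kernel\<close>

context sectorial_pair
begin

text \<open>Between the rays both q and the kernel are of order 1 / (\<rho> + s), so the integrand
  is of order s^-2 while the connecting segments grow only like s: enough for integrability and for
  Cauchy's theorem. L may depend on x, as it only compares \<rho> + s with the distance to the
  pole.\<close>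

lemma kernel_rotate:
  fixes x :: real
  assumes S: "open S" "convex S" and q: "q holomorphic_on S" and x: "of_real x \<notin> S"
    and n: "norm d = 1" "norm e = 1" and L: "L \<ge> 0"
    and chord: "\<And>s t. s \<ge> 0 \<Longrightarrow> t \<in> closed_segment (a + of_real s * d) (b + of_real s * e) \<Longrightarrow>
       t \<in> S \<and> norm (q t) \<le> 2 * K / (\<rho> + s) \<and> \<rho> + s \<le> L * norm (of_real x - t)"
  defines "k \<equiv> (\<lambda>t. 1 / (of_real x - t))"
  shows "ray_integrable (\<lambda>t. q t * k t) a d" (is ?ia) and "ray_integrable (\<lambda>t. q t * k t) b e" (is ?ib)
    and "ray_int (\<lambda>t. q t * k t) a d = seg_int (\<lambda>t. q t * k t) a b + ray_int (\<lambda>t. q t * k t) b e"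
proof -
  have hol: "(\<lambda>t. q t * k t) holomorphic_on S"
    unfolding k_def using x by (intro holomorphic_intros q) auto
  have bd: "norm (q t * k t) \<le> 2 * K * L * (1 / (\<rho> + s)\<^sup>2)"
    if "s \<ge> 0" "t \<in> closed_segment (a + of_real s * d) (b + of_real s * e)" for s t
  proof -
    have rs: "\<rho> + s > 0" using that R by simp
    have c: "norm (q t) \<le> 2 * K / (\<rho> + s)" "\<rho> + s \<le> L * norm (of_real x - t)" using chord[OF that] by auto
    have "norm (of_real x - t) > 0" using c(2) rs L by (metis less_eq_real_def linorder_not_less mult_eq_0_iff norm_ge_zero order_le_less_trans)
    hence "norm (k t) \<le> L / (\<rho> + s)" unfolding k_def using c(2) rs by (simp add: norm_divide field_simps)
    hence "norm (q t) * norm (k t) \<le> (2 * K / (\<rho> + s)) * (L / (\<rho> + s))"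
      using c rs const L by (intro mult_mono) auto
    thus ?thesis by (simp add: norm_mult power2_eq_square)
  qed
  have rays: "a + of_real s * d \<in> S" "b + of_real s * e \<in> S" if "s \<ge> 0" for s
    using chord[OF that, of "a + of_real s * d"] chord[OF that, of "b + of_real s * e"] by auto
  have hint: "set_integrable lborel {0<..} (\<lambda>s. 2 * K * L * (1 / (\<rho> + s)\<^sup>2))"
    using R by (intro set_integrable_mult_right set_integrable_square_ray) simp
  show i: ?ia ?ib
    using bd by (auto intro!: ray_integrableI[OF S(1) hol _ hint] rays simp: n)
  show "ray_int (\<lambda>t. q t * k t) a d = seg_int (\<lambda>t. q t * k t) a b + ray_int (\<lambda>t. q t * k t) b e"
  proof (rule ray_int_rotate[OF S(2) S(1) hol rays i, where h = "\<lambda>s. 2 * K * L * (1 / (\<rho> + s)\<^sup>2) * (norm (b - a) + 2 * s)"])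
    show "((\<lambda>s. 2 * K * L * (1 / (\<rho> + s)\<^sup>2) * (norm (b - a) + 2 * s)) \<longlongrightarrow> 0) at_top"
      using R by real_asymp
    fix s :: real and t assume st: "1 \<le> s" "t \<in> closed_segment (a + of_real s * d) (b + of_real s * e)"
    have "b + of_real s * e - (a + of_real s * d) = (b - a) + (of_real s * e - of_real s * d)" by simp
    also have "norm \<dots> \<le> norm (b - a) + (norm (of_real s * e) + norm (of_real s * d))"
      by (intro order_trans[OF norm_triangle_ineq] add_mono norm_triangle_ineq4 order_refl)
    finally have "norm (b + of_real s * e - (a + of_real s * d)) \<le> norm (b - a) + 2 * s"
      using st(1) n by (simp add: norm_mult)
    thus "norm (q t * k t) * norm (b + of_real s * e - (a + of_real s * d)) \<le> 2 * K * L * (1 / (\<rho> + s)\<^sup>2) * (norm (b - a) + 2 * s)"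
      using bd[of s t] st const L by (intro mult_mono) auto
  qed auto
qed

lemma norm_directions: "\<bar>\<sigma>\<bar> = 1 \<Longrightarrow> norm (up \<sigma>) = 1"
  by (simp add: up_def cmod_def)

text \<open>Merges the decay estimates in Re and in Im into one: typically y is the larger of the
  two coordinates in modulus, which is at least half of their sum.\<close>

lemma K_half: "m > 0 \<Longrightarrow> m \<le> 2 * y \<Longrightarrow> K / y \<le> 2 * K / m"
  using const by (simp add: field_simps mult_left_mono)

context
  fixes x :: real
  assumes x: "x > \<rho>"
begin

definition kernel :: "complex \<Rightarrow> complex" where "kernel t = 1 / (of_real x - t)"

lemma norm_ge: "\<bar>Im t\<bar> \<le> norm (of_real x - t)" "\<bar>Re t - x\<bar> \<le> norm (of_real x - t)"
  using abs_Im_le_cmod[of "of_real x - t"] abs_Re_le_cmod[of "of_real x - t"] by auto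

text \<open>Where t keeps the distance \<rho> from the pole, x is absorbed into that distance. This
  produces the constant 2 + x / \<rho> in the moves to the right, which pass above or below the
  pole.\<close>

lemma x_le: "\<rho> \<le> n \<Longrightarrow> x \<le> x / \<rho> * n"
  using x R by (simp add: field_simps mult_left_mono)

lemma x_notin_half: "of_real x \<notin> half \<sigma>"
  using R by (simp add: half_def)

lemma kernel_pm_cr_cl:
  assumes \<sigma>: "\<bar>\<sigma>\<bar> = 1"
  shows "ray_integrable (\<lambda>t. pm t * kernel t) (cr \<sigma>) (up \<sigma>)"
    "ray_int (\<lambda>t. pm t * kernel t) (cr \<sigma>) (up \<sigma>) = seg_int (\<lambda>t. pm t * kernel t) (cr \<sigma>) (cl \<sigma>) + ray_int (\<lambda>t. pm t * kernel t) (cl \<sigma>) (up \<sigma>)"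
proof -
  have c: "t \<in> half \<sigma> \<and> norm (pm t) \<le> 2 * K / (\<rho> + s) \<and> \<rho> + s \<le> 1 * norm (of_real x - t)"
    if s: "s \<ge> 0" and t: "t \<in> closed_segment (cr \<sigma> + of_real s * up \<sigma>) (cl \<sigma> + of_real s * up \<sigma>)" for s t
  proof -
    obtain u where u: "0 \<le> u" "u \<le> 1" "Im t = (1 - u) * (\<sigma> * \<rho> + s * \<sigma>) + u * (\<sigma> * \<rho> + s * \<sigma>)"
      using closed_segment_ReIm[OF t] by auto
    have im: "\<sigma> * Im t = \<rho> + s" unfolding u(3) using \<sigma> by (simp add: algebra_simps sigma_cases sigma_sq)
    hence h: "t \<in> half \<sigma>" using R s by (simp add: half_def)
    have "\<bar>Im t\<bar> = \<rho> + s" using half_abs(1)[OF \<sigma> h] im by simp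
    thus ?thesis using h pm_Im[OF half_abs(2)[OF \<sigma> h]] norm_ge(1)[of t] K_half[of "\<rho> + s" "\<rho> + s"] R s by auto
  qed
  show "ray_integrable (\<lambda>t. pm t * kernel t) (cr \<sigma>) (up \<sigma>)"
    "ray_int (\<lambda>t. pm t * kernel t) (cr \<sigma>) (up \<sigma>) = seg_int (\<lambda>t. pm t * kernel t) (cr \<sigma>) (cl \<sigma>) + ray_int (\<lambda>t. pm t * kernel t) (cl \<sigma>) (up \<sigma>)"
    unfolding kernel_def
    by (rule kernel_rotate[OF half half_hol(2)[OF \<sigma>] x_notin_half norm_directions[OF \<sigma>] norm_directions[OF \<sigma>] _ c]; simp)+
qed

lemma kernel_pm_up_left:
  assumes \<sigma>: "\<bar>\<sigma>\<bar> = 1"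
  shows "ray_int (\<lambda>t. pm t * kernel t) (cl \<sigma>) (up \<sigma>) = ray_int (\<lambda>t. pm t * kernel t) (cl \<sigma>) (-1)"
proof -
  have c: "t \<in> half \<sigma> \<and> norm (pm t) \<le> 2 * K / (\<rho> + s) \<and> \<rho> + s \<le> 2 * norm (of_real x - t)"
    if s: "s \<ge> 0" and t: "t \<in> closed_segment (cl \<sigma> + of_real s * up \<sigma>) (cl \<sigma> + of_real s * (-1))" for s t
  proof -
    obtain u where u: "0 \<le> u" "u \<le> 1" "Re t = (1 - u) * (- \<rho>) + u * (- \<rho> - s)" "Im t = (1 - u) * (\<sigma> * \<rho> + s * \<sigma>) + u * (\<sigma> * \<rho>)"
      using closed_segment_ReIm[OF t] by auto
    have im: "\<sigma> * Im t = \<rho> + (1 - u) * s" unfolding u(4) using \<sigma> by (simp add: algebra_simps sigma_cases sigma_sq)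
    have re: "- Re t = \<rho> + u * s" unfolding u(3) by (simp add: algebra_simps)
    have us: "u * s \<ge> 0" "(1 - u) * s \<ge> 0" using u s by auto
    have h: "t \<in> half \<sigma>" using R im us by (simp add: half_def)
    have abs: "\<bar>Im t\<bar> = \<rho> + (1 - u) * s" using half_abs(1)[OF \<sigma> h] im by simp
    have sum: "\<bar>Im t\<bar> + - Re t = 2 * \<rho> + s" unfolding abs re by (simp add: algebra_simps)
    have pm: "norm (pm t) \<le> 2 * K / (\<rho> + s)"
    proof (cases "- Re t \<ge> \<bar>Im t\<bar>")
      case True
      have "norm (pm t) \<le> K / - Re t" using re us R by (intro pm_Re) linarith
      also have "\<dots> \<le> 2 * K / (\<rho> + s)" using True sum R s by (intro K_half) linarith+
      finally show ?thesis .
    next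
      case False
      have "norm (pm t) \<le> K / \<bar>Im t\<bar>" by (intro pm_Im half_abs(2)[OF \<sigma> h])
      also have "\<dots> \<le> 2 * K / (\<rho> + s)" using False sum R s by (intro K_half) linarith+
      finally show ?thesis .
    qed
    have "- Re t \<le> norm (of_real x - t)" using norm_ge(2)[of t] x R by linarith
    thus ?thesis using h pm norm_ge(1)[of t] sum R by linarith
  qed
  have "ray_int (\<lambda>t. pm t * kernel t) (cl \<sigma>) (up \<sigma>) = seg_int (\<lambda>t. pm t * kernel t) (cl \<sigma>) (cl \<sigma>) + ray_int (\<lambda>t. pm t * kernel t) (cl \<sigma>) (-1)"
    unfolding kernel_def
    by (rule kernel_rotate[OF half half_hol(2)[OF \<sigma>] x_notin_half norm_directions[OF \<sigma>] _ _ c]; simp)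
  thus ?thesis by (simp add: seg_int_def pint_def)
qed

lemma kernel_pm_left_corners:
  "ray_int (\<lambda>t. pm t * kernel t) (cl 1) (-1) = seg_int (\<lambda>t. pm t * kernel t) (cl 1) (cl (-1)) + ray_int (\<lambda>t. pm t * kernel t) (cl (-1)) (-1)"
proof -
  have c: "t \<in> left_half \<and> norm (pm t) \<le> 2 * K / (\<rho> + s) \<and> \<rho> + s \<le> 1 * norm (of_real x - t)"
    if s: "s \<ge> 0" and t: "t \<in> closed_segment (cl 1 + of_real s * (-1)) (cl (-1) + of_real s * (-1))" for s t
  proof -
    obtain u where u: "0 \<le> u" "u \<le> 1" "Re t = (1 - u) * (- \<rho> - s) + u * (- \<rho> - s)"
      using closed_segment_ReIm[OF t] by auto
    have re: "- Re t = \<rho> + s" unfolding u(3) by (simp add: algebra_simps)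
    have "norm (pm t) \<le> K / - Re t" using re s R by (intro pm_Re) linarith
    also have "\<dots> \<le> 2 * K / (\<rho> + s)" using re R s by (intro K_half) linarith+
    finally show ?thesis using re norm_ge(2)[of t] R x s by (auto simp: left_half_def)
  qed
  have xn: "of_real x \<notin> left_half" using x R by (simp add: left_half_def)
  show ?thesis unfolding kernel_def
    by (rule kernel_rotate[OF side_half(3,4,6) xn _ _ _ c]; simp)
qed

lemma kernel_pp_up_right:
  assumes \<sigma>: "\<bar>\<sigma>\<bar> = 1"
  shows "ray_integrable (\<lambda>t. pp t * kernel t) (cr \<sigma>) (up \<sigma>)"
    "ray_int (\<lambda>t. pp t * kernel t) (cr \<sigma>) (up \<sigma>) = ray_int (\<lambda>t. pp t * kernel t) (cr \<sigma>) 1"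
proof -
  have c: "t \<in> half \<sigma> \<and> norm (pp t) \<le> 2 * K / (\<rho> + s) \<and> \<rho> + s \<le> (2 + x / \<rho>) * norm (of_real x - t)"
    if s: "s \<ge> 0" and t: "t \<in> closed_segment (cr \<sigma> + of_real s * up \<sigma>) (cr \<sigma> + of_real s * 1)" for s t
  proof -
    obtain u where u: "0 \<le> u" "u \<le> 1" "Re t = (1 - u) * \<rho> + u * (\<rho> + s)" "Im t = (1 - u) * (\<sigma> * \<rho> + s * \<sigma>) + u * (\<sigma> * \<rho>)"
      using closed_segment_ReIm[OF t] by auto
    have im: "\<sigma> * Im t = \<rho> + (1 - u) * s" unfolding u(4) using \<sigma> by (simp add: algebra_simps sigma_cases sigma_sq)
    have re: "Re t = \<rho> + u * s" unfolding u(3) by (simp add: algebra_simps)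
    have us: "u * s \<ge> 0" "(1 - u) * s \<ge> 0" using u s by auto
    have h: "t \<in> half \<sigma>" using R im us by (simp add: half_def)
    have abs: "\<bar>Im t\<bar> = \<rho> + (1 - u) * s" using half_abs(1)[OF \<sigma> h] im by simp
    have sum: "\<bar>Im t\<bar> + Re t = 2 * \<rho> + s" unfolding abs re by (simp add: algebra_simps)
    have pp: "norm (pp t) \<le> 2 * K / (\<rho> + s)"
    proof (cases "Re t \<ge> \<bar>Im t\<bar>")
      case True
      have "norm (pp t) \<le> K / Re t" using re us R by (intro pp_Re) linarith
      also have "\<dots> \<le> 2 * K / (\<rho> + s)" using True sum R s by (intro K_half) linarith+
      finally show ?thesis .
    next
      case False
      have "norm (pp t) \<le> K / \<bar>Im t\<bar>" by (intro pp_Im half_abs(2)[OF \<sigma> h])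
      also have "\<dots> \<le> 2 * K / (\<rho> + s)" using False sum R s by (intro K_half) linarith+
      finally show ?thesis .
    qed
    have "x \<le> x / \<rho> * norm (of_real x - t)" using abs us norm_ge(1)[of t] by (intro x_le) linarith
    moreover have "(2 + x / \<rho>) * norm (of_real x - t) = 2 * norm (of_real x - t) + x / \<rho> * norm (of_real x - t)"
      by (simp add: algebra_simps)
    ultimately show ?thesis using h pp norm_ge[of t] sum R by linarith
  qed
  have L: "2 + x / \<rho> \<ge> 0" using x R by simp
  show "ray_integrable (\<lambda>t. pp t * kernel t) (cr \<sigma>) (up \<sigma>)" unfolding kernel_def
    by (rule kernel_rotate(1)[where e = 1 and b = "cr \<sigma>", OF half half_hol(1)[OF \<sigma>] x_notin_half norm_directions[OF \<sigma>] _ L c]) simp_all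
  have "ray_int (\<lambda>t. pp t * kernel t) (cr \<sigma>) (up \<sigma>) = seg_int (\<lambda>t. pp t * kernel t) (cr \<sigma>) (cr \<sigma>) + ray_int (\<lambda>t. pp t * kernel t) (cr \<sigma>) 1"
    unfolding kernel_def
    by (rule kernel_rotate(3)[where e = 1 and b = "cr \<sigma>", OF half half_hol(1)[OF \<sigma>] x_notin_half norm_directions[OF \<sigma>] _ L c]) simp_all
  thus "ray_int (\<lambda>t. pp t * kernel t) (cr \<sigma>) (up \<sigma>) = ray_int (\<lambda>t. pp t * kernel t) (cr \<sigma>) 1" by (simp add: seg_int_def pint_def)
qed

text \<open>The right-hand corners of the rectangle for Cauchy's formula: the abscissa x + 1 puts
  the pole strictly inside, and beyond it the two rays can be closed up.\<close>

definition pr :: "real \<Rightarrow> complex" where "pr \<sigma> = Complex (x + 1) (\<sigma> * \<rho>)"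

lemma kernel_pp_cr_pr:
  assumes \<sigma>: "\<bar>\<sigma>\<bar> = 1"
  shows "ray_int (\<lambda>t. pp t * kernel t) (cr \<sigma>) 1 = seg_int (\<lambda>t. pp t * kernel t) (cr \<sigma>) (pr \<sigma>) + ray_int (\<lambda>t. pp t * kernel t) (pr \<sigma>) 1"
proof -
  have c: "t \<in> half \<sigma> \<and> norm (pp t) \<le> 2 * K / (\<rho> + s) \<and> \<rho> + s \<le> (2 + x / \<rho>) * norm (of_real x - t)"
    if s: "s \<ge> 0" and t: "t \<in> closed_segment (cr \<sigma> + of_real s * 1) (pr \<sigma> + of_real s * 1)" for s t
  proof -
    obtain u where u: "0 \<le> u" "u \<le> 1" "Re t = (1 - u) * (\<rho> + s) + u * (x + 1 + s)" "Im t = (1 - u) * (\<sigma> * \<rho>) + u * (\<sigma> * \<rho>)"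
      using closed_segment_ReIm[OF t] by (auto simp: pr_def)
    have im: "\<sigma> * Im t = \<rho>" unfolding u(4) using \<sigma> by (simp add: algebra_simps sigma_cases sigma_sq)
    have "Re t = \<rho> + s + u * (x + 1 - \<rho>)" unfolding u(3) by (simp add: algebra_simps)
    moreover have "u * (x + 1 - \<rho>) \<ge> 0" using u x by simp
    ultimately have re: "Re t \<ge> \<rho> + s" by linarith
    have h: "t \<in> half \<sigma>" using R im by (simp add: half_def)
    have abs: "\<bar>Im t\<bar> = \<rho>" using half_abs(1)[OF \<sigma> h] im by simp
    have "norm (pp t) \<le> K / Re t" using re R s by (intro pp_Re) linarith
    also have "\<dots> \<le> 2 * K / (\<rho> + s)" using re R s by (intro K_half) linarith+
    finally have pp: "norm (pp t) \<le> 2 * K / (\<rho> + s)" .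
    have "x \<le> x / \<rho> * norm (of_real x - t)" using abs norm_ge(1)[of t] by (intro x_le) linarith
    moreover have "(2 + x / \<rho>) * norm (of_real x - t) = 2 * norm (of_real x - t) + x / \<rho> * norm (of_real x - t)"
      by (simp add: algebra_simps)
    ultimately show ?thesis using h pp norm_ge[of t] R re by linarith
  qed
  have L: "2 + x / \<rho> \<ge> 0" using x R by simp
  show ?thesis unfolding kernel_def
    by (rule kernel_rotate[OF half half_hol(1)[OF \<sigma>] x_notin_half _ _ L c]; simp)
qed

lemma kernel_pp_right_corners:
  "ray_int (\<lambda>t. pp t * kernel t) (pr (-1)) 1 = seg_int (\<lambda>t. pp t * kernel t) (pr (-1)) (pr 1) + ray_int (\<lambda>t. pp t * kernel t) (pr 1) 1"
proof -
  define S where "S = {z. Re z > x}"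
  have S: "open S" "convex S" unfolding S_def by (simp_all add: open_halfspace_Re_gt convex_halfspace_Re_gt)
  have hol: "pp holomorphic_on S" using side_half(5) x R by (auto simp: right_half_def S_def elim!: holomorphic_on_subset)
  have c: "t \<in> S \<and> norm (pp t) \<le> 2 * K / (\<rho> + s) \<and> \<rho> + s \<le> (\<rho> + 1) * norm (of_real x - t)"
    if s: "s \<ge> 0" and t: "t \<in> closed_segment (pr (-1) + of_real s * 1) (pr 1 + of_real s * 1)" for s t
  proof -
    obtain u where u: "0 \<le> u" "u \<le> 1" "Re t = (1 - u) * (x + 1 + s) + u * (x + 1 + s)"
      using closed_segment_ReIm[OF t] by (auto simp: pr_def)
    have re: "Re t = x + 1 + s" unfolding u(3) by (simp add: algebra_simps)
    have "norm (pp t) \<le> K / Re t" using re R s x by (intro pp_Re) linarith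
    also have "\<dots> \<le> 2 * K / (\<rho> + s)" using re R s x by (intro K_half) linarith+
    finally have pp: "norm (pp t) \<le> 2 * K / (\<rho> + s)" .
    have "1 + s \<le> norm (of_real x - t)" using norm_ge(2)[of t] re s by linarith
    hence "(\<rho> + 1) * (1 + s) \<le> (\<rho> + 1) * norm (of_real x - t)" using R by (intro mult_left_mono) auto
    moreover have "\<rho> + s \<le> (\<rho> + 1) * (1 + s)" using R s by (simp add: algebra_simps)
    ultimately show ?thesis using pp re s by (auto simp: S_def)
  qed
  have L: "\<rho> + 1 \<ge> 0" "of_real x \<notin> S" using x R by (simp_all add: S_def)
  show ?thesis unfolding kernel_def
    by (rule kernel_rotate[OF S hol L(2) _ _ L(1) c]; simp)
qed

text \<open>The contour falls apart into a part with pm and one with pp. The rays of pm are carried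
  to the left, where they cancel against the left side of the square, the pole being outside the
  region swept. Those of pp are carried to the right, and together with the right side of the square
  they leave a rectangle around the pole x.\<close>

lemma heine_kernel: "heine kernel = 2 * of_real pi * \<i> * pp (of_real x)"
proof -
  have side: "heine_side kernel \<sigma> = ray_int (\<lambda>t. pp t * kernel t) (cr \<sigma>) 1 - ray_int (\<lambda>t. pm t * kernel t) (cl \<sigma>) (-1)"
    if \<sigma>: "\<bar>\<sigma>\<bar> = 1" for \<sigma>
  proof -
    have "ray_int (\<lambda>t. dd t * kernel t) (cr \<sigma>) (up \<sigma>) = ray_int (\<lambda>t. pp t * kernel t) (cr \<sigma>) (up \<sigma>) - ray_int (\<lambda>t. pm t * kernel t) (cr \<sigma>) (up \<sigma>)"
      unfolding pint_def using set_integral_diff(2)[OF kernel_pp_up_right(1)[OF \<sigma>, unfolded ray_integrable_def] kernel_pm_cr_cl(1)[OF \<sigma>, unfolded ray_integrable_def]]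
      by (simp add: algebra_simps)
    thus ?thesis unfolding heine_side_def kernel_pp_up_right(2)[OF \<sigma>] kernel_pm_cr_cl(2)[OF \<sigma>] kernel_pm_up_left[OF \<sigma>] by simp
  qed
  have "seg_int (\<lambda>t. pp t * kernel t) (cr (-1)) (pr (-1)) + seg_int (\<lambda>t. pp t * kernel t) (pr (-1)) (pr 1)
      - seg_int (\<lambda>t. pp t * kernel t) (cr 1) (pr 1) - seg_int (\<lambda>t. pp t * kernel t) (cr (-1)) (cr 1) = - (2 * of_real pi * \<i> * pp (of_real x))"
  proof -
    have b: "Complex (Re (pr 1)) (Im (cr (-1))) = pr (-1)" "Complex (Re (cr (-1))) (Im (pr 1)) = cr 1"
      by (simp_all add: pr_def cr_def)
    have "cbox (cr (-1)) (pr 1) \<subseteq> right_half" using R by (auto simp: in_cbox_complex_iff right_half_def pr_def)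
    moreover have "of_real x \<in> box (cr (-1)) (pr 1)" using R x by (auto simp: in_box_complex_iff pr_def)
    ultimately show ?thesis
      using Cauchy_rectangle[OF side_half(2,1,5), of "of_real x" "cr (-1)" "pr 1"] unfolding b kernel_def by simp
  qed
  thus ?thesis
    unfolding heine_def side[of 1, simplified] side[of "-1", simplified] kernel_pm_left_corners
      kernel_pp_cr_pr[of 1, simplified] kernel_pp_cr_pr[of "-1", simplified] kernel_pp_right_corners by (simp add: algebra_simps)
qed

text \<open>Along the positive axis the Laplace transform exchanges the two kernels in each of the
  six pieces of the contour, and for the Cauchy kernel the value is known.\<close>

lemma heine_laplace:
  "(LBINT \<xi>:{0<..}. exp (- of_real (x * \<xi>)) * heine (\<lambda>t. exp (of_real \<xi> * t))) = 2 * of_real pi * \<i> * pp (of_real x)"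
proof -
  let ?L = "\<lambda>q A a d. LBINT \<xi>:{0<..}. exp (- of_real (x * \<xi>)) * pint A (\<lambda>t. q t * exp (of_real \<xi> * t)) a d"
  let ?I = "\<lambda>q A a d. set_integrable lborel {0<..} (\<lambda>\<xi>. exp (- of_real (x * \<xi>)) * pint A (\<lambda>t. q t * exp (of_real \<xi> * t)) a d)"
  have seg: "?I q {0..1} a (b - a) \<and> ?L q {0..1} a (b - a) = seg_int (\<lambda>t. q t * kernel t) a b"
    if q: "q holomorphic_on S" "convex S" and ab: "a \<in> S" "b \<in> S" "Re a \<le> \<rho>" "Re b \<le> \<rho>" for q S a b
  proof -
    have in_S: "a + of_real s * (b - a) \<in> S" if "s \<in> {0..1}" for s :: real
      using q(2)[unfolded convex_def, rule_format, OF ab(1,2), of "1 - s" s] that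
      by (simp add: scaleR_conv_of_real algebra_simps)
    have cont: "continuous_on {0..1} (\<lambda>s::real. q (a + of_real s * (b - a)))"
      by (intro continuous_on_compose2[OF holomorphic_on_imp_continuous_on[OF q(1)]] continuous_intros) (use in_S in auto)
    have int: "set_integrable lborel {0..1} (\<lambda>s::real. q (a + of_real s * (b - a)) * (b - a))"
      unfolding set_integrable_def by (rule borel_integrable_compact) (intro compact_Icc continuous_intros cont)+
    have re: "Re (a + of_real s * (b - a)) \<le> \<rho>" if "s \<in> {0..1}" for s :: real
    proof -
      have "Re (a + of_real s * (b - a)) = (1 - s) * Re a + s * Re b" by (simp add: algebra_simps)
      also have "\<dots> \<le> (1 - s) * \<rho> + s * \<rho>" using that ab by (intro add_mono mult_left_mono) auto
      finally show ?thesis by (simp add: algebra_simps)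
    qed
    show ?thesis unfolding seg_int_def kernel_def
      using pint_exp_laplace[OF _ cont int re x] by simp
  qed
  have ray: "?I dd {0<..} (cr \<sigma>) (up \<sigma>) \<and> ?L dd {0<..} (cr \<sigma>) (up \<sigma>) = ray_int (\<lambda>t. dd t * kernel t) (cr \<sigma>) (up \<sigma>)"
    if \<sigma>: "\<bar>\<sigma>\<bar> = 1" for \<sigma>
  proof -
    have in_S: "cr \<sigma> + of_real s * up \<sigma> \<in> half \<sigma>" if "s > 0" for s
      using that R \<sigma> by (auto simp: half_def distrib_left sigma_cases mult.left_commute[of \<sigma> s] sigma_sq)
    have cont: "continuous_on {0<..} (\<lambda>s::real. dd (cr \<sigma> + of_real s * up \<sigma>))"
      by (intro continuous_on_diff continuous_on_compose2[OF holomorphic_on_imp_continuous_on[OF half_hol(1)[OF \<sigma>]]]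
          continuous_on_compose2[OF holomorphic_on_imp_continuous_on[OF half_hol(2)[OF \<sigma>]]] continuous_intros) (use in_S in auto)
    \<comment> \<open>The exponential estimate at \<zeta> = 0 is the integrability of the difference
      itself.\<close>
    have int: "set_integrable lborel {0<..} (\<lambda>s. dd (cr \<sigma> + of_real s * up \<sigma>) * up \<sigma>)"
      using delta_up_integrable[of 0, OF _ \<sigma>] by (simp add: ray_integrable_def)
    show ?thesis unfolding kernel_def
      using pint_exp_laplace[OF _ cont int _ x] by simp
  qed
  have s1: "?I pp {0..1} (cr (-1)) (cr 1 - cr (-1)) \<and> ?L pp {0..1} (cr (-1)) (cr 1 - cr (-1)) = seg_int (\<lambda>t. pp t * kernel t) (cr (-1)) (cr 1)"
    by (rule seg[OF side_half(5,2)]) (use R in \<open>auto simp: right_half_def\<close>)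
  have s2: "?I pm {0..1} (cl 1) (cl (-1) - cl 1) \<and> ?L pm {0..1} (cl 1) (cl (-1) - cl 1) = seg_int (\<lambda>t. pm t * kernel t) (cl 1) (cl (-1))"
    by (rule seg[OF side_half(6,4)]) (use R in \<open>auto simp: left_half_def\<close>)
  have s3: "?I pm {0..1} (cr \<sigma>) (cl \<sigma> - cr \<sigma>) \<and> ?L pm {0..1} (cr \<sigma>) (cl \<sigma> - cr \<sigma>) = seg_int (\<lambda>t. pm t * kernel t) (cr \<sigma>) (cl \<sigma>)"
    if \<sigma>: "\<bar>\<sigma>\<bar> = 1" for \<sigma>
    by (rule seg[OF half_hol(2)[OF \<sigma>] half(2)]) (use R \<sigma> in \<open>auto simp: half_def sigma_cases\<close>)
  have abs1: "\<bar>- 1 :: real\<bar> = 1" by simp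
  have "(LBINT \<xi>:{0<..}. exp (- of_real (x * \<xi>)) * heine (\<lambda>t. exp (of_real \<xi> * t))) = heine kernel"
  proof -
    have lin: "(LBINT \<xi>:{0<..}. f1 \<xi> + (f2 \<xi> + f3 \<xi>) - (f4 \<xi> + f5 \<xi>) + f6 \<xi>) = (LBINT \<xi>:{0<..}. f1 \<xi>) + ((LBINT \<xi>:{0<..}. f2 \<xi>) + (LBINT \<xi>:{0<..}. f3 \<xi>))
       - ((LBINT \<xi>:{0<..}. f4 \<xi>) + (LBINT \<xi>:{0<..}. f5 \<xi>)) + (LBINT \<xi>:{0<..}. f6 \<xi>)"
      if "set_integrable lborel {0<..} f1" "set_integrable lborel {0<..} f2" "set_integrable lborel {0<..} f3"
         "set_integrable lborel {0<..} f4" "set_integrable lborel {0<..} f5" "set_integrable lborel {0<..} f6"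
       for f1 f2 f3 f4 f5 f6 :: "real \<Rightarrow> complex"
      using that by (simp add: set_integral_add set_integral_diff)
    note * = s1 s3[of 1, OF abs_one] ray[of 1, OF abs_one] s3[of "-1", OF abs1] ray[of "-1", OF abs1] s2
    note ** = *[THEN conjunct1] *[THEN conjunct2]
    show ?thesis
      unfolding heine_def heine_side_def **(7-12)[symmetric] lin[OF **(1-6), symmetric]
      by (simp only: seg_int_def distrib_left right_diff_distrib)
  qed
  thus ?thesis by (simp add: heine_kernel)
qed

end

end

text \<open>In this cone |z| \<le> 2 Re z, so that bounds by powers of 1 / Re z, which the Laplace
  integral gives, are bounds by powers of 1 / |z|.\<close>

definition cone_filter :: "complex filter" where
  "cone_filter = inf at_infinity (principal {z. \<bar>Im z\<bar> \<le> Re z})"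

lemma eventually_cone_filter:
  "eventually P cone_filter \<longleftrightarrow> eventually (\<lambda>z. \<bar>Im z\<bar> \<le> Re z \<longrightarrow> P z) at_infinity"
  by (simp add: cone_filter_def eventually_inf_principal)

lemma cone_filter_le: "cone_filter \<le> at_infinity"
  by (simp add: cone_filter_def)

lemma cone_norm_le: "\<bar>Im z\<bar> \<le> Re z \<Longrightarrow> norm z \<le> 2 * Re z"
  using cmod_le[of z] by linarith

lemma eventually_cone_Re_ge: "eventually (\<lambda>z. Re z \<ge> b \<and> \<bar>Im z\<bar> \<le> Re z) cone_filter"
  unfolding eventually_cone_filter eventually_at_infinity
proof (rule exI[of _ "2 * b"], intro allI impI)
  fix z assume "norm z \<ge> 2 * b" "\<bar>Im z\<bar> \<le> Re z"
  thus "Re z \<ge> b \<and> \<bar>Im z\<bar> \<le> Re z" using cone_norm_le[of z] by linarith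
qed

lemma continuous_imp_locally_bounded_on:
  assumes "open I" "continuous_on I b"
  shows "locally_bounded_on I b"
  unfolding locally_bounded_on_def
proof
  fix \<theta> assume "\<theta> \<in> I"
  then obtain e where e: "e > 0" "cball \<theta> e \<subseteq> I" using assms(1) open_contains_cball by blast
  have "compact (b ` cball \<theta> e)"
    using continuous_on_subset[OF assms(2) e(2)] by (intro compact_continuous_image) auto
  hence "bounded (b ` cball \<theta> e)" by (rule compact_imp_bounded)
  hence "bounded (b ` (I \<inter> ball \<theta> e))" by (rule bounded_subset) auto
  with e(1) show "\<exists>d>0. bounded (b ` (I \<inter> ball \<theta> d))" by blast
qed

lemma set_integral_power_exp_ray:
  fixes c :: real
  assumes "c > 0"
  shows "(LBINT s:{0<..}. s ^ n * exp (- c * s)) = fact n / c ^ Suc n"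
proof -
  have "of_real (LBINT s:{0<..}. s ^ n * exp (- c * s)) = (LBINT s:{0<..}. complex_of_real (s ^ n * exp (- c * s)))"
    by (rule set_integral_complex_of_real[symmetric])
  also have "\<dots> = (LBINT s:{0<..}. of_real s ^ n * exp (- of_real c * of_real s))"
    by (rule set_lebesgue_integral_cong) (auto simp: exp_of_real[symmetric])
  also have "\<dots> = fact n / of_real c ^ Suc n"
    by (rule laplace_power) (use assms in simp)
  also have "\<dots> = of_real (fact n / c ^ Suc n)" by simp
  finally show ?thesis by (simp only: of_real_eq_iff)
qed

section \<open>The Borel transform of a sectorial pair\<close>

context sectorial_pair
begin

text \<open>The Cauchy--Heine form is holomorphic in the unit disc and supplies the Taylor series;
  the Hankel form below is holomorphic for Re \<zeta> > 0 and supplies the continuation.\<close>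

definition borel_near :: "complex \<Rightarrow> complex" where
  "borel_near \<zeta> = heine (\<lambda>t. exp (\<zeta> * t)) / (2 * of_real pi * \<i>)"

definition borel_far :: "complex \<Rightarrow> complex" where
  "borel_far \<zeta> = hankel (\<lambda>t. exp (\<zeta> * t)) / (2 * of_real pi * \<i>)"

lemma seg_holomorphic:
  assumes "q holomorphic_on S" "convex S" "a \<in> S" "b \<in> S"
  shows "(\<lambda>\<zeta>. seg_int (\<lambda>t. q t * exp (\<zeta> * t)) a b) holomorphic_on X"
proof -
  have "continuous_on (closed_segment a b) q"
    using assms closed_segment_subset by (meson continuous_on_subset holomorphic_on_imp_continuous_on)
  from seg_int_exp_holomorphic[OF this] show ?thesis by (rule holomorphic_on_subset) auto
qed

lemma ball_Re_Im:
  assumes "w \<in> ball \<zeta> r" shows "\<bar>Re w - Re \<zeta>\<bar> < r" "\<bar>Im w - Im \<zeta>\<bar> < r"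
  using assms abs_Re_le_cmod[of "w - \<zeta>"] abs_Im_le_cmod[of "w - \<zeta>"] by (auto simp: dist_norm norm_minus_commute)

lemma heine_holomorphic: "borel_near holomorphic_on ball 0 1"
proof -
  have ray: "(\<lambda>\<zeta>. ray_int (\<lambda>t. dd t * exp (\<zeta> * t)) (cr \<sigma>) (up \<sigma>)) holomorphic_on ball 0 1" if \<sigma>: "\<bar>\<sigma>\<bar> = 1" for \<sigma>
  proof (rule pint_exp_holomorphic)
    have in_half: "cr \<sigma> + of_real s * up \<sigma> \<in> half \<sigma>" and co: "\<sigma> * Im (cr \<sigma> + of_real s * up \<sigma>) = \<rho> + s" "Re (cr \<sigma> + of_real s * up \<sigma>) = \<rho>"
      if "s > 0" for s
      using that R \<sigma> by (auto simp: half_def distrib_left sigma_cases mult.left_commute[of \<sigma> s] sigma_sq)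
    show "continuous_on {0<..} (\<lambda>s::real. dd (cr \<sigma> + of_real s * up \<sigma>))"
      by (intro continuous_on_diff continuous_on_compose2[OF holomorphic_on_imp_continuous_on[OF half_hol(1)[OF \<sigma>]]]
          continuous_on_compose2[OF holomorphic_on_imp_continuous_on[OF half_hol(2)[OF \<sigma>]]] continuous_intros) (use in_half in auto)
    fix \<zeta> :: complex assume \<zeta>: "\<zeta> \<in> ball 0 1"
    show "\<exists>r>0. \<exists>g. ball \<zeta> r \<subseteq> ball 0 1 \<and> set_integrable lborel {0<..} g \<and>
       (\<forall>w\<in>ball \<zeta> r. \<forall>s\<in>{0<..}. norm (dd (cr \<sigma> + of_real s * up \<sigma>) * exp (w * (cr \<sigma> + of_real s * up \<sigma>)) * up \<sigma>) \<le> g s)"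
    proof (rule exI[of _ "1 - norm \<zeta>"], intro conjI, use \<zeta> in simp, rule exI[of _ "\<lambda>s. C * exp \<rho> * exp (- 1 * s)"], intro conjI ballI)
      show sub: "ball \<zeta> (1 - norm \<zeta>) \<subseteq> ball 0 1"
      proof
        fix w assume "w \<in> ball \<zeta> (1 - norm \<zeta>)"
        thus "w \<in> ball 0 1" using norm_triangle_ineq[of "w - \<zeta>" \<zeta>] by (simp add: dist_norm norm_minus_commute)
      qed
      show "set_integrable lborel {0<..} (\<lambda>s. C * exp \<rho> * exp (- 1 * s))"
        by (intro set_integrable_mult_right set_integrable_exp_ray) simp
      fix w and s :: real assume w: "w \<in> ball \<zeta> (1 - norm \<zeta>)" and s: "s \<in> {0<..}"
      have w1: "norm w < 1" using sub w by auto
      have im: "\<bar>Im w\<bar> \<le> 1" and re: "Re w \<le> 1" using abs_Im_le_cmod[of w] complex_Re_le_cmod[of w] w1 by linarith+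
      have "norm (dd (cr \<sigma> + of_real s * up \<sigma>) * exp (w * (cr \<sigma> + of_real s * up \<sigma>))) \<le> C * exp (Re w * \<rho> - (\<rho> + s))"
        using delta_bound[OF im \<sigma> in_half[of s]] co[of s] s by simp
      also have "\<dots> \<le> C * exp (\<rho> + - 1 * s)"
      proof -
        have "Re w * \<rho> \<le> 1 * \<rho>" using re R by (intro mult_right_mono) auto
        thus ?thesis using const R by (intro mult_left_mono) auto
      qed
      finally show "norm (dd (cr \<sigma> + of_real s * up \<sigma>) * exp (w * (cr \<sigma> + of_real s * up \<sigma>)) * up \<sigma>) \<le> C * exp \<rho> * exp (- 1 * s)"
        unfolding norm_mult[of _ "up \<sigma>"] norm_directions[OF \<sigma>] exp_add mult_1_right
          by (simp only: mult.assoc)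
    qed
  qed auto
  have s3: "(\<lambda>\<zeta>. seg_int (\<lambda>t. pm t * exp (\<zeta> * t)) (cr \<sigma>) (cl \<sigma>)) holomorphic_on ball 0 1" if \<sigma>: "\<bar>\<sigma>\<bar> = 1" for \<sigma>
    by (rule seg_holomorphic[OF half_hol(2)[OF \<sigma>] half(2)]) (use R \<sigma> in \<open>auto simp: half_def sigma_cases\<close>)
  have s1: "(\<lambda>\<zeta>. seg_int (\<lambda>t. pp t * exp (\<zeta> * t)) (cr (-1)) (cr 1)) holomorphic_on ball 0 1"
    by (rule seg_holomorphic[OF side_half(5,2)]) (use R in \<open>auto simp: right_half_def\<close>)
  have s2: "(\<lambda>\<zeta>. seg_int (\<lambda>t. pm t * exp (\<zeta> * t)) (cl 1) (cl (-1))) holomorphic_on ball 0 1"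
    by (rule seg_holomorphic[OF side_half(6,4)]) (use R in \<open>auto simp: left_half_def\<close>)
  have abs1: "\<bar>- 1 :: real\<bar> = 1" by simp
  show ?thesis unfolding borel_near_def heine_def heine_side_def
    by (intro holomorphic_intros s1 s2 s3[OF abs_one] s3[OF abs1] ray[OF abs_one] ray[OF abs1]) auto
qed

lemma hankel_holomorphic: "borel_far holomorphic_on {\<zeta>. Re \<zeta> > 0}"
proof -
  have ray: "(\<lambda>\<zeta>. ray_int (\<lambda>t. pp t * exp (\<zeta> * t)) (cr \<sigma>) (-1)) holomorphic_on {\<zeta>. Re \<zeta> > 0}" if \<sigma>: "\<bar>\<sigma>\<bar> = 1" for \<sigma>
  proof (rule pint_exp_holomorphic)
    show "continuous_on {0<..} (\<lambda>s::real. pp (cr \<sigma> + of_real s * (-1)))"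
      by (intro continuous_on_compose2[OF holomorphic_on_imp_continuous_on[OF half_hol(1)[OF \<sigma>]]] continuous_intros)
         (use in_half_left(1)[OF \<sigma>] in auto)
    show "open {\<zeta>. Re \<zeta> > 0}" by (rule open_halfspace_Re_gt)
    fix \<zeta> :: complex assume \<zeta>: "\<zeta> \<in> {\<zeta>. Re \<zeta> > 0}"
    define r where "r = Re \<zeta> / 2"
    have r: "r > 0" using \<zeta> by (simp add: r_def)
    define L where "L = M * exp ((Re \<zeta> + r) * \<rho> + (\<bar>Im \<zeta>\<bar> + r) * \<rho>)"
    show "\<exists>r>0. \<exists>g. ball \<zeta> r \<subseteq> {\<zeta>. Re \<zeta> > 0} \<and> set_integrable lborel {0<..} g \<and>
       (\<forall>w\<in>ball \<zeta> r. \<forall>s\<in>{0<..}. norm (pp (cr \<sigma> + of_real s * (-1)) * exp (w * (cr \<sigma> + of_real s * (-1))) * (-1)) \<le> g s)"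
    proof (rule exI[of _ r], intro conjI r, rule exI[of _ "\<lambda>s. L * exp (- r * s)"], intro conjI ballI)
      show "ball \<zeta> r \<subseteq> {\<zeta>. Re \<zeta> > 0}"
      proof
        fix w assume "w \<in> ball \<zeta> r" from ball_Re_Im(1)[OF this] r show "w \<in> {\<zeta>. Re \<zeta> > 0}" unfolding mem_Collect_eq r_def by linarith
      qed
      show "set_integrable lborel {0<..} (\<lambda>s. L * exp (- r * s))"
        by (intro set_integrable_mult_right set_integrable_exp_ray r)
      fix w and s :: real assume w: "w \<in> ball \<zeta> r" and s: "s \<in> {0<..}"
      note b = ball_Re_Im[OF w]
      have rw: "Re w \<ge> r" "Re w \<le> Re \<zeta> + r" "\<bar>Im w\<bar> \<le> \<bar>Im \<zeta>\<bar> + r" using b unfolding r_def by linarith+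
      have "norm (pp (cr \<sigma> + of_real s * -1)) \<le> M"
        using half_abs(3)[OF \<sigma> in_half_left(1)[OF \<sigma>]] pp_bd by blast
      hence "norm (pp (cr \<sigma> + of_real s * (-1)) * exp (w * (cr \<sigma> + of_real s * (-1)))) \<le> M * exp (Re w * \<rho> + \<bar>Im w\<bar> * \<rho>) * exp (- Re w * s)"
        using rw r R abs_sigma_rho[OF \<sigma>] by (intro left_ray_bound) auto
      also have "\<dots> \<le> L * exp (- r * s)" unfolding L_def
      proof (intro mult_mono mult_left_mono)
        show "exp (Re w * \<rho> + \<bar>Im w\<bar> * \<rho>) \<le> exp ((Re \<zeta> + r) * \<rho> + (\<bar>Im \<zeta>\<bar> + r) * \<rho>)"
          unfolding exp_le_cancel_iff using rw R by (intro add_mono mult_right_mono) auto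
        have "r * s \<le> Re w * s" using rw s by (intro mult_right_mono) auto
        thus "exp (- Re w * s) \<le> exp (- r * s)" by simp
      qed (use const in auto)
      finally show "norm (pp (cr \<sigma> + of_real s * (-1)) * exp (w * (cr \<sigma> + of_real s * (-1))) * (-1)) \<le> L * exp (- r * s)" by simp
    qed
  qed auto
  have s1: "(\<lambda>\<zeta>. seg_int (\<lambda>t. pp t * exp (\<zeta> * t)) (cr (-1)) (cr 1)) holomorphic_on {\<zeta>. Re \<zeta> > 0}"
    by (rule seg_holomorphic[OF side_half(5,2)]) (use R in \<open>auto simp: right_half_def\<close>)
  have abs1: "\<bar>- 1 :: real\<bar> = 1" by simp
  show ?thesis unfolding borel_far_def hankel_def
    by (intro holomorphic_intros s1 ray[OF abs_one] ray[OF abs1]) auto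
qed

lemma borel_far_eq_near:
  assumes "Re \<zeta> > 0" "\<bar>Im \<zeta>\<bar> \<le> 1"
  shows "borel_far \<zeta> = borel_near \<zeta>"
  by (simp add: borel_far_def borel_near_def hankel_eq_heine[OF assms])

text \<open>On the vertical side |t| is at most 2 \<rho>, which gives the rate; each horizontal ray
  costs a factor 1 / Re \<zeta>. The singularity of this bound at 0 is removed afterwards by means
  of \<open>borel_near\<close>.\<close>

lemma borel_far_bound:
  assumes \<zeta>: "Re \<zeta> > 0"
  shows "norm (borel_far \<zeta>) \<le> (2 * \<rho> * M + 2 * M / Re \<zeta>) * exp (2 * \<rho> * norm \<zeta>)"
proof -
  define E where "E = exp (2 * \<rho> * norm \<zeta>)"
  have seg: "norm (seg_int (\<lambda>t. pp t * exp (\<zeta> * t)) (cr (-1)) (cr 1)) \<le> (M * E) * norm (cr 1 - cr (-1))"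
  proof (rule seg_int_norm_le)
    show "continuous_on right_half (\<lambda>t. pp t * exp (\<zeta> * t))"
      by (intro continuous_intros holomorphic_on_imp_continuous_on[OF side_half(5)])
    show "closed_segment (cr (-1)) (cr 1) \<subseteq> right_half"
      by (intro closed_segment_subset side_half) (use R in \<open>auto simp: right_half_def\<close>)
    fix t assume t: "t \<in> closed_segment (cr (-1)) (cr 1)"
    then obtain u where u: "0 \<le> u" "u \<le> 1" "Re t = (1 - u) * \<rho> + u * \<rho>" "Im t = (1 - u) * (- \<rho>) + u * \<rho>"
      by (rule closed_segment_ReIm) auto
    have re: "Re t = \<rho>" unfolding u(3) by (simp add: algebra_simps)
    have "Im t = (2 * u - 1) * \<rho>" unfolding u(4) by (simp add: algebra_simps)
    hence "\<bar>Im t\<bar> = \<bar>2 * u - 1\<bar> * \<rho>" using R by (simp add: abs_mult)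
    also have "\<dots> \<le> 1 * \<rho>" using u R by (intro mult_right_mono) auto
    finally have "norm t \<le> 2 * \<rho>" using cmod_le[of t] re R by simp
    hence "norm (\<zeta> * t) \<le> 2 * \<rho> * norm \<zeta>" unfolding norm_mult
      by (metis mult.commute mult_left_mono norm_ge_zero)
    hence "norm (exp (\<zeta> * t)) \<le> E" unfolding E_def by (intro order_trans[OF norm_exp]) simp
    moreover have "norm (pp t) \<le> M" using re R by (intro pp_bd) (simp add: right_dom_def)
    ultimately show "norm (pp t * exp (\<zeta> * t)) \<le> M * E" unfolding norm_mult using const by (intro mult_mono) auto
  qed
  have "cr 1 - cr (-1) = \<i> * of_real (2 * \<rho>)" by (simp add: cr_def complex_eq_iff)
  hence "norm (cr 1 - cr (-1)) = 2 * \<rho>" using R by (simp add: norm_mult)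
  with seg have seg': "norm (seg_int (\<lambda>t. pp t * exp (\<zeta> * t)) (cr (-1)) (cr 1)) \<le> 2 * \<rho> * M * E" by (simp add: mult_ac)
  have ray: "norm (ray_int (\<lambda>t. pp t * exp (\<zeta> * t)) (cr \<sigma>) (-1)) \<le> M * E * (1 / Re \<zeta>)" if \<sigma>: "\<bar>\<sigma>\<bar> = 1" for \<sigma>
  proof -
    have bd: "norm (pp (cr \<sigma> + of_real s * (-1))) \<le> M" for s
        using half_abs(3)[OF \<sigma> in_half_left(1)[OF \<sigma>]] pp_bd by blast
    have "norm (ray_int (\<lambda>t. pp t * exp (\<zeta> * t)) (cr \<sigma>) (-1)) \<le> (LBINT s:{0<..}. M * exp (Re \<zeta> * \<rho> + \<bar>Im \<zeta>\<bar> * \<rho>) * exp (- Re \<zeta> * s))"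
      unfolding pint_def
    proof (rule set_integral_norm_le)
      have "ray_integrable (\<lambda>t. pp t * exp (\<zeta> * t)) (cr \<sigma>) (-1)"
        using left_ray_integrable[OF \<zeta> half(1) half_hol(1)[OF \<sigma>]] half_abs(3)[OF \<sigma>] pp_bd in_half_left \<sigma> abs_sigma_rho[OF \<sigma>] by auto
      thus "set_integrable lborel {0<..} (\<lambda>s. pp (cr \<sigma> + of_real s * -1) * exp (\<zeta> * (cr \<sigma> + of_real s * -1)) * -1)"
        by (simp add: ray_integrable_def)
      show "set_integrable lborel {0<..} (\<lambda>s. M * exp (Re \<zeta> * \<rho> + \<bar>Im \<zeta>\<bar> * \<rho>) * exp (- Re \<zeta> * s))"
        by (intro set_integrable_mult_right set_integrable_exp_ray \<zeta>)
      show "norm (pp (cr \<sigma> + of_real s * -1) * exp (\<zeta> * (cr \<sigma> + of_real s * -1)) * -1) \<le> M * exp (Re \<zeta> * \<rho> + \<bar>Im \<zeta>\<bar> * \<rho>) * exp (- Re \<zeta> * s)" if "s \<in> {0<..}" for s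
        using left_ray_bound[OF \<zeta> _ _ bd[of s], of "cr \<sigma> + of_real s * -1" s] abs_sigma_rho[OF \<sigma>] by simp
    qed
    also have "\<dots> = M * exp (Re \<zeta> * \<rho> + \<bar>Im \<zeta>\<bar> * \<rho>) * (1 / Re \<zeta>)"
      by (simp only: set_integral_mult_right set_integral_exp_ray[OF \<zeta>])
    also have "\<dots> \<le> M * E * (1 / Re \<zeta>)"
    proof -
      have "Re \<zeta> + \<bar>Im \<zeta>\<bar> \<le> 2 * norm \<zeta>" using complex_Re_le_cmod[of \<zeta>] abs_Im_le_cmod[of \<zeta>] by linarith
      hence "(Re \<zeta> + \<bar>Im \<zeta>\<bar>) * \<rho> \<le> 2 * norm \<zeta> * \<rho>" using R by (intro mult_right_mono) auto
      thus ?thesis using \<zeta> const unfolding E_def by (intro mult_right_mono mult_left_mono) (auto simp: algebra_simps)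
    qed
    finally show ?thesis .
  qed
  have abs1: "\<bar>- 1 :: real\<bar> = 1" by simp
  have "norm (hankel (\<lambda>t. exp (\<zeta> * t))) \<le> 2 * \<rho> * M * E + M * E * (1 / Re \<zeta>) + M * E * (1 / Re \<zeta>)"
    unfolding hankel_def
    by (intro order_trans[OF norm_triangle_ineq4] add_mono order_trans[OF norm_triangle_ineq] seg' ray[OF abs_one] ray[OF abs1])
  also have "\<dots> = (2 * \<rho> * M + 2 * M / Re \<zeta>) * E" by (simp add: algebra_simps)
  finally have *: "norm (hankel (\<lambda>t. exp (\<zeta> * t))) \<le> (2 * \<rho> * M + 2 * M / Re \<zeta>) * E" .
  have "norm (borel_far \<zeta>) = norm (hankel (\<lambda>t. exp (\<zeta> * t))) / (2 * pi)"
    by (simp add: borel_far_def norm_divide norm_mult)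
  also have "\<dots> \<le> norm (hankel (\<lambda>t. exp (\<zeta> * t))) / 1"
    using pi_gt3 by (intro divide_left_mono) auto
  finally show ?thesis using * by (simp add: E_def)
qed

definition borel_series :: "complex fps" where
  "borel_series = fps_expansion borel_near 0"

text \<open>The formal Laplace transform of the Taylor series: \<zeta>^m goes to m!
  z^-(m+1).\<close>

definition formal_series :: "complex fps" where
  "formal_series = Abs_fps (\<lambda>n. case n of 0 \<Rightarrow> 0 | Suc m \<Rightarrow> fact m * fps_nth borel_series m)"

lemma formal_series_nth_0 [simp]: "fps_nth formal_series 0 = 0"
  and formal_series_nth_Suc: "fps_nth formal_series (Suc m) = fact m * fps_nth borel_series m"
  by (simp_all add: formal_series_def)

lemma borel_transform_formal_series: "borel_transform formal_series = borel_series"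
  by (simp add: borel_transform_def fps_eq_iff formal_series_nth_Suc)

lemma ball_eball: "ball 0 1 = eball (0::complex) 1"
  by (auto simp: eball_def one_ereal_def)

lemma borel_series_radius: "fps_conv_radius borel_series \<ge> 1"
  unfolding borel_series_def
  by (rule conv_radius_fps_expansion) (use heine_holomorphic in \<open>simp add: ball_eball\<close>)

lemma eval_borel_series: "norm \<zeta> < 1 \<Longrightarrow> eval_fps borel_series \<zeta> = borel_near \<zeta>"
  unfolding borel_series_def using eval_fps_expansion[of borel_near 0 1 \<zeta>] heine_holomorphic
  by (simp flip: ball_eball)

lemma laplace_borel_far_real:
  assumes x: "x > \<rho>"
  shows "laplace borel_far 0 (of_real x) = pp (of_real x)"
proof -
  have "laplace borel_far 0 (of_real x) = (LBINT \<xi>:{0<..}. (exp (- of_real (x * \<xi>)) * heine (\<lambda>t. exp (of_real \<xi> * t))) / (2 * of_real pi * \<i>))"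
    unfolding laplace_def
    by (rule set_lebesgue_integral_cong) (auto simp: borel_far_eq_near borel_near_def)
  also have "\<dots> = (LBINT \<xi>:{0<..}. (exp (- of_real (x * \<xi>)) * heine (\<lambda>t. exp (of_real \<xi> * t)))) / (2 * of_real pi * \<i>)"
    by (rule set_integral_divide_zero)
  finally show ?thesis unfolding heine_laplace[OF x] by simp
qed

lemma near_bound: obtains A where "A \<ge> 0" "\<And>\<zeta>. norm \<zeta> \<le> 1/2 \<Longrightarrow> norm (borel_near \<zeta>) \<le> A"
proof -
  have "continuous_on (cball 0 (1/2)) borel_near"
    by (rule continuous_on_subset[OF holomorphic_on_imp_continuous_on[OF heine_holomorphic]]) auto
  hence "compact (borel_near ` cball 0 (1/2))" by (rule compact_continuous_image) auto
  hence "bounded (borel_near ` cball 0 (1/2))" by (rule compact_imp_bounded)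
  then obtain A where A: "\<forall>x\<in>borel_near ` cball 0 (1/2). norm x \<le> A" unfolding bounded_iff by blast
  show ?thesis
  proof (rule that[of "max A 0"])
    fix \<zeta> :: complex assume "norm \<zeta> \<le> 1/2"
    hence "norm (borel_near \<zeta>) \<le> A" using A by (simp add: dist_norm)
    thus "norm (borel_near \<zeta>) \<le> max A 0" by simp
  qed simp
qed

text \<open>Where \<xi> \<le> 1/2 the bound on a disc is used; elsewhere Re \<zeta> = \<xi> cos
  \<theta> is at least cos \<theta> / 2. The factor 1 / cos \<theta> that this leaves is locally
  bounded on the open arc, although unbounded on it.\<close>

lemma exp_bounded_borel_far: "exp_bounded_on arc_plus borel_far (\<lambda>_. 2 * \<rho>)"
proof -
  obtain A where A: "A \<ge> 0" "\<And>\<zeta>. norm \<zeta> \<le> 1/2 \<Longrightarrow> norm (borel_near \<zeta>) \<le> A" by (rule near_bound) blast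
  define \<alpha> where "\<alpha> = (\<lambda>\<theta>. A + (2 * \<rho> * M + 4 * M / cos \<theta>))"
  have cos: "cos \<theta> > 0" if "\<theta> \<in> arc_plus" for \<theta> using that by (auto simp: arc_plus_def intro!: cos_gt_zero_pi)
  have "continuous_on arc_plus \<alpha>" unfolding \<alpha>_def using cos by (intro continuous_intros) force
  hence "locally_bounded_on arc_plus \<alpha>" by (intro continuous_imp_locally_bounded_on) (simp_all add: arc_plus_def)
  moreover have "locally_bounded_on arc_plus (\<lambda>_. 2 * \<rho>)" by (intro continuous_imp_locally_bounded_on) (simp_all add: arc_plus_def)
  moreover have "norm (borel_far (of_real \<xi> * cis \<theta>)) \<le> \<alpha> \<theta> * exp (2 * \<rho> * \<xi>)" if th: "\<theta> \<in> arc_plus" and xi: "\<xi> > 0" for \<theta> \<xi>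
  proof (cases "\<xi> \<le> 1/2")
    case True
    let ?z = "of_real \<xi> * cis \<theta>"
    have re: "Re ?z > 0" using xi cos[OF th] by simp
    have n: "norm ?z \<le> 1/2" using True xi by (simp add: norm_mult)
    have "norm (borel_far ?z) \<le> A"
      using borel_far_eq_near[OF re] abs_Im_le_cmod[of ?z] n A(2)[OF n] by simp
    also have "A \<le> \<alpha> \<theta> * 1" unfolding \<alpha>_def using cos[OF th] const R by simp
    also have "\<dots> \<le> \<alpha> \<theta> * exp (2 * \<rho> * \<xi>)"
      using xi R A(1) cos[OF th] const by (intro mult_left_mono) (auto simp: \<alpha>_def)
    finally show ?thesis .
  next
    case False
    let ?z = "of_real \<xi> * cis \<theta>"
    have re: "Re ?z > 0" using xi cos[OF th] by simp
    have "norm (borel_far ?z) \<le> (2 * \<rho> * M + 2 * M / Re ?z) * exp (2 * \<rho> * norm ?z)" by (rule borel_far_bound[OF re])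
    also have "norm ?z = \<xi>" using xi by (simp add: norm_mult)
    also have "(2 * \<rho> * M + 2 * M / Re ?z) * exp (2 * \<rho> * \<xi>) \<le> \<alpha> \<theta> * exp (2 * \<rho> * \<xi>)"
    proof (intro mult_right_mono)
      have "cos \<theta> * (1/2) \<le> cos \<theta> * \<xi>" using False cos[OF th] by (intro mult_left_mono) auto
      hence "2 * M / (\<xi> * cos \<theta>) \<le> 2 * M / (cos \<theta> / 2)"
        using const cos[OF th] xi by (intro divide_left_mono) (auto simp: mult.commute)
      thus "2 * \<rho> * M + 2 * M / Re ?z \<le> \<alpha> \<theta>" using A(1) by (simp add: \<alpha>_def)
    qed simp
    finally show ?thesis .
  qed
  ultimately show ?thesis unfolding exp_bounded_on_def by blast
qed

text \<open>Outside the domain both Re z and |Im z| are at most R, so Re (z cis \<theta>) is at most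
  2 R. The rate 2 \<rho> thus places all half-planes of convergence where pp is holomorphic.\<close>

lemma half_plane_subset:
  assumes "\<theta> \<in> arc_plus" "Re (z * cis \<theta>) > 2 * \<rho>"
  shows "z \<in> right_dom R"
proof (rule ccontr)
  assume "z \<notin> right_dom R"
  hence z: "Re z \<le> R" "\<bar>Im z\<bar> \<le> R" by (auto simp: right_dom_def)
  have cos: "cos \<theta> > 0" using assms(1) by (auto simp: arc_plus_def intro!: cos_gt_zero_pi)
  have "Re z * cos \<theta> \<le> R * cos \<theta>" using z cos by (intro mult_right_mono) auto
  also have "\<dots> \<le> R * 1" using R by (intro mult_left_mono) auto
  finally have 1: "Re z * cos \<theta> \<le> R" by simp
  have "- (Im z * sin \<theta>) \<le> \<bar>Im z\<bar> * \<bar>sin \<theta>\<bar>" by (metis abs_ge_minus_self abs_mult)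
  also have "\<dots> \<le> R * 1" using z by (intro mult_mono) auto
  finally show False using 1 assms(2) R by simp
qed

lemma exp_bounded_ray_far:
  assumes "\<theta> \<in> arc_plus"
  obtains A where "exp_bounded_ray borel_far \<theta> A (2 * \<rho>)"
proof -
  have hol: "borel_far holomorphic_on sector arc_plus" using hankel_holomorphic by (simp add: sector_arc_plus)
  have in_sector: "of_real \<xi> * cis \<theta> \<in> sector arc_plus" if "\<xi> > 0" for \<xi>
    using that assms unfolding sector_def by blast
  obtain \<alpha> where "\<And>\<theta> \<xi>. \<theta> \<in> arc_plus \<Longrightarrow> \<xi> > 0 \<Longrightarrow> norm (borel_far (of_real \<xi> * cis \<theta>)) \<le> \<alpha> \<theta> * exp (2 * \<rho> * \<xi>)"
    using exp_bounded_borel_far unfolding exp_bounded_on_def by blast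
  with assms have "exp_bounded_ray borel_far \<theta> (\<alpha> \<theta>) (2 * \<rho>)"
    unfolding exp_bounded_ray_def
    by (auto intro!: continuous_on_compose2[OF holomorphic_on_imp_continuous_on[OF hol]] continuous_intros in_sector)
  thus ?thesis by (rule that)
qed

text \<open>From the real half-line the identity theorem carries the equation to the half-plane of
  direction 0. A tilted half-plane overlaps with it, the direction does not matter on the overlap,
  and the identity theorem applies again.\<close>

lemma laplace_borel_far:
  assumes th: "\<theta> \<in> arc_plus" and z: "Re (z * cis \<theta>) > 2 * \<rho>"
  shows "laplace borel_far \<theta> z = pp z"
proof -
  have hol: "borel_far holomorphic_on sector arc_plus" using hankel_holomorphic by (simp add: sector_arc_plus)
  have lap_hol: "laplace borel_far \<theta> holomorphic_on {z. Re (z * cis \<theta>) > 2 * \<rho>}" if arc: "\<theta> \<in> arc_plus" for \<theta>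
  proof -
    obtain A where "exp_bounded_ray borel_far \<theta> A (2 * \<rho>)" by (rule exp_bounded_ray_far[OF arc])
    thus ?thesis by (rule laplace_holomorphic)
  qed
  have hp: "{z. Re (z * cis \<theta>) > b} = {z. inner (cis (-\<theta>)) z > b}" for \<theta> b
    by (auto simp: inner_complex_def algebra_simps)
  have hpo: "open {z. Re (z * cis \<theta>) > b}" "connected {z. Re (z * cis \<theta>) > b}" for \<theta> b
    unfolding hp by (auto intro: open_halfspace_gt convex_connected convex_halfspace_gt)
  have pp_holo: "pp holomorphic_on {z. Re (z * cis \<theta>) > 2 * \<rho>}" if "\<theta> \<in> arc_plus" for \<theta>
    by (rule holomorphic_on_subset[OF pp_hol]) (use half_plane_subset[OF that] in auto)
  have 0: "0 \<in> arc_plus" by (simp add: arc_plus_def)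
  have step1: "laplace borel_far 0 w = pp w" if w: "Re w > 2 * \<rho>" for w
  proof -
    have "laplace borel_far 0 w - pp w = 0"
    proof (rule analytic_continuation[where f = "\<lambda>w. laplace borel_far 0 w - pp w" and S = "{z. Re (z * cis 0) > 2 * \<rho>}"
          and U = "of_real ` {2 * \<rho> <..}" and \<xi> = "of_real (2 * \<rho> + 1)"])
      show "(\<lambda>w. laplace borel_far 0 w - pp w) holomorphic_on {z. Re (z * cis 0) > 2 * \<rho>}"
        by (intro holomorphic_on_diff lap_hol pp_holo 0)
      show "(of_real (2 * \<rho> + 1) :: complex) islimpt of_real ` {2 * \<rho> <..}"
        unfolding islimpt_approachable
      proof (intro allI impI)
        fix e :: real assume e: "e > 0"
        show "\<exists>x'\<in>of_real ` {2 * \<rho> <..}. x' \<noteq> (of_real (2 * \<rho> + 1) :: complex) \<and> dist x' (of_real (2 * \<rho> + 1)) < e"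
        proof (rule bexI, rule conjI)
          show "(of_real (2 * \<rho> + 1 + e/2) :: complex) \<noteq> of_real (2 * \<rho> + 1)" using e unfolding of_real_eq_iff by simp
          show "dist (of_real (2 * \<rho> + 1 + e/2) :: complex) (of_real (2 * \<rho> + 1)) < e"
            using e unfolding dist_of_real by (simp add: dist_real_def)
          show "(of_real (2 * \<rho> + 1 + e/2) :: complex) \<in> of_real ` {2 * \<rho> <..}" by (rule imageI) (use e in simp)
        qed
      qed
      show "laplace borel_far 0 x - pp x = 0" if "x \<in> of_real ` {2 * \<rho> <..}" for x
        using that R laplace_borel_far_real by auto
    qed (use w hpo[where b = "2 * \<rho>" and \<theta> = 0] in auto)
    thus ?thesis by simp
  qed
  have "laplace borel_far \<theta> z - pp z = 0"
  proof (rule analytic_continuation_open[where s = "{z. Re (z * cis \<theta>) > 2 * \<rho>} \<inter> {z. Re z > 2 * \<rho>}" and s' = "{z. Re (z * cis \<theta>) > 2 * \<rho>}"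
         and f = "\<lambda>w. laplace borel_far \<theta> w - pp w" and g = "\<lambda>_. 0"])
    show "{z. Re (z * cis \<theta>) > 2 * \<rho>} \<inter> {z. Re z > 2 * \<rho>} \<noteq> {}"
    proof -
      \<comment> \<open>A point of argument -\<theta>/2 is equally good for the directions 0 and
        \<theta>, so it lies in both half-planes once it is far enough out.\<close>
      have c: "cos (\<theta>/2) > 0" using th by (intro cos_gt_zero_pi) (auto simp: arc_plus_def)
      define X where "X = (2 * \<rho> + 1) / cos (\<theta>/2)"
      have "of_real X * cis (- \<theta>/2) * cis \<theta> = of_real X * cis (\<theta>/2)" by (simp add: mult.assoc cis_mult)
      hence "of_real X * cis (- \<theta>/2) \<in> {z. Re (z * cis \<theta>) > 2 * \<rho>} \<inter> {z. Re z > 2 * \<rho>}"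
        using c by (simp only: Int_iff mem_Collect_eq) (simp add: X_def)
      thus ?thesis by blast
    qed
    show "open ({z. Re (z * cis \<theta>) > 2 * \<rho>} \<inter> {z. Re z > 2 * \<rho>})" using hpo open_halfspace_Re_gt by (intro open_Int) auto
    show "(\<lambda>w. laplace borel_far \<theta> w - pp w) holomorphic_on {z. Re (z * cis \<theta>) > 2 * \<rho>}"
      by (intro holomorphic_on_diff lap_hol pp_holo th)
    fix w assume w: "w \<in> {z. Re (z * cis \<theta>) > 2 * \<rho>} \<inter> {z. Re z > 2 * \<rho>}"
    have "laplace borel_far \<theta> w = laplace borel_far 0 w"
    proof (rule laplace_direction_indep[where I = arc_plus and ?\<beta>1.0 = "\<lambda>_. 2 * \<rho>" and ?\<beta>2.0 = "\<lambda>_. 2 * \<rho>"])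
      show "convex (sector arc_plus)" "open (sector arc_plus)"
        unfolding sector_arc_plus by (rule convex_halfspace_Re_gt, rule open_halfspace_Re_gt)
      show "is_interval arc_plus" "\<And>\<theta>1 \<theta>2. \<theta>1 \<in> arc_plus \<Longrightarrow> \<theta>2 \<in> arc_plus \<Longrightarrow> \<theta>2 - \<theta>1 < pi"
        by (auto simp: arc_plus_def is_interval_1)
    qed (use th 0 hol exp_bounded_borel_far w in auto)
    thus "laplace borel_far \<theta> w - pp w = 0" using step1 w by simp
  qed (use hpo z in auto)
  thus ?thesis by simp
qed

theorem borel_summable_plus: "borel_summable formal_series arc_plus (2 * \<rho>) pp"
  unfolding borel_summable_def
proof (rule exI[of _ borel_far], intro conjI ballI allI impI laplace_borel_far exp_bounded_borel_far)
  show "borel_continuation formal_series arc_plus borel_far"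
    unfolding borel_continuation_def borel_transform_formal_series
  proof (intro conjI)
    show "fps_conv_radius borel_series > 0" using borel_series_radius by (rule less_le_trans[rotated]) simp
    show "borel_far holomorphic_on sector arc_plus" using hankel_holomorphic by (simp add: sector_arc_plus)
    show "\<exists>r>0. \<forall>\<zeta>\<in>sector arc_plus. norm \<zeta> < r \<longrightarrow> borel_far \<zeta> = eval_fps borel_series \<zeta>"
    proof (rule exI[of _ 1], intro conjI ballI impI)
      fix \<zeta> assume "\<zeta> \<in> sector arc_plus" "norm \<zeta> < 1"
      thus "borel_far \<zeta> = eval_fps borel_series \<zeta>"
        using borel_far_eq_near[of \<zeta>] abs_Im_le_cmod[of \<zeta>] eval_borel_series by (simp add: sector_arc_plus)
    qed simp
  qed
qed

text \<open>The remainder estimate behind Watson's lemma. For \<xi> \<le> 1/2 the remainder is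
  \<xi>^n times a convergent series; for larger \<xi> each term is estimated by itself, every lower
  power being at most 2^n \<xi>^n.\<close>

lemma borel_far_taylor:
  obtains D where "D \<ge> 0" "\<And>\<xi>. \<xi> > 0 \<Longrightarrow> norm (borel_far (of_real \<xi>) - (\<Sum>k<n. fps_nth borel_series k * of_real \<xi> ^ k)) \<le> D * \<xi> ^ n * exp (2 * \<rho> * \<xi>)"
proof -
  define a where "a = borel_series"
  define d where "d = fps_shift n a"
  have rad: "fps_conv_radius d \<ge> 1" using borel_series_radius by (simp add: d_def a_def)
  have dec: "eval_fps a \<zeta> - (\<Sum>k<n. fps_nth a k * \<zeta> ^ k) = \<zeta> ^ n * eval_fps d \<zeta>" if "norm \<zeta> < 1" for \<zeta>
  proof -
    have n1: "norm \<zeta> < fps_conv_radius a" "norm \<zeta> < fps_conv_radius d"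
      using that borel_series_radius rad unfolding a_def
      by (auto intro!: less_le_trans[OF _ borel_series_radius] less_le_trans[OF _ rad])
    have "a = fps_X ^ n * d + fps_cutoff n a" unfolding d_def by (rule fps_shift_cutoff'[symmetric])
    hence "eval_fps a \<zeta> = eval_fps (fps_X ^ n * d + fps_cutoff n a) \<zeta>" by simp
    also have "\<dots> = eval_fps (fps_X ^ n * d) \<zeta> + eval_fps (fps_cutoff n a) \<zeta>"
      by (rule eval_fps_add) (use n1 in \<open>auto intro: less_le_trans[OF _ fps_conv_radius_mult]\<close>)
    also have "eval_fps (fps_X ^ n * d) \<zeta> = \<zeta> ^ n * eval_fps d \<zeta>"
      using n1 by (subst eval_fps_mult) (auto simp: eval_fps_power)
    finally show ?thesis by (simp add: eval_fps_cutoff)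
  qed
  have "continuous_on (cball 0 (1/2)) (eval_fps d)"
  proof (rule continuous_on_eval_fps')
    show "continuous_on (cball 0 (1/2)) (\<lambda>z. z)" by (rule continuous_on_id)
  qed (use rad in \<open>auto simp: in_eball_iff intro!: less_le_trans[OF _ rad] simp: one_ereal_def\<close>)
  hence "compact (eval_fps d ` cball 0 (1/2))" by (rule compact_continuous_image) auto
  hence "bounded (eval_fps d ` cball 0 (1/2))" by (rule compact_imp_bounded)
  then obtain D1 where D1': "\<forall>x\<in>eval_fps d ` cball 0 (1/2). norm x \<le> D1" unfolding bounded_iff by blast
  have D1: "norm (eval_fps d \<zeta>) \<le> D1" if "norm \<zeta> \<le> 1/2" for \<zeta>
    using D1' that by (simp add: dist_norm)
  have D10: "D1 \<ge> 0" using D1[of 0] norm_ge_zero order_trans by (metis norm_zero half_bounded_equal zero_le_divide_1_iff zero_le_numeral)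
  obtain \<alpha> where al: "\<And>\<theta> \<xi>. \<theta> \<in> arc_plus \<Longrightarrow> \<xi> > 0 \<Longrightarrow> norm (borel_far (of_real \<xi> * cis \<theta>)) \<le> \<alpha> \<theta> * exp (2 * \<rho> * \<xi>)"
    using exp_bounded_borel_far unfolding exp_bounded_on_def by blast
  have al0: "norm (borel_far (of_real \<xi>)) \<le> \<bar>\<alpha> 0\<bar> * exp (2 * \<rho> * \<xi>)" if "\<xi> > 0" for \<xi>
  proof -
    have "norm (borel_far (of_real \<xi>)) \<le> \<alpha> 0 * exp (2 * \<rho> * \<xi>)" using al[of 0 \<xi>] that by (simp add: arc_plus_def)
    also have "\<dots> \<le> \<bar>\<alpha> 0\<bar> * exp (2 * \<rho> * \<xi>)" by (intro mult_right_mono) auto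
    finally show ?thesis .
  qed
  define D where "D = D1 + 2 ^ n * (\<bar>\<alpha> 0\<bar> + (\<Sum>k<n. norm (fps_nth a k)))"
  have S0: "(\<Sum>k<n. norm (fps_nth a k)) \<ge> 0" by (intro sum_nonneg) auto
  show ?thesis
  proof (rule that[of D])
    show "D \<ge> 0" using D10 S0 by (simp add: D_def)
    fix \<xi> :: real assume xi: "\<xi> > 0"
    have e1: "exp (2 * \<rho> * \<xi>) \<ge> 1" using xi R by simp
    show "norm (borel_far (of_real \<xi>) - (\<Sum>k<n. fps_nth borel_series k * of_real \<xi> ^ k)) \<le> D * \<xi> ^ n * exp (2 * \<rho> * \<xi>)"
    proof (cases "\<xi> \<le> 1/2")
      case True
      have "borel_far (of_real \<xi>) = eval_fps a (of_real \<xi>)"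
        using borel_far_eq_near[of "of_real \<xi>"] eval_borel_series[of "of_real \<xi>"] xi True by (simp add: a_def)
      hence "norm (borel_far (of_real \<xi>) - (\<Sum>k<n. fps_nth a k * of_real \<xi> ^ k)) = norm (of_real \<xi> ^ n * eval_fps d (of_real \<xi>))"
        using dec[of "of_real \<xi>"] xi True by simp
      also have "\<dots> = \<xi> ^ n * norm (eval_fps d (of_real \<xi>))" using xi by (simp add: norm_mult norm_power)
      also have "\<dots> \<le> \<xi> ^ n * D1" using D1[of "of_real \<xi>"] xi True by (intro mult_left_mono) auto
      also have "\<dots> \<le> \<xi> ^ n * D" using xi S0 by (intro mult_left_mono) (auto simp: D_def)
      also have "\<dots> \<le> (\<xi> ^ n * D) * exp (2 * \<rho> * \<xi>)" using mult_left_mono[OF e1, of "\<xi> ^ n * D"] xi D10 S0 by (simp add: D_def)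
      finally show ?thesis by (simp add: a_def mult_ac)
    next
      case False
      have pw: "\<xi> ^ k \<le> 2 ^ n * \<xi> ^ n" if "k \<le> n" for k
      proof -
        have "(1/2::real) ^ n * \<xi> ^ k \<le> (1/2) ^ (n - k) * \<xi> ^ k" using xi
          by (intro mult_right_mono power_decreasing) auto
        also have "\<dots> \<le> \<xi> ^ (n - k) * \<xi> ^ k" using xi False by (intro mult_right_mono power_mono) auto
        also have "\<dots> = \<xi> ^ n" using that by (simp flip: power_add)
        finally show ?thesis by (simp add: field_simps)
      qed
      have p0: "1 \<le> 2 ^ n * \<xi> ^ n" using pw[of 0] by simp
      have "norm (borel_far (of_real \<xi>) - (\<Sum>k<n. fps_nth a k * of_real \<xi> ^ k)) \<le> norm (borel_far (of_real \<xi>)) + (\<Sum>k<n. norm (fps_nth a k) * \<xi> ^ k)"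
        using xi by (intro order_trans[OF norm_triangle_ineq4] add_mono order_refl order_trans[OF norm_sum] sum_mono) (simp add: norm_mult norm_power)
      also have "\<dots> \<le> \<bar>\<alpha> 0\<bar> * exp (2 * \<rho> * \<xi>) * (2 ^ n * \<xi> ^ n) + (\<Sum>k<n. norm (fps_nth a k) * (2 ^ n * \<xi> ^ n)) * exp (2 * \<rho> * \<xi>)"
      proof (intro add_mono)
        have "norm (borel_far (of_real \<xi>)) \<le> (\<bar>\<alpha> 0\<bar> * exp (2 * \<rho> * \<xi>)) * 1" using al0[OF xi] by simp
        also have "\<dots> \<le> \<bar>\<alpha> 0\<bar> * exp (2 * \<rho> * \<xi>) * (2 ^ n * \<xi> ^ n)" using p0 by (intro mult_left_mono) auto
        finally show "norm (borel_far (of_real \<xi>)) \<le> \<bar>\<alpha> 0\<bar> * exp (2 * \<rho> * \<xi>) * (2 ^ n * \<xi> ^ n)" .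
        have "(\<Sum>k<n. norm (fps_nth a k) * \<xi> ^ k) \<le> (\<Sum>k<n. norm (fps_nth a k) * (2 ^ n * \<xi> ^ n)) * 1"
          unfolding mult_1_right by (intro sum_mono mult_left_mono pw) auto
        also have "\<dots> \<le> (\<Sum>k<n. norm (fps_nth a k) * (2 ^ n * \<xi> ^ n)) * exp (2 * \<rho> * \<xi>)"
          using e1 xi by (intro mult_left_mono sum_nonneg) auto
        finally show "(\<Sum>k<n. norm (fps_nth a k) * \<xi> ^ k) \<le> (\<Sum>k<n. norm (fps_nth a k) * (2 ^ n * \<xi> ^ n)) * exp (2 * \<rho> * \<xi>)" .
      qed
      also have "\<dots> = (2 ^ n * (\<bar>\<alpha> 0\<bar> + (\<Sum>k<n. norm (fps_nth a k)))) * \<xi> ^ n * exp (2 * \<rho> * \<xi>)"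
        unfolding sum_distrib_right[symmetric] by (simp add: algebra_simps)
      also have "\<dots> \<le> D * \<xi> ^ n * exp (2 * \<rho> * \<xi>)"
        using xi D10 by (intro mult_right_mono) (auto simp: D_def)
      finally show ?thesis by (simp add: a_def)
    qed
  qed
qed

text \<open>Watson's lemma: the Taylor remainder of order n integrates to a multiple of 1 / (Re z -
  2 \<rho>)^(n+1). Order N = n + 1 matches n Borel coefficients because the constant term of the
  formal series is 0.\<close>

theorem asymptotic_plus: "asymptotic_to cone_filter pp formal_series"
  unfolding asymptotic_to_def
proof
  fix N show "(\<lambda>z. pp z - eval_fps (fps_cutoff N formal_series) (inverse z)) \<in> O[cone_filter](\<lambda>z. inverse z ^ N)"
  proof (cases N)
    case 0
    have "(\<lambda>z. pp z) \<in> O[cone_filter](\<lambda>z. 1)"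
      by (rule bigoI[of _ M])
         (use eventually_cone_Re_ge[of "R + 1"] pp_bd in \<open>auto elim!: eventually_mono simp: right_dom_def\<close>)
    thus ?thesis using 0 by simp
  next
    case (Suc n)
    obtain D where D: "D \<ge> 0" "\<And>\<xi>. \<xi> > 0 \<Longrightarrow> norm (borel_far (of_real \<xi>) - (\<Sum>k<n. fps_nth borel_series k * of_real \<xi> ^ k)) \<le> D * \<xi> ^ n * exp (2 * \<rho> * \<xi>)"
      by (rule borel_far_taylor) blast
    have bd: "norm (pp z - eval_fps (fps_cutoff N formal_series) (inverse z)) \<le> (D * fact n * 4 ^ N) * norm (inverse z ^ N)"
      if z: "Re z \<ge> 4 * \<rho>" "\<bar>Im z\<bar> \<le> Re z" for z
    proof -
      have zp: "Re z > 0" "Re z > 2 * \<rho>" using z R by auto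
      define c where "c = Re z - 2 * \<rho>"
      have c: "c > 0" using zp by (simp add: c_def)
      \<comment> \<open>From |z| \<le> 2 Re z and 2 \<rho> \<le> Re z / 2; the source of the factor
        4^N.\<close>
      have "norm z \<le> 4 * c" using cone_norm_le[OF z(2)] z(1) by (simp add: c_def)
      have mono: "set_integrable lborel {0<..} (\<lambda>\<xi>. fps_nth borel_series k * (of_real \<xi> ^ k * exp (- z * of_real \<xi>)))"
        and mono_val: "(LBINT \<xi>:{0<..}. fps_nth borel_series k * (of_real \<xi> ^ k * exp (- z * of_real \<xi>))) = fps_nth borel_series k * (fact k / z ^ Suc k)" for k
      proof -
        have "set_integrable lborel {0<..} (\<lambda>s. of_real s ^ k * exp (- z * of_real s))"
          by (rule set_integrable_continuous_bound[OF _ _ set_integrable_power_exp_ray[OF zp(1), of k]])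
             (auto intro!: continuous_intros simp: norm_mult norm_power)
        thus "set_integrable lborel {0<..} (\<lambda>\<xi>. fps_nth borel_series k * (of_real \<xi> ^ k * exp (- z * of_real \<xi>)))" by (rule set_integrable_mult_right)
        show "(LBINT \<xi>:{0<..}. fps_nth borel_series k * (of_real \<xi> ^ k * exp (- z * of_real \<xi>))) = fps_nth borel_series k * (fact k / z ^ Suc k)"
          by (simp only: set_integral_mult_right laplace_power[OF zp(1)])
      qed
      have sumint: "set_integrable lborel {0<..} (\<lambda>\<xi>. \<Sum>k<m. fps_nth borel_series k * (of_real \<xi> ^ k * exp (- z * of_real \<xi>))) \<and>
          (LBINT \<xi>:{0<..}. \<Sum>k<m. fps_nth borel_series k * (of_real \<xi> ^ k * exp (- z * of_real \<xi>))) = (\<Sum>k<m. fps_nth borel_series k * (fact k / z ^ Suc k))" for m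
      proof (induction m)
        case 0 thus ?case by (simp add: set_integrable_def set_lebesgue_integral_def)
      next
        case (Suc m)
        show ?case unfolding sum.lessThan_Suc
          using set_integral_add[OF conjunct1[OF Suc] mono[of m]] Suc mono_val[of m] by simp
      qed
      have 0: "0 \<in> arc_plus" by (simp add: arc_plus_def)
      obtain A where A: "exp_bounded_ray borel_far 0 A (2 * \<rho>)" by (rule exp_bounded_ray_far[OF 0])
      have fint: "set_integrable lborel {0<..} (\<lambda>\<xi>. exp (- z * of_real \<xi>) * borel_far (of_real \<xi>))"
        using laplace_integrable[OF A, of z] zp by simp
      have "pp z = (LBINT \<xi>:{0<..}. exp (- z * of_real \<xi>) * borel_far (of_real \<xi>))"
        using laplace_borel_far[OF 0, of z] zp by (simp add: laplace_def)
      moreover have "eval_fps (fps_cutoff N formal_series) (inverse z) = (\<Sum>k<n. fps_nth borel_series k * (fact k / z ^ Suc k))"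
      proof -
        have "eval_fps (fps_cutoff N formal_series) (inverse z) = (\<Sum>k<Suc n. fps_nth formal_series k * inverse z ^ k)"
          by (simp add: eval_fps_cutoff Suc)
        also have "\<dots> = (\<Sum>k<n. fps_nth formal_series (Suc k) * inverse z ^ Suc k)"
          by (subst sum.lessThan_Suc_shift) simp
        also have "\<dots> = (\<Sum>k<n. fps_nth borel_series k * (fact k / z ^ Suc k))"
          by (intro sum.cong refl) (simp add: formal_series_nth_Suc field_simps)
        finally show ?thesis .
      qed
      ultimately have "pp z - eval_fps (fps_cutoff N formal_series) (inverse z) =
          (LBINT \<xi>:{0<..}. exp (- z * of_real \<xi>) * borel_far (of_real \<xi>) - (\<Sum>k<n. fps_nth borel_series k * (of_real \<xi> ^ k * exp (- z * of_real \<xi>))))"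
        using set_integral_diff(2)[OF fint conjunct1[OF sumint[of n]]] sumint[of n] by simp
      also have "norm \<dots> \<le> (LBINT \<xi>:{0<..}. D * (\<xi> ^ n * exp (- c * \<xi>)))"
      proof (rule set_integral_norm_le)
        show "set_integrable lborel {0<..} (\<lambda>\<xi>. D * (\<xi> ^ n * exp (- c * \<xi>)))"
          by (intro set_integrable_mult_right set_integrable_power_exp_ray c)
        show "set_integrable lborel {0<..} (\<lambda>\<xi>. exp (- z * of_real \<xi>) * borel_far (of_real \<xi>) - (\<Sum>k<n. fps_nth borel_series k * (of_real \<xi> ^ k * exp (- z * of_real \<xi>))))"
          by (rule set_integral_diff(1)[OF fint conjunct1[OF sumint[of n]]])
        fix \<xi> :: real assume "\<xi> \<in> {0<..}"
        hence xi: "\<xi> > 0" by simp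
        have "exp (- z * of_real \<xi>) * borel_far (of_real \<xi>) - (\<Sum>k<n. fps_nth borel_series k * (of_real \<xi> ^ k * exp (- z * of_real \<xi>)))
          = exp (- z * of_real \<xi>) * (borel_far (of_real \<xi>) - (\<Sum>k<n. fps_nth borel_series k * of_real \<xi> ^ k))"
          by (simp add: right_diff_distrib sum_distrib_left mult_ac)
        also have "norm \<dots> \<le> exp (- Re z * \<xi>) * (D * \<xi> ^ n * exp (2 * \<rho> * \<xi>))"
          unfolding norm_mult using D(2)[OF xi] by (intro mult_mono) auto
        also have "\<dots> = D * (\<xi> ^ n * exp (- c * \<xi>))" by (simp add: c_def algebra_simps flip: exp_add)
        finally show "norm (exp (- z * of_real \<xi>) * borel_far (of_real \<xi>) - (\<Sum>k<n. fps_nth borel_series k * (of_real \<xi> ^ k * exp (- z * of_real \<xi>)))) \<le> D * (\<xi> ^ n * exp (- c * \<xi>))" .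
      qed
      also have "\<dots> = D * (fact n / c ^ N)"
        unfolding Suc by (simp only: set_integral_mult_right set_integral_power_exp_ray[OF c])
      also have "\<dots> \<le> D * (fact n * (4 ^ N * norm (inverse z ^ N)))"
      proof (intro mult_left_mono D(1))
        have z0: "norm z > 0" using zp by auto
        have "norm z ^ N \<le> (4 * c) ^ N" using \<open>norm z \<le> 4 * c\<close> by (intro power_mono) auto
        hence "1 / c ^ N \<le> 4 ^ N * (1 / norm z ^ N)" using z0 c by (simp add: field_simps power_mult_distrib)
        hence "fact n * (1 / c ^ N) \<le> fact n * (4 ^ N * (1 / norm z ^ N))" by (intro mult_left_mono) auto
        thus "fact n / c ^ N \<le> fact n * (4 ^ N * norm (inverse z ^ N))" by (simp add: norm_inverse norm_power power_inverse inverse_eq_divide norm_divide power_divide)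
      qed
      finally show ?thesis by (simp add: mult_ac)
    qed
    show ?thesis
      by (rule bigoI[of _ "D * fact n * 4 ^ N"]) (use eventually_cone_Re_ge[of "4 * \<rho>"] bd in \<open>auto elim!: eventually_mono\<close>)
  qed
qed

end

subsection \<open>Fatou coordinates\<close>

text \<open>Comparison with the integral of 1 / ((x + t)^2 + y^2), whose primitive arctan ((x + t) /
  y) / y varies by at most pi / y. Within a unit interval the integrand drops by a factor of at most
  2, hence 2 pi, rounded up to 7. The bound does not involve Re z, so it holds far to the left as
  well.\<close>

lemma sum_inverse_square_Im:
  fixes z :: complex
  assumes y: "\<bar>Im z\<bar> \<ge> 2"
  shows "(\<Sum>k<n. 1 / (norm (z + of_nat k))\<^sup>2) \<le> 7 / \<bar>Im z\<bar>"
proof -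
  define x y where "x = Re z" and "y = \<bar>Im z\<bar>"
  have y: "y \<ge> 2" using assms by (simp add: y_def)
  define G where "G = (\<lambda>t::real. arctan ((x + t) / y) / y)"
  have y4: "y\<^sup>2 \<ge> 4" using power_mono[of 2 y 2] y by simp
  have norm2: "(norm (z + of_nat k))\<^sup>2 = (x + k)\<^sup>2 + y\<^sup>2" for k
    by (simp add: cmod_power2 x_def y_def)
  have G': "(G has_real_derivative 1 / ((x + t)\<^sup>2 + y\<^sup>2)) (at t)" for t
  proof -
    have "(G has_real_derivative inverse (1 + ((x + t) / y)\<^sup>2) * (1 / y) / y) (at t)"
      unfolding G_def using y by (auto intro!: derivative_eq_intros)
    also have "inverse (1 + ((x + t) / y)\<^sup>2) * (1 / y) / y = 1 / ((x + t)\<^sup>2 + y\<^sup>2)"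
    proof -
      have "1 + ((x + t) / y)\<^sup>2 = ((x + t)\<^sup>2 + y\<^sup>2) / y\<^sup>2" using y by (subst power_divide) (simp add: field_simps)
      thus ?thesis using y by (simp add: power2_eq_square)
    qed
    finally show ?thesis .
  qed
  have step: "1 / ((x + k)\<^sup>2 + y\<^sup>2) \<le> 2 * (G (k + 1) - G k)" for k :: real
  proof -
    obtain \<xi> where xi: "k < \<xi>" "\<xi> < k + 1" "G (k + 1) - G k = (k + 1 - k) * (1 / ((x + \<xi>)\<^sup>2 + y\<^sup>2))"
      using MVT2[of k "k + 1" G "\<lambda>t. 1 / ((x + t)\<^sup>2 + y\<^sup>2)"] G' by auto
    have "(x + \<xi>)\<^sup>2 \<le> 2 * (x + k)\<^sup>2 + 2 * (\<xi> - k)\<^sup>2"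
      using sum_squares_ge_zero[of "(x + k) - (\<xi> - k)" 0] by (simp add: power2_eq_square algebra_simps)
    moreover have "(\<xi> - k)\<^sup>2 \<le> 1" using xi by (simp add: power_le_one)
    ultimately have "(x + \<xi>)\<^sup>2 + y\<^sup>2 \<le> 2 * ((x + k)\<^sup>2 + y\<^sup>2)" using y4 by simp
    moreover have pos: "(x + t)\<^sup>2 + y\<^sup>2 > 0" for t using y4 zero_le_power2[of "x + t"] by linarith
    ultimately have "2 / (2 * ((x + k)\<^sup>2 + y\<^sup>2)) \<le> 2 / ((x + \<xi>)\<^sup>2 + y\<^sup>2)"
      by (intro divide_left_mono mult_pos_pos pos) simp_all
    hence "1 / ((x + k)\<^sup>2 + y\<^sup>2) \<le> 2 * ((k + 1 - k) * (1 / ((x + \<xi>)\<^sup>2 + y\<^sup>2)))"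
      by (subst (asm) mult_divide_mult_cancel_left_if[of 2 1, simplified mult_1_right]) simp
    thus ?thesis by (simp only: xi(3))
  qed
  have step': "1 / (norm (z + of_nat k))\<^sup>2 \<le> 2 * (G (real (Suc k)) - G (real k))" for k
  proof -
    have "real (Suc k) = real k + 1" by simp
    thus ?thesis using step[of "real k"] by (simp only: norm2)
  qed
  have "(\<Sum>k<n. 1 / (norm (z + of_nat k))\<^sup>2) \<le> (\<Sum>k<n. 2 * (G (real (Suc k)) - G (real k)))"
    by (rule sum_mono) (rule step')
  also have "\<dots> = 2 * (G n - G 0)" unfolding sum_distrib_left[symmetric]
    by (subst sum_lessThan_telescope[where f = "\<lambda>k. G (real k)"]) simp
  also have "\<dots> \<le> 2 * (pi / y)"
  proof -
    have "arctan ((x + real n) / y) \<le> pi / 2" "- (pi / 2) \<le> arctan ((x + 0) / y)"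
      using arctan_bounded[of "(x + real n) / y"] arctan_bounded[of "(x + 0) / y"] by simp_all
    hence "(arctan ((x + real n) / y) - arctan ((x + 0) / y)) / y \<le> pi / y"
      using y by (intro divide_right_mono) linarith+
    thus ?thesis by (simp add: G_def diff_divide_distrib)
  qed
  also have "\<dots> \<le> 7 / y" using y pi_less_4 pi_approx by (simp add: field_simps)
  finally show ?thesis by (simp add: y_def)
qed

text \<open>As Re z > 0, |z + k|^2 \<ge> |z|^2 + k^2 \<ge> (|z| + k)^2 / 2, and with m = |z| the
  bound 1 / (m + k)^2 is below a telescoping difference of 1 / (m + k - 1). The constant 7 is
  generous, to match the estimate in Im z.\<close>

lemma sum_inverse_square_Re:
  fixes z :: complex
  assumes x: "Re z \<ge> 2"
  shows "(\<Sum>k<n. 1 / (norm (z + of_nat k))\<^sup>2) \<le> 7 / Re z"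
proof -
  define m where "m = norm z"
  have m: "m \<ge> Re z" unfolding m_def by (rule complex_Re_le_cmod)
  have step: "1 / (norm (z + of_nat k))\<^sup>2 \<le> 2 * (- 1 / (m + real (Suc k) - 1) - - 1 / (m + real k - 1))" for k
  proof -
    have "(norm (z + of_nat k))\<^sup>2 = m\<^sup>2 + 2 * real k * Re z + (real k)\<^sup>2"
      unfolding m_def cmod_power2 by (simp add: power2_eq_square algebra_simps)
    moreover have "2 * real k * Re z \<ge> 0" using x by simp
    moreover have "(m + real k)\<^sup>2 \<le> 2 * (m\<^sup>2 + (real k)\<^sup>2)"
      using sum_squares_ge_zero[of "m - real k" 0] by (simp add: power2_eq_square algebra_simps)
    ultimately have le: "(m + real k)\<^sup>2 \<le> 2 * (norm (z + of_nat k))\<^sup>2" by (simp add: mult.commute)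
    have mk: "m + real k \<ge> 2" using m x by simp
    hence A: "(m + real k)\<^sup>2 > 0" by simp
    have B: "(norm (z + of_nat k))\<^sup>2 > 0" using le A by linarith
    have "1 / (norm (z + of_nat k))\<^sup>2 \<le> 2 / (m + real k)\<^sup>2"
      unfolding pos_le_divide_eq[OF A] times_divide_eq_left pos_divide_le_eq[OF B] using le by simp
    also have "\<dots> \<le> 2 / ((m + real k) * (m + real k - 1))"
      using mk by (intro divide_left_mono) (auto simp: power2_eq_square)
    also have "\<dots> = 2 * (- 1 / (m + real (Suc k) - 1) - - 1 / (m + real k - 1))"
      using mk by (simp add: field_simps)
    finally show ?thesis .
  qed
  have "(\<Sum>k<n. 1 / (norm (z + of_nat k))\<^sup>2) \<le> (\<Sum>k<n. 2 * (- 1 / (m + real (Suc k) - 1) - - 1 / (m + real k - 1)))"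
    by (intro sum_mono step)
  also have "\<dots> = 2 * (- 1 / (m + real n - 1) - - 1 / (m + real 0 - 1))"
    unfolding sum_distrib_left[symmetric]
    by (subst sum_lessThan_telescope[where f = "\<lambda>k. - 1 / (m + real k - 1)"]) simp
  also have "\<dots> \<le> 2 / (m - 1)" using m x by simp
  also have "\<dots> \<le> 7 / Re z" using m x by (simp add: field_simps)
  finally show ?thesis .
qed

lemma right_dom_add_nat: "z \<in> right_dom R \<Longrightarrow> z + of_nat k \<in> right_dom R"
  by (auto simp: right_dom_def)

lemma right_dom_norm: "z \<in> right_dom R \<Longrightarrow> norm z > R"
  using complex_Re_le_cmod[of z] abs_Im_le_cmod[of z] by (auto simp: right_dom_def)

lemma right_dom_mono: "R \<le> R' \<Longrightarrow> z \<in> right_dom R' \<Longrightarrow> z \<in> right_dom R"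
  by (auto simp: right_dom_def)

lemma right_dom_perturb:
  assumes "z \<in> right_dom (R + r)" "norm (w - z) \<le> r" shows "w \<in> right_dom R"
  using assms abs_Re_le_cmod[of "w - z"] abs_Im_le_cmod[of "w - z"] by (auto simp: right_dom_def)

text \<open>b stands for f - id - 1, of order z^-2. It is not tied to a germ, so that the reflected
  inverse of \<open>F\<close> can be an instance too.\<close>

locale parabolic =
  fixes b :: "complex \<Rightarrow> complex" and C R0 :: real
  assumes R0: "R0 \<ge> 1" and C: "C \<ge> 0" and hol: "b holomorphic_on {z. norm z > R0}"
    and bound: "\<And>z. norm z > R0 \<Longrightarrow> norm (b z) \<le> C / norm z ^ 2"
begin

definition F :: "complex \<Rightarrow> complex" where "F z = z + 1 + b z"

text \<open>The term 112 C makes 28 C / R1, the possible deviation of an orbit from the translation,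
  at most 1/4; the term 2 R0 keeps an orbit outside the disc of radius R0 even when its modulus is
  halved.\<close>

definition R1 :: real where "R1 = 2 * R0 + 2 + 112 * C"

text \<open>The limit of \<open>(F ^^ n) z - n - z\<close>, since b is the deviation of
  \<open>F\<close> from the translation by 1.\<close>

definition fatou :: "complex \<Rightarrow> complex" where "fatou z = (\<Sum>k. b ((F ^^ k) z))"

lemma R1: "R1 \<ge> 4" "R1 \<ge> R0" "28 * C / R1 \<le> 1/4"
  using R0 C by (auto simp: R1_def field_simps)

lemma sum_inverse_square:
  assumes z: "z \<in> right_dom R1"
  shows "(\<Sum>k<n. 1 / (norm (z + of_nat k))\<^sup>2) \<le> 7 / R1"
proof (cases "Re z > R1")
  case True
  have "(\<Sum>k<n. 1 / (norm (z + of_nat k))\<^sup>2) \<le> 7 / Re z" using True R1 by (intro sum_inverse_square_Re) auto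
  also have "\<dots> \<le> 7 / R1" using True R1 by (intro divide_left_mono) auto
  finally show ?thesis .
next
  case False
  hence im: "\<bar>Im z\<bar> > R1" using z by (auto simp: right_dom_def)
  have "(\<Sum>k<n. 1 / (norm (z + of_nat k))\<^sup>2) \<le> 7 / \<bar>Im z\<bar>" using im R1 by (intro sum_inverse_square_Im) auto
  also have "\<dots> \<le> 7 / R1" using im R1 by (intro divide_left_mono) auto
  finally show ?thesis .
qed

text \<open>Strong induction: the deviation from z + n is a sum of earlier values of b, hence at
  most 1/4 by the choice of \<open>R1\<close>, so the n-th point has modulus at least |z + n| / 2.
  Squaring this half gives the factor 4 in the next bound for b.\<close>

lemma orbit:
  assumes z: "z \<in> right_dom R1"
  shows "norm ((F ^^ n) z) > R0" and "norm (b ((F ^^ n) z)) \<le> 4 * C * (1 / (norm (z + of_nat n))\<^sup>2)"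
proof -
  have eq: "(F ^^ n) z = z + of_nat n + (\<Sum>k<n. b ((F ^^ k) z))" for n
    by (induction n) (simp_all add: F_def algebra_simps)
  have main: "norm ((F ^^ n) z) > R0 \<and> norm (b ((F ^^ n) z)) \<le> 4 * C * (1 / (norm (z + of_nat n))\<^sup>2)" for n
  proof (induction n rule: less_induct)
    case (less n)
    have "norm ((F ^^ n) z - (z + of_nat n)) = norm (\<Sum>k<n. b ((F ^^ k) z))" by (subst eq) simp
    also have "\<dots> \<le> (\<Sum>k<n. norm (b ((F ^^ k) z)))" by (rule norm_sum)
    also have "\<dots> \<le> (\<Sum>k<n. 4 * C * (1 / (norm (z + of_nat k))\<^sup>2))" using less by (intro sum_mono) auto
    also have "\<dots> = 4 * C * (\<Sum>k<n. 1 / (norm (z + of_nat k))\<^sup>2)" by (simp only: sum_distrib_left)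
    also have "\<dots> \<le> 4 * C * (7 / R1)" using C sum_inverse_square[OF z] by (intro mult_left_mono) auto
    also have "\<dots> \<le> 1/4" using R1 by simp
    finally have q: "norm ((F ^^ n) z - (z + of_nat n)) \<le> 1/4" .
    have zn: "norm (z + of_nat n) > R1" by (intro right_dom_norm right_dom_add_nat z)
    have "norm (z + of_nat n) \<le> norm ((F ^^ n) z) + norm ((F ^^ n) z - (z + of_nat n))"
      by (metis norm_triangle_sub add.commute norm_minus_commute)
    hence ge: "norm ((F ^^ n) z) \<ge> norm (z + of_nat n) / 2" using q zn R1 by simp
    have R0': "norm ((F ^^ n) z) > R0" using ge zn C by (simp add: R1_def)
    have "norm (b ((F ^^ n) z)) \<le> C / norm ((F ^^ n) z) ^ 2" by (rule bound[OF R0'])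
    also have "\<dots> \<le> C / (norm (z + of_nat n) / 2) ^ 2"
      using ge zn R1 C by (intro divide_left_mono power_mono mult_pos_pos zero_less_power) auto
    also have "\<dots> = 4 * C * (1 / (norm (z + of_nat n))\<^sup>2)" by (simp add: power_divide)
    finally show ?case using R0' by blast
  qed
  show "norm ((F ^^ n) z) > R0" "norm (b ((F ^^ n) z)) \<le> 4 * C * (1 / (norm (z + of_nat n))\<^sup>2)"
    using main by blast+
qed

lemma summable_orbit:
  assumes z: "z \<in> right_dom R1"
  shows "summable (\<lambda>k. 1 / (norm (z + of_nat k))\<^sup>2)" "summable (\<lambda>k. norm (b ((F ^^ k) z)))"
proof -
  show s: "summable (\<lambda>k. 1 / (norm (z + of_nat k))\<^sup>2)"
    by (rule bounded_imp_summable[of _ "7 / R1"])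
       (use sum_inverse_square[OF z, of "Suc _"] in \<open>simp_all add: lessThan_Suc_atMost\<close>)
  show "summable (\<lambda>k. norm (b ((F ^^ k) z)))"
    by (rule summable_comparison_test'[OF summable_mult[OF s, of "4 * C"], of 0]) (use orbit(2)[OF z] in auto)
qed

lemma norm_fatou_le:
  assumes z: "z \<in> right_dom R1" and s: "\<And>n. (\<Sum>k<n. 1 / (norm (z + of_nat k))\<^sup>2) \<le> s"
  shows "norm (fatou z) \<le> 4 * C * s"
proof -
  have "norm (fatou z) \<le> (\<Sum>k. norm (b ((F ^^ k) z)))"
    unfolding fatou_def by (rule summable_norm[OF summable_orbit(2)[OF z]])
  also have "\<dots> \<le> (\<Sum>k. 4 * C * (1 / (norm (z + of_nat k))\<^sup>2))"
    by (intro suminf_le orbit(2)[OF z] summable_orbit[OF z] summable_mult)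
  also have "\<dots> = 4 * C * (\<Sum>k. 1 / (norm (z + of_nat k))\<^sup>2)" by (rule suminf_mult[OF summable_orbit(1)[OF z]])
  also have "\<dots> \<le> 4 * C * s" using C
    by (intro mult_left_mono suminf_le_const summable_orbit[OF z] s) auto
  finally show ?thesis .
qed

lemma fatou_bounds:
  "z \<in> right_dom R1 \<Longrightarrow> norm (fatou z) \<le> 1/4"
  "Re z > R1 \<Longrightarrow> norm (fatou z) \<le> 28 * C / Re z"
  "\<bar>Im z\<bar> > R1 \<Longrightarrow> norm (fatou z) \<le> 28 * C / \<bar>Im z\<bar>"
proof -
  show "norm (fatou z) \<le> 1/4" if "z \<in> right_dom R1"
    using norm_fatou_le[OF that sum_inverse_square[OF that]] R1(3) by simp
  show "norm (fatou z) \<le> 28 * C / Re z" if "Re z > R1"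
    using norm_fatou_le[of z "7 / Re z"] sum_inverse_square_Re[of z] that R1(1) by (simp add: right_dom_def)
  show "norm (fatou z) \<le> 28 * C / \<bar>Im z\<bar>" if "\<bar>Im z\<bar> > R1"
    using norm_fatou_le[of z "7 / \<bar>Im z\<bar>"] sum_inverse_square_Im[of z] that R1(1) by (simp add: right_dom_def)
qed

lemma orbit_holomorphic: "(\<lambda>z. (F ^^ n) z) holomorphic_on right_dom R1"
proof (induction n)
  case (Suc n)
  have "(\<lambda>z. b ((F ^^ n) z)) holomorphic_on right_dom R1"
    using holomorphic_on_compose_gen[OF Suc hol] orbit(1) by (auto simp: o_def)
  thus ?case unfolding funpow.simps o_def F_def[of "(F ^^ n) _"] by (intro holomorphic_intros Suc)
qed auto

text \<open>Weierstrass test on discs: for k \<ge> 2 |w| one has |w + k| \<ge> k / 2, and the terms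
  are at most 16 C / k^2.\<close>

lemma fatou_holomorphic: "fatou holomorphic_on right_dom R1"
proof (rule holomorphic_uniform_sequence[OF open_right_dom])
  show "(\<lambda>z. \<Sum>k<n. b ((F ^^ k) z)) holomorphic_on right_dom R1" for n
  proof (intro holomorphic_intros)
    show "(\<lambda>z. b ((F ^^ k) z)) holomorphic_on right_dom R1" for k
      using holomorphic_on_compose_gen[OF orbit_holomorphic hol] orbit(1) by (auto simp: o_def)
  qed
  fix z assume "z \<in> right_dom R1"
  then obtain d where d: "d > 0" "cball z d \<subseteq> right_dom R1" using open_right_dom open_contains_cball by blast
  define B where "B = norm z + d"
  have "uniform_limit (cball z d) (\<lambda>n z. \<Sum>k<n. b ((F ^^ k) z)) (\<lambda>z. \<Sum>k. b ((F ^^ k) z)) sequentially"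
  proof (rule Weierstrass_m_test_ev)
    have "\<forall>\<^sub>F k in sequentially. real k \<ge> 2 * B \<and> k > 0"
      using filterlim_real_sequentially eventually_gt_at_top[of 0] by (auto simp: filterlim_at_top eventually_conj_iff)
    thus "\<forall>\<^sub>F k in sequentially. \<forall>w\<in>cball z d. norm (b ((F ^^ k) w)) \<le> 16 * C * (1 / real k ^ 2)"
    proof eventually_elim
      case (elim k)
      show ?case
      proof
        fix w assume w: "w \<in> cball z d"
        have "norm w \<le> B" using w norm_triangle_ineq2[of w z] by (simp add: B_def dist_norm norm_minus_commute)
        moreover have "real k - norm w \<le> norm (w + of_nat k)" using norm_triangle_ineq4[of "w + of_nat k" w] by simp
        ultimately have ge: "norm (w + of_nat k) \<ge> real k / 2" using elim by linarith
        have "norm (b ((F ^^ k) w)) \<le> 4 * C * (1 / (norm (w + of_nat k))\<^sup>2)" using d w by (intro orbit(2)) auto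
        also have "\<dots> \<le> 4 * C * (1 / (real k / 2)\<^sup>2)" using ge elim C
          by (intro mult_left_mono divide_left_mono power_mono mult_pos_pos zero_less_power) auto
        also have "\<dots> = 16 * C * (1 / real k ^ 2)" by (simp add: power_divide)
        finally show "norm (b ((F ^^ k) w)) \<le> 16 * C * (1 / real k ^ 2)" .
      qed
    qed
    show "summable (\<lambda>k. 16 * C * (1 / real k ^ 2))"
      using inverse_power_summable[of 2, where ?'a = real] by (intro summable_mult) (simp add: inverse_eq_divide)
  qed
  thus "\<exists>d>0. cball z d \<subseteq> right_dom R1 \<and> uniform_limit (cball z d) (\<lambda>n z. \<Sum>k<n. b ((F ^^ k) z)) fatou sequentially"
    unfolding fatou_def using d by blast
qed

lemma fatou_eq:
  assumes z: "z \<in> right_dom R1"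
  shows "fatou (F z) = fatou z - b z"
proof -
  have "summable (\<lambda>k. b ((F ^^ k) z))" by (rule summable_norm_cancel[OF summable_orbit(2)[OF z]])
  from suminf_split_head[OF this] show ?thesis by (simp add: fatou_def funpow_Suc_right del: funpow.simps)
qed

end

text \<open>Cauchy's estimate gives \<phi> the Lipschitz constant 1/2 near T, so id + \<phi> is
  injective there; Brouwer's theorem for w -> z - \<phi>(w) on a disc of radius 1/4 shows that each
  z in T is attained. Injectivity is proved on the unit neighbourhood V of T, because preimages of
  points of T need not lie in T; hence the last conclusion for all w close to T.\<close>

lemma near_identity_inverse:
  assumes S: "open S" and hol: "\<phi> holomorphic_on S" and bd: "\<And>z. z \<in> S \<Longrightarrow> norm (\<phi> z) \<le> 1/4"
    and T: "open T" "\<And>z. z \<in> T \<Longrightarrow> cball z 2 \<subseteq> S"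
  obtains \<psi> where "\<psi> holomorphic_on T" "\<And>z. z \<in> T \<Longrightarrow> norm (\<psi> z) \<le> 1/4"
    "\<And>z. z \<in> T \<Longrightarrow> \<phi> (z + \<psi> z) = - \<psi> z" "\<And>z w. z \<in> T \<Longrightarrow> dist z w < 1 \<Longrightarrow> \<psi> (w + \<phi> w) = - \<phi> w"
proof -
  define V where "V = (\<Union>z\<in>T. ball z 1)"
  have V: "open V" unfolding V_def by auto
  have VS: "cball w 1 \<subseteq> S" if "w \<in> V" for w
  proof
    fix x assume x: "x \<in> cball w 1"
    obtain z where z: "z \<in> T" "dist z w < 1" using \<open>w \<in> V\<close> by (auto simp: V_def)
    have "dist z x \<le> 2" using z x dist_triangle[of z x w] by simp
    thus "x \<in> S" using T(2)[OF z(1)] by auto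
  qed
  have VS': "V \<subseteq> S" using VS by force
  define v where "v = (\<lambda>w. w + \<phi> w)"
  have vhol: "v holomorphic_on V" unfolding v_def by (intro holomorphic_intros holomorphic_on_subset[OF hol VS'])
  have inj: "inj_on v V"
  proof (rule inj_onI)
    fix w w' assume w: "w \<in> V" "w' \<in> V" "v w = v w'"
    have wS: "w \<in> S" "w' \<in> S" using w VS' by auto
    have eq: "w - w' = \<phi> w' - \<phi> w" using w(3) by (simp add: v_def algebra_simps)
    have "norm (w - w') \<le> 1/2" unfolding eq using bd[OF wS(1)] bd[OF wS(2)] norm_triangle_ineq4[of "\<phi> w'" "\<phi> w"] by linarith
    have "norm (\<phi> w' - \<phi> w) \<le> 1/2 * norm (w' - w)"
    proof (rule field_differentiable_bound[of "cball w (1/2)" \<phi> "deriv \<phi>"])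
      fix x assume x: "x \<in> cball w (1/2)"
      have sub: "cball x (1/2) \<subseteq> S"
      proof
        fix y assume "y \<in> cball x (1/2)"
        hence "dist w y \<le> 1" using x dist_triangle[of w y x] by simp
        thus "y \<in> S" using VS[OF w(1)] by auto
      qed
      have xS: "x \<in> S" using sub by auto
      show "(\<phi> has_field_derivative deriv \<phi> x) (at x within cball w (1/2))"
        by (rule has_field_derivative_at_within[OF holomorphic_derivI[OF hol S xS]])
      have "norm ((deriv ^^ 1) \<phi> x) \<le> fact 1 * (1/4) / (1/2) ^ 1"
      proof (rule Cauchy_inequality)
        show "\<phi> holomorphic_on ball x (1/2)" using sub by (intro holomorphic_on_subset[OF hol]) auto
        show "continuous_on (cball x (1/2)) \<phi>" by (rule continuous_on_subset[OF holomorphic_on_imp_continuous_on[OF hol] sub])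
        show "norm (\<phi> y) \<le> 1/4" if "norm (x - y) = 1/2" for y
          using sub that by (intro bd) (auto simp: dist_norm)
      qed simp
      thus "norm (deriv \<phi> x) \<le> 1/2" by simp
    qed (use \<open>norm (w - w') \<le> 1/2\<close> in \<open>auto simp: dist_norm\<close>)
    hence "norm (w - w') \<le> 1/2 * norm (w - w')" by (metis eq norm_minus_commute)
    hence "norm (w - w') \<le> 0" by simp
    thus "w = w'" by simp
  qed
  obtain g where g: "g holomorphic_on (v ` V)" "\<And>w. w \<in> V \<Longrightarrow> g (v w) = w"
    using holomorphic_has_inverse[OF vhol V inj] by metis
  have surj: "\<exists>w\<in>V. v w = z \<and> norm (w - z) \<le> 1/4" if z: "z \<in> T" for z
  proof -
    have sub: "cball z (1/4) \<subseteq> S" using T(2)[OF z] by (auto simp: subset_iff)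
    obtain w where w: "w \<in> cball z (1/4)" "z - \<phi> w = w"
    proof (rule brouwer[of "cball z (1/4)" "\<lambda>w. z - \<phi> w"])
      show "continuous_on (cball z (1/4)) (\<lambda>w. z - \<phi> w)"
        by (intro continuous_intros continuous_on_subset[OF holomorphic_on_imp_continuous_on[OF hol] sub])
      show "(\<lambda>w. z - \<phi> w) \<in> cball z (1/4) \<rightarrow> cball z (1/4)" using bd sub by (auto simp: dist_norm)
    qed auto
    have "w \<in> V" unfolding V_def using z w(1) by (auto intro!: bexI[of _ z])
    moreover have "v w = z" using w(2) by (simp add: v_def algebra_simps)
    ultimately show ?thesis using w(1) by (auto simp: dist_norm norm_minus_commute)
  qed
  show ?thesis
  proof (rule that[of "\<lambda>z. g z - z"])
    show "(\<lambda>z. g z - z) holomorphic_on T"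
      using surj by (intro holomorphic_intros holomorphic_on_subset[OF g(1)]) force
    show "norm (g z - z) \<le> 1/4" if "z \<in> T" for z using surj[OF that] g(2) by force
    show "\<phi> (z + (g z - z)) = - (g z - z)" if "z \<in> T" for z
      using surj[OF that] g(2) by (force simp: v_def algebra_simps)
    show "g (w + \<phi> w) - (w + \<phi> w) = - \<phi> w" if "z \<in> T" "dist z w < 1" for z w
      using g(2)[of w] that by (auto simp: v_def V_def)
  qed
qed

definition exterior :: "real \<Rightarrow> complex set" where "exterior R = {z. norm z > R}"

lemma open_exterior: "open (exterior R)"
proof -
  have "exterior R = - cball 0 R" by (auto simp: exterior_def)
  thus ?thesis by (simp only: open_Compl closed_cball)
qed

lemma left_dom_uminus: "z \<in> left_dom R \<longleftrightarrow> - z \<in> right_dom R"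
  by (auto simp: left_dom_def right_dom_def)

lemma exterior_perturb: "z \<in> exterior (R + r) \<Longrightarrow> norm (w - z) \<le> r \<Longrightarrow> w \<in> exterior R"
  using norm_triangle_ineq2[of z w] by (simp add: exterior_def norm_minus_commute)

context parabolic
begin

text \<open>
  In the coordinate \<open>- z\<close> the inverse of \<open>F\<close> is again of the same type; this yields the
  Fatou coordinate of the repelling side.
\<close>

lemma reflected_inverse:
  obtains b' C' R' where "parabolic b' C' R'" "R' \<ge> R0"
    "\<And>w. norm w > R' \<Longrightarrow> F (- parabolic.F b' w) = - w"
    "\<And>z. norm z > R' \<Longrightarrow> parabolic.F b' (- F z) = - z"
proof -
  \<comment> \<open>Makes |b| \<le> C / R \<le> 1/4, as \<open>near_identity_inverse\<close>
    demands.\<close>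
  define R where "R = max R0 (4 * C + 1)"
  have RR: "R \<ge> R0" "R \<ge> 1" "R \<ge> 4 * C" using R0 C by (auto simp: R_def)
  have bd: "norm (b z) \<le> 1/4" if "z \<in> exterior R" for z
  proof -
    have z: "norm z > R" using that by (simp add: exterior_def)
    have z0: "norm z > 0" "R > 0" "R \<le> norm z * norm z" using z RR mult_mono[of 1 "norm z" R "norm z"] by auto
    have "norm (b z) \<le> C / (norm z)\<^sup>2" using z RR by (intro bound) auto
    also have "\<dots> \<le> C / R" using z0 C by (intro divide_left_mono mult_pos_pos) (auto simp: power2_eq_square)
    also have "\<dots> \<le> 1/4" using RR by (simp add: field_simps)
    finally show ?thesis .
  qed
  have hol': "b holomorphic_on exterior R" using hol RR by (elim holomorphic_on_subset) (auto simp: exterior_def)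
  have T: "cball z 2 \<subseteq> exterior R" if "z \<in> exterior (R + 2)" for z
    using exterior_perturb[OF that] by (auto simp: dist_norm norm_minus_commute)
  obtain \<psi> where psi: "\<psi> holomorphic_on exterior (R + 2)" "\<And>z. z \<in> exterior (R + 2) \<Longrightarrow> norm (\<psi> z) \<le> 1/4"
    "\<And>z. z \<in> exterior (R + 2) \<Longrightarrow> b (z + \<psi> z) = - \<psi> z" "\<And>z w. z \<in> exterior (R + 2) \<Longrightarrow> dist z w < 1 \<Longrightarrow> \<psi> (w + b w) = - b w"
    by (rule near_identity_inverse[where T = "exterior (R + 2)", OF open_exterior hol' bd open_exterior T];
        (assumption | (rule that; assumption)))
  \<comment> \<open>\<open>F\<close> is id + b followed by the translation by 1, so its inverse is w
    -> (w - 1) + \<psi>(w - 1); conjugating with -id gives w + 1 - \<psi>(-w - 1).\<close>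
  define b' where "b' = (\<lambda>w. - \<psi> (- w - 1))"
  define R' where "R' = 2 * R + 6"
  have ext: "- w - 1 \<in> exterior (R + 2)" if "norm w > R'" for w :: complex
    using that norm_triangle_ineq2[of "-w" 1] RR by (simp add: R'_def exterior_def)
  interpret P: parabolic b' "4 * C" R'
  proof
    show "R' \<ge> 1" "4 * C \<ge> 0" using RR C by (auto simp: R'_def)
    have "\<psi> \<circ> (\<lambda>w. - w - 1) holomorphic_on {z. norm z > R'}"
      by (rule holomorphic_on_compose_gen[OF _ psi(1)]) (use ext in \<open>auto intro!: holomorphic_intros\<close>)
    hence "(\<lambda>w. \<psi> (- w - 1)) holomorphic_on {z. norm z > R'}" by (simp add: o_def)
    thus "b' holomorphic_on {z. norm z > R'}" unfolding b'_def by (intro holomorphic_intros)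
    fix w :: complex assume w: "norm w > R'"
    define u where "u = - w - 1"
    have u: "u \<in> exterior (R + 2)" using ext[OF w] by (simp add: u_def)
    have "norm (u + \<psi> u) \<ge> norm w - norm (1 - \<psi> u)"
      using norm_triangle_ineq2[of "-w" "1 - \<psi> u"] by (simp add: u_def algebra_simps)
    moreover have "norm (1 - \<psi> u) \<le> 5/4" using norm_triangle_ineq4[of 1 "\<psi> u"] psi(2)[OF u] by simp
    ultimately have ge: "norm (u + \<psi> u) \<ge> norm w / 2" using w RR by (simp add: R'_def)
    have gt: "norm (u + \<psi> u) > R0" using ge w RR by (simp add: R'_def)
    have "norm (b' w) = norm (b (u + \<psi> u))" using psi(3)[OF u] by (simp add: b'_def u_def)
    also have "\<dots> \<le> C / (norm (u + \<psi> u))\<^sup>2" by (rule bound[OF gt])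
    also have "\<dots> \<le> C / (norm w / 2)\<^sup>2" using ge w RR C by (intro divide_left_mono power_mono mult_pos_pos zero_less_power) (auto simp: R'_def)
    also have "\<dots> = 4 * C / (norm w)\<^sup>2" by (simp add: power_divide)
    finally show "norm (b' w) \<le> 4 * C / (norm w)\<^sup>2" .
  qed
  show ?thesis
  proof (rule that[of b' "4 * C" R'])
    show "parabolic b' (4 * C) R'" by (rule P.parabolic_axioms)
    show "R' \<ge> R0" using RR by (simp add: R'_def)
    fix w :: complex assume w: "norm w > R'"
    have "P.F w = w + 1 - \<psi> (- w - 1)" unfolding P.F_def by (simp add: b'_def)
    hence "- P.F w = (- w - 1) + \<psi> (- w - 1)" by simp
    thus "F (- P.F w) = - w" using psi(3)[OF ext[OF w]] by (simp only: F_def) simp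
    have "w \<in> exterior (R + 2)" using w RR by (simp add: exterior_def R'_def)
    hence "\<psi> (w + b w) = - b w" using psi(4)[of w w] by simp
    thus "P.F (- F w) = - w" unfolding F_def P.F_def by (simp add: b'_def algebra_simps)
  qed
qed

end

text \<open>
  \<open>id + \<phi>\<close> is a Fatou coordinate for \<open>F\<close> on the domain \<open>D\<close>, and \<open>id + \<psi>\<close> is its inverse.
\<close>

definition fatou_pair :: "complex set \<Rightarrow> (complex \<Rightarrow> complex) \<Rightarrow> real \<Rightarrow> real \<Rightarrow> (complex \<Rightarrow> complex) \<Rightarrow> (complex \<Rightarrow> complex) \<Rightarrow> bool" where
  "fatou_pair D F R K \<phi> \<psi> \<longleftrightarrow> \<phi> holomorphic_on D \<and> \<psi> holomorphic_on D \<and>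
     (\<forall>z\<in>D. norm (\<phi> z) \<le> 1/4 \<and> norm (\<psi> z) \<le> 1/4) \<and>
     (\<forall>z. \<bar>Im z\<bar> > R \<longrightarrow> norm (\<phi> z) \<le> K / \<bar>Im z\<bar> \<and> norm (\<psi> z) \<le> K / \<bar>Im z\<bar>) \<and>
     (\<forall>z\<in>D. F z + \<phi> (F z) = z + \<phi> z + 1) \<and>
     (\<forall>z\<in>D. \<phi> (z + \<psi> z) = - \<psi> z) \<and> (\<forall>z\<in>D. \<psi> (z + \<phi> z) = - \<phi> z) \<and> K \<ge> 0 \<and> R \<ge> 4"

lemma (in parabolic) fatou_pair_right:
  obtains R K \<phi> \<psi> where "fatou_pair (right_dom R) F R K \<phi> \<psi>" "R \<ge> R0"
    "\<And>z. Re z > R \<Longrightarrow> norm (\<phi> z) \<le> K / Re z \<and> norm (\<psi> z) \<le> K / Re z"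
proof -
  have T: "cball z 2 \<subseteq> right_dom R1" if "z \<in> right_dom (R1 + 2)" for z
    using right_dom_perturb[OF that] by (auto simp: dist_norm norm_minus_commute)
  obtain \<psi> where psi: "\<psi> holomorphic_on right_dom (R1 + 2)" "\<And>z. z \<in> right_dom (R1 + 2) \<Longrightarrow> norm (\<psi> z) \<le> 1/4"
    "\<And>z. z \<in> right_dom (R1 + 2) \<Longrightarrow> fatou (z + \<psi> z) = - \<psi> z" "\<And>z w. z \<in> right_dom (R1 + 2) \<Longrightarrow> dist z w < 1 \<Longrightarrow> \<psi> (w + fatou w) = - fatou w"
    by (rule near_identity_inverse[where T = "right_dom (R1 + 2)", OF open_right_dom fatou_holomorphic fatou_bounds(1) open_right_dom T];
        (assumption | (rule that; assumption)))
  \<comment> \<open>Twice the constant 28 C of \<open>fatou_bounds\<close>: \<psi>(z) = -\<phi>(z +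
    \<psi>(z)), and z + \<psi>(z) keeps at least half of the height or abscissa of z.\<close>
  define K where "K = 56 * C"
  have sub: "right_dom (R1 + 2) \<subseteq> right_dom R1" by (auto simp: right_dom_def)
  have psi_Im: "norm (\<psi> z) \<le> K / \<bar>Im z\<bar>" if "\<bar>Im z\<bar> > R1 + 2" for z
  proof -
    have z: "z \<in> right_dom (R1 + 2)" using that by (simp add: right_dom_def)
    have "\<bar>Im (\<psi> z)\<bar> \<le> 1/4" using abs_Im_le_cmod[of "\<psi> z"] psi(2)[OF z] by linarith
    hence im: "\<bar>Im (z + \<psi> z)\<bar> \<ge> \<bar>Im z\<bar> / 2" "\<bar>Im (z + \<psi> z)\<bar> > R1" unfolding plus_complex.sel using that R1 by linarith+
    have "norm (\<psi> z) = norm (fatou (z + \<psi> z))" using psi(3)[OF z] by simp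
    also have "\<dots> \<le> 28 * C / \<bar>Im (z + \<psi> z)\<bar>" by (rule fatou_bounds(3)[OF im(2)])
    also have "\<dots> \<le> 28 * C / (\<bar>Im z\<bar> / 2)" using im that R1 C by (intro divide_left_mono) auto
    finally show ?thesis by (simp add: K_def)
  qed
  have psi_Re: "norm (\<psi> z) \<le> K / Re z" if "Re z > R1 + 2" for z
  proof -
    have z: "z \<in> right_dom (R1 + 2)" using that by (simp add: right_dom_def)
    have "\<bar>Re (\<psi> z)\<bar> \<le> 1/4" using abs_Re_le_cmod[of "\<psi> z"] psi(2)[OF z] by linarith
    hence im: "Re (z + \<psi> z) \<ge> Re z / 2" "Re (z + \<psi> z) > R1" using that R1 by simp_all
    have "norm (\<psi> z) = norm (fatou (z + \<psi> z))" using psi(3)[OF z] by simp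
    also have "\<dots> \<le> 28 * C / Re (z + \<psi> z)" by (rule fatou_bounds(2)[OF im(2)])
    also have "\<dots> \<le> 28 * C / (Re z / 2)" using im that R1 C by (intro divide_left_mono) auto
    finally show ?thesis by (simp add: K_def)
  qed
  have K: "28 * C / x \<le> K / x" if "x > 0" for x using C that by (simp add: K_def divide_right_mono)
  show ?thesis
  proof (rule that[of "R1 + 2" K fatou \<psi>])
    show "fatou_pair (right_dom (R1 + 2)) F (R1 + 2) K fatou \<psi>"
      unfolding fatou_pair_def
    proof (intro conjI ballI allI impI)
      show "fatou holomorphic_on right_dom (R1 + 2)" by (rule holomorphic_on_subset[OF fatou_holomorphic sub])
      show "K \<ge> 0" "R1 + 2 \<ge> 4" using C R1 by (auto simp: K_def)
      show "norm (fatou z) \<le> K / \<bar>Im z\<bar>" if "R1 + 2 < \<bar>Im z\<bar>" for z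
        using fatou_bounds(3)[of z] K[of "\<bar>Im z\<bar>"] that R1 by linarith
      fix z assume z: "z \<in> right_dom (R1 + 2)"
      show "norm (fatou z) \<le> 1/4" using fatou_bounds(1) z sub by blast
      show "F z + fatou (F z) = z + fatou z + 1" using fatou_eq[of z] z sub by (auto simp: F_def)
      show "\<psi> (z + fatou z) = - fatou z" using psi(4)[OF z, of z] by simp
    qed (use psi psi_Im in auto)
    show "norm (fatou z) \<le> K / Re z \<and> norm (\<psi> z) \<le> K / Re z" if "Re z > R1 + 2" for z
      using psi_Re[OF that] fatou_bounds(2)[of z] K[of "Re z"] that R1 by linarith
  qed (use R1 in auto)
qed

lemma fatou_pair_mono:
  assumes "fatou_pair D F R K \<phi> \<psi>" "D' \<subseteq> D" "R \<le> R'" "K \<le> K'"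
  shows "fatou_pair D' F R' K' \<phi> \<psi>"
proof -
  have "K / \<bar>y\<bar> \<le> K' / \<bar>y\<bar>" for y :: real using assms(4) by (simp add: divide_right_mono)
  hence "norm w \<le> K / \<bar>y\<bar> \<Longrightarrow> norm w \<le> K' / \<bar>y\<bar>" for w :: complex and y by (rule order_trans[rotated])
  moreover have "\<phi> holomorphic_on D'" "\<psi> holomorphic_on D'"
    using assms(1,2) by (auto simp: fatou_pair_def elim: holomorphic_on_subset)
  ultimately show ?thesis using assms unfolding fatou_pair_def by (auto simp: subset_iff)
qed

lemma left_dom_mono: "R \<le> R' \<Longrightarrow> left_dom R' \<subseteq> left_dom R" and right_dom_mono': "R \<le> R' \<Longrightarrow> right_dom R' \<subseteq> right_dom R"
  by (auto simp: left_dom_def right_dom_def)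

text \<open>The right-hand pair of the reflected inverse, transported by z -> -z. Its functional
  equation is used at -F(z), where the reflected map returns -z; \<open>R''\<close> leaves room for
  this step.\<close>

lemma (in parabolic) fatou_pair_left:
  obtains R K \<phi> \<psi> where "fatou_pair (left_dom R) F R K \<phi> \<psi>" "R \<ge> R0"
    "\<And>z. Re z < - R \<Longrightarrow> norm (\<phi> z) \<le> K / - Re z \<and> norm (\<psi> z) \<le> K / - Re z"
proof -
  obtain b' C' R' where P: "parabolic b' C' R'" "R' \<ge> R0"
    "\<And>w. norm w > R' \<Longrightarrow> F (- parabolic.F b' w) = - w"
    "\<And>z. norm z > R' \<Longrightarrow> parabolic.F b' (- F z) = - z" by (rule reflected_inverse) (rule that; assumption)
  interpret P: parabolic b' C' R' by (rule P(1))
  obtain R K \<phi> \<psi> where fp: "fatou_pair (right_dom R) P.F R K \<phi> \<psi>" and R: "R \<ge> R'"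
    and Re: "\<And>z. Re z > R \<Longrightarrow> norm (\<phi> z) \<le> K / Re z \<and> norm (\<psi> z) \<le> K / Re z"
    by (rule P.fatou_pair_right) (rule that; assumption)
  define \<phi>' where "\<phi>' = (\<lambda>z. - \<phi> (- z))"
  define \<psi>' where "\<psi>' = (\<lambda>z. - \<psi> (- z))"
  have hol_refl: "(\<lambda>z. - g (- z)) holomorphic_on left_dom S" if "g holomorphic_on right_dom S" for g S
  proof -
    have "(g \<circ> uminus) holomorphic_on left_dom S"
      by (rule holomorphic_on_compose_gen[OF _ that]) (auto intro!: holomorphic_intros simp: left_dom_uminus)
    thus ?thesis by (intro holomorphic_intros) (simp add: o_def)
  qed
  have R4: "R \<ge> 4" using fp by (simp add: fatou_pair_def)
  have bsmall: "norm (F z - z) \<le> 2" if "norm z > R0 + C" for z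
  proof -
    have z: "norm z > R0" "norm z > C" "norm z > 1" using that C R0 by linarith+
    have "norm (b z) \<le> C / (norm z)\<^sup>2" by (rule bound[OF z(1)])
    also have "\<dots> \<le> 1"
    proof -
      have "C \<le> (norm z)\<^sup>2" using z C mult_mono[of C "norm z" 1 "norm z"] by (simp add: power2_eq_square)
      moreover have "(norm z)\<^sup>2 > 0" using z by (intro zero_less_power) linarith
      ultimately show ?thesis by (simp only: pos_divide_le_eq mult_1_left)
    qed
    finally show ?thesis using norm_triangle_ineq[of 1 "b z"] by (simp add: F_def)
  qed
  define R'' where "R'' = R + 2 + C"
  have sub: "left_dom R'' \<subseteq> left_dom R" using C by (intro left_dom_mono) (simp add: R''_def)
  show ?thesis
  proof (rule that[of R'' K \<phi>' \<psi>'])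
    show "R'' \<ge> R0" using R P(2) C by (simp add: R''_def)
    show "norm (\<phi>' z) \<le> K / - Re z \<and> norm (\<psi>' z) \<le> K / - Re z" if "Re z < - R''" for z
      using Re[of "- z"] that C by (simp add: \<phi>'_def \<psi>'_def R''_def)
    show "fatou_pair (left_dom R'') F R'' K \<phi>' \<psi>'" unfolding fatou_pair_def
    proof (intro conjI ballI allI impI)
      show "\<phi>' holomorphic_on left_dom R''" "\<psi>' holomorphic_on left_dom R''"
        using fp unfolding \<phi>'_def \<psi>'_def fatou_pair_def by (auto intro!: holomorphic_on_subset[OF hol_refl sub])
      show "K \<ge> 0" "R'' \<ge> 4" using fp C by (auto simp: fatou_pair_def R''_def)
      show "norm (\<phi>' z) \<le> K / \<bar>Im z\<bar>" "norm (\<psi>' z) \<le> K / \<bar>Im z\<bar>" if "R'' < \<bar>Im z\<bar>" for z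
      proof -
        have "\<bar>Im (- z)\<bar> > R" using that C by (simp add: R''_def)
        hence "norm (\<phi> (- z)) \<le> K / \<bar>Im (- z)\<bar> \<and> norm (\<psi> (- z)) \<le> K / \<bar>Im (- z)\<bar>"
          using fp unfolding fatou_pair_def by blast
        thus "norm (\<phi>' z) \<le> K / \<bar>Im z\<bar>" "norm (\<psi>' z) \<le> K / \<bar>Im z\<bar>" by (simp_all add: \<phi>'_def \<psi>'_def)
      qed
      fix z assume z: "z \<in> left_dom R''"
      have mz: "- z \<in> right_dom R''" using z by (simp add: left_dom_uminus)
      hence mz': "- z \<in> right_dom R" by (rule right_dom_mono[rotated]) (use C in \<open>simp add: R''_def\<close>)
      show "norm (\<phi>' z) \<le> 1/4" "norm (\<psi>' z) \<le> 1/4" using fp mz' by (auto simp: fatou_pair_def \<phi>'_def \<psi>'_def)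
      show "\<phi>' (z + \<psi>' z) = - \<psi>' z" "\<psi>' (z + \<phi>' z) = - \<phi>' z"
        using fp mz' by (auto simp: fatou_pair_def \<phi>'_def \<psi>'_def)
      have nz: "norm z > R''" using right_dom_norm[OF mz] by simp
      have "norm (- F z - - z) \<le> 2 + C" using bsmall[of z] nz R P(2) C by (simp add: R''_def norm_minus_commute)
      hence mF: "- F z \<in> right_dom R" using right_dom_perturb[of "- z" R "2 + C"] mz by (simp add: R''_def add.assoc)
      have "P.F (- F z) = - z" using P(4)[of z] nz R C by (simp add: R''_def)
      moreover have "P.F (- F z) + \<phi> (P.F (- F z)) = - F z + \<phi> (- F z) + 1"
        using fp mF unfolding fatou_pair_def by blast
      ultimately have e: "- z + \<phi> (- z) = - F z + \<phi> (- F z) + 1" by simp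
      show "F z + \<phi>' (F z) = z + \<phi>' z + 1" unfolding \<phi>'_def using arg_cong[OF e, of uminus] by (simp add: algebra_simps)
    qed
  qed
qed

subsection \<open>Periodic functions\<close>

lemma periodic_int_shift:
  fixes P :: "complex \<Rightarrow> complex" and n :: int
  assumes per: "\<And>z. Im z > \<sigma> \<Longrightarrow> P (z + 1) = P z" and z: "Im z > \<sigma>"
  shows "P (z + of_int n) = P z"
proof -
  have nat: "P (z + of_nat m) = P z" if "Im z > \<sigma>" for m z
  proof (induction m)
    case (Suc m)
    have "P (z + of_nat m + 1) = P (z + of_nat m)" by (rule per) (use that in simp)
    thus ?case using Suc by (simp add: add_ac)
  qed simp
  show ?thesis
  proof (cases "n \<ge> 0")
    case True
    thus ?thesis using nat[OF z, of "nat n"] by (simp add: of_nat_nat)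
  next
    case False
    have "P (z + of_int n + of_nat (nat (- n))) = P (z + of_int n)" by (rule nat) (use z in simp)
    thus ?thesis using False by (simp add: of_nat_nat)
  qed
qed

text \<open>By periodicity P is a function of q = exp (2 pi i z) on a punctured disc. At q = 0 the
  bound K / Im z tends to 0, so the singularity is removable with value 0: the Fourier expansion has
  no constant term.\<close>

lemma periodic_fourier:
  fixes P :: "complex \<Rightarrow> complex"
  assumes hol: "P holomorphic_on {z. Im z > \<sigma>}" and per: "\<And>z. Im z > \<sigma> \<Longrightarrow> P (z + 1) = P z"
    and bd: "\<And>z. Im z > \<sigma> \<Longrightarrow> norm (P z) \<le> K / Im z" and \<sigma>: "\<sigma> > 0"
  obtains k where "k holomorphic_on ball 0 (exp (- 2 * pi * \<sigma>))" "k 0 = 0"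
    "\<And>z. Im z > \<sigma> \<Longrightarrow> P z = k (exp (2 * of_real pi * \<i> * z))"
proof -
  define \<rho> where "\<rho> = exp (- 2 * pi * \<sigma>)"
  have \<rho>: "\<rho> > 0" by (simp add: \<rho>_def)
  define w where "w = (2 * of_real pi * \<i> :: complex)"
  have w: "w \<noteq> 0" by (simp add: w_def)
  define k0 where "k0 = (\<lambda>q. P (Ln q / w))"
  have Im_Ln: "Im (l / w) = - Re l / (2 * pi)" for l
    by (simp add: w_def Im_divide power2_eq_square field_simps)
  have Im_gt: "Im (Ln q / w) > \<sigma>" if "q \<in> ball 0 \<rho> - {0}" for q :: complex
  proof -
    have "ln (norm q) < - 2 * pi * \<sigma>" using that ln_less_cancel_iff[of "norm q" "exp (- 2 * pi * \<sigma>)"] by (auto simp: \<rho>_def)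
    thus ?thesis using that by (simp add: Im_Ln field_simps)
  qed
  have k0_exp: "k0 (exp (w * z)) = P z" if z: "Im z > \<sigma>" for z
  proof -
    have "exp (Ln (exp (w * z))) = exp (w * z)" by simp
    then obtain n :: int where n: "Ln (exp (w * z)) = w * z + of_int (2 * n) * of_real pi * \<i>"
      using exp_eq by (metis (no_types, lifting) mult.commute mult.assoc of_real_mult of_real_of_int_eq of_int_mult)
    hence "Ln (exp (w * z)) / w = z + of_int n" by (simp add: w_def field_simps)
    thus ?thesis unfolding k0_def using periodic_int_shift[where P = P and \<sigma> = \<sigma>, OF per z] by simp
  qed
  have k0_hol: "k0 holomorphic_on ball 0 \<rho> - {0}"
  proof (rule holomorphic_on_open[THEN iffD2], force, rule ballI)
    fix q :: complex assume q: "q \<in> ball 0 \<rho> - {0}"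
    \<comment> \<open>The principal logarithm jumps across the negative axis. Around q the branch z0
      + Ln (x / q) / w is used instead; the two differ by integers, which P does not see.\<close>
    define z0 where "z0 = Ln q / w"
    have z0: "Im z0 > \<sigma>" "exp (w * z0) = q" using Im_gt[OF q] q w by (auto simp: z0_def)
    have "((\<lambda>x. z0 + Ln (x / q) / w) has_field_derivative (1 / q) / w) (at q)"
      using q w by (auto intro!: derivative_eq_intros)
    moreover have PD: "(P has_field_derivative deriv P z0) (at z0)"
      by (rule holomorphic_derivI[OF hol open_halfspace_Im_gt]) (use z0 in simp)
    ultimately have D: "((\<lambda>x. P (z0 + Ln (x / q) / w)) has_field_derivative deriv P z0 * ((1 / q) / w)) (at q)"
      using q by (intro DERIV_chain2[of P]) auto
    have "isCont (\<lambda>x. z0 + Ln (x / q) / w) q"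
      using q w by (intro continuous_intros) auto
    hence "((\<lambda>x. Im (z0 + Ln (x / q) / w)) \<longlongrightarrow> Im (z0 + Ln (q / q) / w)) (at q)"
      unfolding isCont_def by (intro tendsto_Im)
    hence "\<forall>\<^sub>F x in at q. Im (z0 + Ln (x / q) / w) > \<sigma>"
      by (rule order_tendstoD) (use z0 q in simp)
    hence ev: "\<forall>\<^sub>F x in nhds q. Im (z0 + Ln (x / q) / w) > \<sigma>"
      using z0 q by (simp add: eventually_at_filter eventually_mono[OF eventually_conj[OF _ always_eventually]])
         (auto elim!: eventually_mono)
    have ev0: "\<forall>\<^sub>F x in nhds q. x \<noteq> 0" using q by (intro t1_space_nhds) auto
    have "\<forall>\<^sub>F x in nhds q. P (z0 + Ln (x / q) / w) = k0 x"
      using ev ev0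
    proof eventually_elim
      case (elim x)
      have "exp (w * (z0 + Ln (x / q) / w)) = x" using elim(2) q w z0 by (simp add: distrib_left exp_add)
      thus ?case using k0_exp[OF elim(1)] by simp
    qed
    hence "(k0 has_field_derivative deriv P z0 * ((1 / q) / w)) (at q)"
      using D by (subst (asm) DERIV_cong_ev[OF refl _ refl]) auto
    thus "\<exists>f'. (k0 has_field_derivative f') (at q)" by blast
  qed
  have lim: "(k0 \<longlongrightarrow> 0) (at 0)"
  proof (rule Lim_null_comparison)
    show "\<forall>\<^sub>F q in at 0. norm (k0 q) \<le> \<bar>K\<bar> * (2 * pi) * inverse (- ln (norm q))"
    proof -
      have "\<forall>\<^sub>F q in at (0::complex). q \<in> ball 0 \<rho> - {0}"
        using \<rho> eventually_at_in_open[of "ball 0 \<rho>" "0::complex"] by simp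
      thus ?thesis
      proof eventually_elim
        case (elim q)
        have g: "Im (Ln q / w) > \<sigma>" by (rule Im_gt[OF elim])
        have "norm (k0 q) \<le> K / Im (Ln q / w)" unfolding k0_def by (rule bd[OF g])
        also have "\<dots> \<le> \<bar>K\<bar> / Im (Ln q / w)" using g \<sigma> by (intro divide_right_mono) auto
        finally show ?case using elim by (simp add: Im_Ln field_simps)
      qed
    qed
    have "filterlim (\<lambda>q::complex. norm q) (at_right 0) (at 0)"
      by (auto simp: filterlim_at intro!: tendsto_eq_intros eventually_at_filter[THEN iffD2])
    hence "filterlim (\<lambda>q::complex. ln (norm q)) at_bot (at 0)" by (rule filterlim_compose[OF ln_at_0])
    hence "filterlim (\<lambda>q::complex. - ln (norm q)) at_top (at 0)" by (simp add: filterlim_uminus_at_top)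
    hence "((\<lambda>q::complex. inverse (- ln (norm q))) \<longlongrightarrow> 0) (at 0)" by (rule tendsto_inverse_0_at_top)
    from tendsto_mult[OF tendsto_const this]
    show "((\<lambda>q::complex. \<bar>K\<bar> * (2 * pi) * inverse (- ln (norm q))) \<longlongrightarrow> 0) (at 0)" by fastforce
  qed
  define k where "k = (\<lambda>q. if q = 0 then 0 else k0 q)"
  have "k holomorphic_on ball 0 \<rho>"
  proof (rule no_isolated_singularity'[of "{0}"])
    show "(k \<longlongrightarrow> k z) (at z within ball 0 \<rho>)" if "z \<in> {0}" for z
    proof -
      have "(k \<longlongrightarrow> 0) (at 0)"
        by (rule Lim_transform_eventually[OF lim]) (simp add: k_def eventually_at_filter)
      thus ?thesis using that by (auto simp: k_def intro: tendsto_within_subset)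
    qed
    show "k holomorphic_on ball 0 \<rho> - {0}"
      by (rule holomorphic_transform[OF k0_hol]) (auto simp: k_def)
  qed auto
  moreover have "P z = k (exp (2 * of_real pi * \<i> * z))" if "Im z > \<sigma>" for z
    using k0_exp[OF that] by (simp add: k_def w_def)
  ultimately show ?thesis by (intro that[of k]) (auto simp: \<rho>_def k_def)
qed

lemma norm_exp_2pi: "norm (exp (2 * of_real pi * \<i> * z)) = exp (- 2 * pi * Im z)"
  by simp

text \<open>Since k vanishes at 0 and has bounded derivative on a smaller disc, |k(q)| \<le> C |q|,
  and |q| = exp (-2 pi Im z). Periodicity thus upgrades decay like 1 / Im z to exponential
  decay.\<close>

lemma periodic_exp_decay:
  fixes P :: "complex \<Rightarrow> complex"
  assumes hol: "P holomorphic_on {z. Im z > \<sigma>}" and per: "\<And>z. Im z > \<sigma> \<Longrightarrow> P (z + 1) = P z"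
    and bd: "\<And>z. Im z > \<sigma> \<Longrightarrow> norm (P z) \<le> K / Im z" and \<sigma>: "\<sigma> > 0"
  obtains C where "C \<ge> 0" "\<And>z. Im z > \<sigma> + 1 \<Longrightarrow> norm (P z) \<le> C * exp (- 2 * pi * Im z)"
proof -
  obtain k where k: "k holomorphic_on ball 0 (exp (- 2 * pi * \<sigma>))" "k 0 = 0"
    "\<And>z. Im z > \<sigma> \<Longrightarrow> P z = k (exp (2 * of_real pi * \<i> * z))"
    by (rule periodic_fourier[OF hol per bd \<sigma>]; (assumption | (rule that; assumption)))
  define r where "r = exp (- 2 * pi * (\<sigma> + 1))"
  have r: "r > 0" "cball 0 r \<subseteq> ball (0::complex) (exp (- 2 * pi * \<sigma>))"
  proof -
    have "r < exp (- 2 * pi * \<sigma>)" unfolding r_def exp_less_cancel_iff by (simp add: algebra_simps)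
    thus "cball 0 r \<subseteq> ball (0::complex) (exp (- 2 * pi * \<sigma>))" by auto
  qed (simp add: r_def)
  have "compact (deriv k ` cball 0 r)"
    by (intro compact_continuous_image continuous_on_subset[OF holomorphic_on_imp_continuous_on[OF holomorphic_deriv[OF k(1)]] r(2)]) auto
  hence "bounded (deriv k ` cball 0 r)" by (rule compact_imp_bounded)
  then obtain C where C: "\<forall>x\<in>deriv k ` cball 0 r. norm x \<le> C" unfolding bounded_iff by blast
  show ?thesis
  proof (rule that[of "max C 0"])
    fix z assume z: "Im z > \<sigma> + 1"
    define q where "q = exp (2 * of_real pi * \<i> * z)"
    have nq: "norm q = exp (- 2 * pi * Im z)" unfolding q_def by (rule norm_exp_2pi)
    have q: "q \<in> cball 0 r" using z unfolding mem_cball_0 nq r_def by simp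
    have "norm (k q - k 0) \<le> C * norm (q - 0)"
    proof (rule field_differentiable_bound[of "cball 0 r" k "deriv k"])
      show "(k has_field_derivative deriv k x) (at x within cball 0 r)" if "x \<in> cball 0 r" for x
        by (rule has_field_derivative_at_within[OF holomorphic_derivI[OF k(1)]]) (use r that in auto)
    qed (use C q r in auto)
    also have "\<dots> \<le> max C 0 * norm q" by (simp add: mult_right_mono)
    finally have "norm (k q) \<le> max C 0 * norm q" using k(2) by simp
    thus "norm (P z) \<le> max C 0 * exp (- 2 * pi * Im z)" using k(3)[of z] z by (simp only: q_def[symmetric] nq)
  qed simp
qed

subsection \<open>Horn maps\<close>

text \<open>The series of z -> -p(-z), that is, conjugation of id + p by -id.\<close>

definition reflect :: "complex fps \<Rightarrow> complex fps" where
  "reflect a = Abs_fps (\<lambda>n. - ((-1) ^ n * fps_nth a n))"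

lemma reflect_nth [simp]: "fps_nth (reflect a) n = - ((-1) ^ n * fps_nth a n)"
  by (simp add: reflect_def)

lemma asymptotic_to_reflect:
  assumes "asymptotic_to G p a"
  shows "asymptotic_to (filtermap uminus G) (\<lambda>z. - p (- z)) (reflect a)"
  unfolding asymptotic_to_def
proof
  fix N
  have e: "eval_fps (fps_cutoff N (reflect a)) (inverse (- z)) = - eval_fps (fps_cutoff N a) (inverse z)" for z
    unfolding eval_fps_cutoff sum_negf[symmetric] by (intro sum.cong refl) (simp add: power_minus[of "inverse z"])
  obtain c where c: "\<forall>\<^sub>F z in G. norm (p z - eval_fps (fps_cutoff N a) (inverse z)) \<le> c * norm (inverse z ^ N)"
    using assms[unfolded asymptotic_to_def, rule_format, of N] by (elim landau_o.bigE)
  show "(\<lambda>z. - p (- z) - eval_fps (fps_cutoff N (reflect a)) (inverse z)) \<in> O[filtermap uminus G](\<lambda>z. inverse z ^ N)"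
  proof (rule bigoI[of _ c])
    show "\<forall>\<^sub>F z in filtermap uminus G. norm (- p (- z) - eval_fps (fps_cutoff N (reflect a)) (inverse z)) \<le> c * norm (inverse z ^ N)"
      unfolding eventually_filtermap using c
    proof eventually_elim
      case (elim z)
      have "- p (- (- z)) - eval_fps (fps_cutoff N (reflect a)) (inverse (- z)) = - (p z - eval_fps (fps_cutoff N a) (inverse z))"
        unfolding e by simp
      hence "norm (- p (- (- z)) - eval_fps (fps_cutoff N (reflect a)) (inverse (- z))) = norm (p z - eval_fps (fps_cutoff N a) (inverse z))"
        by (simp only: norm_minus_cancel)
      with elim show ?case by (simp add: norm_power)
    qed
  qed
qed

text \<open>The Borel transform of the reflected series at \<zeta> is that of \<phi> at -\<zeta>;
  directions move by pi, which exchanges the two arcs.\<close>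

lemma borel_summable_reflect:
  assumes "borel_summable \<phi> arc_plus B p"
  shows "borel_summable (reflect \<phi>) arc_minus B (\<lambda>z. - p (- z))"
proof -
  obtain F where F: "borel_continuation \<phi> arc_plus F" "exp_bounded_on arc_plus F (\<lambda>_. B)"
     and L: "\<And>\<theta> z. \<theta> \<in> arc_plus \<Longrightarrow> Re (z * cis \<theta>) > B \<Longrightarrow> laplace F \<theta> z = p z"
    using assms unfolding borel_summable_def by blast
  have bt: "fps_nth (borel_transform (reflect \<phi>)) n = (-1) ^ n * fps_nth (borel_transform \<phi>) n" for n
    by (simp add: borel_transform_def)
  have rad: "fps_conv_radius (borel_transform (reflect \<phi>)) = fps_conv_radius (borel_transform \<phi>)"
    unfolding fps_conv_radius_def conv_radius_def by (simp add: bt norm_mult norm_power)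
  have ev: "eval_fps (borel_transform (reflect \<phi>)) \<zeta> = eval_fps (borel_transform \<phi>) (- \<zeta>)" for \<zeta>
    unfolding eval_fps_def by (rule arg_cong[of _ _ suminf], rule ext) (simp add: bt power_minus[of \<zeta>] mult_ac)
  have cis: "cis \<theta> = - cis (\<theta> - pi)" for \<theta> by (simp add: cis_diff_pi)
  show ?thesis unfolding borel_summable_def
  proof (rule exI[of _ "\<lambda>\<zeta>. F (- \<zeta>)"], intro conjI ballI allI impI)
    show "borel_continuation (reflect \<phi>) arc_minus (\<lambda>\<zeta>. F (- \<zeta>))"
      unfolding borel_continuation_def rad ev
    proof (intro conjI)
      show "fps_conv_radius (borel_transform \<phi>) > 0" using F(1) by (simp add: borel_continuation_def)
      have "F \<circ> uminus holomorphic_on sector arc_minus"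
        by (rule holomorphic_on_compose_gen[of _ _ _ "sector arc_plus"])
           (use F(1) in \<open>auto simp: borel_continuation_def sector_arc_plus sector_arc_minus intro!: holomorphic_intros\<close>)
      thus "(\<lambda>\<zeta>. F (- \<zeta>)) holomorphic_on sector arc_minus" by (simp add: o_def)
      obtain r where "r > 0" "\<And>\<zeta>. \<zeta> \<in> sector arc_plus \<Longrightarrow> norm \<zeta> < r \<Longrightarrow> F \<zeta> = eval_fps (borel_transform \<phi>) \<zeta>"
        using F(1) unfolding borel_continuation_def by blast
      thus "\<exists>r>0. \<forall>\<zeta>\<in>sector arc_minus. norm \<zeta> < r \<longrightarrow> F (- \<zeta>) = eval_fps (borel_transform \<phi>) (- \<zeta>)"
        by (intro exI[of _ r]) (simp add: sector_arc_plus sector_arc_minus)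
    qed
    obtain \<alpha> where al: "locally_bounded_on arc_plus \<alpha>" "\<And>\<theta> \<xi>. \<theta> \<in> arc_plus \<Longrightarrow> \<xi> > 0 \<Longrightarrow> norm (F (of_real \<xi> * cis \<theta>)) \<le> \<alpha> \<theta> * exp (B * \<xi>)"
      using F(2) unfolding exp_bounded_on_def by blast
    have lb: "locally_bounded_on arc_minus (\<lambda>\<theta>. \<alpha> (\<theta> - pi))" unfolding locally_bounded_on_def
    proof
      fix \<theta> assume "\<theta> \<in> arc_minus"
      hence "\<theta> - pi \<in> arc_plus" by (simp add: arc_minus_iff)
      then obtain d where d: "d > 0" "bounded (\<alpha> ` (arc_plus \<inter> ball (\<theta> - pi) d))" using al(1) unfolding locally_bounded_on_def by blast
      have "(\<lambda>\<theta>. \<alpha> (\<theta> - pi)) ` (arc_minus \<inter> ball \<theta> d) \<subseteq> \<alpha> ` (arc_plus \<inter> ball (\<theta> - pi) d)"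
        by (auto simp: arc_minus_iff dist_real_def intro!: imageI)
      with d show "\<exists>d>0. bounded ((\<lambda>\<theta>. \<alpha> (\<theta> - pi)) ` (arc_minus \<inter> ball \<theta> d))" using bounded_subset by blast
    qed
    have lbB: "locally_bounded_on arc_minus (\<lambda>_. B)"
      by (intro continuous_imp_locally_bounded_on) (simp_all add: arc_minus_def)
    have "norm (F (- (of_real \<xi> * cis \<theta>))) \<le> \<alpha> (\<theta> - pi) * exp (B * \<xi>)" if "\<theta> \<in> arc_minus" "\<xi> > 0" for \<theta> \<xi>
      using al(2)[of "\<theta> - pi" \<xi>] that by (simp add: arc_minus_iff cis_diff_pi)
    with lb lbB show "exp_bounded_on arc_minus (\<lambda>\<zeta>. F (- \<zeta>)) (\<lambda>_. B)"
      unfolding exp_bounded_on_def by blast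
    fix \<theta> z assume th: "\<theta> \<in> arc_minus" "Re (z * cis \<theta>) > B"
    have "laplace (\<lambda>\<zeta>. F (- \<zeta>)) \<theta> z = (LBINT \<xi>:{0<..}. - (exp (- (- z) * of_real \<xi> * cis (\<theta> - pi)) * F (of_real \<xi> * cis (\<theta> - pi)) * cis (\<theta> - pi)))"
      unfolding laplace_def by (rule set_lebesgue_integral_cong) (simp_all add: cis_diff_pi)
    also have "\<dots> = - laplace F (\<theta> - pi) (- z)"
      unfolding laplace_def set_lebesgue_integral_def by (simp add: scaleR_minus_right)
    also have "laplace F (\<theta> - pi) (- z) = p (- z)"
      using L[of "\<theta> - pi" "- z"] th by (simp add: arc_minus_iff cis_diff_pi)
    finally show "laplace (\<lambda>\<zeta>. F (- \<zeta>)) \<theta> z = - p (- z)" .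
  qed
qed

lemma asymptotic_to_add_const:
  assumes "asymptotic_to G p a"
  shows "asymptotic_to G (\<lambda>z. p z + c) (a + fps_const c)"
  unfolding asymptotic_to_def
proof
  fix N show "(\<lambda>z. p z + c - eval_fps (fps_cutoff N (a + fps_const c)) (inverse z)) \<in> O[G](\<lambda>z. inverse z ^ N)"
  proof (cases N)
    case 0
    have "p \<in> O[G](\<lambda>_. 1)" using assms[unfolded asymptotic_to_def, rule_format, of 0] by simp
    hence "(\<lambda>z. p z + c) \<in> O[G](\<lambda>_. 1)" by (rule sum_in_bigo(1)) simp
    thus ?thesis using 0 by simp
  next
    case (Suc n)
    have "eval_fps (fps_cutoff N (a + fps_const c)) w = eval_fps (fps_cutoff N a) w + c" for w
      unfolding eval_fps_cutoff Suc by (subst (1 2) sum.lessThan_Suc_shift) (simp add: algebra_simps)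
    thus ?thesis using assms[unfolded asymptotic_to_def, rule_format, of N] by simp
  qed
qed

lemma left_dom_perturb:
  assumes "z \<in> left_dom (R + r)" "norm (w - z) \<le> r" shows "w \<in> left_dom R"
  using right_dom_perturb[of "- z" R r "- w"] assms by (simp add: left_dom_uminus norm_minus_commute)

text \<open>The equation v o F = v + 1 read through the inverse u of v. The margin 3 keeps t +
  \<psi>(t) and its image under F in the domain; D is left open so as to cover both sides.\<close>

lemma fatou_pair_conjugates:
  assumes fp: "fatou_pair (D R) F R K \<phi> \<psi>"
    and pert: "\<And>z w R r. z \<in> D (R + r) \<Longrightarrow> norm (w - z) \<le> r \<Longrightarrow> w \<in> D R"
    and F: "\<And>z. z \<in> D R \<Longrightarrow> norm (F z - (z + 1)) \<le> 1/4" and t: "t \<in> D (R + 3)"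
  shows "F (t + \<psi> t) = t + 1 + \<psi> (t + 1)"
proof -
  have tD: "t \<in> D R" using pert[of t R 3 t] t by simp
  define x where "x = t + \<psi> t"
  have "norm (\<psi> t) \<le> 1/4" using fp tD unfolding fatou_pair_def by blast
  hence x2: "x \<in> D (R + 2)" using pert[of t "R + 2" 1 x] t by (simp add: x_def add.assoc)
  have xD: "x \<in> D R" using pert[of x R 2 x] x2 by simp
  have "norm (F x - x) \<le> norm (F x - (x + 1)) + norm (1 :: complex)"
    using norm_triangle_ineq[of "F x - (x + 1)" 1] by simp
  hence "norm (F x - x) \<le> 2" using F[OF xD] by simp
  hence FD: "F x \<in> D R" using pert[of x R 2 "F x"] x2 by simp
  have 1: "F x + \<phi> (F x) = x + \<phi> x + 1" "\<psi> (F x + \<phi> (F x)) = - \<phi> (F x)" "\<phi> (t + \<psi> t) = - \<psi> t"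
    using fp xD FD tD unfolding fatou_pair_def by blast+
  have "x + \<phi> x = t" using 1(3) by (simp add: x_def)
  hence "F x + \<phi> (F x) = t + 1" using 1(1) by simp
  moreover from this have "\<psi> (t + 1) = - \<phi> (F x)" using 1(2) by simp
  ultimately show ?thesis unfolding x_def[symmetric] by (simp add: algebra_simps)
qed

text \<open>The letters p and m mark the right (+) and the left (-) side; \<phi> and \<psi> are v -
  id and u - id. R and K are common to both sides, and R may be enlarged, so that two germs can
  share it.\<close>

locale germ_data =
  fixes a :: "complex fps" and R K :: real and \<phi>p \<psi>p \<phi>m \<psi>m :: "complex \<Rightarrow> complex"
  assumes a: "simple_parabolic_resiter0 a"
    and right: "fatou_pair (right_dom R) (germ_fun a) R K \<phi>p \<psi>p"
    and left: "fatou_pair (left_dom R) (germ_fun a) R K \<phi>m \<psi>m"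
    and right_Re: "\<And>z. Re z > R \<Longrightarrow> norm (\<phi>p z) \<le> K / Re z \<and> norm (\<psi>p z) \<le> K / Re z"
    and left_Re: "\<And>z. Re z < - R \<Longrightarrow> norm (\<phi>m z) \<le> K / - Re z \<and> norm (\<psi>m z) \<le> K / - Re z"
    and near_shift: "\<And>z. norm z > R \<Longrightarrow> norm (germ_fun a z - (z + 1)) \<le> 1/4"
begin

abbreviation "F \<equiv> germ_fun a"

lemma K: "K \<ge> 0" and R4: "R \<ge> 4" using right by (simp_all add: fatou_pair_def)

lemma near_shift_dom: "z \<in> right_dom R \<or> z \<in> left_dom R \<Longrightarrow> norm (F z - (z + 1)) \<le> 1/4"
  using near_shift right_dom_norm[of z] right_dom_norm[of "- z"] by (auto simp: left_dom_uminus)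

lemma Im_dom: "\<bar>Im z\<bar> > R \<Longrightarrow> z \<in> right_dom R \<and> z \<in> left_dom R"
  by (simp add: right_dom_def left_dom_def)

lemma small: "z \<in> right_dom R \<Longrightarrow> norm (\<phi>p z) \<le> 1/4 \<and> norm (\<psi>p z) \<le> 1/4"
  "z \<in> left_dom R \<Longrightarrow> norm (\<phi>m z) \<le> 1/4 \<and> norm (\<psi>m z) \<le> 1/4"
  using left right by (auto simp: fatou_pair_def)

lemma Im_bounds: "\<bar>Im z\<bar> > R \<Longrightarrow> norm (\<phi>p z) \<le> K / \<bar>Im z\<bar>" "\<bar>Im z\<bar> > R \<Longrightarrow> norm (\<psi>p z) \<le> K / \<bar>Im z\<bar>"
  "\<bar>Im z\<bar> > R \<Longrightarrow> norm (\<phi>m z) \<le> K / \<bar>Im z\<bar>" "\<bar>Im z\<bar> > R \<Longrightarrow> norm (\<psi>m z) \<le> K / \<bar>Im z\<bar>"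
  using left right unfolding fatou_pair_def by blast+

lemma holo: "\<phi>p holomorphic_on right_dom R" "\<psi>p holomorphic_on right_dom R"
  "\<phi>m holomorphic_on left_dom R" "\<psi>m holomorphic_on left_dom R"
  using left right by (auto simp: fatou_pair_def)

lemma funeq: "z \<in> right_dom R \<Longrightarrow> F z + \<phi>p (F z) = z + \<phi>p z + 1" "z \<in> left_dom R \<Longrightarrow> F z + \<phi>m (F z) = z + \<phi>m z + 1"
  and inv: "z \<in> right_dom R \<Longrightarrow> \<phi>p (z + \<psi>p z) = - \<psi>p z" "z \<in> right_dom R \<Longrightarrow> \<psi>p (z + \<phi>p z) = - \<phi>p z"
    "z \<in> left_dom R \<Longrightarrow> \<phi>m (z + \<psi>m z) = - \<psi>m z" "z \<in> left_dom R \<Longrightarrow> \<psi>m (z + \<phi>m z) = - \<phi>m z"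
  using left right by (auto simp: fatou_pair_def)

lemma u_shift: "t \<in> right_dom (R + 3) \<Longrightarrow> F (t + \<psi>p t) = t + 1 + \<psi>p (t + 1)" "t \<in> left_dom (R + 3) \<Longrightarrow> F (t + \<psi>m t) = t + 1 + \<psi>m (t + 1)"
proof -
  show "F (t + \<psi>p t) = t + 1 + \<psi>p (t + 1)" if "t \<in> right_dom (R + 3)"
  proof (rule fatou_pair_conjugates[where D = right_dom, OF right])
    show "\<And>z w R r. z \<in> right_dom (R + r) \<Longrightarrow> norm (w - z) \<le> r \<Longrightarrow> w \<in> right_dom R" by (rule right_dom_perturb)
  qed (use near_shift_dom that in auto)
  show "F (t + \<psi>m t) = t + 1 + \<psi>m (t + 1)" if "t \<in> left_dom (R + 3)"
  proof (rule fatou_pair_conjugates[where D = left_dom, OF left])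
    show "\<And>z w R r. z \<in> left_dom (R + r) \<Longrightarrow> norm (w - z) \<le> r \<Longrightarrow> w \<in> left_dom R" by (rule left_dom_perturb)
  qed (use near_shift_dom that in auto)
qed

definition horn :: "complex \<Rightarrow> complex" where
  "horn z = (z + \<psi>m z) + \<phi>p (z + \<psi>m z)"

definition horn_diff :: "complex \<Rightarrow> complex" where
  "horn_diff z = \<psi>m z + \<phi>p (z + \<psi>m z)"

lemma horn_eq: "horn z = z + horn_diff z"
  by (simp add: horn_def horn_diff_def)

lemma Im_pert: "norm w \<le> r \<Longrightarrow> \<bar>Im (z + w)\<bar> \<ge> \<bar>Im z\<bar> - r"
  using abs_Im_le_cmod[of w] by auto

text \<open>u^- carries the translation by 1 to F and v^+ carries F back to it, so their composite
  commutes with the translation. In the bound, K comes from \<psi>m and 2 K from \<phi>p at a point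
  of at least half the height.\<close>

lemma horn_diff_bounded_periodic:
  assumes z: "\<bar>Im z\<bar> > R + 3"
  shows "norm (horn_diff z) \<le> 3 * K / \<bar>Im z\<bar>" "norm (horn_diff z) \<le> 1/2" "horn_diff (z + 1) = horn_diff z"
proof -
  have zl: "z \<in> left_dom R" using z by (simp add: left_dom_def)
  have s: "norm (\<psi>m z) \<le> 1/4" using small(2)[OF zl] by simp
  have im: "\<bar>Im (z + \<psi>m z)\<bar> > R" "\<bar>Im (z + \<psi>m z)\<bar> \<ge> \<bar>Im z\<bar> / 2" using Im_pert[OF s, of z] z R4 by linarith+
  have "norm (horn_diff z) \<le> norm (\<psi>m z) + norm (\<phi>p (z + \<psi>m z))" unfolding horn_diff_def by (rule norm_triangle_ineq)
  also have "\<dots> \<le> K / \<bar>Im z\<bar> + K / (\<bar>Im z\<bar> / 2)"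
  proof (rule add_mono)
    show "norm (\<psi>m z) \<le> K / \<bar>Im z\<bar>" using Im_bounds(4)[of z] z by simp
    have "norm (\<phi>p (z + \<psi>m z)) \<le> K / \<bar>Im (z + \<psi>m z)\<bar>" by (rule Im_bounds(1)[OF im(1)])
    also have "\<dots> \<le> K / (\<bar>Im z\<bar> / 2)" using im z R4 K by (intro divide_left_mono) auto
    finally show "norm (\<phi>p (z + \<psi>m z)) \<le> K / (\<bar>Im z\<bar> / 2)" .
  qed
  also have "\<dots> = 3 * K / \<bar>Im z\<bar>" using z R4 by (simp add: field_simps)
  finally show "norm (horn_diff z) \<le> 3 * K / \<bar>Im z\<bar>" .
  have d: "z + \<psi>m z \<in> right_dom R" using Im_dom[OF im(1)] by simp
  have "norm (horn_diff z) \<le> norm (\<psi>m z) + norm (\<phi>p (z + \<psi>m z))" unfolding horn_diff_def by (rule norm_triangle_ineq)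
  also have "\<dots> \<le> 1/4 + 1/4" using s small(1)[OF d] by (intro add_mono) auto
  finally show "norm (horn_diff z) \<le> 1/2" by simp
  have "F (z + \<psi>m z) = z + 1 + \<psi>m (z + 1)" using z by (intro u_shift(2)) (simp add: left_dom_def)
  with funeq(1)[OF d] have "(z + 1 + \<psi>m (z + 1)) + \<phi>p (z + 1 + \<psi>m (z + 1)) = z + \<psi>m z + \<phi>p (z + \<psi>m z) + 1" by simp
  thus "horn_diff (z + 1) = horn_diff z" by (simp add: horn_diff_def algebra_simps)
qed

lemma horn_diff_hol: "horn_diff holomorphic_on {z. \<bar>Im z\<bar> > R + 3}"
proof -
  have m: "\<psi>m holomorphic_on {z. \<bar>Im z\<bar> > R + 3}" by (rule holomorphic_on_subset[OF holo(4)]) (auto simp: left_dom_def)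
  have "\<phi>p \<circ> (\<lambda>z. z + \<psi>m z) holomorphic_on {z. \<bar>Im z\<bar> > R + 3}"
  proof (rule holomorphic_on_compose_gen[OF _ holo(1)])
    show "(\<lambda>z. z + \<psi>m z) holomorphic_on {z. \<bar>Im z\<bar> > R + 3}" by (intro holomorphic_intros m)
    show "(\<lambda>z. z + \<psi>m z) ` {z. \<bar>Im z\<bar> > R + 3} \<subseteq> right_dom R"
    proof
      fix x assume "x \<in> (\<lambda>z. z + \<psi>m z) ` {z. \<bar>Im z\<bar> > R + 3}"
      then obtain z where z: "\<bar>Im z\<bar> > R + 3" "x = z + \<psi>m z" by auto
      have "norm (\<psi>m z) \<le> 1/4" using small(2)[of z] z by (simp add: left_dom_def)
      from Im_pert[OF this, of z] z show "x \<in> right_dom R" using Im_dom[of x] by simp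
    qed
  qed
  thus ?thesis unfolding horn_diff_def by (intro holomorphic_intros m) (simp add: o_def)
qed

lemma horn_diff_upper:
  shows "horn_diff holomorphic_on {z. Im z > R + 3}"
    "Im z > R + 3 \<Longrightarrow> horn_diff (z + 1) = horn_diff z" "Im z > R + 3 \<Longrightarrow> norm (horn_diff z) \<le> 3 * K / Im z"
proof -
  show "horn_diff holomorphic_on {z. Im z > R + 3}" by (rule holomorphic_on_subset[OF horn_diff_hol]) auto
  show "horn_diff (z + 1) = horn_diff z" if "Im z > R + 3" using horn_diff_bounded_periodic(3)[of z] that by simp
  show "norm (horn_diff z) \<le> 3 * K / Im z" if "Im z > R + 3" using horn_diff_bounded_periodic(1)[of z] that R4 by simp
qed

lemma horn_diff_fourier_up:
  obtains k where "k holomorphic_on ball 0 (exp (- 2 * pi * (R + 3)))" "k 0 = 0"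
    "\<And>z. Im z > R + 3 \<Longrightarrow> horn_diff z = k (exp (2 * of_real pi * \<i> * z))"
proof (rule periodic_fourier[of horn_diff "R + 3" "3 * K"])
qed (use horn_diff_upper R4 that in auto)

text \<open>The map z -> -z brings the lower half-plane to the upper one, for which the results on
  periodic functions are stated.\<close>

lemma horn_diff_lower:
  shows "(\<lambda>z. horn_diff (- z)) holomorphic_on {z. Im z > R + 3}"
    "Im z > R + 3 \<Longrightarrow> horn_diff (- (z + 1)) = horn_diff (- z)" "Im z > R + 3 \<Longrightarrow> norm (horn_diff (- z)) \<le> 3 * K / Im z"
proof -
  have "horn_diff \<circ> uminus holomorphic_on {z. Im z > R + 3}"
    by (rule holomorphic_on_compose_gen[OF _ horn_diff_hol]) (auto intro!: holomorphic_intros)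
  thus "(\<lambda>z. horn_diff (- z)) holomorphic_on {z. Im z > R + 3}" by (simp add: o_def)
  show "horn_diff (- (z + 1)) = horn_diff (- z)" if "Im z > R + 3"
    using horn_diff_bounded_periodic(3)[of "- z - 1"] that by simp
  show "norm (horn_diff (- z)) \<le> 3 * K / Im z" if "Im z > R + 3"
    using horn_diff_bounded_periodic(1)[of "- z"] that R4 by simp
qed

lemma horn_diff_fourier_low:
  obtains k where "k holomorphic_on ball 0 (exp (- 2 * pi * (R + 3)))" "k 0 = 0"
    "\<And>z. Im z < - (R + 3) \<Longrightarrow> horn_diff z = k (exp (- (2 * of_real pi * \<i> * z)))"
proof (rule periodic_fourier[of "\<lambda>z. horn_diff (- z)" "R + 3" "3 * K"])
  fix k assume k: "k holomorphic_on ball 0 (exp (- 2 * pi * (R + 3)))" "k 0 = 0"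
    "\<And>z. Im z > R + 3 \<Longrightarrow> horn_diff (- z) = k (exp (2 * of_real pi * \<i> * z))"
  show thesis
  proof (rule that[OF k(1,2)])
    show "horn_diff z = k (exp (- (2 * of_real pi * \<i> * z)))" if "Im z < - (R + 3)" for z
      using k(3)[of "- z"] that by simp
  qed
qed (use horn_diff_lower R4 in auto)

lemma horn_diff_decay:
  obtains C where "C \<ge> 0" "\<And>z. \<bar>Im z\<bar> > R + 4 \<Longrightarrow> norm (horn_diff z) \<le> C * exp (- 2 * pi * \<bar>Im z\<bar>)"
proof -
  obtain C1 where C1: "C1 \<ge> 0" "\<And>z. Im z > R + 3 + 1 \<Longrightarrow> norm (horn_diff z) \<le> C1 * exp (- 2 * pi * Im z)"
    by (rule periodic_exp_decay[OF horn_diff_upper(1), of "3 * K"]) (use horn_diff_upper R4 in auto)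
  obtain C2 where C2: "C2 \<ge> 0" "\<And>z. Im z > R + 3 + 1 \<Longrightarrow> norm (horn_diff (- z)) \<le> C2 * exp (- 2 * pi * Im z)"
    by (rule periodic_exp_decay[OF horn_diff_lower(1), of "3 * K"]) (use horn_diff_lower R4 in auto)
  show ?thesis
  proof (rule that[of "max C1 C2"])
    fix z assume z: "\<bar>Im z\<bar> > R + 4"
    show "norm (horn_diff z) \<le> max C1 C2 * exp (- 2 * pi * \<bar>Im z\<bar>)"
    proof (cases "Im z > 0")
      case True
      hence "norm (horn_diff z) \<le> C1 * exp (- 2 * pi * \<bar>Im z\<bar>)" using C1(2)[of z] z by simp
      also have "\<dots> \<le> max C1 C2 * exp (- 2 * pi * \<bar>Im z\<bar>)" by (intro mult_right_mono) auto
      finally show ?thesis .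
    next
      case False
      hence "norm (horn_diff z) \<le> C2 * exp (- 2 * pi * \<bar>Im z\<bar>)" using C2(2)[of "- z"] z by simp
      also have "\<dots> \<le> max C1 C2 * exp (- 2 * pi * \<bar>Im z\<bar>)" by (intro mult_right_mono) auto
      finally show ?thesis .
    qed
  qed (use C1 in auto)
qed

lemma exp_pi_le: "y \<ge> 0 \<Longrightarrow> exp (- 2 * pi * y) \<le> exp (- 2 * y)"
  using pi_gt3 by (simp add: mult_right_mono)

text \<open>At t = v^-(z) one has u^-(t) = z, so \<open>horn_diff t\<close> is v^+(z) - v^-(z), the
  difference wanted. As |Im t| \<ge> |Im z| - 1, the change of point costs the factor exp 2.\<close>

lemma \<phi>_diff_decay:
  obtains C where "C \<ge> 0" "\<And>z. \<bar>Im z\<bar> > R + 5 \<Longrightarrow> norm (\<phi>p z - \<phi>m z) \<le> C * exp (- 2 * \<bar>Im z\<bar>)"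
proof -
  obtain C where C: "C \<ge> 0" "\<And>z. \<bar>Im z\<bar> > R + 4 \<Longrightarrow> norm (horn_diff z) \<le> C * exp (- 2 * pi * \<bar>Im z\<bar>)"
    by (rule horn_diff_decay) (rule that; assumption)
  show ?thesis
  proof (rule that[of "C * exp 2"])
    fix z assume z: "\<bar>Im z\<bar> > R + 5"
    have zl: "z \<in> left_dom R" using z by (simp add: left_dom_def)
    define t where "t = z + \<phi>m z"
    have s: "norm (\<phi>m z) \<le> 1" using small(2)[OF zl] by simp
    have im: "\<bar>Im t\<bar> > R + 4" "\<bar>Im t\<bar> \<ge> \<bar>Im z\<bar> - 1" using Im_pert[OF s, of z] z unfolding t_def by linarith+
    have "\<psi>m t = - \<phi>m z" using inv(4)[OF zl] by (simp add: t_def)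
    hence "horn_diff t = \<phi>p z - \<phi>m z" by (simp add: horn_diff_def t_def)
    hence "norm (\<phi>p z - \<phi>m z) \<le> C * exp (- 2 * pi * \<bar>Im t\<bar>)" using C(2)[OF im(1)] by simp
    also have "\<dots> \<le> C * exp (- 2 * \<bar>Im t\<bar>)" using C(1) by (intro mult_left_mono exp_pi_le) auto
    also have "\<dots> \<le> C * exp (2 + - 2 * \<bar>Im z\<bar>)" using C(1) im by (intro mult_left_mono) auto
    finally show "norm (\<phi>p z - \<phi>m z) \<le> C * exp 2 * exp (- 2 * \<bar>Im z\<bar>)" by (simp only: exp_add mult.assoc)
  qed (use C in simp)
qed

lemma \<psi>p_lipschitz:
  assumes z: "\<bar>Im z\<bar> > R + 3" and h: "norm h \<le> 1/2"
  shows "norm (\<psi>p (z + h) - \<psi>p z) \<le> norm h"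
proof -
  have "norm (\<psi>p (z + h) - \<psi>p z) \<le> 1/4 * norm ((z + h) - z)"
  proof (rule field_differentiable_bound[of "cball z (1/2)" \<psi>p "deriv \<psi>p"])
    fix x assume x: "x \<in> cball z (1/2)"
    have sub: "cball x 1 \<subseteq> right_dom R"
    proof
      fix y assume y: "y \<in> cball x 1"
      have "norm (y - z) \<le> 2" using x y dist_triangle[of y z x] by (simp add: dist_norm norm_minus_commute)
      from Im_pert[OF this, of z] z show "y \<in> right_dom R" using Im_dom[of y] by simp
    qed
    have xS: "x \<in> right_dom R" using sub by auto
    show "(\<psi>p has_field_derivative deriv \<psi>p x) (at x within cball z (1/2))"
      by (rule has_field_derivative_at_within[OF holomorphic_derivI[OF holo(2) open_right_dom xS]])
    have "norm ((deriv ^^ 1) \<psi>p x) \<le> fact 1 * (1/4) / 1 ^ 1"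
    proof (rule Cauchy_inequality)
      show "\<psi>p holomorphic_on ball x 1" using sub by (intro holomorphic_on_subset[OF holo(2)]) auto
      show "continuous_on (cball x 1) \<psi>p" by (rule continuous_on_subset[OF holomorphic_on_imp_continuous_on[OF holo(2)] sub])
      show "norm (\<psi>p y) \<le> 1/4" if "norm (x - y) = 1" for y
      proof -
        have "y \<in> right_dom R" using sub that by (auto simp: dist_norm subset_iff)
        thus ?thesis using small(1) by blast
      qed
    qed simp
    thus "norm (deriv \<psi>p x) \<le> 1/4" by simp
  qed (use h in \<open>auto simp: dist_norm\<close>)
  also have "\<dots> \<le> norm h" by simp
  finally show ?thesis .
qed

text \<open>From u^+ o h = u^- for the horn map h, the difference u^+ - u^- at z compares the values
  of u^+ at z and at h(z); the Lipschitz bound for \<psi>p controls it by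
  \<open>horn_diff\<close>.\<close>

lemma \<psi>_diff_decay:
  obtains C where "C \<ge> 0" "\<And>z. \<bar>Im z\<bar> > R + 5 \<Longrightarrow> norm (\<psi>p z - \<psi>m z) \<le> C * exp (- 2 * \<bar>Im z\<bar>)"
proof -
  obtain C where C: "C \<ge> 0" "\<And>z. \<bar>Im z\<bar> > R + 4 \<Longrightarrow> norm (horn_diff z) \<le> C * exp (- 2 * pi * \<bar>Im z\<bar>)"
    by (rule horn_diff_decay) (rule that; assumption)
  show ?thesis
  proof (rule that[of "2 * C"])
    fix z assume z: "\<bar>Im z\<bar> > R + 5"
    have zl: "z \<in> left_dom R" using z by (simp add: left_dom_def)
    define x where "x = z + \<psi>m z"
    have s: "norm (\<psi>m z) \<le> 1" using small(2)[OF zl] by simp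
    have "\<bar>Im x\<bar> > R" using Im_pert[OF s, of z] z unfolding x_def by linarith
    hence "\<psi>p (x + \<phi>p x) = - \<phi>p x" using Im_dom inv(2) by blast
    moreover have "x + \<phi>p x = z + horn_diff z" by (simp add: x_def horn_diff_def)
    ultimately have e: "\<psi>p (z + horn_diff z) = - \<phi>p x" by simp
    have "\<psi>p z - \<psi>m z = - (\<psi>p (z + horn_diff z) - \<psi>p z) - horn_diff z"
      using e by (simp add: horn_diff_def x_def)
    also have "norm \<dots> \<le> norm (\<psi>p (z + horn_diff z) - \<psi>p z) + norm (horn_diff z)"
      by (metis norm_minus_cancel norm_triangle_ineq4)
    also have "\<dots> \<le> 2 * norm (horn_diff z)" using \<psi>p_lipschitz[of z "horn_diff z"] horn_diff_bounded_periodic(2)[of z] z by simp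
    also have "\<dots> \<le> 2 * (C * exp (- 2 * pi * \<bar>Im z\<bar>))" using C(2)[of z] z by simp
    also have "\<dots> \<le> 2 * (C * exp (- 2 * \<bar>Im z\<bar>))" using C(1) by (intro mult_left_mono exp_pi_le) auto
    finally show "norm (\<psi>p z - \<psi>m z) \<le> 2 * C * exp (- 2 * \<bar>Im z\<bar>)" by simp
  qed (use C in simp)
qed

end

text \<open>An expansion is determined on a single half-line, where membership in the domains is
  immediate. The negative axis is \<open>filtermap uminus real_filter\<close>.\<close>

definition real_filter :: "complex filter" where
  "real_filter = filtermap of_real at_top"

lemma real_filter_le_cone: "real_filter \<le> cone_filter"
  unfolding real_filter_def le_filter_def eventually_filtermap eventually_cone_filter
proof (intro allI impI)
  fix P assume "\<forall>\<^sub>F z in at_infinity. \<bar>Im z\<bar> \<le> Re z \<longrightarrow> P z"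
  then obtain b where b: "\<And>z. norm z \<ge> b \<Longrightarrow> \<bar>Im z\<bar> \<le> Re z \<longrightarrow> P z" by (auto simp: eventually_at_infinity)
  show "\<forall>\<^sub>F x in at_top. P (of_real x)"
    using eventually_ge_at_top[of "max 0 b"] by eventually_elim (use b in auto)
qed

lemma real_filter_le: "real_filter \<le> at_infinity"
  using real_filter_le_cone cone_filter_le by (rule order_trans)

lemma real_filter_nontrivial: "real_filter \<noteq> bot"
  by (simp add: real_filter_def filtermap_bot_iff)

lemma uminus_real_filter_le: "filtermap uminus real_filter \<le> at_infinity"
  unfolding le_filter_def eventually_filtermap
proof (intro allI impI)
  fix P :: "complex \<Rightarrow> bool" assume "eventually P at_infinity"
  then obtain b where "\<And>z. norm z \<ge> b \<Longrightarrow> P z" by (auto simp: eventually_at_infinity)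
  hence "eventually (\<lambda>z. P (- z)) at_infinity" unfolding eventually_at_infinity by (intro exI[of _ b]) auto
  thus "eventually (\<lambda>z. P (- z)) real_filter" using real_filter_le by (rule filter_leD[rotated])
qed

lemma cis_Re_ge:
  assumes "\<bar>\<alpha>\<bar> \<le> 5 * pi / 12" "r \<ge> 0"
  shows "Re (of_real r * cis \<alpha>) \<ge> r * cos (5 * pi / 12)"
proof -
  have "cos (5 * pi / 12) \<le> cos \<bar>\<alpha>\<bar>" using assms(1) by (subst cos_mono_le_eq) auto
  hence "cos (5 * pi / 12) \<le> cos \<alpha>" by simp
  thus ?thesis using assms(2) by (simp add: mult_left_mono)
qed

lemma cis_minus_2pi: "cis (\<theta> - 2 * pi) = cis \<theta>"
  by (simp add: complex_eq_iff cos_diff sin_diff)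

lemma half_line_islimpt: "(of_real (y + 1) * \<i> * of_real \<sigma>) islimpt (\<lambda>t. of_real t * \<i> * of_real \<sigma>) ` {y<..}"
  if "\<bar>\<sigma>\<bar> = 1" for \<sigma> :: real
  unfolding islimpt_approachable
proof (intro allI impI)
  fix e :: real assume e: "e > 0"
  have n: "norm (of_real t * \<i> * of_real \<sigma>) = \<bar>t\<bar>" for t using that by (simp add: norm_mult)
  have d: "of_real (y + 1 + e/2) * \<i> * of_real \<sigma> - of_real (y + 1) * \<i> * of_real \<sigma> = of_real (e/2) * \<i> * of_real \<sigma>"
    by (simp add: algebra_simps)
  have n2: "norm (of_real (y + 1 + e/2) * \<i> * of_real \<sigma> - of_real (y + 1) * \<i> * of_real \<sigma>) = e/2"
    unfolding d n using e by simp
  show "\<exists>x'\<in>(\<lambda>t. of_real t * \<i> * of_real \<sigma>) ` {y<..}. x' \<noteq> of_real (y + 1) * \<i> * of_real \<sigma> \<and> dist x' (of_real (y + 1) * \<i> * of_real \<sigma>) < e"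
  proof (rule bexI, rule conjI)
    show "of_real (y + 1 + e/2) * \<i> * of_real \<sigma> \<noteq> of_real (y + 1) * \<i> * of_real \<sigma>"
    proof
      assume "of_real (y + 1 + e/2) * \<i> * of_real \<sigma> = of_real (y + 1) * \<i> * of_real \<sigma>"
      hence "norm (of_real (y + 1 + e/2) * \<i> * of_real \<sigma> - of_real (y + 1) * \<i> * of_real \<sigma>) = 0"
        by (simp only: diff_self norm_zero)
      thus False using n2 e by simp
    qed
    show "dist (of_real (y + 1 + e/2) * \<i> * of_real \<sigma>) (of_real (y + 1) * \<i> * of_real \<sigma>) < e"
      unfolding dist_norm n2 using e by simp
    show "of_real (y + 1 + e/2) * \<i> * of_real \<sigma> \<in> (\<lambda>t. of_real t * \<i> * of_real \<sigma>) ` {y<..}"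
      by (rule imageI) (use e in simp)
  qed
qed

context germ_data
begin

lemma germ_coeffs: "fps_conv_radius a > 0" "fps_nth a 0 = 1"
  using a by (auto simp: simple_parabolic_resiter0_def)

text \<open>The exponential decay of \<phi>p - \<phi>m is what makes the two an instance of
  \<open>sectorial_pair\<close>.\<close>

lemma summable_right:
  obtains \<phi> B where "fps_nth \<phi> 0 = 0" "borel_summable \<phi> arc_plus B \<phi>p" "asymptotic_to cone_filter \<phi>p \<phi>"
proof -
  obtain C where C: "C \<ge> 0" "\<And>z. \<bar>Im z\<bar> > R + 5 \<Longrightarrow> norm (\<phi>p z - \<phi>m z) \<le> C * exp (- 2 * \<bar>Im z\<bar>)"
    by (rule \<phi>_diff_decay) (rule that; assumption)
  interpret S: sectorial_pair "R + 5" "R + 6" "1/4" K C \<phi>p \<phi>m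
  proof
    show "\<phi>p holomorphic_on right_dom (R + 5)" by (rule holomorphic_on_subset[OF holo(1) right_dom_mono']) simp
    show "\<phi>m holomorphic_on left_dom (R + 5)" by (rule holomorphic_on_subset[OF holo(3) left_dom_mono]) simp
    show "norm (\<phi>p z) \<le> 1/4" if "z \<in> right_dom (R + 5)" for z using small(1)[of z] right_dom_mono'[of R "R + 5"] that by auto
    show "norm (\<phi>m z) \<le> 1/4" if "z \<in> left_dom (R + 5)" for z using small(2)[of z] left_dom_mono[of R "R + 5"] that by auto
  qed (use R4 K C right_Re left_Re Im_bounds in auto)
  show ?thesis by (rule that[OF S.formal_series_nth_0 S.borel_summable_plus S.asymptotic_plus])
qed

text \<open>The Cauchy--Heine theory is formulated for the right-hand member of a pair, so the pair
  is reflected: the left function becomes the right-hand member, and the result is reflected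
  back.\<close>

lemma summable_left:
  obtains \<psi> B where "fps_nth \<psi> 0 = 0" "borel_summable \<psi> arc_minus B \<psi>m" "asymptotic_to (filtermap uminus real_filter) \<psi>m \<psi>"
proof -
  obtain C where C: "C \<ge> 0" "\<And>z. \<bar>Im z\<bar> > R + 5 \<Longrightarrow> norm (\<psi>p z - \<psi>m z) \<le> C * exp (- 2 * \<bar>Im z\<bar>)"
    by (rule \<psi>_diff_decay) (rule that; assumption)
  interpret S: sectorial_pair "R + 5" "R + 6" "1/4" K C "\<lambda>z. - \<psi>m (- z)" "\<lambda>z. - \<psi>p (- z)"
  proof
    have m: "left_dom (R + 5) \<subseteq> left_dom R" and p: "right_dom (R + 5) \<subseteq> right_dom R"
      by (rule left_dom_mono, simp, rule right_dom_mono', simp)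
    have "\<psi>m \<circ> uminus holomorphic_on right_dom (R + 5)"
      by (rule holomorphic_on_compose_gen[OF _ holo(4)]) (use p in \<open>auto intro!: holomorphic_intros simp: left_dom_uminus\<close>)
    thus "(\<lambda>z. - \<psi>m (- z)) holomorphic_on right_dom (R + 5)" by (intro holomorphic_intros) (simp add: o_def)
    have "\<psi>p \<circ> uminus holomorphic_on left_dom (R + 5)"
      by (rule holomorphic_on_compose_gen[OF _ holo(2)]) (use m in \<open>auto intro!: holomorphic_intros simp: left_dom_uminus\<close>)
    thus "(\<lambda>z. - \<psi>p (- z)) holomorphic_on left_dom (R + 5)" by (intro holomorphic_intros) (simp add: o_def)
    show "norm (- \<psi>m (- z)) \<le> 1/4" if "z \<in> right_dom (R + 5)" for z
      using small(2)[of "- z"] p that by (auto simp: left_dom_uminus)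
    show "norm (- \<psi>p (- z)) \<le> 1/4" if "z \<in> left_dom (R + 5)" for z
      using small(1)[of "- z"] m that by (auto simp: left_dom_uminus)
    show "norm (- \<psi>m (- z)) \<le> K / Re z" if "Re z > R + 5" for z using left_Re[of "- z"] that by simp
    show "norm (- \<psi>p (- z)) \<le> K / - Re z" if "Re z < - (R + 5)" for z using right_Re[of "- z"] that by simp
    show "norm (- \<psi>m (- z)) \<le> K / \<bar>Im z\<bar>" if "\<bar>Im z\<bar> > R + 5" for z using Im_bounds(4)[of "- z"] that by simp
    show "norm (- \<psi>p (- z)) \<le> K / \<bar>Im z\<bar>" if "\<bar>Im z\<bar> > R + 5" for z using Im_bounds(2)[of "- z"] that by simp
    show "norm (- \<psi>m (- z) - - \<psi>p (- z)) \<le> C * exp (- 2 * \<bar>Im z\<bar>)" if "\<bar>Im z\<bar> > R + 5" for z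
      using C(2)[of "- z"] that by simp
  qed (use R4 K C in auto)
  have s: "borel_summable (reflect S.formal_series) arc_minus (2 * (R + 6)) \<psi>m"
    using borel_summable_reflect[OF S.borel_summable_plus] by simp
  have as: "asymptotic_to (filtermap uminus real_filter) \<psi>m (reflect S.formal_series)"
    using asymptotic_to_reflect[OF asymptotic_to_mono[OF S.asymptotic_plus real_filter_le_cone]] by simp
  show ?thesis by (rule that[OF _ s as]) simp
qed

lemma asymptotic_F: "G \<le> at_infinity \<Longrightarrow> asymptotic_to G (\<lambda>z. eval_fps a (inverse z)) a"
  by (rule asymptotic_to_mono[OF asymptotic_to_eval_fps[OF germ_coeffs(1)]])

text \<open>Both sides of v^+ o F = v^+ + 1 are expanded along the positive axis; uniqueness of the
  expansion turns the equation of functions into one of formal series.\<close>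

lemma formal_iterator:
  assumes "fps_nth \<phi> 0 = 0" "asymptotic_to cone_filter \<phi>p \<phi>"
  shows "germ_comp \<phi> a = \<phi> + 1"
proof -
  have lim: "filterlim (\<lambda>z. z + eval_fps a (inverse z)) cone_filter real_filter"
    unfolding filterlim_iff real_filter_def eventually_filtermap
  proof (intro allI impI)
    fix P assume "eventually P cone_filter"
    then obtain b where b: "\<And>z. norm z \<ge> b \<Longrightarrow> \<bar>Im z\<bar> \<le> Re z \<longrightarrow> P z"
      unfolding eventually_cone_filter eventually_at_infinity by blast
    show "\<forall>\<^sub>F x in at_top. P (of_real x + eval_fps a (inverse (of_real x)))"
      using eventually_gt_at_top[of "max R b"]
    proof eventually_elim
      case (elim x)
      define w where "w = F (of_real x)"
      have "norm (w - (of_real x + 1)) \<le> 1/4" unfolding w_def using elim R4 by (intro near_shift) auto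
      hence "\<bar>Re w - (x + 1)\<bar> \<le> 1/4" "\<bar>Im w\<bar> \<le> 1/4"
        using abs_Re_le_cmod[of "w - (of_real x + 1)"] abs_Im_le_cmod[of "w - (of_real x + 1)"] by auto
      moreover from this have "norm w \<ge> b" "\<bar>Im w\<bar> \<le> Re w" using complex_Re_le_cmod[of w] elim R4 by linarith+
      ultimately have "P w" using b by blast
      thus ?case by (simp add: w_def germ_fun_def)
    qed
  qed
  have "asymptotic_to real_filter (\<lambda>z. eval_fps a (inverse z) + \<phi>p (z + eval_fps a (inverse z))) (germ_comp \<phi> a)"
    by (rule asymptotic_to_compose[OF real_filter_le asymptotic_F[OF real_filter_le] cone_filter_le assms(2) lim])
  moreover have "\<forall>\<^sub>F z in real_filter. eval_fps a (inverse z) + \<phi>p (z + eval_fps a (inverse z)) = \<phi>p z + 1"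
    unfolding real_filter_def eventually_filtermap using eventually_gt_at_top[of R]
  proof eventually_elim
    case (elim x)
    have "of_real x \<in> right_dom R" using elim by (simp add: right_dom_def)
    from funeq(1)[OF this] show ?case by (simp add: germ_fun_def algebra_simps)
  qed
  ultimately have "asymptotic_to real_filter (\<lambda>z. \<phi>p z + 1) (germ_comp \<phi> a)" by (rule asymptotic_to_cong)
  moreover have "asymptotic_to real_filter (\<lambda>z. \<phi>p z + 1) (\<phi> + fps_const 1)"
    by (intro asymptotic_to_add_const asymptotic_to_mono[OF assms(2) real_filter_le_cone])
  ultimately show ?thesis using asymptotic_to_unique[OF real_filter_le real_filter_nontrivial] by fastforce
qed

text \<open>The same transfer for F o u^- = u^- o (z + 1), now along the negative axis, the side on
  which the expansion of u^- is available.\<close>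

lemma formal_inv_iterator:
  assumes "fps_nth \<psi> 0 = 0" "asymptotic_to (filtermap uminus real_filter) \<psi>m \<psi>"
  shows "germ_comp a \<psi> = germ_comp \<psi> 1"
proof -
  define G where "G = filtermap uminus real_filter"
  have G: "G \<le> at_infinity" "G \<noteq> bot" "asymptotic_to G \<psi>m \<psi>"
    using uminus_real_filter_le real_filter_nontrivial assms(2) by (auto simp: G_def filtermap_bot_iff)
  have evG: "eventually P G" if "\<And>x. x > M \<Longrightarrow> P (- of_real x)" for P M
    unfolding G_def real_filter_def eventually_filtermap using eventually_gt_at_top[of M] by eventually_elim (rule that)
  have lim1: "filterlim (\<lambda>z. z + \<psi>m z) at_infinity G"
    unfolding filterlim_iff
  proof (intro allI impI)
    fix P :: "complex \<Rightarrow> bool" assume "eventually P at_infinity"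
    then obtain b where b: "\<And>z. norm z \<ge> b \<Longrightarrow> P z" by (auto simp: eventually_at_infinity)
    show "\<forall>\<^sub>F z in G. P (z + \<psi>m z)"
    proof (rule evG[of "max R (b + 1)"], rule b)
      fix x assume x: "x > max R (b + 1)"
      have "norm (\<psi>m (- of_real x)) \<le> 1/4" using small(2)[of "- of_real x"] x by (simp add: left_dom_def)
      moreover have "norm (- of_real x :: complex) \<le> norm (- of_real x + \<psi>m (- of_real x)) + norm (\<psi>m (- of_real x))"
        using norm_triangle_ineq4[of "- of_real x + \<psi>m (- of_real x)" "\<psi>m (- of_real x)"] by simp
      ultimately show "norm (- of_real x + \<psi>m (- of_real x)) \<ge> b" using x R4 by simp
    qed
  qed
  have lim2: "filterlim (\<lambda>z. z + 1) G G"
    unfolding filterlim_iff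
  proof (intro allI impI)
    fix P assume "eventually P G"
    then obtain b where b: "\<And>x. x \<ge> b \<Longrightarrow> P (- of_real x)"
      unfolding G_def real_filter_def eventually_filtermap eventually_at_top_linorder by blast
    show "\<forall>\<^sub>F z in G. P (z + 1)"
    proof (rule evG[of "b + 1"])
      fix x assume "x > b + 1"
      hence "P (- of_real (x - 1))" by (intro b) simp
      thus "P (- of_real x + 1)" by simp
    qed
  qed
  have 1: "asymptotic_to G (\<lambda>z. \<psi>m z + eval_fps a (inverse (z + \<psi>m z))) (germ_comp a \<psi>)"
    by (rule asymptotic_to_compose[OF G(1) G(3) order_refl asymptotic_F[OF order_refl] lim1])
  have c1: "asymptotic_to G (\<lambda>z. 1) 1"
    using asymptotic_to_mono[OF asymptotic_to_eval_fps[of 1] G(1)] by simp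
  have 2: "asymptotic_to G (\<lambda>z. 1 + \<psi>m (z + 1)) (germ_comp \<psi> 1)"
    by (rule asymptotic_to_compose[OF G(1) c1 G(1) G(3) lim2])
  have "\<forall>\<^sub>F z in G. \<psi>m z + eval_fps a (inverse (z + \<psi>m z)) = 1 + \<psi>m (z + 1)"
  proof (rule evG[of "R + 3"])
    fix x assume "x > R + 3"
    hence "- of_real x \<in> left_dom (R + 3)" by (simp add: left_dom_def)
    from u_shift(2)[OF this]
    have "(- of_real x + \<psi>m (- of_real x)) + eval_fps a (inverse (- of_real x + \<psi>m (- of_real x))) = - of_real x + 1 + \<psi>m (- of_real x + 1)"
      by (simp only: germ_fun_def)
    thus "\<psi>m (- of_real x) + eval_fps a (inverse (- of_real x + \<psi>m (- of_real x))) = 1 + \<psi>m (- of_real x + 1)"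
      by (simp only: add.assoc add_left_cancel)
  qed
  from asymptotic_to_unique[OF G(1,2) asymptotic_to_cong[OF 1 this] 2] show ?thesis .
qed

lemma borel_sums:
  obtains B where "\<And>\<theta> z. \<theta> \<in> arc_plus \<Longrightarrow> Re (z * cis \<theta>) > B \<Longrightarrow> v_plus a z = z + \<phi>p z"
    "\<And>\<theta> z. \<theta> \<in> arc_minus \<Longrightarrow> Re (z * cis \<theta>) > B \<Longrightarrow> u_minus a z = z + \<psi>m z"
proof -
  obtain \<phi> B1 where phi: "fps_nth \<phi> 0 = 0" "borel_summable \<phi> arc_plus B1 \<phi>p" "asymptotic_to cone_filter \<phi>p \<phi>"
    by (rule summable_right) (rule that; assumption)
  obtain \<psi> B2 where psi: "fps_nth \<psi> 0 = 0" "borel_summable \<psi> arc_minus B2 \<psi>m" "asymptotic_to (filtermap uminus real_filter) \<psi>m \<psi>"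
    by (rule summable_left) (rule that; assumption)
  note fi = formal_iterator[OF phi(1,3)]
  have it: "iterator a = \<phi>" by (rule iterator_unique[OF germ_coeffs(2) phi(1) fi])
  have iv: "inv_iterator a = \<psi>" by (rule inv_iterator_unique[OF germ_coeffs(2) phi(1) fi psi(1) formal_inv_iterator[OF psi(1,3)]])
  show ?thesis
  proof (rule that[of "max B1 B2"])
    show "v_plus a z = z + \<phi>p z" if "\<theta> \<in> arc_plus" "Re (z * cis \<theta>) > max B1 B2" for \<theta> z
      unfolding v_plus_def it by (rule borel_sum_eq[OF _ phi(2) that(1)]) (use that in auto)
    show "u_minus a z = z + \<psi>m z" if "\<theta> \<in> arc_minus" "Re (z * cis \<theta>) > max B1 B2" for \<theta> z
      unfolding u_minus_def iv by (rule borel_sum_eq[OF _ psi(2) that(1)]) (use that in auto)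
  qed
qed

text \<open>
  One direction of summation serves a whole quarter plane: the angles chosen below lie in the two
  arcs and stay, added to the argument \<open>\<theta>\<close>, within \<open>5\<pi>/12\<close> of \<open>0\<close> modulo \<open>2\<pi>\<close>.
\<close>

lemma horn_composite:
  obtains R' where "R' > 0" "\<And>r \<theta>. r > R' \<Longrightarrow> \<theta> \<in> {pi/4<..<3*pi/4} \<Longrightarrow> v_plus a (u_minus a (of_real r * cis \<theta>)) = horn (of_real r * cis \<theta>)"
    "\<And>r \<theta>. r > R' \<Longrightarrow> \<theta> \<in> {5*pi/4<..<7*pi/4} \<Longrightarrow> v_plus a (u_minus a (of_real r * cis \<theta>)) = horn (of_real r * cis \<theta>)"
proof -
  obtain B where B: "\<And>\<theta> z. \<theta> \<in> arc_plus \<Longrightarrow> Re (z * cis \<theta>) > B \<Longrightarrow> v_plus a z = z + \<phi>p z"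
    "\<And>\<theta> z. \<theta> \<in> arc_minus \<Longrightarrow> Re (z * cis \<theta>) > B \<Longrightarrow> u_minus a z = z + \<psi>m z"
    by (rule borel_sums) (rule that; assumption)
  define c where "c = cos (5 * pi / 12)"
  have c: "c > 0" unfolding c_def by (intro cos_gt_zero_pi) auto
  define R' where "R' = (\<bar>B\<bar> + R + 1) / c"
  have R': "R' > 0" using c R4 by (simp add: R'_def)
  have rc: "r * c > \<bar>B\<bar> + R + 1" if "r > R'" for r using that c by (simp add: R'_def field_simps)
  have main: "v_plus a (u_minus a (of_real r * cis \<theta>)) = horn (of_real r * cis \<theta>)"
    if r: "r > R'" and u: "\<theta>u \<in> arc_minus" "cis (\<theta> + \<theta>u) = cis \<alpha>" "\<bar>\<alpha>\<bar> \<le> 5 * pi / 12"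
      and v: "\<theta>v \<in> arc_plus" "cis (\<theta> + \<theta>v) = cis \<beta>" "\<bar>\<beta>\<bar> \<le> 5 * pi / 12"
      and s: "\<sigma> = 1 \<or> \<sigma> = -1" "Im (cis \<theta>) = \<sigma> * Re (cis \<gamma>)" "\<bar>\<gamma>\<bar> \<le> 5 * pi / 12" for r \<theta> \<theta>u \<alpha> \<theta>v \<beta> \<gamma> and \<sigma> :: real
  proof -
    define z where "z = of_real r * cis \<theta>"
    have r0: "r \<ge> 0" using r R' by simp
    have eq: "z * cis \<theta>u = of_real r * cis \<alpha>" using u(2) by (simp add: z_def mult.assoc cis_mult)
    have "Re (z * cis \<theta>u) > B" unfolding eq using cis_Re_ge[OF u(3) r0] rc[OF r] R4 unfolding c_def by linarith
    hence um: "u_minus a z = z + \<psi>m z" by (rule B(2)[OF u(1)])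
    \<comment> \<open>\<gamma> is \<theta> measured from the imaginary half-axis; it bounds |Im z|
      from below, so that z lies in the domain of \<psi>m.\<close>
    have "cos \<gamma> > 0" using cis_Re_ge[OF s(3), of 1] c by (simp add: c_def)
    hence "\<bar>Im z\<bar> = Re (of_real r * cis \<gamma>)"
      using s cis_Re_ge[OF s(3) r0] rc[OF r] R4 r0 c by (auto simp: z_def c_def abs_mult)
    hence "\<bar>Im z\<bar> > R" using cis_Re_ge[OF s(3) r0] rc[OF r] unfolding c_def by linarith
    hence "z \<in> left_dom R" by (simp add: left_dom_def)
    hence sm: "norm (\<psi>m z) \<le> 1/4" using small(2) by blast
    have "z * cis \<theta>v = of_real r * cis \<beta>" using v(2) by (simp add: z_def mult.assoc cis_mult)
    hence "Re (z * cis \<theta>v) \<ge> r * c" using cis_Re_ge[OF v(3) r0] unfolding c_def by simp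
    moreover have "\<bar>Re (\<psi>m z * cis \<theta>v)\<bar> \<le> 1/4" using abs_Re_le_cmod[of "\<psi>m z * cis \<theta>v"] sm by (simp add: norm_mult)
    ultimately have "Re ((z + \<psi>m z) * cis \<theta>v) > B" unfolding distrib_right plus_complex.sel using rc[OF r] R4 by linarith
    hence "v_plus a (z + \<psi>m z) = (z + \<psi>m z) + \<phi>p (z + \<psi>m z)" by (rule B(1)[OF v(1)])
    thus ?thesis using um by (simp add: z_def horn_def)
  qed
  show ?thesis
  proof (rule that[OF R'])
    fix r \<theta> assume r: "r > R'"
    { assume th: "\<theta> \<in> {pi/4<..<3*pi/4}"
      \<comment> \<open>Adding 4 pi/3 and -pi/3 sends (pi/4, 3 pi/4) to (-5 pi/12, pi/12), modulo 2
        pi, and to (-pi/12, 5 pi/12); both stay away from the directions of the imaginary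
        axis.\<close>
      have e: "\<theta> + 4 * pi / 3 = (\<theta> - 2 * pi / 3) + 2 * pi" by (simp add: field_simps)
      have "cis (\<theta> + 4 * pi / 3) = cis (\<theta> - 2 * pi / 3)" unfolding e using cis_minus_2pi[of "\<theta> - 2 * pi / 3 + 2 * pi"] by simp
      moreover have "Im (cis \<theta>) = 1 * Re (cis (\<theta> - pi/2))" by (simp add: cos_diff)
      moreover have th': "pi / 4 < \<theta>" "\<theta> < 3 * pi / 4" using th by simp_all
      have "\<bar>\<theta> - 2 * pi / 3\<bar> \<le> 5 * pi / 12" using th' by linarith
      moreover have "\<bar>\<theta> + - pi / 3\<bar> \<le> 5 * pi / 12" using th' by linarith
      moreover have "\<bar>\<theta> - pi / 2\<bar> \<le> 5 * pi / 12" using th' by linarith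
      ultimately show "v_plus a (u_minus a (of_real r * cis \<theta>)) = horn (of_real r * cis \<theta>)"
        using th pi_gt_zero by (intro main[OF r, of "4 * pi / 3" \<theta> "\<theta> - 2 * pi / 3" "- pi / 3" "\<theta> + - pi / 3" 1 "\<theta> - pi/2"])
          (simp_all add: arc_plus_def arc_minus_def) }
    { assume th: "\<theta> \<in> {5*pi/4<..<7*pi/4}"
      have e: "\<theta> + 2 * pi / 3 = (\<theta> - 4 * pi / 3) + 2 * pi" "\<theta> + pi / 3 = (\<theta> - 5 * pi / 3) + 2 * pi" by (simp_all add: field_simps)
      have "cis (\<theta> + 2 * pi / 3) = cis (\<theta> - 4 * pi / 3)" "cis (\<theta> + pi / 3) = cis (\<theta> - 5 * pi / 3)"
        unfolding e using cis_minus_2pi[of "\<theta> - 4 * pi / 3 + 2 * pi"] cis_minus_2pi[of "\<theta> - 5 * pi / 3 + 2 * pi"] by simp_all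
      moreover have "Im (cis \<theta>) = - 1 * Re (cis (\<theta> - 3 * pi/2))" using cos_3over2_pi sin_3over2_pi by (simp add: cos_diff)
      moreover have th': "5 * pi / 4 < \<theta>" "\<theta> < 7 * pi / 4" using th by simp_all
      have "\<bar>\<theta> - 4 * pi / 3\<bar> \<le> 5 * pi / 12" using th' by linarith
      moreover have "\<bar>\<theta> - 5 * pi / 3\<bar> \<le> 5 * pi / 12" using th' by linarith
      moreover have "\<bar>\<theta> - 3 * pi / 2\<bar> \<le> 5 * pi / 12" using th' by linarith
      ultimately show "v_plus a (u_minus a (of_real r * cis \<theta>)) = horn (of_real r * cis \<theta>)"
        using th pi_gt_zero by (intro main[OF r, of "2 * pi / 3" \<theta> "\<theta> - 4 * pi / 3" "pi / 3" "\<theta> - 5 * pi / 3" "-1" "\<theta> - 3 * pi/2"])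
          (simp_all add: arc_plus_def arc_minus_def) }
  qed
qed

lemma horn_hol: "horn holomorphic_on {z. \<bar>Im z\<bar> > R + 3}"
  unfolding horn_eq[abs_def] by (intro holomorphic_intros horn_diff_hol)

text \<open>\<open>horn\<close> meets the specification in \<open>horn_up\<close>, so
  \<open>SOME\<close> selects a function that meets it as well. Both agree far up on the imaginary
  axis, hence on a common half-plane by the identity theorem.\<close>

lemma horn_up_eq:
  obtains \<sigma> where "\<sigma> > 0" "\<sigma> \<ge> R + 3" "\<And>z. Im z > \<sigma> \<Longrightarrow> horn_up a z = horn z"
proof -
  obtain R' where R': "R' > 0" and c: "\<And>r \<theta>. r > R' \<Longrightarrow> \<theta> \<in> {pi/4<..<3*pi/4} \<Longrightarrow> v_plus a (u_minus a (of_real r * cis \<theta>)) = horn (of_real r * cis \<theta>)"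
    by (rule horn_composite) (rule that; assumption)
  have "\<exists>\<sigma>>0. horn_up a holomorphic_on {z. Im z > \<sigma>} \<and> (\<exists>R>0. \<forall>r>R. \<forall>\<theta>\<in>{pi/4<..<3*pi/4}.
        horn_up a (of_real r * cis \<theta>) = v_plus a (u_minus a (of_real r * cis \<theta>)))"
    unfolding horn_up_def
  proof (rule someI[where x = horn and P = "\<lambda>H. \<exists>\<sigma>>0. H holomorphic_on {z. Im z > \<sigma>} \<and> (\<exists>R>0. \<forall>r>R. \<forall>\<theta>\<in>{pi/4<..<3*pi/4}.
        H (of_real r * cis \<theta>) = v_plus a (u_minus a (of_real r * cis \<theta>)))"])
    show "\<exists>\<sigma>>0. horn holomorphic_on {z. Im z > \<sigma>} \<and> (\<exists>R>0. \<forall>r>R. \<forall>\<theta>\<in>{pi/4<..<3*pi/4}.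
        horn (of_real r * cis \<theta>) = v_plus a (u_minus a (of_real r * cis \<theta>)))"
    proof (rule exI[of _ "R + 3"], intro conjI)
      show "horn holomorphic_on {z. Im z > R + 3}" by (rule holomorphic_on_subset[OF horn_hol]) auto
    qed (use R4 R' c in auto)
  qed
  then obtain s R2 where s: "s > 0" "horn_up a holomorphic_on {z. Im z > s}" and R2: "R2 > 0"
    "\<And>r \<theta>. r > R2 \<Longrightarrow> \<theta> \<in> {pi/4<..<3*pi/4} \<Longrightarrow> horn_up a (of_real r * cis \<theta>) = v_plus a (u_minus a (of_real r * cis \<theta>))" by blast
  define \<sigma> where "\<sigma> = max s (R + 3)"
  have sig: "\<sigma> > 0" "\<sigma> \<ge> s" "\<sigma> \<ge> R + 3" using s R4 by (auto simp: \<sigma>_def)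
  define y where "y = Max {R', R2, \<sigma>}"
  have y: "y \<ge> R'" "y \<ge> R2" "y \<ge> \<sigma>" by (auto simp: y_def)
  show ?thesis
  proof (rule that[OF sig(1) sig(3)])
    fix z assume z: "Im z > \<sigma>"
    have "horn_up a z - horn z = 0"
    proof (rule analytic_continuation[where f = "\<lambda>z. horn_up a z - horn z" and S = "{z. Im z > \<sigma>}" and U = "(\<lambda>t. of_real t * \<i> * of_real 1) ` {y<..}" and \<xi> = "of_real (y + 1) * \<i> * of_real 1"])
      show "(\<lambda>z. horn_up a z - horn z) holomorphic_on {z. Im z > \<sigma>}"
        using sig by (intro holomorphic_on_diff holomorphic_on_subset[OF s(2)] holomorphic_on_subset[OF horn_hol]) auto
      show "connected {z. Im z > \<sigma>}" by (intro convex_connected convex_halfspace_Im_gt)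
      fix x assume "x \<in> (\<lambda>t. of_real t * \<i> * of_real 1) ` {y<..}"
      then obtain t where t: "t > y" "x = of_real t * cis (pi/2)" by auto
      have "horn_up a x = horn x" unfolding t(2) using R2(2)[of t "pi/2"] c[of t "pi/2"] t(1) y by auto
      thus "horn_up a x - horn x = 0" by simp
    qed (use z y half_line_islimpt[of 1 y] in \<open>auto simp: open_halfspace_Im_gt\<close>)
    thus "horn_up a z = horn z" by simp
  qed
qed

lemma horn_low_eq:
  obtains \<sigma> where "\<sigma> > 0" "\<sigma> \<ge> R + 3" "\<And>z. Im z < - \<sigma> \<Longrightarrow> horn_low a z = horn z"
proof -
  obtain R' where R': "R' > 0" and c: "\<And>r \<theta>. r > R' \<Longrightarrow> \<theta> \<in> {5*pi/4<..<7*pi/4} \<Longrightarrow> v_plus a (u_minus a (of_real r * cis \<theta>)) = horn (of_real r * cis \<theta>)"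
    by (rule horn_composite) (rule that; assumption)
  have "\<exists>\<sigma>>0. horn_low a holomorphic_on {z. Im z < - \<sigma>} \<and> (\<exists>R>0. \<forall>r>R. \<forall>\<theta>\<in>{5*pi/4<..<7*pi/4}.
        horn_low a (of_real r * cis \<theta>) = v_plus a (u_minus a (of_real r * cis \<theta>)))"
    unfolding horn_low_def
  proof (rule someI[where x = horn and P = "\<lambda>H. \<exists>\<sigma>>0. H holomorphic_on {z. Im z < - \<sigma>} \<and> (\<exists>R>0. \<forall>r>R. \<forall>\<theta>\<in>{5*pi/4<..<7*pi/4}.
        H (of_real r * cis \<theta>) = v_plus a (u_minus a (of_real r * cis \<theta>)))"])
    show "\<exists>\<sigma>>0. horn holomorphic_on {z. Im z < - \<sigma>} \<and> (\<exists>R>0. \<forall>r>R. \<forall>\<theta>\<in>{5*pi/4<..<7*pi/4}.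
        horn (of_real r * cis \<theta>) = v_plus a (u_minus a (of_real r * cis \<theta>)))"
    proof (rule exI[of _ "R + 3"], intro conjI)
      show "horn holomorphic_on {z. Im z < - (R + 3)}" by (rule holomorphic_on_subset[OF horn_hol]) auto
    qed (use R4 R' c in auto)
  qed
  then obtain s R2 where s: "s > 0" "horn_low a holomorphic_on {z. Im z < - s}" and R2: "R2 > 0"
    "\<And>r \<theta>. r > R2 \<Longrightarrow> \<theta> \<in> {5*pi/4<..<7*pi/4} \<Longrightarrow> horn_low a (of_real r * cis \<theta>) = v_plus a (u_minus a (of_real r * cis \<theta>))" by blast
  define \<sigma> where "\<sigma> = max s (R + 3)"
  have sig: "\<sigma> > 0" "\<sigma> \<ge> s" "\<sigma> \<ge> R + 3" using s R4 by (auto simp: \<sigma>_def)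
  define y where "y = Max {R', R2, \<sigma>}"
  have y: "y \<ge> R'" "y \<ge> R2" "y \<ge> \<sigma>" by (auto simp: y_def)
  have cis32: "cis (3 * pi / 2) = - \<i>" using cos_3over2_pi sin_3over2_pi by (simp add: complex_eq_iff)
  show ?thesis
  proof (rule that[OF sig(1) sig(3)])
    fix z assume z: "Im z < - \<sigma>"
    have "horn_low a z - horn z = 0"
    proof (rule analytic_continuation[where f = "\<lambda>z. horn_low a z - horn z" and S = "{z. Im z < - \<sigma>}" and U = "(\<lambda>t. of_real t * \<i> * of_real (-1)) ` {y<..}" and \<xi> = "of_real (y + 1) * \<i> * of_real (-1)"])
      show "(\<lambda>z. horn_low a z - horn z) holomorphic_on {z. Im z < - \<sigma>}"
        using sig by (intro holomorphic_on_diff holomorphic_on_subset[OF s(2)] holomorphic_on_subset[OF horn_hol]) auto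
      show "connected {z. Im z < - \<sigma>}" by (intro convex_connected convex_halfspace_Im_lt)
      fix x assume "x \<in> (\<lambda>t. of_real t * \<i> * of_real (-1)) ` {y<..}"
      then obtain t where t: "t > y" "x = of_real t * cis (3 * pi / 2)" by (auto simp: cis32)
      have "horn_low a x = horn x" unfolding t(2) using R2(2)[of t "3 * pi / 2"] c[of t "3 * pi / 2"] t(1) y by auto
      thus "horn_low a x - horn x = 0" by simp
    qed (use z y half_line_islimpt[of "-1" y] in \<open>auto simp: open_halfspace_Im_lt\<close>)
    thus "horn_low a z = horn z" by simp
  qed
qed

end

text \<open>With coefficients 1 and 0 in degrees 0 and 1 the series is 1 + X^2 s, and s is bounded
  on a closed disc: this is the bound of order z^-2.\<close>

lemma simple_parabolic_imp_parabolic: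
  assumes "simple_parabolic_resiter0 a"
  obtains C R0 where "parabolic (\<lambda>z. eval_fps a (inverse z) - 1) C R0"
proof -
  define s where "s = fps_shift 2 a"
  have a: "fps_conv_radius a > 0" "fps_nth a 0 = 1" "fps_nth a 1 = 0" using assms by (simp_all add: simple_parabolic_resiter0_def)
  have split: "a = 1 + fps_X ^ 2 * s"
  proof (rule fps_ext)
    fix n show "fps_nth a n = fps_nth (1 + fps_X ^ 2 * s) n"
      using a by (cases n rule: nat.exhaust; cases "n = 1") (auto simp: s_def fps_X_power_mult_nth Suc_diff_le)
  qed
  have rs: "fps_conv_radius s = fps_conv_radius a" by (simp add: s_def)
  obtain e where e: "0 < ereal e" "ereal e < fps_conv_radius a" using ereal_dense2 a(1) by blast
  have e0: "e > 0" using e by simp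
  have ev: "eval_fps a w - 1 = w ^ 2 * eval_fps s w" if "norm w < fps_conv_radius a" for w
  proof -
    have m: "eval_fps (fps_X ^ 2 * s) w = w ^ 2 * eval_fps s w"
      using that rs by (subst eval_fps_mult) (auto simp: eval_fps_power)
    have "ereal (norm w) < min (fps_conv_radius (fps_X ^ 2 :: complex fps)) (fps_conv_radius s)" using that rs by simp
    hence "ereal (norm w) < fps_conv_radius (fps_X ^ 2 * s)" using fps_conv_radius_mult[of "fps_X ^ 2" s] by (rule less_le_trans)
    thus ?thesis by (subst split) (simp add: eval_fps_add m)
  qed
  have sub: "cball (0 :: complex) e \<subseteq> eball 0 (fps_conv_radius a)"
  proof
    fix x :: complex assume "x \<in> cball 0 e"
    hence "ereal (norm x) \<le> ereal e" by simp
    thus "x \<in> eball 0 (fps_conv_radius a)" unfolding in_eball_iff using le_less_trans[OF _ e(2)] by simp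
  qed
  have "continuous_on (cball 0 e) (eval_fps s)"
    using sub rs by (intro holomorphic_on_imp_continuous_on holomorphic_intros) auto
  hence "bounded (eval_fps s ` cball 0 e)" by (intro compact_imp_bounded compact_continuous_image) auto
  then obtain C where C: "C > 0" "\<And>w. w \<in> cball 0 e \<Longrightarrow> norm (eval_fps s w) \<le> C" by (auto simp: bounded_pos)
  have inv_e: "inverse z \<in> cball 0 e" if "norm z > max 1 (1 / e)" for z :: complex
  proof -
    have "norm z > 1 / e" "z \<noteq> 0" using that by auto
    hence "norm (inverse z) \<le> e" unfolding norm_inverse using e0 by (simp add: field_simps)
    thus ?thesis by simp
  qed
  have "parabolic (\<lambda>z. eval_fps a (inverse z) - 1) C (max 1 (1 / e))"
  proof
    have "eval_fps a \<circ> inverse holomorphic_on {z. norm z > max 1 (1 / e)}"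
      by (rule holomorphic_on_compose_gen[OF _ holomorphic_on_eval_fps[OF sub]]) (use inv_e in \<open>auto intro!: holomorphic_intros\<close>)
    thus "(\<lambda>z. eval_fps a (inverse z) - 1) holomorphic_on {z. norm z > max 1 (1 / e)}"
      by (auto simp: o_def intro!: holomorphic_intros)
    fix z :: complex assume z: "norm z > max 1 (1 / e)"
    have "norm (inverse z) < fps_conv_radius a" using inv_e[OF z] sub by (auto simp: in_eball_iff)
    hence "norm (eval_fps a (inverse z) - 1) = norm (eval_fps s (inverse z)) / norm z ^ 2"
      by (simp add: ev norm_mult norm_power norm_inverse norm_divide field_simps)
    also have "\<dots> \<le> C / norm z ^ 2" using C(2)[OF inv_e[OF z]] by (intro divide_right_mono) auto
    finally show "norm (eval_fps a (inverse z) - 1) \<le> C / norm z ^ 2" .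
  qed (use C in auto)
  thus ?thesis by (rule that)
qed

lemma germ_data_mono:
  assumes "germ_data a R K \<phi>p \<psi>p \<phi>m \<psi>m" "R \<le> R'"
  shows "germ_data a R' K \<phi>p \<psi>p \<phi>m \<psi>m"
proof -
  interpret germ_data a R K \<phi>p \<psi>p \<phi>m \<psi>m by fact
  show ?thesis
  proof
    show "fatou_pair (right_dom R') F R' K \<phi>p \<psi>p" by (rule fatou_pair_mono[OF right right_dom_mono' _ order_refl]) (use assms(2) in simp_all)
    show "fatou_pair (left_dom R') F R' K \<phi>m \<psi>m" by (rule fatou_pair_mono[OF left left_dom_mono _ order_refl]) (use assms(2) in simp_all)
  qed (use a right_Re left_Re near_shift assms(2) in auto)
qed

lemma germ_data_exists:
  assumes a: "simple_parabolic_resiter0 a"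
  obtains R K \<phi>p \<psi>p \<phi>m \<psi>m where "germ_data a R K \<phi>p \<psi>p \<phi>m \<psi>m"
proof -
  obtain C R0 where P: "parabolic (\<lambda>z. eval_fps a (inverse z) - 1) C R0" by (rule simple_parabolic_imp_parabolic[OF a])
  interpret P: parabolic "\<lambda>z. eval_fps a (inverse z) - 1" C R0 by (rule P)
  have F: "P.F = germ_fun a" by (rule ext) (simp add: P.F_def germ_fun_def)
  obtain R1 K1 \<phi>p \<psi>p where p: "fatou_pair (right_dom R1) P.F R1 K1 \<phi>p \<psi>p" "R1 \<ge> R0"
    "\<And>z. Re z > R1 \<Longrightarrow> norm (\<phi>p z) \<le> K1 / Re z \<and> norm (\<psi>p z) \<le> K1 / Re z"
    by (rule P.fatou_pair_right) (rule that; assumption)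
  obtain R2 K2 \<phi>m \<psi>m where m: "fatou_pair (left_dom R2) P.F R2 K2 \<phi>m \<psi>m" "R2 \<ge> R0"
    "\<And>z. Re z < - R2 \<Longrightarrow> norm (\<phi>m z) \<le> K2 / - Re z \<and> norm (\<psi>m z) \<le> K2 / - Re z"
    by (rule P.fatou_pair_left) (rule that; assumption)
  \<comment> \<open>The last entry gives |F(z) - z - 1| \<le> C / |z| \<le> 1/4, which is
    \<open>near_shift\<close>.\<close>
  define R where "R = Max {R1, R2, R0, 4 * C + 1}"
  have R: "R1 \<le> R" "R2 \<le> R" "R0 \<le> R" "4 * C + 1 \<le> R" by (auto simp: R_def)
  define K where "K = max K1 K2"
  have K: "K1 \<le> K" "K2 \<le> K" by (auto simp: K_def)
  have R4: "R1 \<ge> 4" "R2 \<ge> 4" using p m by (simp_all add: fatou_pair_def)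
  have div: "x \<le> K' / y \<Longrightarrow> K' \<le> K \<Longrightarrow> y > 0 \<Longrightarrow> x \<le> K / y" for x y K' :: real
    by (erule order_trans) (rule divide_right_mono, auto)
  have "germ_data a R K \<phi>p \<psi>p \<phi>m \<psi>m"
  proof
    show "fatou_pair (right_dom R) (germ_fun a) R K \<phi>p \<psi>p"
      using fatou_pair_mono[OF p(1) right_dom_mono'[OF R(1)] R(1) K(1)] by (simp only: F)
    show "fatou_pair (left_dom R) (germ_fun a) R K \<phi>m \<psi>m"
      using fatou_pair_mono[OF m(1) left_dom_mono[OF R(2)] R(2) K(2)] by (simp only: F)
    show "norm (\<phi>p z) \<le> K / Re z \<and> norm (\<psi>p z) \<le> K / Re z" if "Re z > R" for z
      using p(3)[of z] that R(1) R4 K by (auto intro: div)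
    show "norm (\<phi>m z) \<le> K / - Re z \<and> norm (\<psi>m z) \<le> K / - Re z" if "Re z < - R" for z
    proof -
      have "- Re z > 0" using that R(2) R4 by linarith
      thus ?thesis using m(3)[of z] that R(2) K(2) div[of _ K2 "- Re z"] by auto
    qed
    show "norm (germ_fun a z - (z + 1)) \<le> 1/4" if z: "norm z > R" for z
    proof -
      have n: "norm z > R0" "norm z > 4 * C" "norm z \<ge> 1" using z R P.R0 by auto
      have "norm (germ_fun a z - (z + 1)) = norm (eval_fps a (inverse z) - 1)" by (simp add: germ_fun_def)
      also have "\<dots> \<le> C / norm z ^ 2" by (rule P.bound[OF n(1)])
      also have "\<dots> \<le> C / norm z ^ 1" using n P.C P.R0 by (intro divide_left_mono power_increasing mult_pos_pos zero_less_power) linarith+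
      also have "\<dots> \<le> 1/4" using n unfolding power_one_right by (subst pos_divide_le_eq) linarith+
      finally show ?thesis .
    qed
  qed (rule a)
  thus ?thesis by (rule that)
qed

subsection \<open>Analytic conjugacy\<close>

lemma right_filter_le: "filtercomap Re at_top \<le> at_infinity"
  unfolding le_filter_def eventually_at_infinity eventually_filtercomap_at_top_linorder
  using complex_Re_le_cmod order_trans by blast

lemma left_filter_le: "filtercomap Re at_bot \<le> at_infinity"
  unfolding le_filter_def eventually_at_infinity eventually_filtercomap_at_bot_linorder
proof (intro allI impI)
  fix P assume "\<exists>b. \<forall>x::complex. b \<le> norm x \<longrightarrow> P x"
  then obtain b where b: "\<And>x::complex. b \<le> norm x \<Longrightarrow> P x" by blast
  have "P x" if "Re x \<le> - b" for x using b[of x] abs_Re_le_cmod[of x] that by linarith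
  thus "\<exists>N. \<forall>x. Re x \<le> N \<longrightarrow> P x" by blast
qed

context germ_data
begin

text \<open>An invariant function is determined by its limit along the orbits, forward on the right, backward on the left.\<close>

lemma invariant_right:
  fixes w :: "complex \<Rightarrow> complex"
  assumes R': "R' \<ge> R" and w: "\<And>z. z \<in> right_dom R' \<Longrightarrow> w (F z) = w z"
    and lim: "(w \<longlongrightarrow> c) (filtercomap Re at_top)" and z: "z \<in> right_dom (R' + 4)"
  shows "w z = c"
proof -
  define t where "t = z + \<phi>p z"
  have zR: "z \<in> right_dom R" using z R' right_dom_mono[of R "R' + 4" z] by simp
  have t: "t \<in> right_dom (R' + 3)" using right_dom_perturb[of z "R' + 3" 1 t] z small(1)[OF zR] by (simp add: t_def add.assoc)
  \<comment> \<open>The orbit of z, written as u^+(t + n): in the Fatou coordinate it is a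
    translation orbit, whose abscissa tends to infinity.\<close>
  define x where "x n = t + of_nat n + \<psi>p (t + of_nat n)" for n
  have tn: "t + of_nat n \<in> right_dom (R' + 3)" for n by (rule right_dom_add_nat[OF t])
  have tn2: "t + of_nat n \<in> right_dom (R + 3)" for n using tn[of n] R' right_dom_mono[of "R + 3" "R' + 3"] by auto
  have sm: "norm (\<psi>p (t + of_nat n)) \<le> 1/4" for n using small(1) right_dom_mono[OF _ tn2, of R n] by auto
  have xn: "x n \<in> right_dom R'" for n using right_dom_perturb[of "t + of_nat n" R' 3 "x n"] tn sm[of n] by (simp add: x_def)
  have "F (x n) = x (Suc n)" for n using u_shift(1)[OF tn2, of n] by (simp add: x_def add_ac)
  hence "w (x (Suc n)) = w (x n)" for n using w[OF xn, of n] by simp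
  hence const: "w (x n) = w (x 0)" for n by (induction n) auto
  have x0: "x 0 = z" using inv(2)[OF zR] by (simp add: x_def t_def)
  have "filterlim (\<lambda>n. Re (x n)) at_top sequentially"
  proof (rule filterlim_at_top_mono)
    show "filterlim (\<lambda>n. (Re t - 1) + real n) at_top sequentially"
      by (rule filterlim_tendsto_add_at_top[OF tendsto_const filterlim_real_sequentially])
    show "\<forall>\<^sub>F n in sequentially. Re t - 1 + real n \<le> Re (x n)"
    proof (intro always_eventually allI)
      fix n show "Re t - 1 + real n \<le> Re (x n)"
        using sm[of n] abs_Re_le_cmod[of "\<psi>p (t + of_nat n)"] by (simp add: x_def)
    qed
  qed
  hence "filterlim x (filtercomap Re at_top) sequentially" by (simp add: filterlim_filtercomap_iff o_def)
  with lim have "(\<lambda>n. w (x n)) \<longlonglongrightarrow> c" by (rule filterlim_compose)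
  hence "(\<lambda>n. w z) \<longlonglongrightarrow> c" by (simp add: const x0)
  thus ?thesis by (simp add: LIMSEQ_const_iff)
qed

lemma invariant_left:
  fixes w :: "complex \<Rightarrow> complex"
  assumes R': "R' \<ge> R" and w: "\<And>z. z \<in> left_dom R' \<Longrightarrow> w (F z) = w z"
    and lim: "(w \<longlongrightarrow> c) (filtercomap Re at_bot)" and z: "z \<in> left_dom (R' + 4)"
  shows "w z = c"
proof -
  define t where "t = z + \<phi>m z"
  have zR: "z \<in> left_dom R" using z R' left_dom_mono[of R "R' + 4"] by auto
  have t: "t \<in> left_dom (R' + 3)" using left_dom_perturb[of z "R' + 3" 1 t] z small(2)[OF zR] by (simp add: t_def add.assoc)
  \<comment> \<open>A backward orbit without an inverse of F: the point u^-(t - n) is mapped by F to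
    u^-(t - n + 1).\<close>
  define x where "x n = t - of_nat n + \<psi>m (t - of_nat n)" for n
  have tn: "t - of_nat n \<in> left_dom (R' + 3)" for n using t by (auto simp: left_dom_def)
  have tn2: "t - of_nat n \<in> left_dom (R + 3)" for n using tn[of n] R' left_dom_mono[of "R + 3" "R' + 3"] by auto
  have sm: "norm (\<psi>m (t - of_nat n)) \<le> 1/4" for n using small(2) left_dom_mono[of R "R + 3"] tn2[of n] by auto
  have xn: "x n \<in> left_dom R'" for n using left_dom_perturb[of "t - of_nat n" R' 3 "x n"] tn sm[of n] by (simp add: x_def)
  have "F (x (Suc n)) = x n" for n using u_shift(2)[OF tn2, of "Suc n"] by (simp add: x_def algebra_simps)
  hence "w (x (Suc n)) = w (x n)" for n using w[OF xn, of "Suc n"] by simp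
  hence const: "w (x n) = w (x 0)" for n by (induction n) auto
  have x0: "x 0 = z" using inv(4)[OF zR] by (simp add: x_def t_def)
  have "filterlim (\<lambda>n. Re (x n)) at_bot sequentially"
  proof (rule filterlim_at_bot_mono)
    show "filterlim (\<lambda>n. (Re t + 1) + - real n) at_bot sequentially"
      by (subst filterlim_tendsto_add_at_bot_iff[OF tendsto_const]) (simp add: filterlim_uminus_at_bot filterlim_real_sequentially)
    show "\<forall>\<^sub>F n in sequentially. Re t + 1 + - real n \<ge> Re (x n)"
    proof (intro always_eventually allI)
      fix n show "Re t + 1 + - real n \<ge> Re (x n)"
        using sm[of n] abs_Re_le_cmod[of "\<psi>m (t - of_nat n)"] by (simp add: x_def)
    qed
  qed
  hence "filterlim x (filtercomap Re at_bot) sequentially" by (simp add: filterlim_filtercomap_iff o_def)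
  with lim have "(\<lambda>n. w (x n)) \<longlonglongrightarrow> c" by (rule filterlim_compose)
  hence "(\<lambda>n. w z) \<longlonglongrightarrow> c" by (simp add: const x0)
  thus ?thesis by (simp add: LIMSEQ_const_iff)
qed

lemma \<phi>_tendsto: "(\<phi>p \<longlongrightarrow> 0) (filtercomap Re at_top)" "(\<phi>m \<longlongrightarrow> 0) (filtercomap Re at_bot)"
proof -
  show "(\<phi>p \<longlongrightarrow> 0) (filtercomap Re at_top)"
  proof (rule Lim_null_comparison)
    show "\<forall>\<^sub>F z in filtercomap Re at_top. norm (\<phi>p z) \<le> K / Re z"
      unfolding eventually_filtercomap_at_top_linorder by (rule exI[of _ "R + 1"]) (use right_Re in auto)
    show "((\<lambda>z. K / Re z) \<longlongrightarrow> 0) (filtercomap Re at_top)"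
      by (rule tendsto_divide_0[OF tendsto_const]) (rule filterlim_mono[OF filterlim_filtercomap at_top_le_at_infinity order_refl])
  qed
  show "(\<phi>m \<longlongrightarrow> 0) (filtercomap Re at_bot)"
  proof (rule Lim_null_comparison)
    show "\<forall>\<^sub>F z in filtercomap Re at_bot. norm (\<phi>m z) \<le> (- K) / Re z"
      unfolding eventually_filtercomap_at_bot_linorder by (rule exI[of _ "- R - 1"]) (use left_Re in auto)
    show "((\<lambda>z. (- K) / Re z) \<longlongrightarrow> 0) (filtercomap Re at_bot)"
      by (rule tendsto_divide_0[OF tendsto_const]) (rule filterlim_mono[OF filterlim_filtercomap at_bot_le_at_infinity order_refl])
  qed
qed

end

locale germ_data_pair = f: germ_data a R K \<phi>p \<psi>p \<phi>m \<psi>m + g: germ_data b R L \<Phi>p \<Psi>p \<Phi>m \<Psi>m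
  for a b R K L \<phi>p \<psi>p \<phi>m \<psi>m \<Phi>p \<Psi>p \<Phi>m \<Psi>m
begin

text \<open>The clauses for the two half-planes merge into one about |Im z|, since both horn maps
  continue the same function \<open>horn\<close>. The margin |Im c| is for the argument z +
  c.\<close>

lemma horn_maps_related_iff:
  "horn_maps_related a b c \<longleftrightarrow> (\<exists>\<sigma>. \<forall>z. \<bar>Im z\<bar> > \<sigma> \<longrightarrow> g.horn z = f.horn (z + c) - c)"
proof
  obtain su where su: "\<And>z. Im z > su \<Longrightarrow> horn_up a z = f.horn z" by (rule f.horn_up_eq) (rule that; assumption)
  obtain sl where sl: "\<And>z. Im z < - sl \<Longrightarrow> horn_low a z = f.horn z" by (rule f.horn_low_eq) (rule that; assumption)
  obtain tu where tu: "\<And>z. Im z > tu \<Longrightarrow> horn_up b z = g.horn z" by (rule g.horn_up_eq) (rule that; assumption)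
  obtain tl where tl: "\<And>z. Im z < - tl \<Longrightarrow> horn_low b z = g.horn z" by (rule g.horn_low_eq) (rule that; assumption)
  define m where "m = Max {su, sl, tu, tl, 1} + \<bar>Im c\<bar>"
  have "Max {su, sl, tu, tl, 1} \<ge> su" "Max {su, sl, tu, tl, 1} \<ge> sl" "Max {su, sl, tu, tl, 1} \<ge> tu"
    "Max {su, sl, tu, tl, 1} \<ge> tl" "Max {su, sl, tu, tl, 1} \<ge> 1" by simp_all
  hence m: "m - \<bar>Im c\<bar> \<ge> su" "m - \<bar>Im c\<bar> \<ge> sl" "m - \<bar>Im c\<bar> \<ge> tu" "m - \<bar>Im c\<bar> \<ge> tl" "m - \<bar>Im c\<bar> \<ge> 1"
    by (simp_all only: m_def add_diff_cancel_right')
  have up: "horn_up a (z + c) = f.horn (z + c)" "horn_up b z = g.horn z" if "Im z > m" for z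
    by (rule su tu; use that m in simp; linarith)+
  have low: "horn_low a (z + c) = f.horn (z + c)" "horn_low b z = g.horn z" if "Im z < - m" for z
    by (rule sl tl; use that m in simp; linarith)+
  { assume "horn_maps_related a b c"
    then obtain s1 s2 where s: "\<And>z. Im z > s1 \<Longrightarrow> horn_up b z = horn_up a (z + c) - c" "\<And>z. Im z < - s2 \<Longrightarrow> horn_low b z = horn_low a (z + c) - c"
      unfolding horn_maps_related_def by blast
    have "g.horn z = f.horn (z + c) - c" if "\<bar>Im z\<bar> > Max {s1, s2, m}" for z
    proof -
      have "\<bar>Im z\<bar> > s1" "\<bar>Im z\<bar> > s2" "\<bar>Im z\<bar> > m" using that by simp_all
      thus ?thesis using s[of z] up[of z] low[of z] by (cases "Im z \<ge> 0") simp_all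
    qed
    thus "\<exists>\<sigma>. \<forall>z. \<bar>Im z\<bar> > \<sigma> \<longrightarrow> g.horn z = f.horn (z + c) - c" by blast }
  assume "\<exists>\<sigma>. \<forall>z. \<bar>Im z\<bar> > \<sigma> \<longrightarrow> g.horn z = f.horn (z + c) - c"
  then obtain s where s: "\<And>z. \<bar>Im z\<bar> > s \<Longrightarrow> g.horn z = f.horn (z + c) - c" by blast
  have ms: "max s m > 0" "max s m \<ge> s" "max s m \<ge> m" using m(5) by auto
  show "horn_maps_related a b c" unfolding horn_maps_related_def
  proof (intro conjI exI[of _ "max s m"] allI impI)
    fix z assume "Im z > max s m"
    hence "\<bar>Im z\<bar> > s" "Im z > m" by linarith+
    thus "horn_up b z = horn_up a (z + c) - c" using s[of z] up[of z] by simp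
  next
    fix z assume "Im z < - max s m"
    hence "\<bar>Im z\<bar> > s" "Im z < - m" by linarith+
    thus "horn_low b z = horn_low a (z + c) - c" using s[of z] low[of z] by simp
  qed (use ms in auto)
qed

text \<open>A conjugacy intertwines the Fatou coordinates up to its constant term.\<close>

lemma conjugate_imp_related:
  assumes h: "fps_conv_radius h > 0" "germ_comp b h = germ_comp h a"
  shows "horn_maps_related a b (- fps_nth h 0)"
proof -
  define c where "c = fps_nth h 0"
  define \<eta> where "\<eta> z = eval_fps h (inverse z)" for z
  \<comment> \<open>Near infinity |h(z) - z| \<le> r, as h - id tends to c.\<close>
  define r where "r = norm c + 1"
  have r: "r > 0" by (simp add: r_def add_nonneg_pos)
  have conv: "fps_conv_radius a > 0" "fps_conv_radius b > 0" using f.a g.a by (simp_all add: simple_parabolic_resiter0_def)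
  have "continuous (at 0) (eval_fps h)" using h(1) by (intro continuous_eval_fps) (simp add: zero_ereal_def)
  hence "(eval_fps h \<longlongrightarrow> c) (nhds 0)" by (simp add: isCont_def c_def eval_fps_at_0 tendsto_nhds_iff)
  hence eta: "(\<eta> \<longlongrightarrow> c) at_infinity" unfolding \<eta>_def[abs_def] by (rule filterlim_compose) (rule tendsto_inverse_0)
  have "\<forall>\<^sub>F z in at_infinity. norm (\<eta> z - c) < 1" using tendstoD[OF eta, of 1] by (simp add: dist_norm)
  moreover have "\<forall>\<^sub>F z in at_infinity. germ_fun b (germ_fun h z) = germ_fun h (germ_fun a z)"
    using germ_fun_comp[OF conv(2) h(1)] germ_fun_comp[OF h(1) conv(1)] by eventually_elim (use h(2) in simp)
  ultimately have "\<forall>\<^sub>F z in at_infinity. norm (\<eta> z - c) < 1 \<and> germ_fun b (germ_fun h z) = germ_fun h (germ_fun a z)"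
    by (rule eventually_conj)
  then obtain R0 where R0: "\<And>z. norm z \<ge> R0 \<Longrightarrow> norm (\<eta> z - c) < 1 \<and> germ_fun b (germ_fun h z) = germ_fun h (germ_fun a z)"
    by (auto simp: eventually_at_infinity)
  define R1 where "R1 = max R R0"
  have R1: "R1 \<ge> R" "R1 \<ge> R0" by (auto simp: R1_def)
  have hz: "germ_fun h z = z + \<eta> z" for z by (simp add: germ_fun_def \<eta>_def)
  have sm: "norm (\<eta> z) \<le> r" if "norm z > R1" for z
    using R0[of z] that R1 norm_triangle_sub[of "\<eta> z" c] by (simp add: r_def)
  have eqv: "germ_fun b (germ_fun h z) = germ_fun h (germ_fun a z)" if "norm z > R1" for z using R0[of z] that R1 by simp
  have fl: "filterlim (germ_fun h) (filtercomap Re at_top) (filtercomap Re at_top)" "filterlim (germ_fun h) (filtercomap Re at_bot) (filtercomap Re at_bot)"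
  proof -
    have "filterlim (\<lambda>z. Re (\<eta> z) + Re z) at_top (filtercomap Re at_top)"
      by (rule filterlim_tendsto_add_at_top[OF tendsto_Re[OF tendsto_mono[OF right_filter_le eta]] filterlim_filtercomap])
    thus "filterlim (germ_fun h) (filtercomap Re at_top) (filtercomap Re at_top)"
      by (simp add: filterlim_filtercomap_iff o_def hz add.commute)
    have "filterlim (\<lambda>z. Re (\<eta> z) + Re z) at_bot (filtercomap Re at_bot)"
      by (subst filterlim_tendsto_add_at_bot_iff[OF tendsto_Re[OF tendsto_mono[OF left_filter_le eta]]]) (rule filterlim_filtercomap)
    thus "filterlim (germ_fun h) (filtercomap Re at_bot) (filtercomap Re at_bot)"
      by (simp add: filterlim_filtercomap_iff o_def hz add.commute)
  qed
  have plus: "germ_fun h z + \<Phi>p (germ_fun h z) - (z + \<phi>p z) = c" if z: "z \<in> right_dom (R1 + r + 4)" for z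
  proof (rule f.invariant_right[where R' = "R1 + r" and w = "\<lambda>z. germ_fun h z + \<Phi>p (germ_fun h z) - (z + \<phi>p z)"])
    fix z assume z: "z \<in> right_dom (R1 + r)"
    have zR: "z \<in> right_dom R1" "z \<in> right_dom R" using z r R1 right_dom_mono[of _ "R1 + r" z] by simp_all
    have n: "norm z > R1" by (rule right_dom_norm[OF zR(1)])
    have "germ_fun h z \<in> right_dom R1" using right_dom_perturb[OF z, of "germ_fun h z"] sm[OF n] by (simp add: hz)
    hence hR: "germ_fun h z \<in> right_dom R" using right_dom_mono R1(1) by blast
    show "germ_fun h (f.F z) + \<Phi>p (germ_fun h (f.F z)) - (f.F z + \<phi>p (f.F z)) = germ_fun h z + \<Phi>p (germ_fun h z) - (z + \<phi>p z)"
      using f.funeq(1)[OF zR(2)] g.funeq(1)[OF hR] eqv[OF n] by simp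
  next
    have "((\<lambda>z. \<eta> z + \<Phi>p (germ_fun h z) - \<phi>p z) \<longlongrightarrow> c + 0 - 0) (filtercomap Re at_top)"
      by (intro tendsto_intros f.\<phi>_tendsto filterlim_compose[OF g.\<phi>_tendsto(1) fl(1)] tendsto_mono[OF right_filter_le eta])
    thus "((\<lambda>z. germ_fun h z + \<Phi>p (germ_fun h z) - (z + \<phi>p z)) \<longlongrightarrow> c) (filtercomap Re at_top)"
      by (simp add: hz algebra_simps)
  qed (use z r R1 in auto)
  have minus: "germ_fun h z + \<Phi>m (germ_fun h z) - (z + \<phi>m z) = c" if z: "z \<in> left_dom (R1 + r + 4)" for z
  proof (rule f.invariant_left[where R' = "R1 + r" and w = "\<lambda>z. germ_fun h z + \<Phi>m (germ_fun h z) - (z + \<phi>m z)"])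
    fix z assume z: "z \<in> left_dom (R1 + r)"
    have zR: "z \<in> left_dom R1" "z \<in> left_dom R" using z r R1 left_dom_mono[of R1 "R1 + r"] left_dom_mono[of R "R1 + r"] by auto
    have n: "norm z > R1" using right_dom_norm[of "- z" R1] zR(1) by (simp add: left_dom_uminus)
    have "germ_fun h z \<in> left_dom R1" using left_dom_perturb[OF z, of "germ_fun h z"] sm[OF n] by (simp add: hz)
    hence hR: "germ_fun h z \<in> left_dom R" using left_dom_mono R1(1) by blast
    show "germ_fun h (f.F z) + \<Phi>m (germ_fun h (f.F z)) - (f.F z + \<phi>m (f.F z)) = germ_fun h z + \<Phi>m (germ_fun h z) - (z + \<phi>m z)"
      using f.funeq(2)[OF zR(2)] g.funeq(2)[OF hR] eqv[OF n] by simp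
  next
    have "((\<lambda>z. \<eta> z + \<Phi>m (germ_fun h z) - \<phi>m z) \<longlongrightarrow> c + 0 - 0) (filtercomap Re at_bot)"
      by (intro tendsto_intros f.\<phi>_tendsto filterlim_compose[OF g.\<phi>_tendsto(2) fl(2)] tendsto_mono[OF left_filter_le eta])
    thus "((\<lambda>z. germ_fun h z + \<Phi>m (germ_fun h z) - (z + \<phi>m z)) \<longlongrightarrow> c) (filtercomap Re at_bot)"
      by (simp add: hz algebra_simps)
  qed (use z r R1 in auto)
  \<comment> \<open>At x = u^-(t), with u^- taken for f, the left identity says that h(x) is u^-(t +
    c) for g, and the right one evaluates v^+ of g there. Replacing t by z - c shows that the
    constant of the relation is -c.\<close>
  have "g.horn (t + c) = f.horn t + c" if t: "\<bar>Im t\<bar> > R1 + r + 5" for t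
  proof -
    define x where "x = t + \<psi>m t"
    define y where "y = germ_fun h x"
    have tR: "t \<in> left_dom R" using t R1 r by (simp add: left_dom_def)
    have imx: "\<bar>Im x\<bar> > R1 + r + 4" unfolding x_def using f.Im_pert[of "\<psi>m t" "1/4" t] f.small(2)[OF tR] t by linarith
    have "norm x > R1" using imx abs_Im_le_cmod[of x] r by linarith
    hence imy: "\<bar>Im y\<bar> > R" unfolding y_def hz using f.Im_pert[OF sm, of x x] imx R1 by linarith
    note yd = g.Im_dom[OF imy]
    have x': "x + \<phi>m x = t" using f.inv(3)[OF tR] by (simp add: x_def)
    have "x \<in> left_dom (R1 + r + 4)" using imx by (simp add: left_dom_def)
    from minus[OF this] have e1: "y + \<Phi>m y = t + c" by (simp add: y_def x' algebra_simps)
    hence e2: "t + c + \<Psi>m (t + c) = y" using g.inv(4)[of y] yd by (metis add.right_neutral add.assoc add.right_inverse)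
    have "x \<in> right_dom (R1 + r + 4)" using imx by (simp add: right_dom_def)
    from plus[OF this] have "y + \<Phi>p y = x + \<phi>p x + c" by (simp add: y_def algebra_simps)
    thus ?thesis unfolding g.horn_def f.horn_def e2 x_def .
  qed
  note main = this
  have "g.horn z = f.horn (z + (- c)) - (- c)" if "\<bar>Im z\<bar> > R1 + r + 5 + \<bar>Im c\<bar>" for z
    using main[of "z - c"] that by simp
  thus ?thesis unfolding horn_maps_related_iff c_def by blast
qed

end

section \<open>Gluing the two sides into a convergent germ\<close>

lemma right_left_dom_Int: "R \<ge> 0 \<Longrightarrow> z \<in> right_dom R \<Longrightarrow> z \<in> left_dom R \<Longrightarrow> \<bar>Im z\<bar> > R"
  by (auto simp: right_dom_def left_dom_def)

lemma right_left_dom_cover: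
  assumes "norm z > 2 * R" shows "z \<in> right_dom R \<or> z \<in> left_dom R"
proof (rule ccontr)
  assume "\<not> ?thesis"
  hence "\<bar>Re z\<bar> \<le> R" "\<bar>Im z\<bar> \<le> R" by (auto simp: right_dom_def left_dom_def)
  thus False using cmod_le[of z] assms by linarith
qed

lemma germ_of_near_identity:
  assumes hol: "k holomorphic_on {z. norm z > M}" and bd: "\<And>z. norm z > M \<Longrightarrow> norm (k z - z) \<le> B" and M: "M > 0"
  obtains h where "fps_conv_radius h > 0" "\<forall>\<^sub>F z in at_infinity. germ_fun h z = k z"
proof -
  define \<eta> where "\<eta> w = k (inverse w) - inverse w" for w
  define e where "e = inverse M"
  have e: "e > 0" using M by (simp add: e_def)
  have inv_gt: "norm (inverse w) > M" if "w \<in> ball 0 e - {0}" for w :: complex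
  proof -
    have "norm w < inverse M" "w \<noteq> 0" using that by (auto simp: e_def)
    thus ?thesis using M unfolding norm_inverse by (simp add: field_simps)
  qed
  have "k \<circ> inverse holomorphic_on ball 0 e - {0}"
    by (rule holomorphic_on_compose_gen[OF _ hol]) (use inv_gt in \<open>auto intro!: holomorphic_intros\<close>)
  hence eta_hol: "\<eta> holomorphic_on ball 0 e - {0}" unfolding \<eta>_def[abs_def] o_def by (intro holomorphic_intros) auto
  have "\<forall>\<^sub>F w in at 0. w \<in> ball (0::complex) e - {0}" unfolding eventually_at by (rule exI[of _ e]) (use e in \<open>auto simp: dist_commute\<close>)
  hence bdd: "\<forall>\<^sub>F w in at 0. norm (\<eta> w) \<le> B"
    by (elim eventually_mono) (use bd inv_gt in \<open>auto simp: \<eta>_def\<close>)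
  obtain G where G: "G holomorphic_on ball 0 e" "\<And>w. w \<in> ball 0 e - {0} \<Longrightarrow> G w = \<eta> w"
  proof -
    have "\<exists>G. G holomorphic_on ball 0 e \<and> (\<forall>w\<in>ball 0 e - {0}. G w = \<eta> w)"
      by (subst holomorphic_on_extend_bounded[OF eta_hol]) (use e bdd in auto)
    thus thesis using that by blast
  qed
  define h where "h = fps_expansion G 0"
  have "G has_fps_expansion h" unfolding h_def by (rule has_fps_expansion_fps_expansion[OF _ _ G(1)]) (use e in auto)
  hence h: "fps_conv_radius h > 0" "\<forall>\<^sub>F w in nhds 0. eval_fps h w = G w" by (auto simp: has_fps_expansion_def)
  have "\<forall>\<^sub>F w in nhds 0. w \<in> ball (0::complex) e" using e by (intro eventually_nhds_in_open) auto
  with h(2) have "\<forall>\<^sub>F w in nhds 0. w \<noteq> 0 \<longrightarrow> eval_fps h w = \<eta> w" by eventually_elim (use G(2) in auto)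
  hence "\<forall>\<^sub>F z in at_infinity. inverse z \<noteq> 0 \<longrightarrow> eval_fps h (inverse z) = \<eta> (inverse z)"
    by (rule eventually_compose_filterlim) (rule tendsto_inverse_0)
  moreover have "\<forall>\<^sub>F z in at_infinity. (z::complex) \<noteq> 0" by (rule eventually_not_equal_at_infinity)
  ultimately have "\<forall>\<^sub>F z in at_infinity. germ_fun h z = k z" by eventually_elim (simp add: germ_fun_def \<eta>_def)
  with h(1) show ?thesis by (rule that)
qed

text \<open>A convergent series is its own asymptotic expansion, and expansions are unique.\<close>

lemma germ_fun_eq_imp_eq:
  assumes "fps_conv_radius A > 0" "fps_conv_radius B > 0" "\<forall>\<^sub>F z in at_infinity. germ_fun A z = germ_fun B z"
  shows "A = B"
proof -
  have "\<forall>\<^sub>F z in at_infinity. eval_fps A (inverse z) = eval_fps B (inverse z)"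
    using assms(3) by eventually_elim (simp add: germ_fun_def)
  from asymptotic_to_cong[OF asymptotic_to_eval_fps[OF assms(1)] this] asymptotic_to_eval_fps[OF assms(2)]
  show ?thesis by (intro asymptotic_to_unique[OF order_refl]) (auto simp: trivial_limit_at_infinity)
qed

context germ_data_pair
begin

text \<open>The conjugacy is obtained on either side from the Fatou coordinates; the horn maps make the two agree.\<close>

lemma related_imp_conjugate:
  assumes rel: "\<And>z. \<bar>Im z\<bar> > \<sigma> \<Longrightarrow> g.horn z = f.horn (z + c) - c"
  shows "analytically_conjugate a b"
proof -
  define r where "r = norm c + 1"
  have r: "r \<ge> 1" by (simp add: r_def)
  define M where "M = max R \<sigma>"
  have M: "M \<ge> R" "M \<ge> \<sigma>" by (auto simp: M_def)
  define D where "D = M + 4 + r"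
  have D: "D > 0" "D \<ge> R" using M r f.R4 by (auto simp: D_def)
  define yp where "yp z = z + \<phi>p z - c" for z
  define ym where "ym z = z + \<phi>m z - c" for z
  define kp where "kp z = yp z + \<Psi>p (yp z)" for z
  define km where "km z = ym z + \<Psi>m (ym z)" for z
  have add_near: "norm (p - c) \<le> r" if "norm p \<le> 1/4" for p using norm_triangle_ineq4[of p c] that by (simp add: r_def)
  have RD: "z \<in> right_dom R" if "z \<in> right_dom D" for z using right_dom_mono[OF D(2) that] .
  have LD: "z \<in> left_dom R" if "z \<in> left_dom D" for z using left_dom_mono[OF D(2)] that by blast
  have yp4: "yp z \<in> right_dom (M + 4)" if "z \<in> right_dom D" for z
    using right_dom_perturb[of z "M + 4" r "yp z"] that add_near[of "\<phi>p z"] f.small(1)[OF RD[OF that]]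
    by (simp add: D_def yp_def algebra_simps)
  have ym4: "ym z \<in> left_dom (M + 4)" if "z \<in> left_dom D" for z
    using left_dom_perturb[of z "M + 4" r "ym z"] that add_near[of "\<phi>m z"] f.small(2)[OF LD[OF that]]
    by (simp add: D_def ym_def algebra_simps)
  have ypR: "yp z \<in> right_dom (R + 3)" "yp z \<in> right_dom R" if "z \<in> right_dom D" for z
    using right_dom_mono[OF _ yp4[OF that]] M by auto
  have ymR: "ym z \<in> left_dom (R + 3)" "ym z \<in> left_dom R" if "z \<in> left_dom D" for z
    using left_dom_mono[of "R + 3" "M + 4"] left_dom_mono[of R "M + 4"] ym4[OF that] M by auto
  have near: "norm (kp z - z) \<le> r + 1" if "z \<in> right_dom D" for z
  proof -
    have "norm (kp z - z) \<le> norm (\<phi>p z - c) + norm (\<Psi>p (yp z))"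
      using norm_triangle_ineq[of "\<phi>p z - c" "\<Psi>p (yp z)"] by (simp add: kp_def yp_def algebra_simps)
    thus ?thesis using add_near[of "\<phi>p z"] f.small(1)[OF RD[OF that]] g.small(1)[OF ypR(2)[OF that]] by simp
  qed
  have near': "norm (km z - z) \<le> r + 1" if "z \<in> left_dom D" for z
  proof -
    have "norm (km z - z) \<le> norm (\<phi>m z - c) + norm (\<Psi>m (ym z))"
      using norm_triangle_ineq[of "\<phi>m z - c" "\<Psi>m (ym z)"] by (simp add: km_def ym_def algebra_simps)
    thus ?thesis using add_near[of "\<phi>m z"] f.small(2)[OF LD[OF that]] g.small(2)[OF ymR(2)[OF that]] by simp
  qed
  \<comment> \<open>With x = \<open>km z\<close> the relation of the horn maps, taken at v_f^-(z) -
    c, reads v_g^+(x) = v_f^+(z) - c; applying u_g^+ to both sides gives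
    \<open>kp z\<close>.\<close>
  have agree: "kp z = km z" if z: "z \<in> right_dom D" "z \<in> left_dom D" for z
  proof -
    have imz: "\<bar>Im z\<bar> > D" using right_left_dom_Int[OF _ z] D by simp
    have s: "norm (\<phi>m z - c) \<le> r" using add_near[of "\<phi>m z"] f.small(2)[OF LD[OF z(2)]] by simp
    have "ym z = z + (\<phi>m z - c)" by (simp add: ym_def)
    hence imy: "\<bar>Im (ym z)\<bar> > M + 3" using f.Im_pert[OF s, of z] imz by (simp add: D_def)
    define x where "x = km z"
    have imx: "\<bar>Im x\<bar> > M" unfolding x_def km_def using f.Im_pert[of "\<Psi>m (ym z)" "1/4" "ym z"] g.small(2)[OF ymR(2)[OF z(2)]] imy by linarith
    have "ym z + c = z + \<phi>m z" by (simp add: ym_def)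
    moreover have "z + \<phi>m z + \<psi>m (z + \<phi>m z) = z" using f.inv(4)[OF LD[OF z(2)]] by simp
    ultimately have "f.horn (ym z + c) = z + \<phi>p z" unfolding f.horn_def by (simp only:)
    moreover have "g.horn (ym z) = f.horn (ym z + c) - c" by (rule rel) (use imy M in linarith)
    ultimately have "x + \<Phi>p x = yp z" unfolding x_def km_def g.horn_def yp_def by simp
    moreover have "\<Psi>p (x + \<Phi>p x) = - \<Phi>p x" using g.inv(2)[of x] g.Im_dom[of x] imx M by simp
    ultimately show ?thesis unfolding kp_def x_def[symmetric] by (metis add.right_neutral add.assoc add.right_inverse)
  qed
  have shift_p: "germ_fun b (kp z) = kp (germ_fun a z)" if z: "z \<in> right_dom D" for z
  proof -
    have "yp (germ_fun a z) = yp z + 1" using f.funeq(1)[OF RD[OF z]] by (simp add: yp_def)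
    thus ?thesis using g.u_shift(1)[OF ypR(1)[OF z]] by (simp add: kp_def)
  qed
  have shift_m: "germ_fun b (km z) = km (germ_fun a z)" if z: "z \<in> left_dom D" for z
  proof -
    have "ym (germ_fun a z) = ym z + 1" using f.funeq(2)[OF LD[OF z]] by (simp add: ym_def)
    thus ?thesis using g.u_shift(2)[OF ymR(1)[OF z]] by (simp add: km_def)
  qed
  define k where "k z = (if z \<in> right_dom D then kp z else km z)" for z
  have kR: "k z = kp z" if "z \<in> right_dom D" for z using that by (simp add: k_def)
  have kL: "k z = km z" if "z \<in> left_dom D" for z using that agree by (auto simp: k_def)
  have kp_hol: "kp holomorphic_on right_dom D"
  proof -
    have y: "yp holomorphic_on right_dom D" unfolding yp_def[abs_def]
      by (intro holomorphic_intros holomorphic_on_subset[OF f.holo(1)]) (use RD in auto)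
    have "\<Psi>p \<circ> yp holomorphic_on right_dom D"
      by (rule holomorphic_on_compose_gen[OF y g.holo(2)]) (use ypR in auto)
    thus ?thesis unfolding kp_def[abs_def] o_def by (intro holomorphic_intros y)
  qed
  have km_hol: "km holomorphic_on left_dom D"
  proof -
    have y: "ym holomorphic_on left_dom D" unfolding ym_def[abs_def]
      by (intro holomorphic_intros holomorphic_on_subset[OF f.holo(3)]) (use LD in auto)
    have "\<Psi>m \<circ> ym holomorphic_on left_dom D"
      by (rule holomorphic_on_compose_gen[OF y g.holo(4)]) (use ymR in auto)
    thus ?thesis unfolding km_def[abs_def] o_def by (intro holomorphic_intros y)
  qed
  have "k holomorphic_on right_dom D \<union> left_dom D"
    by (intro holomorphic_on_Un open_right_dom open_left_dom holomorphic_transform[OF kp_hol] holomorphic_transform[OF km_hol])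
       (simp_all add: kR kL)
  hence k_hol: "k holomorphic_on {z. norm z > 2 * D}" by (rule holomorphic_on_subset) (use right_left_dom_cover in auto)
  have k_near: "norm (k z - z) \<le> r + 1" if "norm z > 2 * D" for z
    using right_left_dom_cover[OF that] near near' kR kL by metis
  obtain h where h: "fps_conv_radius h > 0" "\<forall>\<^sub>F z in at_infinity. germ_fun h z = k z"
    by (rule germ_of_near_identity[OF k_hol k_near]) (use D that in auto)
  then obtain R0 where R0: "\<And>z. norm z \<ge> R0 \<Longrightarrow> germ_fun h z = k z" by (auto simp: eventually_at_infinity)
  have conv: "fps_conv_radius a > 0" "fps_conv_radius b > 0" using f.a g.a by (simp_all add: simple_parabolic_resiter0_def)
  \<comment> \<open>The point F(z) is at distance at most 2 from z; the bounds leave this margin, so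
    that one and the same branch of k serves both points.\<close>
  have eqv: "germ_fun b (germ_fun h z) = germ_fun h (germ_fun a z)" if z: "norm z > max R0 (2 * D + R) + 2" for z
  proof -
    have n: "norm z > R" "norm z > 2 * (D + 2)" "norm z > 2 * D" "norm z \<ge> R0"
      using z f.R4 D by auto
    define q where "q = f.F z"
    have "norm (q - z) \<le> norm (q - (z + 1)) + norm (1::complex)"
      using norm_triangle_ineq[of "q - (z + 1)" 1] by simp
    hence q: "norm (q - z) \<le> 2" using f.near_shift[OF n(1)] by (simp add: q_def)
    hence "norm q \<ge> norm z - 2" using norm_triangle_ineq2[of z q] by (simp add: norm_minus_commute)
    hence nq: "norm q \<ge> R0" using z by simp
    from right_left_dom_cover[OF n(2)] have "germ_fun b (k z) = k q"
    proof
      assume zd: "z \<in> right_dom (D + 2)"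
      have "z \<in> right_dom D" "q \<in> right_dom D" using right_dom_mono[OF _ zd, of D] right_dom_perturb[OF zd q] by simp_all
      thus ?thesis using shift_p[of z] by (simp add: kR q_def)
    next
      assume zd: "z \<in> left_dom (D + 2)"
      have "z \<in> left_dom D" "q \<in> left_dom D" using left_dom_mono[of D "D + 2"] zd left_dom_perturb[OF zd q] by auto
      thus ?thesis using shift_m[of z] by (simp add: kL q_def)
    qed
    thus ?thesis using R0[OF n(4)] R0[OF nq] by (simp add: q_def)
  qed
  have ev: "\<forall>\<^sub>F z in at_infinity. germ_fun b (germ_fun h z) = germ_fun h (germ_fun a z)"
    unfolding eventually_at_infinity by (rule exI[of _ "max R0 (2 * D + R) + 3"]) (auto intro!: eqv)
  have "germ_comp b h = germ_comp h a"
  proof (rule germ_fun_eq_imp_eq)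
    show "\<forall>\<^sub>F z in at_infinity. germ_fun (germ_comp b h) z = germ_fun (germ_comp h a) z"
      using germ_fun_comp[OF conv(2) h(1)] germ_fun_comp[OF h(1) conv(1)] ev by eventually_elim simp
  qed (intro fps_conv_radius_germ_comp conv h)+
  with h(1) show ?thesis unfolding analytically_conjugate_def by blast
qed

theorem conjugate_iff_related: "analytically_conjugate a b \<longleftrightarrow> (\<exists>c. horn_maps_related a b c)"
proof
  assume "analytically_conjugate a b"
  thus "\<exists>c. horn_maps_related a b c" using conjugate_imp_related unfolding analytically_conjugate_def by blast
next
  assume "\<exists>c. horn_maps_related a b c"
  thus "analytically_conjugate a b" using related_imp_conjugate unfolding horn_maps_related_iff by blast
qed

end

subsection \<open>Ecalle--Voronin invariants\<close>

text \<open>The Taylor coefficients of k in the variable q = exp (2 pi i z); the series starts at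
  the first power because k(0) = 0.\<close>

lemma fourier_series_of_holomorphic:
  assumes k: "k holomorphic_on ball 0 (exp (- 2 * pi * \<sigma>))" "k 0 = 0"
  obtains \<alpha> where "\<And>z. Im z > \<sigma> \<Longrightarrow> (\<lambda>n. \<alpha> n * exp (2 * of_real pi * \<i> * of_nat (Suc n) * z)) sums k (exp (2 * of_real pi * \<i> * z))"
proof (rule that[of "\<lambda>n. (deriv ^^ Suc n) k 0 / fact (Suc n)"])
  fix z assume z: "Im z > \<sigma>"
  define q where "q = exp (2 * of_real pi * \<i> * z)"
  have "q \<in> ball 0 (exp (- 2 * pi * \<sigma>))" using z by (simp add: q_def)
  from holomorphic_power_series[OF k(1) this] have "(\<lambda>n. (deriv ^^ n) k 0 / fact n * q ^ n) sums k q" by simp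
  hence "(\<lambda>n. (deriv ^^ Suc n) k 0 / fact (Suc n) * q ^ Suc n) sums k q"
    using sums_Suc_iff[of "\<lambda>n. (deriv ^^ n) k 0 / fact n * q ^ n" "k q"] k(2) by simp
  moreover have "q ^ Suc n = exp (2 * of_real pi * \<i> * of_nat (Suc n) * z)" for n
    unfolding q_def exp_of_nat_mult[symmetric] by (simp only: mult_ac)
  ultimately show "(\<lambda>n. (deriv ^^ Suc n) k 0 / fact (Suc n) * exp (2 * of_real pi * \<i> * of_nat (Suc n) * z))
      sums k (exp (2 * of_real pi * \<i> * z))" by (simp only: q_def)
qed

text \<open>Every q \<noteq> 0 of small modulus is some exp (2 pi i z) with Im z > \<sigma>, so the
  power series with coefficients \<alpha>, shifted by one, vanishes near 0.\<close>

lemma fourier_series_zero: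
  assumes s: "\<And>z. Im z > \<sigma> \<Longrightarrow> (\<lambda>n. \<alpha> n * exp (2 * of_real pi * \<i> * of_nat (Suc n) * z)) sums 0"
  shows "\<alpha> n = 0"
proof -
  define A where "A = Abs_fps (\<lambda>n. case n of 0 \<Rightarrow> 0 | Suc m \<Rightarrow> \<alpha> m)"
  define \<rho> where "\<rho> = exp (- 2 * pi * \<sigma>)"
  have rho: "\<rho> > 0" by (simp add: \<rho>_def)
  have sums: "(\<lambda>n. fps_nth A n * q ^ n) sums 0" if q: "norm q < \<rho>" for q :: complex
  proof (cases "q = 0")
    case True
    thus ?thesis using sums_unique[of "\<lambda>n. fps_nth A n * q ^ n"] powser_sums_zero[of "fps_nth A"] by (simp add: A_def)
  next
    case False
    define z where "z = Ln q / (2 * of_real pi * \<i>)"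
    have eq: "2 * of_real pi * \<i> * z = Ln q" by (simp add: z_def)
    have "norm q = exp (- 2 * pi * Im z)" using norm_exp_2pi[of z] False eq by simp
    hence "Im z > \<sigma>" using q by (simp add: \<rho>_def)
    from s[OF this] have "(\<lambda>n. \<alpha> n * exp (2 * of_real pi * \<i> * of_nat (Suc n) * z)) sums 0" .
    moreover have "exp (2 * of_real pi * \<i> * of_nat (Suc n) * z) = q ^ Suc n" for n
    proof -
      have "2 * of_real pi * \<i> * of_nat (Suc n) * z = of_nat (Suc n) * Ln q" unfolding eq[symmetric] by (simp only: mult_ac)
      thus ?thesis using False by (simp only: exp_of_nat_mult exp_Ln not_False_eq_True)
    qed
    ultimately have "(\<lambda>n. fps_nth A (Suc n) * q ^ Suc n) sums 0" by (simp add: A_def)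
    thus ?thesis using sums_Suc_iff[of "\<lambda>n. fps_nth A n * q ^ n" 0] by (simp add: A_def)
  qed
  have "summable (\<lambda>n. fps_nth A n * (of_real (\<rho>/2)) ^ n)" using sums[of "of_real (\<rho>/2)"] rho by (auto intro: sums_summable)
  hence "conv_radius (fps_nth A) \<ge> norm (of_real (\<rho>/2) :: complex)" by (rule conv_radius_geI)
  hence "fps_conv_radius A > 0" using rho by (simp add: fps_conv_radius_def) (metis ereal_less(2) half_gt_zero less_le_trans)
  hence 1: "eval_fps A has_fps_expansion A" by (simp add: has_fps_expansion_def)
  have "\<forall>\<^sub>F q in nhds 0. q \<in> ball (0 :: complex) \<rho>" using rho by (intro eventually_nhds_in_open) auto
  hence "\<forall>\<^sub>F q in nhds 0. eval_fps A q = 0" by eventually_elim (use sums in \<open>auto simp: eval_fps_def sums_iff\<close>)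
  hence "(\<lambda>_. 0) has_fps_expansion A" using 1 by (subst (asm) has_fps_expansion_cong[OF _ refl])
  hence "A = 0" using fps_expansion_unique_complex has_fps_expansion_0 by blast
  hence "fps_nth A (Suc n) = 0" by simp
  thus ?thesis by (simp add: A_def)
qed

lemma fourier_series_unique:
  assumes "\<And>z. Im z > \<sigma> \<Longrightarrow> (\<lambda>n. \<alpha> n * exp (2 * of_real pi * \<i> * of_nat (Suc n) * z)) sums P z"
    and "\<And>z. Im z > \<sigma> \<Longrightarrow> (\<lambda>n. \<beta> n * exp (2 * of_real pi * \<i> * of_nat (Suc n) * z)) sums P z"
  shows "\<alpha> n = \<beta> n"
proof -
  have "\<alpha> n - \<beta> n = 0"
  proof (rule fourier_series_zero[of \<sigma> "\<lambda>n. \<alpha> n - \<beta> n"])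
    fix z assume z: "Im z > \<sigma>"
    show "(\<lambda>n. (\<alpha> n - \<beta> n) * exp (2 * of_real pi * \<i> * of_nat (Suc n) * z)) sums 0"
      using sums_diff[OF assms(1)[OF z] assms(2)[OF z]] by (simp only: left_diff_distrib diff_self)
  qed
  thus ?thesis by simp
qed

lemma fourier_series_unique_low:
  assumes a: "\<And>z. Im z < - \<sigma> \<Longrightarrow> (\<lambda>n. \<alpha> n * exp (- (2 * of_real pi * \<i> * of_nat (Suc n) * z))) sums P z"
    and b: "\<And>z. Im z < - \<sigma> \<Longrightarrow> (\<lambda>n. \<beta> n * exp (- (2 * of_real pi * \<i> * of_nat (Suc n) * z))) sums P z"
  shows "\<alpha> n = \<beta> n"
proof (rule fourier_series_unique[of \<sigma> \<alpha> "\<lambda>z. P (- z)" \<beta>])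
  fix z assume "Im z > \<sigma>"
  hence "Im (- z) < - \<sigma>" by simp
  from a[OF this] b[OF this]
  show "(\<lambda>n. \<alpha> n * exp (2 * of_real pi * \<i> * of_nat (Suc n) * z)) sums P (- z)"
    "(\<lambda>n. \<beta> n * exp (2 * of_real pi * \<i> * of_nat (Suc n) * z)) sums P (- z)"
    by (simp_all only: mult_minus_right minus_minus)
qed

text \<open>Resolves the definite description in \<open>ecalle_voronin\<close>: the expansions of
  \<open>horn_diff\<close> above and below give a family, and uniqueness on smaller half-planes
  shows that it is the only one. The sums are stated for \<open>horn_diff\<close>, which is free of
  the choice made by \<open>SOME\<close>.\<close>

lemma (in germ_data) ecalle_voronin_sums:
  obtains \<sigma> where "\<sigma> > 0"
    "\<And>z. Im z > \<sigma> \<Longrightarrow> (\<lambda>n. ecalle_voronin a (- int (Suc n)) * exp (2 * of_real pi * \<i> * of_nat (Suc n) * z)) sums horn_diff z"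
    "\<And>z. Im z < - \<sigma> \<Longrightarrow> (\<lambda>n. ecalle_voronin a (int (Suc n)) * exp (- (2 * of_real pi * \<i> * of_nat (Suc n) * z))) sums horn_diff z"
proof -
  obtain ku where ku: "ku holomorphic_on ball 0 (exp (- 2 * pi * (R + 3)))" "ku 0 = 0"
    "\<And>z. Im z > R + 3 \<Longrightarrow> horn_diff z = ku (exp (2 * of_real pi * \<i> * z))" by (rule horn_diff_fourier_up) (rule that; assumption)
  obtain kl where kl: "kl holomorphic_on ball 0 (exp (- 2 * pi * (R + 3)))" "kl 0 = 0"
    "\<And>z. Im z < - (R + 3) \<Longrightarrow> horn_diff z = kl (exp (- (2 * of_real pi * \<i> * z)))" by (rule horn_diff_fourier_low) (rule that; assumption)
  obtain \<alpha> where al: "\<And>z. Im z > R + 3 \<Longrightarrow> (\<lambda>n. \<alpha> n * exp (2 * of_real pi * \<i> * of_nat (Suc n) * z)) sums ku (exp (2 * of_real pi * \<i> * z))"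
    by (rule fourier_series_of_holomorphic[OF ku(1,2)]) (rule that; assumption)
  obtain \<beta> where be: "\<And>z. Im z > R + 3 \<Longrightarrow> (\<lambda>n. \<beta> n * exp (2 * of_real pi * \<i> * of_nat (Suc n) * z)) sums kl (exp (2 * of_real pi * \<i> * z))"
    by (rule fourier_series_of_holomorphic[OF kl(1,2)]) (rule that; assumption)
  have up: "(\<lambda>n. \<alpha> n * exp (2 * of_real pi * \<i> * of_nat (Suc n) * z)) sums horn_diff z" if "Im z > R + 3" for z
    using al[OF that] ku(3)[OF that] by simp
  have low: "(\<lambda>n. \<beta> n * exp (- (2 * of_real pi * \<i> * of_nat (Suc n) * z))) sums horn_diff z" if "Im z < - (R + 3)" for z
  proof -
    have "Im (- z) > R + 3" using that by simp
    from be[OF this] show ?thesis using kl(3)[OF that] by (simp only: mult_minus_right)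
  qed
  obtain su where su: "su > 0" "su \<ge> R + 3" "\<And>z. Im z > su \<Longrightarrow> horn_up a z = horn z" by (rule horn_up_eq) (rule that; assumption)
  obtain sl where sl: "sl > 0" "sl \<ge> R + 3" "\<And>z. Im z < - sl \<Longrightarrow> horn_low a z = horn z" by (rule horn_low_eq) (rule that; assumption)
  define \<sigma> where "\<sigma> = max su sl"
  have sig: "\<sigma> > 0" "\<sigma> \<ge> R + 3" "\<sigma> \<ge> su" "\<sigma> \<ge> sl" using su sl by (auto simp: \<sigma>_def)
  have hu: "horn_up a z - z = horn_diff z" if "Im z > \<sigma>" for z using su(3)[of z] that sig by (simp add: horn_eq)
  have hl: "horn_low a z - z = horn_diff z" if "Im z < - \<sigma>" for z using sl(3)[of z] that sig by (simp add: horn_eq)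
  \<comment> \<open>Negative indices belong to the upper half-plane; the sequences start at 0, hence
    the shift by 1.\<close>
  define A where "A m = (if m > 0 then \<beta> (nat m - 1) else if m < 0 then \<alpha> (nat (- m) - 1) else 0)" for m :: int
  have A: "A 0 = 0" "A (int (Suc n)) = \<beta> n" "A (- int (Suc n)) = \<alpha> n" for n by (simp_all add: A_def nat_add_distrib)
  have "ecalle_voronin a = A" unfolding ecalle_voronin_def
  proof (rule the_equality)
    show "A 0 = 0 \<and> (\<exists>\<sigma>>0. (\<forall>z. Im z > \<sigma> \<longrightarrow> (\<lambda>n. A (- int (Suc n)) * exp (2 * of_real pi * \<i> * of_nat (Suc n) * z)) sums (horn_up a z - z)) \<and>
     (\<forall>z. Im z < - \<sigma> \<longrightarrow> (\<lambda>n. A (int (Suc n)) * exp (- (2 * of_real pi * \<i> * of_nat (Suc n) * z))) sums (horn_low a z - z)))"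
    proof (intro conjI exI[of _ \<sigma>] allI impI)
      fix z assume "Im z > \<sigma>"
      thus "(\<lambda>n. A (- int (Suc n)) * exp (2 * of_real pi * \<i> * of_nat (Suc n) * z)) sums (horn_up a z - z)"
        using hu[of z] up[of z] sig unfolding A(3) by simp
    next
      fix z assume "Im z < - \<sigma>"
      thus "(\<lambda>n. A (int (Suc n)) * exp (- (2 * of_real pi * \<i> * of_nat (Suc n) * z))) sums (horn_low a z - z)"
        using hl[of z] low[of z] sig unfolding A(2) by simp
    qed (use A(1) sig in auto)
  next
    fix B assume B: "B 0 = 0 \<and> (\<exists>\<sigma>>0. (\<forall>z. Im z > \<sigma> \<longrightarrow> (\<lambda>n. B (- int (Suc n)) * exp (2 * of_real pi * \<i> * of_nat (Suc n) * z)) sums (horn_up a z - z)) \<and>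
     (\<forall>z. Im z < - \<sigma> \<longrightarrow> (\<lambda>n. B (int (Suc n)) * exp (- (2 * of_real pi * \<i> * of_nat (Suc n) * z))) sums (horn_low a z - z)))"
    then obtain s where s: "\<And>z. Im z > s \<Longrightarrow> (\<lambda>n. B (- int (Suc n)) * exp (2 * of_real pi * \<i> * of_nat (Suc n) * z)) sums (horn_up a z - z)"
      "\<And>z. Im z < - s \<Longrightarrow> (\<lambda>n. B (int (Suc n)) * exp (- (2 * of_real pi * \<i> * of_nat (Suc n) * z))) sums (horn_low a z - z)" by blast
    define M where "M = max s \<sigma>"
    have M: "M \<ge> s" "M \<ge> \<sigma>" "M \<ge> R + 3" using sig by (auto simp: M_def)
    have u: "B (- int (Suc n)) = \<alpha> n" for n
    proof (rule fourier_series_unique[of M "\<lambda>n. B (- int (Suc n))" horn_diff \<alpha>])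
      fix z assume z: "Im z > M"
      have "Im z > s" "Im z > \<sigma>" "Im z > R + 3" using z M by linarith+
      from s(1)[OF this(1)] hu[OF this(2)] up[OF this(3)]
      show "(\<lambda>n. B (- int (Suc n)) * exp (2 * of_real pi * \<i> * of_nat (Suc n) * z)) sums horn_diff z"
        "(\<lambda>n. \<alpha> n * exp (2 * of_real pi * \<i> * of_nat (Suc n) * z)) sums horn_diff z" by simp_all
    qed
    have l: "B (int (Suc n)) = \<beta> n" for n
    proof (rule fourier_series_unique_low[of M "\<lambda>n. B (int (Suc n))" horn_diff \<beta>])
      fix z assume z: "Im z < - M"
      have "Im z < - s" "Im z < - \<sigma>" "Im z < - (R + 3)" using z M by linarith+
      from s(2)[OF this(1)] hl[OF this(2)] low[OF this(3)]
      show "(\<lambda>n. B (int (Suc n)) * exp (- (2 * of_real pi * \<i> * of_nat (Suc n) * z))) sums horn_diff z"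
        "(\<lambda>n. \<beta> n * exp (- (2 * of_real pi * \<i> * of_nat (Suc n) * z))) sums horn_diff z" by simp_all
    qed
    show "B = A"
    proof
      fix m :: int
      consider "m = 0" | n where "m = int (Suc n)" | n where "m = - int (Suc n)"
        by (metis int_cases3 gr0_conv_Suc)
      thus "B m = A m" by cases (simp_all only: u l A B)
    qed
  qed
  show ?thesis
  proof (rule that[OF sig(1)])
    fix z assume "Im z > \<sigma>"
    thus "(\<lambda>n. ecalle_voronin a (- int (Suc n)) * exp (2 * of_real pi * \<i> * of_nat (Suc n) * z)) sums horn_diff z"
      unfolding \<open>ecalle_voronin a = A\<close> A using up sig by simp
  next
    fix z assume "Im z < - \<sigma>"
    thus "(\<lambda>n. ecalle_voronin a (int (Suc n)) * exp (- (2 * of_real pi * \<i> * of_nat (Suc n) * z))) sums horn_diff z"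
      unfolding \<open>ecalle_voronin a = A\<close> A using low sig by simp
  qed
qed

text \<open>The identity parts cancel, so the relation says that \<open>g.horn_diff\<close> at z is
  \<open>f.horn_diff\<close> at z + c. Translation by c multiplies the term of index m by exp (-2 pi
  i m c): above, where m = -(n + 1), this is exp (2 pi i (n + 1) c).\<close>

lemma (in germ_data_pair) horn_maps_related_iff_ecalle_voronin:
  "horn_maps_related a b c \<longleftrightarrow> (\<forall>m::int. m \<noteq> 0 \<longrightarrow>
     ecalle_voronin b m = exp (- 2 * of_real pi * \<i> * of_int m * c) * ecalle_voronin a m)"
proof -
  define e where "e m = exp (- 2 * of_real pi * \<i> * of_int m * c)" for m :: int
  obtain s where s: "\<And>z. Im z > s \<Longrightarrow> (\<lambda>n. ecalle_voronin a (- int (Suc n)) * exp (2 * of_real pi * \<i> * of_nat (Suc n) * z)) sums f.horn_diff z"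
    "\<And>z. Im z < - s \<Longrightarrow> (\<lambda>n. ecalle_voronin a (int (Suc n)) * exp (- (2 * of_real pi * \<i> * of_nat (Suc n) * z))) sums f.horn_diff z"
    by (rule f.ecalle_voronin_sums) (rule that; assumption)
  obtain t where t: "\<And>z. Im z > t \<Longrightarrow> (\<lambda>n. ecalle_voronin b (- int (Suc n)) * exp (2 * of_real pi * \<i> * of_nat (Suc n) * z)) sums g.horn_diff z"
    "\<And>z. Im z < - t \<Longrightarrow> (\<lambda>n. ecalle_voronin b (int (Suc n)) * exp (- (2 * of_real pi * \<i> * of_nat (Suc n) * z))) sums g.horn_diff z"
    by (rule g.ecalle_voronin_sums) (rule that; assumption)
  \<comment> \<open>Leaves room for the shifted argument z + c.\<close>
  define M where "M = max (s + \<bar>Im c\<bar>) t"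
  have M: "M \<ge> s + \<bar>Im c\<bar>" "M \<ge> t" by (auto simp: M_def)
  have up: "(\<lambda>n. (e (- int (Suc n)) * ecalle_voronin a (- int (Suc n))) * exp (2 * of_real pi * \<i> * of_nat (Suc n) * z)) sums f.horn_diff (z + c)"
    if "Im z > M" for z
  proof -
    have "Im (z + c) > s" using that M by simp
    from s(1)[OF this] show ?thesis
    proof (rule sums_cong[THEN iffD1, rotated])
      fix n
      have "exp (2 * of_real pi * \<i> * of_nat (Suc n) * (z + c)) = e (- int (Suc n)) * exp (2 * of_real pi * \<i> * of_nat (Suc n) * z)"
        unfolding e_def exp_add[symmetric] by (rule arg_cong[of _ _ exp]) (simp add: algebra_simps)
      thus "ecalle_voronin a (- int (Suc n)) * exp (2 * of_real pi * \<i> * of_nat (Suc n) * (z + c)) =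
        e (- int (Suc n)) * ecalle_voronin a (- int (Suc n)) * exp (2 * of_real pi * \<i> * of_nat (Suc n) * z)"
        by (simp only: mult_ac)
    qed
  qed
  have low: "(\<lambda>n. (e (int (Suc n)) * ecalle_voronin a (int (Suc n))) * exp (- (2 * of_real pi * \<i> * of_nat (Suc n) * z))) sums f.horn_diff (z + c)"
    if "Im z < - M" for z
  proof -
    have "Im (z + c) < - s" using that M by simp
    from s(2)[OF this] show ?thesis
    proof (rule sums_cong[THEN iffD1, rotated])
      fix n
      have "exp (- (2 * of_real pi * \<i> * of_nat (Suc n) * (z + c))) = e (int (Suc n)) * exp (- (2 * of_real pi * \<i> * of_nat (Suc n) * z))"
        unfolding e_def exp_add[symmetric] by (rule arg_cong[of _ _ exp]) (simp add: algebra_simps)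
      thus "ecalle_voronin a (int (Suc n)) * exp (- (2 * of_real pi * \<i> * of_nat (Suc n) * (z + c))) =
        e (int (Suc n)) * ecalle_voronin a (int (Suc n)) * exp (- (2 * of_real pi * \<i> * of_nat (Suc n) * z))"
        by (simp only: mult_ac)
    qed
  qed
  have "horn_maps_related a b c \<longleftrightarrow> (\<exists>\<sigma>. \<forall>z. \<bar>Im z\<bar> > \<sigma> \<longrightarrow> g.horn_diff z = f.horn_diff (z + c))"
    unfolding horn_maps_related_iff f.horn_eq g.horn_eq by (simp add: algebra_simps)
  also have "\<dots> \<longleftrightarrow> (\<forall>n. ecalle_voronin b (- int (Suc n)) = e (- int (Suc n)) * ecalle_voronin a (- int (Suc n))) \<and>
                    (\<forall>n. ecalle_voronin b (int (Suc n)) = e (int (Suc n)) * ecalle_voronin a (int (Suc n)))"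
    (is "?L \<longleftrightarrow> ?U \<and> ?D")
  proof
    assume ?L
    then obtain \<sigma> where \<sigma>: "\<And>z. \<bar>Im z\<bar> > \<sigma> \<Longrightarrow> g.horn_diff z = f.horn_diff (z + c)" by blast
    define N where "N = max \<bar>\<sigma>\<bar> M"
    have N: "N \<ge> \<sigma>" "N \<ge> M" "N \<ge> t" "N \<ge> 0" using M by (auto simp: N_def)
    show "?U \<and> ?D"
    proof (intro conjI allI)
      fix n
      show "ecalle_voronin b (- int (Suc n)) = e (- int (Suc n)) * ecalle_voronin a (- int (Suc n))"
      proof (rule fourier_series_unique[of N "\<lambda>n. ecalle_voronin b (- int (Suc n))" g.horn_diff "\<lambda>n. e (- int (Suc n)) * ecalle_voronin a (- int (Suc n))"])
        fix z assume z: "Im z > N"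
        have "Im z > t" "Im z > M" "\<bar>Im z\<bar> > \<sigma>" using z N by linarith+
        from t(1)[OF this(1)] up[OF this(2)] \<sigma>[OF this(3)]
        show "(\<lambda>n. ecalle_voronin b (- int (Suc n)) * exp (2 * of_real pi * \<i> * of_nat (Suc n) * z)) sums g.horn_diff z"
          "(\<lambda>n. e (- int (Suc n)) * ecalle_voronin a (- int (Suc n)) * exp (2 * of_real pi * \<i> * of_nat (Suc n) * z)) sums g.horn_diff z"
          by (simp_all only:)
      qed
      show "ecalle_voronin b (int (Suc n)) = e (int (Suc n)) * ecalle_voronin a (int (Suc n))"
      proof (rule fourier_series_unique_low[of N "\<lambda>n. ecalle_voronin b (int (Suc n))" g.horn_diff "\<lambda>n. e (int (Suc n)) * ecalle_voronin a (int (Suc n))"])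
        fix z assume z: "Im z < - N"
        have "Im z < - t" "Im z < - M" "\<bar>Im z\<bar> > \<sigma>" using z N by linarith+
        from t(2)[OF this(1)] low[OF this(2)] \<sigma>[OF this(3)]
        show "(\<lambda>n. ecalle_voronin b (int (Suc n)) * exp (- (2 * of_real pi * \<i> * of_nat (Suc n) * z))) sums g.horn_diff z"
          "(\<lambda>n. e (int (Suc n)) * ecalle_voronin a (int (Suc n)) * exp (- (2 * of_real pi * \<i> * of_nat (Suc n) * z))) sums g.horn_diff z"
          by (simp_all only:)
      qed
    qed
  next
    assume R: "?U \<and> ?D"
    have "g.horn_diff z = f.horn_diff (z + c)" if z: "\<bar>Im z\<bar> > \<bar>M\<bar>" for z
    proof (cases "Im z > M")
      case True
      hence "Im z > t" using M by linarith
      from t(1)[OF this] R have "(\<lambda>n. e (- int (Suc n)) * ecalle_voronin a (- int (Suc n)) * exp (2 * of_real pi * \<i> * of_nat (Suc n) * z)) sums g.horn_diff z"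
        by (simp only:)
      thus ?thesis using up[OF True] by (rule sums_unique2)
    next
      case False
      hence z': "Im z < - M" "Im z < - t" using z M by linarith+
      from t(2)[OF z'(2)] R have "(\<lambda>n. e (int (Suc n)) * ecalle_voronin a (int (Suc n)) * exp (- (2 * of_real pi * \<i> * of_nat (Suc n) * z))) sums g.horn_diff z"
        by (simp only:)
      thus ?thesis using low[OF z'(1)] by (rule sums_unique2)
    qed
    thus ?L by blast
  qed
  also have "\<dots> \<longleftrightarrow> (\<forall>m::int. m \<noteq> 0 \<longrightarrow> ecalle_voronin b m = e m * ecalle_voronin a m)"
  proof safe
    fix m :: int assume u: ?U and d: ?D and "m \<noteq> 0"
    then consider n where "m = int (Suc n)" | n where "m = - int (Suc n)" by (metis int_cases3 gr0_conv_Suc)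
    thus "ecalle_voronin b m = e m * ecalle_voronin a m" by cases (use u d in blast)+
  qed auto
  finally show ?thesis unfolding e_def .
qed

theorem theorem36p3:
  fixes f g :: "complex fps"
  assumes "simple_parabolic_resiter0 f" and "simple_parabolic_resiter0 g"
  shows "(analytically_conjugate f g \<longleftrightarrow> (\<exists>c. horn_maps_related f g c)) \<and>
         (\<forall>c. horn_maps_related f g c \<longleftrightarrow>
            (\<forall>m::int. m \<noteq> 0 \<longrightarrow>
               ecalle_voronin g m =
                 exp (- 2 * of_real pi * \<i> * of_int m * c) * ecalle_voronin f m))"
proof -
  obtain R1 K \<phi>p \<psi>p \<phi>m \<psi>m where F: "germ_data f R1 K \<phi>p \<psi>p \<phi>m \<psi>m" by (rule germ_data_exists[OF assms(1)])
  obtain R2 L \<Phi>p \<Psi>p \<Phi>m \<Psi>m where G: "germ_data g R2 L \<Phi>p \<Psi>p \<Phi>m \<Psi>m" by (rule germ_data_exists[OF assms(2)])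
  \<comment> \<open>The pair needs one radius for both germs, and the data of each germ persist for
    a larger radius.\<close>
  interpret germ_data_pair f g "max R1 R2" K L \<phi>p \<psi>p \<phi>m \<psi>m \<Phi>p \<Psi>p \<Phi>m \<Psi>m
    unfolding germ_data_pair_def using germ_data_mono[OF F] germ_data_mono[OF G] by simp
  show ?thesis using conjugate_iff_related horn_maps_related_iff_ecalle_voronin by blast
qed

end
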